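(* Let $\Lambda$ be a QID random measure in one of the three settings (A), (B), (C) of the context, with the corresponding $\lambda,a,\sigma^2,\rho$. Let $q\in[0,\infty)$ and assume that $\mathbb{E}[|\Lambda(A)|^q]<\infty$ for all $A\in\mathcal{S}$ and that $\int_{|x|>1}|x|^q\rho^+(s,dx)<\infty$ for all $s\in S$. Let $0\le p\le q$ and, for $u\in\mathbb{R}$, $s\in S$, $$\Phi_p(u,s)=\sup_{|c|\le1}|U(cu,s)|+u^2\sigma^2(s)+V_p(u,s),$$ where $U(u,s)=ua(s)+\int_{\mathbb{R}}(\tau(xu)-u\tau(x))\rho(s,dx)$ and $$V_p(u,s)=\int_{\mathbb{R}}\Big(|xu|^p\mathbf{1}_{|xu|>1}+|xu|^2\mathbf{1}_{|xu|\le1}\Big)|\rho|(s,dx).$$ Let $L_{\Phi_p}(S;\lambda)=\{f\in L_0(S;\lambda):\int_S\Phi_p(|f(s)|,s)\lambda(ds)<\infty\}$ with the $F$-norm $\|f\|_{\Phi_p}=\inf\{c>0:\int_S\Phi_p(c^{-1}|f(s)|,s)\lambda(ds)\le c\}$. Then $$\Big\{f: f\text{ is }\Lambda\text{-integrable and }\mathbb{E}\Big[\Big|\int_Sf\,d\Lambda\Big|^p\Big]<\infty\Big\}\supset L_{\Phi_p}(S;\lambda),$$ and the linear mapping $L_{\Phi_p}(S;\lambda)\ni f\mapsto\int_Sf\,d\Lambda\in L_p(\Omega;\mathbb{P})$ is continuous.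
   Context: $L_0(S;\lambda)$ is the space of real measurable functions modulo $\lambda$-null sets; $L_0(\Omega;\mathbb{P})$ carries the topology of convergence in probability. $\mathcal{B}_0(\mathbb{R})$ is the class of Borel sets $B\subset\mathbb{R}$ with $0\notin\overline B$. $\tau(x)=x$ if $|x|\le1$, $\tau(x)=x/|x|$ if $|x|>1$. A quasi-Lévy type measure is a function $\nu:\mathcal{B}_0(\mathbb{R})\to\mathbb{R}$ whose restriction to $\{B\text{ Borel}: B\cap(-r,r)=\emptyset\}$ is a finite signed measure for each $r>0$ and with $\int(1\wedge x^2)|\nu|(dx)<\infty$; $\nu^+,\nu^-,|\nu|$ denote the unique measures on $\mathcal{B}(\mathbb{R})$ with no mass at $0$ which coincide on those classes with the positive part, negative part and total variation of the restriction. If $\nu$ extends to a signed measure on $\mathcal{B}(\mathbb{R})$ it is identified with the extension. For $g$ $|\nu|$-integrable, $\int g\,d\nu:=\int g\,d\nu^+-\int g\,d\nu^-$. A distribution on $\mathbb{R}$ is QID (quasi-infinitely divisible) with characteristic triplet $(\gamma,a,\nu)$ if its characteristic function is $\exp(i\theta\gamma-\frac{\theta^2}{2}a+\int(e^{i\theta x}-1-i\theta\tau(x))\nu(dx))$ with $\gamma,a\in\mathbb{R}$, $\nu$ a quasi-Lévy type measure; then $\nu$ is called a quasi-Lévy measure. $S$ is a non-empty set and $\mathcal{S}$ a $\delta$-ring of subsets of $S$ containing an increasing sequence $(S_n)$ with $\bigcup_nS_n=S$. A QID random measure is a real process $\{\Lambda(A):A\in\mathcal{S}\}$ such that for disjoint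 $A_n\in\mathcal{S}$ the $\Lambda(A_n)$ are independent, $\Lambda(\bigcup_nA_n)=\sum_n\Lambda(A_n)$ a.s. whenever $\bigcup_nA_n\in\mathcal{S}$, and each $\Lambda(A)$ is QID. In all settings $\Lambda(A)$ has triplet $(\nu_0(A),\nu_1(A),F_A)$, where $\nu_0:\mathcal{S}\to\mathbb{R}$ is a signed measure and $\nu_1:\mathcal{S}\to[0,\infty)$ a measure; $a=d\nu_0/d\lambda$, $\sigma^2=d\nu_1/d\lambda$. (A) $F_A(B)=G_A(B)-M_A(B)$ for $B\in\mathcal{B}_0(\mathbb{R})$, where $G_A,M_A$ are Lévy measures for every $A\in\mathcal{S}$ and $A\mapsto G_A(B)$, $A\mapsto M_A(B)$ are finite measures on $\mathcal{S}$ for every $B\in\mathcal{B}_0(\mathbb{R})$. $\lambda(A)=|\nu_0|(A)+\nu_1(A)+\int(1\wedge x^2)G_A(dx)+\int(1\wedge x^2)M_A(dx)$, extended to a $\sigma$-finite measure on $\sigma(\mathcal{S})$. $\rho(s,B)=\rho_G(s,B)-\rho_M(s,B)$ for $B\in\mathcal{B}_0(\mathbb{R})$, where $\rho_G(s,\cdot),\rho_M(s,\cdot)$ are Lévy measures, measurable in $s$, with $G_A(B)=\int_A\rho_G(s,B)\lambda(ds)$, $M_A(B)=\int_A\rho_M(s,B)\lambda(ds)$. (B) $\mathcal{S}$ is a $\sigma$-algebra, $(A,B)\mapsto F_A(B)$ is a signed bimeasure on $\mathcal{S}\times\mathcal{B}(\mathbb{R})$ (a finite signed measure in each variable) with $\sup_I\sum_{i\in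 I}|F_{A_i}(B_i)|<\infty$, supremum over finite families in $\mathcal{S}\times\mathcal{B}(\mathbb{R})$ with pairwise disjoint rectangles $A_i\times B_i$. $\nu(A)$ is the supremum of the same sums over such families with all $A_i\subset A$ (a finite measure), and $\lambda=|\nu_0|+\nu_1+\nu$. $\rho(s,\cdot)$ is a quasi-Lévy type (signed) measure, measurable in $s$, with $F_A(B)=\int_A\rho(s,B)\lambda(ds)$. (C) $\mathcal{S}$ is a $\sigma$-algebra, $F_A$ is a signed measure on $\mathcal{B}(\mathbb{R})$ for each $A$, $A\mapsto F_A(B)$ is a finite signed measure for each $B\in\mathcal{B}_0(\mathbb{R})$, and $J(A,B)=\int_B(1\wedge x^2)F_A(dx)$ satisfies $\sup_I\sum_{i\in I}|J(A_i,B_i)|<\infty$ over the same families. $\xi(A)$ is the supremum over families with all $A_i\subset A$ (a finite measure), and $\lambda=|\nu_0|+\nu_1+\xi$. $\rho(s,\cdot)$ is a quasi-Lévy type measure, with $\rho^{\pm}(\cdot,B)$ measurable, $\int(1\wedge x^2)|\rho|(s,dx)\le2$ and $J(A,B)=\int_A\int_B(1\wedge x^2)\rho(s,dx)\lambda(ds)$. Integral: for a simple function $f=\sum_{j=1}^nx_j\mathbf{1}_{A_j}$ with disjoint $A_j\in\mathcal{S}$ and $A\in\sigma(\mathcal{S})$, $\int_Af\,d\Lambda=\sum_jx_j\Lambda(A\cap A_j)$. A $\sigma(\mathcal{S})$-measurable $f$ is $\Lambda$-integrable if there are simple $f_n\to f$ $\lambda$-a.e. such that for every $A\in\sigma(\mathcal{S})$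 the sequence $\int_Af_n\,d\Lambda$ converges in probability; $\int_Af\,d\Lambda$ is the limit in probability (independent of the sequence). *)

theory Defs
  imports "HOL-Probability.Probability"
begin

section \<open>Signed measures\<close>

text \<open>
  A real-valued signed measure on a class \<^term>\<open>R\<close> of sets, where \<^term>\<open>R\<close> may be a
  sigma-algebra, a delta-ring, or the class of Borel sets that avoid a neighbourhood of 0.
  Every rearrangement of a disjoint sequence is again admissible, so the series converges
  absolutely.
\<close>

definition signed_measure_on :: "'a set set \<Rightarrow> ('a set \<Rightarrow> real) \<Rightarrow> bool" where
  "signed_measure_on R F \<longleftrightarrow>
     F {} = 0 \<and>
     (\<forall>A :: nat \<Rightarrow> 'a set. range A \<subseteq> R \<longrightarrow> disjoint_family A \<longrightarrow> (\<Union>n. A n) \<in> R \<longrightarrow>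
        (\<lambda>n. F (A n)) sums F (\<Union>n. A n))"

definition signed_pos :: "'a set set \<Rightarrow> ('a set \<Rightarrow> real) \<Rightarrow> 'a set \<Rightarrow> ennreal" where
  "signed_pos R F A = (SUP C\<in>{C \<in> R. C \<subseteq> A}. ennreal (F C))"

definition signed_neg :: "'a set set \<Rightarrow> ('a set \<Rightarrow> real) \<Rightarrow> 'a set \<Rightarrow> ennreal" where
  "signed_neg R F A = (SUP C\<in>{C \<in> R. C \<subseteq> A}. ennreal (- F C))"

definition signed_abs :: "'a set set \<Rightarrow> ('a set \<Rightarrow> real) \<Rightarrow> 'a set \<Rightarrow> ennreal" where
  "signed_abs R F A =
     (SUP Q\<in>{Q. finite Q \<and> Q \<subseteq> R \<and> disjoint Q \<and> \<Union>Q \<subseteq> A}. \<Sum>C\<in>Q. ennreal \<bar>F C\<bar>)"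

section \<open>Quasi-Levy type measures and quasi-infinitely divisible distributions\<close>

definition tau :: "real \<Rightarrow> real" where
  "tau x = (if \<bar>x\<bar> \<le> 1 then x else x / \<bar>x\<bar>)"

definition borel0 :: "real set set" where
  "borel0 = {B \<in> sets borel. 0 \<notin> closure B}"

definition borel_off :: "real \<Rightarrow> real set set" where
  "borel_off r = {B \<in> sets borel. B \<inter> {-r<..<r} = {}}"

text \<open>
  A quasi-Levy type measure is a function \<^term>\<open>\<nu> :: real set \<Rightarrow> real\<close> of which only the
  values on \<^term>\<open>borel0\<close>, the union of the classes \<^term>\<open>borel_off r\<close> for \<^prop>\<open>r > 0\<close>,
  matter. Its positive part, negative part and total variation are the Borel measures without
  mass at 0 that extend those of all the restrictions.
\<close>

definition extends_off_zero :: "(real set set \<Rightarrow> real set \<Rightarrow> ennreal) \<Rightarrow> real measure \<Rightarrow> bool" where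
  "extends_off_zero f M \<longleftrightarrow>
     sets M = sets borel \<and> emeasure M {0} = 0 \<and>
     (\<forall>r>0. \<forall>B\<in>borel_off r. emeasure M B = f (borel_off r) B)"

definition qlt_pos :: "(real set \<Rightarrow> real) \<Rightarrow> real measure" where
  "qlt_pos \<nu> = (THE M. extends_off_zero (\<lambda>R. signed_pos R \<nu>) M)"

definition qlt_neg :: "(real set \<Rightarrow> real) \<Rightarrow> real measure" where
  "qlt_neg \<nu> = (THE M. extends_off_zero (\<lambda>R. signed_neg R \<nu>) M)"

definition qlt_abs :: "(real set \<Rightarrow> real) \<Rightarrow> real measure" where
  "qlt_abs \<nu> = (THE M. extends_off_zero (\<lambda>R. signed_abs R \<nu>) M)"

definition quasi_levy_type :: "(real set \<Rightarrow> real) \<Rightarrow> bool" where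
  "quasi_levy_type \<nu> \<longleftrightarrow>
     (\<forall>r>0. signed_measure_on (borel_off r) \<nu>) \<and>
     (\<integral>\<^sup>+x. ennreal (min 1 (x\<^sup>2)) \<partial>qlt_abs \<nu>) < \<infinity>"

definition qlt_integral ::
  "(real set \<Rightarrow> real) \<Rightarrow> (real \<Rightarrow> 'b::{banach, second_countable_topology}) \<Rightarrow> 'b" where
  "qlt_integral \<nu> g = (LINT x|qlt_pos \<nu>. g x) - (LINT x|qlt_neg \<nu>. g x)"

definition levy_measure :: "real measure \<Rightarrow> bool" where
  "levy_measure M \<longleftrightarrow>
     sets M = sets borel \<and> emeasure M {0} = 0 \<and>
     (\<integral>\<^sup>+x. ennreal (min 1 (x\<^sup>2)) \<partial>M) < \<infinity>"

definition qid_triplet :: "real measure \<Rightarrow> real \<Rightarrow> real \<Rightarrow> (real set \<Rightarrow> real) \<Rightarrow> bool" where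
  "qid_triplet D \<gamma> a \<nu> \<longleftrightarrow>
     quasi_levy_type \<nu> \<and>
     (\<forall>\<theta>. char D \<theta> =
        exp (\<i> * of_real (\<theta> * \<gamma>) - of_real (\<theta>\<^sup>2 / 2 * a)
             + qlt_integral \<nu> (\<lambda>x. iexp (\<theta> * x) - 1 - \<i> * of_real (\<theta> * tau x))))"

section \<open>QID random measures\<close>

definition delta_ring :: "'s set \<Rightarrow> 's set set \<Rightarrow> bool" where
  "delta_ring S R \<longleftrightarrow>
     ring_of_sets S R \<and> (\<forall>A :: nat \<Rightarrow> 's set. range A \<subseteq> R \<longrightarrow> (\<Inter>n. A n) \<in> R)"

definition qid_random_measure ::
  "'w measure \<Rightarrow> 's set \<Rightarrow> 's set set \<Rightarrow> ('s set \<Rightarrow> 'w \<Rightarrow> real) \<Rightarrow> bool" where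
  "qid_random_measure P S R \<Lambda> \<longleftrightarrow>
     prob_space P \<and> S \<noteq> {} \<and> delta_ring S R \<and>
     (\<exists>Sn :: nat \<Rightarrow> 's set. range Sn \<subseteq> R \<and> incseq Sn \<and> (\<Union>n. Sn n) = S) \<and>
     (\<forall>A\<in>R. \<Lambda> A \<in> borel_measurable P) \<and>
     (\<forall>A :: nat \<Rightarrow> 's set. range A \<subseteq> R \<longrightarrow> disjoint_family A \<longrightarrow>
        prob_space.indep_vars P (\<lambda>_. borel) (\<lambda>n. \<Lambda> (A n)) UNIV \<and>
        ((\<Union>n. A n) \<in> R \<longrightarrow> (AE w in P. (\<lambda>n. \<Lambda> (A n) w) sums \<Lambda> (\<Union>n. A n) w))) \<and>
     (\<forall>A\<in>R. \<exists>\<gamma> a \<nu>. qid_triplet (distr P borel (\<Lambda> A)) \<gamma> a \<nu>)"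

text \<open>
  The data common to the three settings. \<^term>\<open>a\<close> and \<^term>\<open>\<sigma>2\<close> are versions of the
  densities of \<^term>\<open>\<nu>0\<close> and \<^term>\<open>\<nu>1\<close> with respect to \<^term>\<open>lam\<close>.
\<close>

definition qid_characteristics ::
  "'w measure \<Rightarrow> 's set \<Rightarrow> 's set set \<Rightarrow> ('s set \<Rightarrow> 'w \<Rightarrow> real) \<Rightarrow>
   ('s set \<Rightarrow> real) \<Rightarrow> ('s set \<Rightarrow> real) \<Rightarrow> ('s set \<Rightarrow> real set \<Rightarrow> real) \<Rightarrow>
   's measure \<Rightarrow> ('s \<Rightarrow> real) \<Rightarrow> ('s \<Rightarrow> real) \<Rightarrow> bool" where
  "qid_characteristics P S R \<Lambda> \<nu>0 \<nu>1 F lam a \<sigma>2 \<longleftrightarrow>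
     qid_random_measure P S R \<Lambda> \<and>
     signed_measure_on R \<nu>0 \<and>
     signed_measure_on R \<nu>1 \<and> (\<forall>A\<in>R. 0 \<le> \<nu>1 A) \<and>
     (\<forall>A\<in>R. qid_triplet (distr P borel (\<Lambda> A)) (\<nu>0 A) (\<nu>1 A) (F A)) \<and>
     sets lam = sigma_sets S R \<and> sigma_finite_measure lam \<and>
     a \<in> borel_measurable lam \<and>
     (\<forall>A\<in>R. set_integrable lam A a \<and> \<nu>0 A = (LINT s:A|lam. a s)) \<and>
     \<sigma>2 \<in> borel_measurable lam \<and> (\<forall>s\<in>S. 0 \<le> \<sigma>2 s) \<and>
     (\<forall>A\<in>R. set_integrable lam A \<sigma>2 \<and> \<nu>1 A = (LINT s:A|lam. \<sigma>2 s))"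

text \<open>
  The supremum of the sums of \<^term>\<open>\<bar>K (C i) (D i)\<bar>\<close> over finite families of pairwise disjoint
  rectangles \<^term>\<open>C i \<times> D i\<close> with \<^prop>\<open>C i \<subseteq> A\<close>.
\<close>

definition rect_variation ::
  "'s set set \<Rightarrow> ('s set \<Rightarrow> real set \<Rightarrow> real) \<Rightarrow> 's set \<Rightarrow> ennreal" where
  "rect_variation R K A =
     (SUP (I, C, D) \<in> {(I :: nat set, C, D).
          finite I \<and> (\<forall>i\<in>I. C i \<in> R \<and> C i \<subseteq> A \<and> D i \<in> sets borel) \<and>
          disjoint_family_on (\<lambda>i. C i \<times> D i) I}.
        \<Sum>i\<in>I. ennreal \<bar>K (C i) (D i)\<bar>)"

definition setting_A ::
  "'w measure \<Rightarrow> 's set \<Rightarrow> 's set set \<Rightarrow> ('s set \<Rightarrow> 'w \<Rightarrow> real) \<Rightarrow>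
   ('s set \<Rightarrow> real) \<Rightarrow> ('s set \<Rightarrow> real) \<Rightarrow> ('s set \<Rightarrow> real set \<Rightarrow> real) \<Rightarrow>
   's measure \<Rightarrow> ('s \<Rightarrow> real) \<Rightarrow> ('s \<Rightarrow> real) \<Rightarrow> ('s \<Rightarrow> real set \<Rightarrow> real) \<Rightarrow> bool" where
  "setting_A P S R \<Lambda> \<nu>0 \<nu>1 F lam a \<sigma>2 \<rho> \<longleftrightarrow>
     qid_characteristics P S R \<Lambda> \<nu>0 \<nu>1 F lam a \<sigma>2 \<and>
     (\<exists>(G :: 's set \<Rightarrow> real measure) (M :: 's set \<Rightarrow> real measure)
        (\<rho>G :: 's \<Rightarrow> real measure) (\<rho>M :: 's \<Rightarrow> real measure).
        (\<forall>A\<in>R. levy_measure (G A) \<and> levy_measure (M A)) \<and>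
        (\<forall>B\<in>borel0. signed_measure_on R (\<lambda>A. measure (G A) B) \<and>
                    signed_measure_on R (\<lambda>A. measure (M A) B)) \<and>
        (\<forall>A\<in>R. \<forall>B\<in>borel0. F A B = measure (G A) B - measure (M A) B) \<and>
        (\<forall>A\<in>R. emeasure lam A =
            signed_abs R \<nu>0 A + ennreal (\<nu>1 A)
            + (\<integral>\<^sup>+x. ennreal (min 1 (x\<^sup>2)) \<partial>G A) + (\<integral>\<^sup>+x. ennreal (min 1 (x\<^sup>2)) \<partial>M A)) \<and>
        (\<forall>s\<in>S. levy_measure (\<rho>G s) \<and> levy_measure (\<rho>M s)) \<and>
        (\<forall>B\<in>borel0. (\<lambda>s. emeasure (\<rho>G s) B) \<in> borel_measurable lam \<and>
                    (\<lambda>s. emeasure (\<rho>M s) B) \<in> borel_measurable lam) \<and>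
        (\<forall>A\<in>R. \<forall>B\<in>borel0.
            emeasure (G A) B = (\<integral>\<^sup>+s\<in>A. emeasure (\<rho>G s) B \<partial>lam) \<and>
            emeasure (M A) B = (\<integral>\<^sup>+s\<in>A. emeasure (\<rho>M s) B \<partial>lam)) \<and>
        (\<forall>s\<in>S. \<forall>B\<in>borel0. \<rho> s B = measure (\<rho>G s) B - measure (\<rho>M s) B))"

definition setting_B ::
  "'w measure \<Rightarrow> 's set \<Rightarrow> 's set set \<Rightarrow> ('s set \<Rightarrow> 'w \<Rightarrow> real) \<Rightarrow>
   ('s set \<Rightarrow> real) \<Rightarrow> ('s set \<Rightarrow> real) \<Rightarrow> ('s set \<Rightarrow> real set \<Rightarrow> real) \<Rightarrow>
   's measure \<Rightarrow> ('s \<Rightarrow> real) \<Rightarrow> ('s \<Rightarrow> real) \<Rightarrow> ('s \<Rightarrow> real set \<Rightarrow> real) \<Rightarrow> bool" where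
  "setting_B P S R \<Lambda> \<nu>0 \<nu>1 F lam a \<sigma>2 \<rho> \<longleftrightarrow>
     qid_characteristics P S R \<Lambda> \<nu>0 \<nu>1 F lam a \<sigma>2 \<and>
     sigma_algebra S R \<and>
     (\<forall>A\<in>R. signed_measure_on (sets borel) (F A)) \<and>
     (\<forall>B\<in>sets borel. signed_measure_on R (\<lambda>A. F A B)) \<and>
     rect_variation R F S < \<infinity> \<and>
     (\<forall>A\<in>R. emeasure lam A = signed_abs R \<nu>0 A + ennreal (\<nu>1 A) + rect_variation R F A) \<and>
     (\<forall>s\<in>S. quasi_levy_type (\<rho> s) \<and> signed_measure_on (sets borel) (\<rho> s)) \<and>
     (\<forall>B\<in>sets borel. (\<lambda>s. \<rho> s B) \<in> borel_measurable lam) \<and>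
     (\<forall>A\<in>R. \<forall>B\<in>sets borel.
         set_integrable lam A (\<lambda>s. \<rho> s B) \<and> F A B = (LINT s:A|lam. \<rho> s B))"

definition J_form :: "('s set \<Rightarrow> real set \<Rightarrow> real) \<Rightarrow> 's set \<Rightarrow> real set \<Rightarrow> real" where
  "J_form F A B = qlt_integral (F A) (\<lambda>x. indicator B x * min 1 (x\<^sup>2))"

definition setting_C ::
  "'w measure \<Rightarrow> 's set \<Rightarrow> 's set set \<Rightarrow> ('s set \<Rightarrow> 'w \<Rightarrow> real) \<Rightarrow>
   ('s set \<Rightarrow> real) \<Rightarrow> ('s set \<Rightarrow> real) \<Rightarrow> ('s set \<Rightarrow> real set \<Rightarrow> real) \<Rightarrow>
   's measure \<Rightarrow> ('s \<Rightarrow> real) \<Rightarrow> ('s \<Rightarrow> real) \<Rightarrow> ('s \<Rightarrow> real set \<Rightarrow> real) \<Rightarrow> bool" where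
  "setting_C P S R \<Lambda> \<nu>0 \<nu>1 F lam a \<sigma>2 \<rho> \<longleftrightarrow>
     qid_characteristics P S R \<Lambda> \<nu>0 \<nu>1 F lam a \<sigma>2 \<and>
     sigma_algebra S R \<and>
     (\<forall>A\<in>R. signed_measure_on (sets borel) (F A)) \<and>
     (\<forall>B\<in>borel0. signed_measure_on R (\<lambda>A. F A B)) \<and>
     rect_variation R (J_form F) S < \<infinity> \<and>
     (\<forall>A\<in>R. emeasure lam A =
         signed_abs R \<nu>0 A + ennreal (\<nu>1 A) + rect_variation R (J_form F) A) \<and>
     (\<forall>s\<in>S. quasi_levy_type (\<rho> s)) \<and>
     (\<forall>B\<in>sets borel. (\<lambda>s. emeasure (qlt_pos (\<rho> s)) B) \<in> borel_measurable lam \<and>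
                      (\<lambda>s. emeasure (qlt_neg (\<rho> s)) B) \<in> borel_measurable lam) \<and>
     (\<forall>s\<in>S. (\<integral>\<^sup>+x. ennreal (min 1 (x\<^sup>2)) \<partial>qlt_abs (\<rho> s)) \<le> 2) \<and>
     (\<forall>A\<in>R. \<forall>B\<in>sets borel.
         set_integrable lam A (\<lambda>s. qlt_integral (\<rho> s) (\<lambda>x. indicator B x * min 1 (x\<^sup>2))) \<and>
         J_form F A B
           = (LINT s:A|lam. qlt_integral (\<rho> s) (\<lambda>x. indicator B x * min 1 (x\<^sup>2))))"

section \<open>The stochastic integral\<close>

definition tendsto_in_prob :: "'w measure \<Rightarrow> (nat \<Rightarrow> 'w \<Rightarrow> real) \<Rightarrow> ('w \<Rightarrow> real) \<Rightarrow> bool" where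
  "tendsto_in_prob P X Y \<longleftrightarrow>
     (\<forall>\<epsilon>>0. (\<lambda>n. measure P {w \<in> space P. \<bar>X n w - Y w\<bar> > \<epsilon>}) \<longlonglongrightarrow> 0)"

text \<open>
  The list of the pairs \<^term>\<open>(x j, A j)\<close> represents the simple function
  \<open>\<Sum>j. x j * indicator (A j)\<close>.
\<close>

definition simple_rep :: "'s set set \<Rightarrow> (real \<times> 's set) list \<Rightarrow> bool" where
  "simple_rep R xs \<longleftrightarrow>
     (\<forall>(x, A) \<in> set xs. A \<in> R) \<and> disjoint_family_on (\<lambda>j. snd (xs ! j)) {..<length xs}"

definition simple_fun :: "(real \<times> 's set) list \<Rightarrow> 's \<Rightarrow> real" where
  "simple_fun xs s = (\<Sum>(x, A)\<leftarrow>xs. x * indicator A s)"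

definition simple_integral_rm ::
  "('s set \<Rightarrow> 'w \<Rightarrow> real) \<Rightarrow> 's set \<Rightarrow> (real \<times> 's set) list \<Rightarrow> 'w \<Rightarrow> real" where
  "simple_integral_rm \<Lambda> A xs w = (\<Sum>(x, C)\<leftarrow>xs. x * \<Lambda> (A \<inter> C) w)"

definition approximates_rm ::
  "'w measure \<Rightarrow> 's set set \<Rightarrow> ('s set \<Rightarrow> 'w \<Rightarrow> real) \<Rightarrow> 's measure \<Rightarrow>
   (nat \<Rightarrow> (real \<times> 's set) list) \<Rightarrow> ('s \<Rightarrow> real) \<Rightarrow> bool" where
  "approximates_rm P R \<Lambda> lam \<phi> f \<longleftrightarrow>
     (\<forall>n. simple_rep R (\<phi> n)) \<and>
     (AE s in lam. (\<lambda>n. simple_fun (\<phi> n) s) \<longlonglongrightarrow> f s) \<and>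
     (\<forall>A\<in>sets lam. \<exists>Y\<in>borel_measurable P.
        tendsto_in_prob P (\<lambda>n. simple_integral_rm \<Lambda> A (\<phi> n)) Y)"

definition integrable_rm ::
  "'w measure \<Rightarrow> 's set set \<Rightarrow> ('s set \<Rightarrow> 'w \<Rightarrow> real) \<Rightarrow> 's measure \<Rightarrow> ('s \<Rightarrow> real) \<Rightarrow> bool" where
  "integrable_rm P R \<Lambda> lam f \<longleftrightarrow>
     f \<in> borel_measurable lam \<and> (\<exists>\<phi>. approximates_rm P R \<Lambda> lam \<phi> f)"

text \<open>The integral is determined up to almost sure equality; this picks a version.\<close>

definition integral_rm ::
  "'w measure \<Rightarrow> 's set set \<Rightarrow> ('s set \<Rightarrow> 'w \<Rightarrow> real) \<Rightarrow> 's measure \<Rightarrow>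
   's set \<Rightarrow> ('s \<Rightarrow> real) \<Rightarrow> 'w \<Rightarrow> real" where
  "integral_rm P R \<Lambda> lam A f =
     (SOME Y. Y \<in> borel_measurable P \<and>
        (\<exists>\<phi>. approximates_rm P R \<Lambda> lam \<phi> f \<and>
             tendsto_in_prob P (\<lambda>n. simple_integral_rm \<Lambda> A (\<phi> n)) Y))"

section \<open>The space of integrands\<close>

definition U_fun ::
  "('s \<Rightarrow> real) \<Rightarrow> ('s \<Rightarrow> real set \<Rightarrow> real) \<Rightarrow> real \<Rightarrow> 's \<Rightarrow> real" where
  "U_fun a \<rho> u s = u * a s + qlt_integral (\<rho> s) (\<lambda>x. tau (x * u) - u * tau x)"

definition V_fun :: "('s \<Rightarrow> real set \<Rightarrow> real) \<Rightarrow> real \<Rightarrow> real \<Rightarrow> 's \<Rightarrow> ennreal" where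
  "V_fun \<rho> p u s =
     (\<integral>\<^sup>+x. ennreal (if \<bar>x * u\<bar> > 1 then \<bar>x * u\<bar> powr p else \<bar>x * u\<bar>\<^sup>2) \<partial>qlt_abs (\<rho> s))"

definition Phi_fun ::
  "('s \<Rightarrow> real) \<Rightarrow> ('s \<Rightarrow> real) \<Rightarrow> ('s \<Rightarrow> real set \<Rightarrow> real) \<Rightarrow> real \<Rightarrow> real \<Rightarrow> 's \<Rightarrow> ennreal" where
  "Phi_fun a \<sigma>2 \<rho> p u s =
     (SUP c\<in>{-1..1}. ennreal \<bar>U_fun a \<rho> (c * u) s\<bar>) + ennreal (u\<^sup>2 * \<sigma>2 s) + V_fun \<rho> p u s"

definition L_Phi ::
  "'s measure \<Rightarrow> ('s \<Rightarrow> real) \<Rightarrow> ('s \<Rightarrow> real) \<Rightarrow> ('s \<Rightarrow> real set \<Rightarrow> real) \<Rightarrow> real \<Rightarrow> ('s \<Rightarrow> real) set" where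
  "L_Phi lam a \<sigma>2 \<rho> p =
     {f \<in> borel_measurable lam. (\<integral>\<^sup>+s. Phi_fun a \<sigma>2 \<rho> p \<bar>f s\<bar> s \<partial>lam) < \<infinity>}"

definition norm_Phi ::
  "'s measure \<Rightarrow> ('s \<Rightarrow> real) \<Rightarrow> ('s \<Rightarrow> real) \<Rightarrow> ('s \<Rightarrow> real set \<Rightarrow> real) \<Rightarrow> real \<Rightarrow> ('s \<Rightarrow> real) \<Rightarrow> real" where
  "norm_Phi lam a \<sigma>2 \<rho> p f =
     Inf {c. c > 0 \<and> (\<integral>\<^sup>+s. Phi_fun a \<sigma>2 \<rho> p (inverse c * \<bar>f s\<bar>) s \<partial>lam) \<le> ennreal c}"

text \<open>
  Absolute moments. For \<^prop>\<open>p = 0\<close> they are finite on a probability space, whatever the value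
  of \<^term>\<open>0 powr 0 :: real\<close> (which is 0 in the library).
\<close>

definition abs_moment :: "'w measure \<Rightarrow> real \<Rightarrow> ('w \<Rightarrow> real) \<Rightarrow> ennreal" where
  "abs_moment P p X = (\<integral>\<^sup>+w. ennreal (\<bar>X w\<bar> powr p) \<partial>P)"

text \<open>
  Convergence in the space of random variables with finite absolute moment of order \<^term>\<open>p\<close>;
  for \<^prop>\<open>p = 0\<close> this space carries the topology of convergence in probability.
\<close>

definition tendsto_Lp ::
  "'w measure \<Rightarrow> real \<Rightarrow> (nat \<Rightarrow> 'w \<Rightarrow> real) \<Rightarrow> ('w \<Rightarrow> real) \<Rightarrow> bool" where
  "tendsto_Lp P p X Y \<longleftrightarrow>
     (if p = 0 then tendsto_in_prob P X Y
      else (\<lambda>n. abs_moment P p (\<lambda>w. X n w - Y w)) \<longlonglongrightarrow> 0)"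

end

theory Submission
  imports Defs
begin

text \<open>
  In each setting the family \<^term>\<open>\<rho>\<close> splits into two measurable kernels of Levy measures,
  \<open>s \<mapsto> qlt_pos (\<rho> s)\<close> and \<open>s \<mapsto> qlt_neg (\<rho> s)\<close>, and the integral of a simple
  function \<open>f\<close> is quasi-infinitely divisible with drift \<open>\<integral>U(f(s),s) lam(ds)\<close>, Gaussian variance
  \<open>\<integral>f\<^sup>2 \<sigma>2 dlam\<close> and the images of the kernels under \<open>(s,x) \<mapsto> x f(s)\<close>. Its characteristic
  exponent at \<open>\<theta>\<close> is dominated by a multiple of the modular \<open>\<integral>Phi_p(|f|) dlam\<close>, so a small
  modular forces the integral to be small in probability. As the modular has the doubling
  property, simple functions are dense and the integral extends to all of \<open>L_Phi\<close>; it does not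
  depend on the approximating sequence by a gliding hump argument. For the moments, move the negative part of the
  quasi-Levy measure to the other side: the sum of the integral and an independent infinitely
  divisible variable is infinitely divisible. Both Levy measures have small moments when the
  modular is small, and the independent variable is bounded with probability at least \<open>1/2\<close>, so
  it can be removed from the sum.
\<close>

text \<open>The two parts of a signed quasi-Levy measure may cancel in the characteristic exponent,
  so the modular bounds the exponent from above and not from below. Every convergence argument
  therefore uses only the direction "small modular, small integral", and uniqueness cannot be read
  off the exponent. That argument runs with exponent 0, for which \<open>modular\<close> is finite
  on every simple function. Cancellation also occurs between different points \<open>s\<close>: the
  kernels \<open>qlt_pos (\<rho> s)\<close> and \<open>qlt_neg (\<rho> s)\<close> represent
  \<open>F A\<close> as a difference that need not be its Jordan decomposition. Such differences are
  compared by moving the negative terms across, as equalities between sums of positive measures.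
  Small moments come from majorants \<open>\<eta> + C * (g z - g 0)\<close> of
  \<open>|z| powr p\<close>, where \<open>g\<close> is submultiplicative or a sum of two such
  functions. Submultiplicative functions pass through Poisson mixtures and have means below
  \<open>exp (C * V)\<close>; after subtraction of \<open>g 0\<close> there remains a multiple of
  \<open>exp (C * V) - 1\<close>, which vanishes with \<open>V\<close>. The \<open>\<eta>\<close>
  absorbs the region near 0, where the majorant may vanish faster than
  \<open>|z| powr p\<close>.\<close>

section \<open>Jordan decomposition\<close>

lemma SUP_add_SUP_le:
  fixes f g :: "_ \<Rightarrow> ennreal"
  assumes "I \<noteq> {}" "J \<noteq> {}" "\<And>i j. i \<in> I \<Longrightarrow> j \<in> J \<Longrightarrow> f i + g j \<le> c"
  shows "(SUP i\<in>I. f i) + (SUP j\<in>J. g j) \<le> c"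
  unfolding ennreal_SUP_add_left[OF assms(1), symmetric] ennreal_SUP_add_right[OF assms(2)]
  using assms(3) by (intro SUP_least)

text \<open>\<open>R\<close> is closed under unions and under intersection with every set of the
  sigma-algebra, but \<open>F\<close> may be unbounded on it, so the decomposition is built from
  suprema and not from a Hahn set. The instances are \<open>borel0\<close> inside the Borel sets and
  a sigma-algebra inside itself.\<close>

locale signed_ring = sigma_algebra \<Omega> \<A> for \<Omega> :: "'a set" and \<A> +
  fixes R :: "'a set set" and F :: "'a set \<Rightarrow> real"
  assumes R_sub: "R \<subseteq> \<A>"
    and R_empty: "{} \<in> R"
    and R_Int: "\<And>C A. C \<in> R \<Longrightarrow> A \<in> \<A> \<Longrightarrow> C \<inter> A \<in> R"
    and R_Un: "\<And>C D. C \<in> R \<Longrightarrow> D \<in> R \<Longrightarrow> C \<union> D \<in> R"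
    and signed: "signed_measure_on R F"
begin

lemma R_subset: "C \<in> R \<Longrightarrow> A \<in> \<A> \<Longrightarrow> A \<subseteq> C \<Longrightarrow> A \<in> R"
  using R_Int[of C A] by (simp add: inf_absorb2)

lemma R_Diff: "C \<in> R \<Longrightarrow> D \<in> R \<Longrightarrow> C - D \<in> R"
  using R_subset[of C "C - D"] R_sub by blast

lemma F_empty: "F {} = 0"
  using signed by (simp add: signed_measure_on_def)

lemma F_sums:
  fixes A :: "nat \<Rightarrow> 'a set"
  assumes "range A \<subseteq> R" "disjoint_family A" "(\<Union>n. A n) \<in> R"
  shows "(\<lambda>n. F (A n)) sums F (\<Union>n. A n)"
  using signed assms unfolding signed_measure_on_def by metis

lemma F_Un:
  assumes "C \<in> R" "D \<in> R" "C \<inter> D = {}"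
  shows "F (C \<union> D) = F C + F D"
proof -
  have r: "range (binaryset C D) \<subseteq> R"
    using assms R_empty by (auto simp: binaryset_def)
  have d: "disjoint_family (binaryset C D)"
    using assms by (auto simp: disjoint_family_on_def binaryset_def)
  have "(\<lambda>n. F (binaryset C D n)) sums F (C \<union> D)"
    using F_sums[OF r d] R_Un[OF assms(1,2)] by (simp add: UN_binaryset_eq)
  moreover have "(\<lambda>n. F (binaryset C D n)) sums (F C + F D)"
    using binaryset_sums[of F C D] F_empty by simp
  ultimately show ?thesis by (rule sums_unique2)
qed

lemma F_Diff: "C \<in> R \<Longrightarrow> D \<in> R \<Longrightarrow> D \<subseteq> C \<Longrightarrow> F (C - D) = F C - F D"
  using F_Un[of D "C - D"] R_Diff[of C D] by (auto simp: Un_absorb1)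

lemma uminus: "signed_ring \<Omega> \<A> R (\<lambda>C. - F C)"
proof (unfold_locales; (rule R_sub R_empty R_Int R_Un; assumption)?)
  show "signed_measure_on R (\<lambda>C. - F C)"
    using signed unfolding signed_measure_on_def by (simp add: sums_minus)
qed

lemma signed_neg_eq: "signed_neg R F = signed_pos R (\<lambda>C. - F C)"
  by (simp add: fun_eq_iff signed_neg_def signed_pos_def)

lemma signed_pos_upper: "C \<in> R \<Longrightarrow> C \<subseteq> A \<Longrightarrow> ennreal (F C) \<le> signed_pos R F A"
  unfolding signed_pos_def by (rule SUP_upper) auto

lemma signed_pos_mono: "A \<subseteq> B \<Longrightarrow> signed_pos R F A \<le> signed_pos R F B"
  unfolding signed_pos_def by (rule SUP_subset_mono) auto

lemma signed_pos_empty: "signed_pos R F {} = 0"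
proof -
  have "{C \<in> R. C \<subseteq> {}} = {{}}" using R_empty by auto
  then show ?thesis by (simp only: signed_pos_def) (simp add: F_empty)
qed

lemma signed_pos_superadd:
  assumes "A \<inter> B = {}"
  shows "signed_pos R F A + signed_pos R F B \<le> signed_pos R F (A \<union> B)"
proof -
  have ne: "{C \<in> R. C \<subseteq> X} \<noteq> {}" for X using R_empty by auto
  have "ennreal (F C) + ennreal (F D) \<le> signed_pos R F (A \<union> B)"
    if C: "C \<in> R" "C \<subseteq> A" and D: "D \<in> R" "D \<subseteq> B" for C D
  proof -
    \<comment> \<open>\<open>ennreal\<close> sends negative reals to 0. A competitor of negative
      value therefore counts nothing and is dropped; otherwise the two values add up to that of the
      union.\<close>
    consider "F C < 0" | "F D < 0" | "0 \<le> F C" "0 \<le> F D" by linarith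
    then show ?thesis
    proof cases
      case 1
      then show ?thesis using signed_pos_upper[of D "A \<union> B"] D by (auto simp: ennreal_neg)
    next
      case 2
      then show ?thesis using signed_pos_upper[of C "A \<union> B"] C by (auto simp: ennreal_neg)
    next
      case 3
      have "F (C \<union> D) = F C + F D" using C D assms by (intro F_Un) auto
      then have "ennreal (F C) + ennreal (F D) = ennreal (F (C \<union> D))"
        using 3 by (simp add: ennreal_plus)
      also have "\<dots> \<le> signed_pos R F (A \<union> B)"
        using C D R_Un by (intro signed_pos_upper) auto
      finally show ?thesis .
    qed
  qed
  then show ?thesis
    unfolding signed_pos_def[of R F A] signed_pos_def[of R F B]
    by (intro SUP_add_SUP_le ne) auto
qed

lemma signed_pos_superadd_sum:
  fixes A :: "nat \<Rightarrow> 'a set"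
  assumes "disjoint_family A"
  shows "(\<Sum>i<n. signed_pos R F (A i)) \<le> signed_pos R F (\<Union>i<n. A i)"
proof (induction n)
  case 0
  then show ?case by (simp add: signed_pos_empty)
next
  case (Suc n)
  have "A i \<inter> A n = {}" if "i < n" for i
    using assms that by (simp add: disjoint_family_on_def)
  then have "(\<Union>i<n. A i) \<inter> A n = {}" by blast
  then have "signed_pos R F (\<Union>i<n. A i) + signed_pos R F (A n) \<le> signed_pos R F ((\<Union>i<n. A i) \<union> A n)"
    by (rule signed_pos_superadd)
  moreover have "(\<Union>i<n. A i) \<union> A n = (\<Union>i<Suc n. A i)" by (auto simp: lessThan_Suc)
  ultimately show ?case
    using order_trans[OF add_right_mono[OF Suc]] by (simp only: sum.lessThan_Suc)
qed

text \<open>Finite superadditivity gives one inequality for all partial sums. For the other, a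
  competitor \<open>C\<close> inside the union is cut into the pieces \<open>C \<inter> A i\<close>,
  each of which competes inside \<open>A i\<close>.\<close>

lemma signed_pos_countably_additive: "countably_additive \<A> (signed_pos R F)"
  unfolding countably_additive_def
proof (intro allI impI)
  fix A :: "nat \<Rightarrow> 'a set"
  assume A: "range A \<subseteq> \<A>" and dis: "disjoint_family A" and "\<Union> (range A) \<in> \<A>"
  let ?U = "\<Union>i. A i"
  show "(\<Sum>i. signed_pos R F (A i)) = signed_pos R F ?U"
  proof (rule antisym)
    have "(\<Sum>i<n. signed_pos R F (A i)) \<le> signed_pos R F ?U" for n
      by (rule order_trans[OF signed_pos_superadd_sum[OF dis]]) (intro signed_pos_mono, auto)
    then show "(\<Sum>i. signed_pos R F (A i)) \<le> signed_pos R F ?U"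
      by (intro suminf_le_const) auto
    show "signed_pos R F ?U \<le> (\<Sum>i. signed_pos R F (A i))"
      unfolding signed_pos_def[of R F ?U]
    proof (rule SUP_least, clarsimp)
      fix C assume C: "C \<in> R" "C \<subseteq> ?U"
      have r: "range (\<lambda>i. C \<inter> A i) \<subseteq> R" using C A R_Int by auto
      have d: "disjoint_family (\<lambda>i. C \<inter> A i)" using dis by (auto simp: disjoint_family_on_def)
      have u: "(\<Union>i. C \<inter> A i) = C" using C by auto
      have "(\<lambda>i. F (C \<inter> A i)) sums F C" using F_sums[OF r d] C u by simp
      then have lim: "(\<lambda>n. ennreal (\<Sum>i<n. F (C \<inter> A i))) \<longlonglongrightarrow> ennreal (F C)"
        unfolding sums_def by (rule tendsto_ennrealI)
      have "ennreal (\<Sum>i<n. F (C \<inter> A i)) \<le> (\<Sum>i. signed_pos R F (A i))" for n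
      proof -
        have "ennreal (\<Sum>i<n. F (C \<inter> A i)) \<le> ennreal (\<Sum>i<n. max 0 (F (C \<inter> A i)))"
          by (intro ennreal_leI sum_mono) auto
        also have "\<dots> = (\<Sum>i<n. ennreal (F (C \<inter> A i)))"
          by (subst sum_ennreal[symmetric]) (auto simp: ennreal_max_0' intro!: sum.cong)
        also have "\<dots> \<le> (\<Sum>i<n. signed_pos R F (A i))"
          using r by (intro sum_mono signed_pos_upper) auto
        also have "\<dots> \<le> (\<Sum>i. signed_pos R F (A i))"
          by (rule sum_le_suminf) auto
        finally show ?thesis .
      qed
      then show "ennreal (F C) \<le> (\<Sum>i. signed_pos R F (A i))"
        using lim by (intro LIMSEQ_le_const2) auto
    qed
  qed
qed

lemma signed_pos_additive:
  assumes "A \<in> \<A>" "B \<in> \<A>" "A \<inter> B = {}"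
  shows "signed_pos R F (A \<union> B) = signed_pos R F A + signed_pos R F B"
proof -
  have "additive \<A> (signed_pos R F)"
    using signed_pos_countably_additive signed_pos_empty
    by (intro countably_additive_additive) (auto simp: positive_def)
  then show ?thesis using assms by (auto simp: additive_def)
qed

text \<open>If the supremum over \<open>X\<close> is infinite, some \<open>C\<close> inside
  \<open>X\<close> has \<open>F C\<close> above \<open>|F X| + 1\<close>, so both \<open>C\<close>
  and \<open>X - C\<close> have values of modulus above 1, and on one of them the supremum is again
  infinite. Keeping that one and removing the other forever yields disjoint sets whose values do not
  tend to 0, against summability.\<close>

lemma signed_pos_finite:
  assumes E: "E \<in> R"
  shows "signed_pos R F E < \<infinity>"
proof (rule ccontr)
  assume "\<not> signed_pos R F E < \<infinity>"
  then have inf: "signed_pos R F E = \<infinity>" by (simp add: less_top[symmetric])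
  have step: "\<exists>Y. (Y \<in> R \<and> signed_pos R F Y = \<infinity>) \<and> (Y \<subseteq> X \<and> \<bar>F (X - Y)\<bar> > 1)"
    if X: "X \<in> R" "signed_pos R F X = \<infinity>" for X
  proof -
    have "ennreal (\<bar>F X\<bar> + 1) < signed_pos R F X" using X by simp
    then obtain C where C: "C \<in> R" "C \<subseteq> X" "ennreal (\<bar>F X\<bar> + 1) < ennreal (F C)"
      unfolding signed_pos_def less_SUP_iff by auto
    then have FC: "\<bar>F X\<bar> + 1 < F C" using ennreal_less_iff[of "\<bar>F X\<bar> + 1" "F C"] by simp
    have D: "X - C \<in> R" "F (X - C) = F X - F C" using C X R_Diff F_Diff by auto
    have "signed_pos R F X = signed_pos R F C + signed_pos R F (X - C)"
      using signed_pos_additive[of C "X - C"] C D R_sub by (auto simp: Un_absorb1)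
    then have "signed_pos R F C = \<infinity> \<or> signed_pos R F (X - C) = \<infinity>"
      using X by (metis infinity_ennreal_def ennreal_add_eq_top)
    then consider "signed_pos R F C = \<infinity>" | "signed_pos R F (X - C) = \<infinity>" by blast
    then show ?thesis
    proof cases
      case 1
      then show ?thesis using C D FC by (intro exI[of _ C]) auto
    next
      case 2
      have "X - (X - C) = C" using C by auto
      then show ?thesis using 2 C D FC by (intro exI[of _ "X - C"]) auto
    qed
  qed
  have "\<exists>X. \<forall>n::nat. (X n \<in> R \<and> signed_pos R F (X n) = \<infinity>) \<and> (X (Suc n) \<subseteq> X n \<and> \<bar>F (X n - X (Suc n))\<bar> > 1)"
  proof (rule dependent_nat_choice)
    show "\<exists>X. X \<in> R \<and> signed_pos R F X = \<infinity>" using E inf by blast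
  qed (use step in blast)
  then obtain X :: "nat \<Rightarrow> 'a set"
    where X: "\<And>n. X n \<in> R" "\<And>n. X (Suc n) \<subseteq> X n" "\<And>n. \<bar>F (X n - X (Suc n))\<bar> > 1"
    by auto
  let ?B = "\<lambda>n. X n - X (Suc n)"
  have dec: "X n \<subseteq> X m" if "m \<le> n" for m n
    using that X(2) by (metis lift_Suc_antimono_le)
  have r: "range ?B \<subseteq> R" using X R_Diff by auto
  have d: "disjoint_family ?B"
    unfolding disjoint_family_on_def
  proof (intro ballI impI)
    fix m n :: nat assume "m \<noteq> n"
    then show "?B m \<inter> ?B n = {}"
      using dec[of "Suc m" n] dec[of "Suc n" m] by (cases "m < n") auto
  qed
  have "(\<Union>n. ?B n) \<subseteq> X 0" using dec by blast
  moreover have "(\<Union>n. ?B n) \<in> \<A>" using r R_sub by (intro countable_UN) auto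
  ultimately have "(\<Union>n. ?B n) \<in> R" using R_subset X(1) by blast
  from F_sums[OF r d this] have "(\<lambda>n. F (?B n)) \<longlonglongrightarrow> 0"
    by (intro summable_LIMSEQ_zero) (auto simp: sums_iff)
  then have "eventually (\<lambda>n. \<bar>F (?B n)\<bar> < 1) sequentially"
    by (auto dest!: tendstoD[where e=1])
  then obtain n where "\<bar>F (?B n)\<bar> < 1" by (auto simp: eventually_sequentially)
  then show False using X(3)[of n] by simp
qed

lemma signed_neg_finite: "E \<in> R \<Longrightarrow> signed_neg R F E < \<infinity>"
  unfolding signed_neg_eq by (rule signed_ring.signed_pos_finite[OF uminus])

lemma signed_neg_countably_additive: "countably_additive \<A> (signed_neg R F)"
  unfolding signed_neg_eq by (rule signed_ring.signed_pos_countably_additive[OF uminus])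

text \<open>For \<open>C\<close> inside \<open>E\<close>, \<open>F C\<close> equals
  \<open>F E - F (E - C)\<close>, and \<open>- F (E - C)\<close> is bounded by the negative
  variation of \<open>E\<close>. Applied to \<open>F\<close> and to its negative this gives
  \<open>jordan\<close>.\<close>

lemma signed_pos_le:
  assumes E: "E \<in> R"
  shows "enn2real (signed_pos R F E) \<le> F E + enn2real (signed_neg R F E)"
proof -
  let ?n = "enn2real (signed_neg R F E)"
  have "ennreal (F C) \<le> ennreal (F E + ?n)" if C: "C \<in> R" "C \<subseteq> E" for C
  proof -
    have "ennreal (- F (E - C)) \<le> signed_neg R F E"
      unfolding signed_neg_eq using C E R_Diff by (intro signed_ring.signed_pos_upper[OF uminus]) auto
    also have "\<dots> = ennreal ?n" using signed_neg_finite[OF E] by simp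
    finally have "- F (E - C) \<le> ?n" by (metis enn2real_nonneg ennreal_le_iff)
    then show ?thesis using F_Diff[OF E C] by (intro ennreal_leI) simp
  qed
  then have "signed_pos R F E \<le> ennreal (F E + ?n)"
    unfolding signed_pos_def by (intro SUP_least) auto
  moreover have "0 \<le> F E + ?n"
  proof -
    have "ennreal (- F E) \<le> ennreal ?n"
      using signed_ring.signed_pos_upper[OF uminus E, of E] signed_neg_finite[OF E]
      by (simp add: signed_neg_eq)
    then have "- F E \<le> ?n" by (metis enn2real_nonneg ennreal_le_iff)
    then show ?thesis by simp
  qed
  ultimately show ?thesis using enn2real_leI by blast
qed

lemma jordan: 
  assumes E: "E \<in> R"
  shows "F E = enn2real (signed_pos R F E) - enn2real (signed_neg R F E)"
proof -
  have "signed_neg R (\<lambda>C. - F C) = signed_pos R F"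
    by (simp add: fun_eq_iff signed_neg_def signed_pos_def)
  then show ?thesis
    using signed_pos_le[OF E] signed_ring.signed_pos_le[OF uminus E] by (simp add: signed_neg_eq)
qed

lemma abs_le_signed_pos_neg:
  "C \<in> R \<Longrightarrow> ennreal \<bar>F C\<bar> \<le> signed_pos R F C + signed_neg R F C"
  using signed_pos_upper[of C C] signed_ring.signed_pos_upper[OF uminus, of C C]
  by (cases "F C \<ge> 0") (auto simp: signed_neg_eq add_increasing add_increasing2 abs_if)

text \<open>For the lower bound, competitors \<open>C\<close> and \<open>D\<close> of the two
  variations may overlap; the common part cancels in \<open>F C - F D\<close>, so they are replaced
  by the disjoint sets \<open>C - D\<close> and \<open>D - C\<close>.\<close>

lemma signed_abs_eq:
  assumes A: "A \<in> \<A>"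
  shows "signed_abs R F A = signed_pos R F A + signed_neg R F A"
proof (rule antisym)
  interpret neg: signed_ring \<Omega> \<A> R "\<lambda>C. - F C" by (rule uminus)
  have fin: "(\<Sum>C\<in>Q. signed_pos R F C + signed_neg R F C) = signed_pos R F (\<Union>Q) + signed_neg R F (\<Union>Q)"
    if "finite Q" "Q \<subseteq> R" "disjoint Q" for Q
    using that
  proof (induction Q rule: finite_induct)
    case empty
    then show ?case by (simp add: signed_pos_empty neg.signed_pos_empty signed_neg_eq)
  next
    case (insert C Q)
    have dj: "C \<inter> \<Union>Q = {}" using insert by (auto simp: disjoint_def)
    have m: "C \<in> \<A>" "\<Union>Q \<in> \<A>"
      using insert R_sub by (auto intro!: finite_Union)
    show ?case
      using insert signed_pos_additive[OF m dj] neg.signed_pos_additive[OF m dj]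
      by (simp add: signed_neg_eq disjoint_def ac_simps)
  qed
  show "signed_abs R F A \<le> signed_pos R F A + signed_neg R F A"
    unfolding signed_abs_def
  proof (rule SUP_least, elim CollectE conjE)
    fix Q assume Q: "finite Q" "Q \<subseteq> R" "disjoint Q" "\<Union>Q \<subseteq> A"
    have "(\<Sum>C\<in>Q. ennreal \<bar>F C\<bar>) \<le> (\<Sum>C\<in>Q. signed_pos R F C + signed_neg R F C)"
      using Q by (intro sum_mono abs_le_signed_pos_neg) auto
    also have "\<dots> \<le> signed_pos R F A + signed_neg R F A"
      unfolding fin[OF Q(1-3)]
      unfolding signed_neg_eq
      using Q by (intro add_mono signed_pos_mono neg.signed_pos_mono)
    finally show "(\<Sum>C\<in>Q. ennreal \<bar>F C\<bar>) \<le> signed_pos R F A + signed_neg R F A" .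
  qed
  have "ennreal (F C) + ennreal (- F D) \<le> signed_abs R F A"
    if C: "C \<in> R" "C \<subseteq> A" and D: "D \<in> R" "D \<subseteq> A" for C D
  proof -
    have up: "(\<Sum>C\<in>Q. ennreal \<bar>F C\<bar>) \<le> signed_abs R F A"
      if "finite Q" "Q \<subseteq> R" "disjoint Q" "\<Union>Q \<subseteq> A" for Q
      unfolding signed_abs_def using that by (intro SUP_upper) auto
    consider "F C < 0" | "F D > 0" | "0 \<le> F C" "F D \<le> 0" by linarith
    then show ?thesis
    proof cases
      case 1
      have "ennreal (- F D) \<le> ennreal \<bar>F D\<bar>" by (intro ennreal_leI) auto
      also have "\<dots> \<le> signed_abs R F A" using up[of "{D}"] D by simp
      finally show ?thesis using 1 by (simp add: ennreal_neg)
    next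
      case 2
      have "ennreal (F C) \<le> ennreal \<bar>F C\<bar>" by (intro ennreal_leI) auto
      also have "\<dots> \<le> signed_abs R F A" using up[of "{C}"] C by simp
      finally show ?thesis using 2 by (simp add: ennreal_neg)
    next
      case 3
      have "ennreal (F C) + ennreal (- F D) = ennreal (F C - F D)"
        using 3 by (simp flip: ennreal_plus)
      also have "F C - F D = F (C - D) - F (D - C)"
      proof -
        have e: "C = (C - D) \<union> (C \<inter> D)" "D = (D - C) \<union> (C \<inter> D)" by auto
        have i: "C \<inter> D \<in> R" "C - D \<in> R" "D - C \<in> R" using C D R_Int R_sub R_Diff by auto
        have "F C = F (C - D) + F (C \<inter> D)" using F_Un[OF i(2,1)] e(1) by auto
        moreover have "F D = F (D - C) + F (C \<inter> D)" using F_Un[OF i(3,1)] e(2) by auto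
        ultimately show ?thesis by simp
      qed
      also have "ennreal \<dots> \<le> ennreal (\<bar>F (C - D)\<bar> + \<bar>F (D - C)\<bar>)"
        by (intro ennreal_leI) linarith
      also have "\<dots> \<le> signed_abs R F A"
      \<comment> \<open>The family is a set of sets, so two equal members would be counted once;
        equality forces both to be empty.\<close>
      proof (cases "C - D = D - C")
        case True
        then have "C - D = {}" by blast
        moreover have "D - C = {}" using True by blast
        ultimately show ?thesis by (simp add: F_empty)
      next
        case False
        have "disjoint {C - D, D - C}" by (auto simp: disjoint_def)
        from up[OF _ _ this] have "ennreal \<bar>F (C - D)\<bar> + ennreal \<bar>F (D - C)\<bar> \<le> signed_abs R F A"
          using False C D R_Diff by auto
        then show ?thesis by simp
      qed
      finally show ?thesis .
    qed
  qed
  moreover have ne: "{C \<in> R. C \<subseteq> X} \<noteq> {}" for X using R_empty by auto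
  ultimately show "signed_pos R F A + signed_neg R F A \<le> signed_abs R F A"
    unfolding signed_pos_def signed_neg_def
    by (intro SUP_add_SUP_le ne) auto
qed

end

section \<open>The measures associated with a quasi-Levy type measure\<close>

lemma borel_off_Int: "B \<in> borel_off r \<Longrightarrow> A \<in> sets borel \<Longrightarrow> A \<subseteq> B \<Longrightarrow> A \<in> borel_off r"
  by (auto simp: borel_off_def)

lemma borel0_iff: "B \<in> borel0 \<longleftrightarrow> (\<exists>r>0. B \<in> borel_off r)"
proof
  assume B: "B \<in> borel0"
  then have "0 \<in> - closure B" by (auto simp: borel0_def)
  then obtain e where e: "e > 0" "ball 0 e \<subseteq> - closure B"
    using open_contains_ball[of "- closure B"] by auto
  have "B \<inter> {-e<..<e} = {}"
    using e closure_subset[of B] by (force simp: dist_real_def abs_less_iff)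
  then show "\<exists>r>0. B \<in> borel_off r"
    using e B by (auto simp: borel0_def borel_off_def)
next
  assume "\<exists>r>0. B \<in> borel_off r"
  then obtain r where r: "r > 0" "B \<in> sets borel" "B \<inter> {-r<..<r} = {}"
    by (auto simp: borel_off_def)
  have "{-r<..<r} \<inter> closure B = {}"
    using r by (subst open_Int_closure_eq_empty) auto
  moreover have "0 \<in> {-r<..<r}" using r by simp
  ultimately have "0 \<notin> closure B" by blast
  then show "B \<in> borel0" using r by (auto simp: borel0_def)
qed

lemma borel0_sets: "borel0 \<subseteq> sets borel"
  by (auto simp: borel0_def)

lemma borel0_subset: "B \<in> borel0 \<Longrightarrow> A \<in> sets borel \<Longrightarrow> A \<subseteq> B \<Longrightarrow> A \<in> borel0"
  using borel_off_Int unfolding borel0_iff by blast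

lemma borel0_zero: "B \<in> borel0 \<Longrightarrow> 0 \<notin> B"
  unfolding borel0_iff by (auto simp: borel_off_def)

lemma borel0_Un: "A \<in> borel0 \<Longrightarrow> B \<in> borel0 \<Longrightarrow> A \<union> B \<in> borel0"
  by (auto simp: borel0_def)

text \<open>Members of \<open>borel0\<close> increasing to the complement of 0; they carry
  statements from \<open>borel0\<close> to all Borel sets by monotone limits.\<close>

definition off :: "nat \<Rightarrow> real set" where
  "off n = {x. 1 / real (Suc n) \<le> \<bar>x\<bar>}"

lemma off_sets [measurable]: "off n \<in> sets borel"
  unfolding off_def by measurable

lemma off_borel0: "off n \<in> borel0"
  unfolding borel0_iff
  by (rule exI[of _ "1 / real (Suc n)"]) (auto simp: borel_off_def off_def)

lemma incseq_off: "incseq off"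
proof (rule incseq_SucI, unfold off_def, clarify)
  fix n and x :: real assume "1 / real (Suc n) \<le> \<bar>x\<bar>"
  moreover have "1 / real (Suc (Suc n)) \<le> 1 / real (Suc n)" by (simp add: frac_le)
  ultimately show "1 / real (Suc (Suc n)) \<le> \<bar>x\<bar>" by linarith
qed

lemma UN_off: "(\<Union>n. off n) = - {0}"
proof -
  have "\<exists>n. 1 / real (Suc n) \<le> \<bar>x\<bar>" if "x \<noteq> 0" for x :: real
    using reals_Archimedean[of "\<bar>x\<bar>"] that by (auto simp: inverse_eq_divide intro: less_imp_le)
  moreover have "\<not> 1 / real (Suc n) \<le> \<bar>0::real\<bar>" for n by simp
  ultimately show ?thesis unfolding off_def by fastforce
qed

lemma emeasure_Diff_zero_SUP:
  assumes "sets M = sets borel" "B \<in> sets borel"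
  shows "emeasure M (B - {0}) = (SUP n. emeasure M (B \<inter> off n))"
proof -
  have "(SUP n. emeasure M (B \<inter> off n)) = emeasure M (\<Union>n. B \<inter> off n)"
    using assms incseq_off by (intro SUP_emeasure_incseq) (auto simp: incseq_def)
  also have "(\<Union>n. B \<inter> off n) = B - {0}" using UN_off by auto
  finally show ?thesis by simp
qed

lemma Int_off_borel0: "B \<in> sets borel \<Longrightarrow> B \<inter> off n \<in> borel0"
  by (rule borel0_subset[OF off_borel0]) auto

text \<open>Both measures are first restricted to the complement of 0, where \<open>borel0\<close>
  determines them. Mass at 0 is left free because \<open>kernel_image\<close> sends the points where
  the integrand vanishes to 0; a function with \<open>h 0 = 0\<close> does not see it.\<close>

lemma nn_integral_eq_off_zero:
  assumes M: "sets M = sets borel" and N: "sets N = sets borel"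
    and eq: "\<And>B. B \<in> borel0 \<Longrightarrow> emeasure M B = emeasure N B"
    and h: "h \<in> borel_measurable borel" "h 0 = 0"
  shows "(\<integral>\<^sup>+x. h x \<partial>M) = (\<integral>\<^sup>+x. h x \<partial>N)"
proof -
  note [measurable_cong] = M N
  note [measurable] = h(1)
  have d: "emeasure (density K (indicator (- {0}))) B = emeasure K (B - {0})"
    if "sets K = sets borel" "B \<in> sets borel" for K and B :: "real set"
  proof -
    have [measurable_cong]: "sets K = sets borel" by fact
    show ?thesis
      using that by (subst emeasure_density)
        (auto simp: indicator_inter_arith[symmetric] Diff_eq Int_commute nn_integral_indicator)
  qed
  have "density M (indicator (- {0})) = density N (indicator (- {0}))"
  proof (rule measure_eqI)
    show "sets (density M (indicator (- {0}))) = sets (density N (indicator (- {0})))"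
      using M N by simp
    fix B assume "B \<in> sets (density M (indicator (- {0})))"
    then have B: "B \<in> sets borel" using M by simp
    show "emeasure (density M (indicator (- {0}))) B = emeasure (density N (indicator (- {0}))) B"
      unfolding d[OF M B] d[OF N B] emeasure_Diff_zero_SUP[OF M B] emeasure_Diff_zero_SUP[OF N B]
      using eq[OF Int_off_borel0[OF B]] by simp
  qed
  moreover have "(\<integral>\<^sup>+x. h x \<partial>K) = (\<integral>\<^sup>+x. h x \<partial>density K (indicator (- {0})))"
    if K: "sets K = sets borel" for K
  proof -
    have [measurable_cong]: "sets K = sets borel" by fact
    show ?thesis
      using h(2) by (subst nn_integral_density) (auto intro!: nn_integral_cong simp: indicator_def)
  qed
  ultimately show ?thesis using M N by metis
qed

section \<open>The positive, negative and total variation measures of a quasi-Levy type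
  measure\<close>

lemma signed_off_iff:
  "(\<forall>r>0. signed_measure_on (borel_off r) \<nu>) \<longleftrightarrow> signed_measure_on borel0 \<nu>"
proof safe
  assume a: "\<forall>r>0. signed_measure_on (borel_off r) \<nu>"
  show "signed_measure_on borel0 \<nu>"
    unfolding signed_measure_on_def
  proof (intro conjI allI impI)
    show "\<nu> {} = 0" using a zero_less_one unfolding signed_measure_on_def by blast
    fix A :: "nat \<Rightarrow> real set"
    assume A: "range A \<subseteq> borel0" "disjoint_family A" "(\<Union>n. A n) \<in> borel0"
    then obtain r where r: "r > 0" "(\<Union>n. A n) \<in> borel_off r" by (auto simp: borel0_iff)
    have "range A \<subseteq> borel_off r"
      using A(1) borel0_sets borel_off_Int[OF r(2)] by blast
    moreover have "signed_measure_on (borel_off r) \<nu>" using a r by blast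
    ultimately show "(\<lambda>n. \<nu> (A n)) sums \<nu> (\<Union>n. A n)"
      using r A(2) unfolding signed_measure_on_def by blast
  qed
next
  fix r :: real assume a: "signed_measure_on borel0 \<nu>" and r: "r > 0"
  then have "borel_off r \<subseteq> borel0" by (auto simp: borel0_iff)
  then show "signed_measure_on (borel_off r) \<nu>"
    using a unfolding signed_measure_on_def by (meson subsetD subset_trans)
qed

lemma signed_ring_borel0:
  assumes "signed_measure_on borel0 \<nu>"
  shows "signed_ring UNIV (sets borel) borel0 \<nu>"
proof -
  interpret sigma_algebra "UNIV :: real set" "sets borel"
    using sets.sigma_algebra_axioms[of borel] by simp
  show ?thesis
  proof unfold_locales
    show "{} \<in> borel0" by (simp add: borel0_def)
    show "C \<inter> A \<in> borel0" if "C \<in> borel0" "A \<in> sets borel" for C A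
      using borel0_subset[OF that(1), of "C \<inter> A"] that borel0_sets by blast
  qed (fact borel0_sets borel0_Un assms)+
qed

text \<open>Resolves the description operators behind \<open>qlt_pos\<close>, \<open>qlt_neg\<close>
  and \<open>qlt_abs\<close>. The set function of \<open>borel0\<close> itself is a measure with the
  required property, and any other such measure agrees with it on the sets
  \<open>B \<inter> off n\<close>, hence everywhere since 0 is null for both.\<close>

lemma extends_off_zero_THE:
  fixes f :: "real set set \<Rightarrow> real set \<Rightarrow> ennreal"
  assumes ca: "countably_additive (sets borel) (f borel0)" and pos: "f borel0 {} = 0"
    and zero: "f borel0 {0} = 0"
    and off: "\<And>r B. r > 0 \<Longrightarrow> B \<in> borel_off r \<Longrightarrow> f (borel_off r) B = f borel0 B"
  defines "M \<equiv> (THE M. extends_off_zero f M)"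
  shows "sets M = sets borel" "\<And>B. B \<in> sets borel \<Longrightarrow> emeasure M B = f borel0 B"
proof -
  interpret sigma_algebra "UNIV :: real set" "sets borel"
    using sets.sigma_algebra_axioms[of borel] by simp
  let ?M = "measure_of UNIV (sets borel) (f borel0) :: real measure"
  have s: "sets ?M = sets borel" by (simp add: sigma_sets_eq)
  have e: "emeasure ?M B = f borel0 B" if "B \<in> sets borel" for B
    using ca pos that by (intro emeasure_measure_of_sigma) (auto simp: positive_def sigma_algebra_axioms)
  have "M = ?M"
    unfolding M_def
  proof (rule the_equality)
    show "extends_off_zero f ?M"
      using zero off s e by (auto simp: extends_off_zero_def borel_off_def)
    fix N assume N: "extends_off_zero f N"
    then have sN: "sets N = sets borel" by (simp add: extends_off_zero_def)
    show "N = ?M"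
    proof (rule measure_eqI)
      fix B assume "B \<in> sets N"
      then have B: "B \<in> sets borel" using sN by simp
      have n0: "emeasure K B = emeasure K (B - {0})" if "sets K = sets borel" "emeasure K {0} = 0" for K
        using emeasure_Diff_null_set[of "{0}" K B] that B by (auto simp: null_sets_def)
      have "emeasure N (B \<inter> off n) = emeasure ?M (B \<inter> off n)" for n
        using Int_off_borel0[OF B, of n] N off e B unfolding extends_off_zero_def borel0_iff
        by (metis off_sets sets.Int)
      then show "emeasure N B = emeasure ?M B"
        using n0[OF sN] n0[OF s] emeasure_Diff_zero_SUP[OF sN B] emeasure_Diff_zero_SUP[OF s B] N e zero
        by (simp add: extends_off_zero_def)
    qed (simp add: s sN)
  qed
  then show "sets M = sets borel" "\<And>B. B \<in> sets borel \<Longrightarrow> emeasure M B = f borel0 B"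
    using s e by auto
qed

text \<open>The competitors inside a set that avoids a neighbourhood of 0 avoid the same
  neighbourhood, so the suprema over \<open>borel_off r\<close> do not depend on
  \<open>r\<close>.\<close>

lemma borel_off_collect:
  "r > 0 \<Longrightarrow> B \<in> borel_off r \<Longrightarrow> {C \<in> borel_off r. C \<subseteq> B} = {C \<in> borel0. C \<subseteq> B}"
  using borel_off_Int[of B r] borel0_sets borel0_iff by blast

lemma
  assumes "signed_measure_on borel0 \<nu>"
  shows sets_qlt_pos: "sets (qlt_pos \<nu>) = sets borel"
    and emeasure_qlt_pos: "\<And>B. B \<in> sets borel \<Longrightarrow> emeasure (qlt_pos \<nu>) B = signed_pos borel0 \<nu> B"
    and sets_qlt_neg: "sets (qlt_neg \<nu>) = sets borel"
    and emeasure_qlt_neg: "\<And>B. B \<in> sets borel \<Longrightarrow> emeasure (qlt_neg \<nu>) B = signed_neg borel0 \<nu> B"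
    and sets_qlt_abs: "sets (qlt_abs \<nu>) = sets borel"
    and emeasure_qlt_abs:
      "\<And>B. B \<in> sets borel \<Longrightarrow> emeasure (qlt_abs \<nu>) B = emeasure (qlt_pos \<nu>) B + emeasure (qlt_neg \<nu>) B"
proof -
  interpret signed_ring UNIV "sets borel" borel0 \<nu> by (rule signed_ring_borel0[OF assms])
  interpret neg: signed_ring UNIV "sets borel" borel0 "\<lambda>C. - \<nu> C" by (rule uminus)
  \<comment> \<open>No member of \<open>borel0\<close> contains 0, so the empty set is the only
    competitor inside the singleton.\<close>
  have z: "{C \<in> borel0. C \<subseteq> {0}} = {{}}"
    using borel0_zero R_empty by (auto simp: subset_singleton_iff)
  have zero: "signed_pos borel0 \<nu> {0} = 0" "signed_neg borel0 \<nu> {0} = 0"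
    unfolding signed_pos_def signed_neg_def z by (simp_all add: F_empty)
  have emp: "signed_neg borel0 \<nu> {} = 0" using neg.signed_pos_empty by (simp add: signed_neg_eq)
  note p = extends_off_zero_THE[of "\<lambda>R. signed_pos R \<nu>", folded qlt_pos_def,
      OF signed_pos_countably_additive signed_pos_empty zero(1)]
  show P: "sets (qlt_pos \<nu>) = sets borel"
    "\<And>B. B \<in> sets borel \<Longrightarrow> emeasure (qlt_pos \<nu>) B = signed_pos borel0 \<nu> B"
    by (rule p; simp add: signed_pos_def borel_off_collect)+
  note n = extends_off_zero_THE[of "\<lambda>R. signed_neg R \<nu>", folded qlt_neg_def,
      OF signed_neg_countably_additive emp zero(2)]
  show N: "sets (qlt_neg \<nu>) = sets borel"
    "\<And>B. B \<in> sets borel \<Longrightarrow> emeasure (qlt_neg \<nu>) B = signed_neg borel0 \<nu> B"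
    by (rule n; simp add: signed_neg_def borel_off_collect)+
  have ca: "countably_additive (sets borel) (signed_abs borel0 \<nu>)"
    unfolding countably_additive_def
  proof (intro allI impI)
    fix A :: "nat \<Rightarrow> real set"
    assume A: "range A \<subseteq> sets borel" "disjoint_family A" "\<Union> (range A) \<in> sets borel"
    have "(\<Sum>i. signed_abs borel0 \<nu> (A i)) = (\<Sum>i. signed_pos borel0 \<nu> (A i)) + (\<Sum>i. signed_neg borel0 \<nu> (A i))"
      using A by (subst suminf_add) (auto simp: signed_abs_eq)
    also have "\<dots> = signed_pos borel0 \<nu> (\<Union> (range A)) + signed_neg borel0 \<nu> (\<Union> (range A))"
      using signed_pos_countably_additive signed_neg_countably_additive A
      by (simp add: countably_additive_def)
    finally show "(\<Sum>i. signed_abs borel0 \<nu> (A i)) = signed_abs borel0 \<nu> (\<Union> (range A))"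
      using A by (simp add: signed_abs_eq)
  qed
  have coll: "{Q. finite Q \<and> Q \<subseteq> borel_off r \<and> disjoint Q \<and> \<Union>Q \<subseteq> B} =
     {Q. finite Q \<and> Q \<subseteq> borel0 \<and> disjoint Q \<and> \<Union>Q \<subseteq> B}"
    if "r > 0" "B \<in> borel_off r" for r B
    using borel_off_collect[OF that] by (auto 0 4 simp: set_eq_iff)
  have off: "signed_abs (borel_off r) \<nu> B = signed_abs borel0 \<nu> B" if "r > 0" "B \<in> borel_off r" for r B
    unfolding signed_abs_def coll[OF that] ..
  have "signed_abs borel0 \<nu> {} = 0" "signed_abs borel0 \<nu> {0} = 0"
    using zero emp by (simp_all add: signed_abs_eq signed_pos_empty)
  note a = extends_off_zero_THE[of "\<lambda>R. signed_abs R \<nu>", folded qlt_abs_def, OF ca this off]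
  show "sets (qlt_abs \<nu>) = sets borel"
    by (rule a(1))
  show "\<And>B. B \<in> sets borel \<Longrightarrow> emeasure (qlt_abs \<nu>) B = emeasure (qlt_pos \<nu>) B + emeasure (qlt_neg \<nu>) B"
    by (simp add: a(2) signed_abs_eq P N)
qed

section \<open>Comparing the Jordan decomposition with other differences of measures\<close>

lemma nn_integral_sum_measure:
  assumes sets: "sets M = sets K" "sets N = sets K"
    and eq: "\<And>B. B \<in> sets K \<Longrightarrow> emeasure K B = emeasure M B + emeasure N B"
    and h: "h \<in> borel_measurable K"
  shows "(\<integral>\<^sup>+x. h x \<partial>K) = (\<integral>\<^sup>+x. h x \<partial>M) + (\<integral>\<^sup>+x. h x \<partial>N)"
  using h
proof (induction rule: borel_measurable_induct)
  have sp: "space M = space K" "space N = space K"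
    using sets_eq_imp_space_eq[OF sets(1)] sets_eq_imp_space_eq[OF sets(2)] by auto
  {
    case (cong f g)
    then have "(\<integral>\<^sup>+x. f x \<partial>L) = (\<integral>\<^sup>+x. g x \<partial>L)" if "space L = space K" for L
      using that by (intro nn_integral_cong) auto
    then show ?case using cong sp by simp
  next
    case (set A)
    then show ?case using sets eq by simp
  next
    case (mult u c)
    have "u \<in> borel_measurable M" "u \<in> borel_measurable N"
      using mult sets measurable_cong_sets[OF sets(1) refl] measurable_cong_sets[OF sets(2) refl] by auto
    then show ?case using mult by (simp add: nn_integral_cmult distrib_left)
  next
    case (add u v)
    have "u \<in> borel_measurable M" "u \<in> borel_measurable N" "v \<in> borel_measurable M" "v \<in> borel_measurable N"
      using add sets measurable_cong_sets[OF sets(1) refl] measurable_cong_sets[OF sets(2) refl] by auto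
    then show ?case using add by (simp add: nn_integral_add ac_simps)
  next
    case (seq U)
    have m: "U i \<in> borel_measurable M" "U i \<in> borel_measurable N" for i
      using seq sets measurable_cong_sets[OF sets(1) refl] measurable_cong_sets[OF sets(2) refl] by auto
    have inc: "incseq (\<lambda>i. \<integral>\<^sup>+x. U i x \<partial>L)" for L
      using seq by (auto simp: incseq_def le_fun_def intro!: nn_integral_mono)
    have "(\<integral>\<^sup>+x. (SUP i. U i x) \<partial>K) = (SUP i. (\<integral>\<^sup>+x. U i x \<partial>M) + (\<integral>\<^sup>+x. U i x \<partial>N))"
      using seq by (subst nn_integral_monotone_convergence_SUP) auto
    also have "\<dots> = (SUP i. (\<integral>\<^sup>+x. U i x \<partial>M)) + (SUP i. (\<integral>\<^sup>+x. U i x \<partial>N))"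
      by (intro ennreal_SUP_add inc)
    finally show ?case using seq m by (simp add: nn_integral_monotone_convergence_SUP image_comp SUP_apply)
  }
qed

abbreviation wgt :: "real \<Rightarrow> real" where "wgt x \<equiv> min 1 (x\<^sup>2)"

abbreviation wint :: "real measure \<Rightarrow> ennreal" where "wint M \<equiv> \<integral>\<^sup>+x. ennreal (wgt x) \<partial>M"

lemma wgt_measurable [measurable]: "(\<lambda>x. ennreal (wgt x)) \<in> borel_measurable borel"
  by measurable

lemma wgt_pos: "x \<noteq> 0 \<Longrightarrow> 0 < wgt x"
  by simp

text \<open>Markov's inequality: on a set at distance \<open>r\<close> from 0 the weight is at least
  \<open>wgt r\<close>.\<close>

lemma emeasure_borel0_finite:
  assumes M: "sets M = sets borel" and fin: "wint M < \<infinity>"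
    and B: "B \<in> borel0"
  shows "emeasure M B < \<infinity>"
proof -
  note [measurable_cong] = M
  obtain r where r: "r > 0" "B \<in> borel_off r" using B by (auto simp: borel0_iff)
  have Bs: "B \<in> sets M" using B borel0_sets M by auto
  have r2: "wgt r > 0" using r by (intro wgt_pos) auto
  have le: "indicator B x \<le> ennreal (1 / wgt r) * ennreal (wgt x)" for x
  proof (cases "x \<in> B")
    case True
    then have "r \<le> \<bar>x\<bar>" using r by (auto simp: borel_off_def abs_if)
    then have "r\<^sup>2 \<le> x\<^sup>2" using r by (intro abs_le_square_iff[THEN iffD1]) auto
    then have "wgt r \<le> wgt x" by auto
    then have "1 \<le> 1 / wgt r * wgt x" using r2 by (simp add: field_simps)
    then have "ennreal 1 \<le> ennreal (1 / wgt r * wgt x)" by (rule ennreal_leI)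
    then show ?thesis using True r2 by (simp add: ennreal_mult[symmetric])
  qed simp
  have "emeasure M B = (\<integral>\<^sup>+x. indicator B x \<partial>M)" using Bs by simp
  also have "\<dots> \<le> (\<integral>\<^sup>+x. ennreal (1 / wgt r) * ennreal (wgt x) \<partial>M)"
    by (intro nn_integral_mono le)
  also have "\<dots> = ennreal (1 / wgt r) * wint M"
    by (intro nn_integral_cmult) measurable
  also have "\<dots> < \<infinity>" using fin by (simp add: ennreal_mult_less_top)
  finally show ?thesis .
qed

lemma ex_sum_measure:
  fixes M N :: "'a measure"
  assumes "sets M = sets N"
  obtains K where "sets K = sets M" "\<And>B. B \<in> sets M \<Longrightarrow> emeasure K B = emeasure M B + emeasure N B"
proof
  let ?f = "\<lambda>B. emeasure M B + emeasure N B"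
  let ?K = "measure_of (space M) (sets M) ?f"
  show "sets ?K = sets M" by simp
  have "countably_additive (sets M) ?f"
    unfolding countably_additive_def
    using assms by (auto simp: suminf_add[symmetric] suminf_emeasure)
  then show "emeasure ?K B = ?f B" if "B \<in> sets M" for B
    using that by (intro emeasure_measure_of_sigma) (auto simp: positive_def sets.sigma_algebra_axioms)
qed

text \<open>From \<open>\<nu> = G - M\<close> and the Jordan decomposition,
  \<open>qlt_pos \<nu> + M\<close> and \<open>qlt_neg \<nu> + G\<close> agree on
  \<open>borel0\<close>. Writing the identity with sums keeps it meaningful when the integrals are
  infinite.\<close>

lemma qlt_diff_nn_integral:
  assumes \<nu>: "signed_measure_on borel0 \<nu>"
    and G: "sets G = sets borel" "\<And>B. B \<in> borel0 \<Longrightarrow> emeasure G B < \<infinity>"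
    and M: "sets M = sets borel" "\<And>B. B \<in> borel0 \<Longrightarrow> emeasure M B < \<infinity>"
    and eq: "\<And>B. B \<in> borel0 \<Longrightarrow> \<nu> B = measure G B - measure M B"
    and h: "h \<in> borel_measurable borel" "h 0 = 0"
  shows "(\<integral>\<^sup>+x. h x \<partial>qlt_pos \<nu>) + (\<integral>\<^sup>+x. h x \<partial>M) = (\<integral>\<^sup>+x. h x \<partial>qlt_neg \<nu>) + (\<integral>\<^sup>+x. h x \<partial>G)"
proof -
  interpret signed_ring UNIV "sets borel" borel0 \<nu> by (rule signed_ring_borel0[OF \<nu>])
  note sp = sets_qlt_pos[OF \<nu>] sets_qlt_neg[OF \<nu>]
  obtain K where K: "sets K = sets (qlt_pos \<nu>)"
    "\<And>B. B \<in> sets (qlt_pos \<nu>) \<Longrightarrow> emeasure K B = emeasure (qlt_pos \<nu>) B + emeasure M B"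
    using ex_sum_measure[of "qlt_pos \<nu>" M] sp M by metis
  obtain L where L: "sets L = sets (qlt_neg \<nu>)"
    "\<And>B. B \<in> sets (qlt_neg \<nu>) \<Longrightarrow> emeasure L B = emeasure (qlt_neg \<nu>) B + emeasure G B"
    using ex_sum_measure[of "qlt_neg \<nu>" G] sp G by metis
  have "emeasure K B = emeasure L B" if B: "B \<in> borel0" for B
  proof -
    have Bs: "B \<in> sets borel" using B borel0_sets by auto
    have "enn2real (signed_pos borel0 \<nu> B) + measure M B = enn2real (signed_neg borel0 \<nu> B) + measure G B"
      using jordan[OF B] eq[OF B] by simp
    then have "ennreal (enn2real (signed_pos borel0 \<nu> B)) + ennreal (measure M B) =
       ennreal (enn2real (signed_neg borel0 \<nu> B)) + ennreal (measure G B)"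
      by (simp flip: ennreal_plus)
    then show ?thesis
      using K(2)[of B] L(2)[of B] Bs sp emeasure_qlt_pos[OF \<nu> Bs] emeasure_qlt_neg[OF \<nu> Bs]
        signed_pos_finite[OF B] signed_neg_finite[OF B] G(2)[OF B] M(2)[OF B]
      by (simp add: emeasure_eq_ennreal_measure)
  qed
  then have "(\<integral>\<^sup>+x. h x \<partial>K) = (\<integral>\<^sup>+x. h x \<partial>L)"
    using K L sp h by (intro nn_integral_eq_off_zero) auto
  moreover have "(\<integral>\<^sup>+x. h x \<partial>K) = (\<integral>\<^sup>+x. h x \<partial>qlt_pos \<nu>) + (\<integral>\<^sup>+x. h x \<partial>M)"
    using K sp M h measurable_cong_sets[of K borel borel borel]
    by (intro nn_integral_sum_measure) auto
  moreover have "(\<integral>\<^sup>+x. h x \<partial>L) = (\<integral>\<^sup>+x. h x \<partial>qlt_neg \<nu>) + (\<integral>\<^sup>+x. h x \<partial>G)"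
    using L sp G h measurable_cong_sets[of L borel borel borel]
    by (intro nn_integral_sum_measure) auto
  ultimately show ?thesis by simp
qed

text \<open>Minimality of the Jordan decomposition: every competitor \<open>C\<close> inside
  \<open>B\<close> satisfies \<open>\<nu> C \<le> G C \<le> G B\<close>.\<close>

lemma qlt_pos_le:
  assumes \<nu>: "signed_measure_on borel0 \<nu>"
    and G: "sets G = sets borel" "\<And>B. B \<in> borel0 \<Longrightarrow> emeasure G B < \<infinity>"
    and le: "\<And>B. B \<in> borel0 \<Longrightarrow> \<nu> B \<le> measure G B"
  shows "qlt_pos \<nu> \<le> G"
proof -
  interpret signed_ring UNIV "sets borel" borel0 \<nu> by (rule signed_ring_borel0[OF \<nu>])
  note sp = sets_qlt_pos[OF \<nu>]
  have "emeasure (qlt_pos \<nu>) B \<le> emeasure G B" if B: "B \<in> sets borel" for B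
  proof -
    have "ennreal (\<nu> C) \<le> emeasure G B" if C: "C \<in> borel0" "C \<subseteq> B" for C
    proof -
      have "ennreal (\<nu> C) \<le> emeasure G C"
        using le[OF C(1)] G(2)[OF C(1)] by (simp add: emeasure_eq_ennreal_measure ennreal_leI)
      also have "\<dots> \<le> emeasure G B" using C B G by (intro emeasure_mono) auto
      finally show ?thesis .
    qed
    then show ?thesis
      using B by (auto simp: emeasure_qlt_pos[OF \<nu>] signed_pos_def intro!: SUP_least)
  qed
  then show ?thesis using sp G by (subst le_measure) auto
qed

lemma nn_integral_qlt_abs:
  assumes \<nu>: "signed_measure_on borel0 \<nu>" and h: "h \<in> borel_measurable borel"
  shows "(\<integral>\<^sup>+x. h x \<partial>qlt_abs \<nu>) = (\<integral>\<^sup>+x. h x \<partial>qlt_pos \<nu>) + (\<integral>\<^sup>+x. h x \<partial>qlt_neg \<nu>)"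
  using h sets_qlt_abs[OF \<nu>] sets_qlt_pos[OF \<nu>] sets_qlt_neg[OF \<nu>] emeasure_qlt_abs[OF \<nu>]
    measurable_cong_sets[of "qlt_abs \<nu>" borel borel borel]
  by (intro nn_integral_sum_measure) auto

lemma qlt_uminus:
  shows "qlt_neg (\<lambda>B. - \<nu> B) = qlt_pos \<nu>" "qlt_pos (\<lambda>B. - \<nu> B) = qlt_neg \<nu>" "qlt_abs (\<lambda>B. - \<nu> B) = qlt_abs \<nu>"
proof -
  have "(\<lambda>R. signed_neg R (\<lambda>B. - \<nu> B)) = (\<lambda>R. signed_pos R \<nu>)"
       "(\<lambda>R. signed_pos R (\<lambda>B. - \<nu> B)) = (\<lambda>R. signed_neg R \<nu>)"
       "(\<lambda>R. signed_abs R (\<lambda>B. - \<nu> B)) = (\<lambda>R. signed_abs R \<nu>)"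
    by (simp_all add: fun_eq_iff signed_neg_def signed_pos_def signed_abs_def)
  then show "qlt_neg (\<lambda>B. - \<nu> B) = qlt_pos \<nu>" "qlt_pos (\<lambda>B. - \<nu> B) = qlt_neg \<nu>" "qlt_abs (\<lambda>B. - \<nu> B) = qlt_abs \<nu>"
    by (simp_all add: qlt_neg_def qlt_pos_def qlt_abs_def)
qed

lemma signed_measure_on_uminus: "signed_measure_on R F \<Longrightarrow> signed_measure_on R (\<lambda>C. - F C)"
  unfolding signed_measure_on_def by (simp add: sums_minus)

lemma qlt_integral_real_diff:
  fixes g :: "real \<Rightarrow> real"
  assumes \<nu>: "signed_measure_on borel0 \<nu>"
    and G: "sets G = sets borel" "\<And>B. B \<in> borel0 \<Longrightarrow> emeasure G B < \<infinity>"
    and M: "sets M = sets borel" "\<And>B. B \<in> borel0 \<Longrightarrow> emeasure M B < \<infinity>"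
    and eq: "\<And>B. B \<in> borel0 \<Longrightarrow> \<nu> B = measure G B - measure M B"
    and g: "g 0 = 0" "integrable (qlt_pos \<nu>) g" "integrable (qlt_neg \<nu>) g" "integrable G g" "integrable M g"
  shows "qlt_integral \<nu> g = (LINT x|G. g x) - (LINT x|M. g x)"
proof -
  have m [measurable]: "g \<in> borel_measurable borel"
    using g(4) G(1) by (metis borel_measurable_integrable measurable_cong_sets)
  have f: "(\<integral>\<^sup>+x. ennreal (g x) \<partial>K) < \<infinity>" "(\<integral>\<^sup>+x. ennreal (- g x) \<partial>K) < \<infinity>"
    if "integrable K g" for K
    using that by (auto simp: real_integrable_def less_top)
  have e: "enn2real (\<integral>\<^sup>+x. ennreal (k x) \<partial>qlt_pos \<nu>) + enn2real (\<integral>\<^sup>+x. ennreal (k x) \<partial>M) =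
      enn2real (\<integral>\<^sup>+x. ennreal (k x) \<partial>qlt_neg \<nu>) + enn2real (\<integral>\<^sup>+x. ennreal (k x) \<partial>G)"
    if [measurable]: "k \<in> borel_measurable borel" and k0: "k 0 = 0"
     and kf: "\<And>K. integrable K g \<Longrightarrow> (\<integral>\<^sup>+x. ennreal (k x) \<partial>K) < \<infinity>" for k
    using qlt_diff_nn_integral[OF \<nu> G M eq, of "\<lambda>x. ennreal (k x)"] k0 kf[OF g(2)] kf[OF g(3)] kf[OF g(4)] kf[OF g(5)]
    by (subst (1 2) enn2real_plus[symmetric]) auto
  show ?thesis
    unfolding qlt_integral_def real_lebesgue_integral_def[OF g(2)] real_lebesgue_integral_def[OF g(3)]
      real_lebesgue_integral_def[OF g(4)] real_lebesgue_integral_def[OF g(5)]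
    using e[of g] e[of "\<lambda>x. - g x"] g(1) f by simp
qed

lemma qlt_integral_complex_diff:
  fixes g :: "real \<Rightarrow> complex"
  assumes \<nu>: "signed_measure_on borel0 \<nu>"
    and G: "sets G = sets borel" "\<And>B. B \<in> borel0 \<Longrightarrow> emeasure G B < \<infinity>"
    and M: "sets M = sets borel" "\<And>B. B \<in> borel0 \<Longrightarrow> emeasure M B < \<infinity>"
    and eq: "\<And>B. B \<in> borel0 \<Longrightarrow> \<nu> B = measure G B - measure M B"
    and g: "g 0 = 0" "integrable (qlt_pos \<nu>) g" "integrable (qlt_neg \<nu>) g" "integrable G g" "integrable M g"
  shows "qlt_integral \<nu> g = (LINT x|G. g x) - (LINT x|M. g x)"
proof -
  note d = qlt_integral_real_diff[OF \<nu> G M eq]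
  show ?thesis
    using d[of "\<lambda>x. Re (g x)"] d[of "\<lambda>x. Im (g x)"] g
    by (simp add: complex_eq_iff qlt_integral_def)
qed

text \<open>The supremum in \<open>signed_pos\<close> runs over uncountably many sets; a countable
  family that serves all \<open>\<nu>\<close> at once makes \<open>qlt_pos (\<rho> s) E\<close>
  measurable in \<open>s\<close>. It consists of the finite unions of base sets: a competitor is
  approximated from inside by a compact set \<open>K\<close>, which is approximated from outside by
  an open set \<open>V\<close>, and some finite union of base sets lies between \<open>K\<close> and
  \<open>V\<close>.\<close>

lemma ex_countable_approximating_family:
  obtains \<U> :: "real set set"
  where "countable \<U>" "{} \<in> \<U>" "\<U> \<subseteq> sets borel"
    "\<And>\<nu> E. signed_measure_on borel0 \<nu> \<Longrightarrow> E \<in> borel0 \<Longrightarrow>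
       signed_pos borel0 \<nu> E = (SUP C\<in>\<U>. ennreal (\<nu> (C \<inter> E)))"
proof -
  obtain \<B> :: "real set set" where \<B>: "countable \<B>" "topological_basis \<B>"
    using ex_countable_basis by auto
  define \<U> where "\<U> = Union ` {Q. finite Q \<and> Q \<subseteq> \<B>}"
  have op: "open O'" if "O' \<in> \<U>" for O'
    using that \<B>(2) by (auto simp: \<U>_def topological_basis_open intro!: open_Union)
  have cov: "\<exists>O'\<in>\<U>. K \<subseteq> O' \<and> O' \<subseteq> V" if K: "compact K" "K \<subseteq> V" and V: "open V" for K V
  proof -
    obtain Q where Q: "Q \<subseteq> \<B>" "\<Union>Q = V" using \<B>(2) V unfolding topological_basis_def by blast
    have "\<And>T. T \<in> Q \<Longrightarrow> open T" using Q \<B>(2) topological_basis_open by blast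
    then obtain Q' where "Q' \<subseteq> Q" "finite Q'" "K \<subseteq> \<Union>Q'"
      using compactE[OF K(1), of Q] K(2) Q by metis
    then show ?thesis using Q by (intro bexI[of _ "\<Union>Q'"]) (auto simp: \<U>_def)
  qed
  show thesis
  proof (rule that[of \<U>])
    show "countable \<U>" unfolding \<U>_def using countable_Collect_finite_subset[OF \<B>(1)] by simp
    show "{} \<in> \<U>" by (auto simp: \<U>_def intro!: image_eqI[of _ _ "{}"])
    show Us: "\<U> \<subseteq> sets borel" using op by auto
    fix \<nu> E assume \<nu>: "signed_measure_on borel0 \<nu>" and E: "E \<in> borel0"
    interpret signed_ring UNIV "sets borel" borel0 \<nu> by (rule signed_ring_borel0[OF \<nu>])
    have Es: "E \<in> sets borel" using E borel0_sets by auto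
    show "signed_pos borel0 \<nu> E = (SUP C\<in>\<U>. ennreal (\<nu> (C \<inter> E)))"
    proof (rule antisym)
      show "(SUP C\<in>\<U>. ennreal (\<nu> (C \<inter> E))) \<le> signed_pos borel0 \<nu> E"
        using Us R_Int[OF E] by (intro SUP_least signed_pos_upper) (auto simp: Int_commute)
      \<comment> \<open>Total variation restricted to \<open>E\<close>. It is finite, as the
        regularity theorems require, and it bounds the change of \<open>\<nu> (C \<inter> E)\<close>
        when \<open>C\<close> is altered.\<close>
      define N where "N = density (qlt_abs \<nu>) (indicator E)"
      note sa = sets_qlt_abs[OF \<nu>]
      have sN: "sets N = sets borel" using sa by (simp add: N_def)
      have eN: "emeasure N B = emeasure (qlt_abs \<nu>) (B \<inter> E)" if "B \<in> sets borel" for B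
      proof -
        have "emeasure N B = (\<integral>\<^sup>+x. indicator E x * indicator B x \<partial>qlt_abs \<nu>)"
          unfolding N_def using that Es sa by (intro emeasure_density borel_measurable_indicator) simp_all
        also have "\<dots> = (\<integral>\<^sup>+x. indicator (B \<inter> E) x \<partial>qlt_abs \<nu>)"
          by (intro nn_integral_cong) (auto simp: indicator_def)
        also have "\<dots> = emeasure (qlt_abs \<nu>) (B \<inter> E)"
          using that Es sa by (intro nn_integral_indicator) simp
        finally show ?thesis .
      qed
      have fE: "emeasure (qlt_abs \<nu>) E < \<infinity>"
        using emeasure_qlt_abs[OF \<nu> Es] emeasure_qlt_pos[OF \<nu> Es] emeasure_qlt_neg[OF \<nu> Es]
          signed_pos_finite[OF E] signed_neg_finite[OF E] by simp
      have "space N = UNIV" using sets_eq_imp_space_eq[OF sN] by simp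
      then have "emeasure N (space N) \<noteq> \<infinity>" using fE eN[of UNIV] by simp
      then interpret N: finite_measure N by (rule finite_measureI)
      have absle: "\<bar>\<nu> (B \<inter> E)\<bar> \<le> measure N B" if B: "B \<in> sets borel" for B
      proof -
        have b: "B \<inter> E \<in> borel0" using R_Int[OF E B] by (simp add: Int_commute)
        have "ennreal \<bar>\<nu> (B \<inter> E)\<bar> \<le> emeasure N B"
          using abs_le_signed_pos_neg[OF b] eN[OF B] emeasure_qlt_abs[OF \<nu>] emeasure_qlt_pos[OF \<nu>]
            emeasure_qlt_neg[OF \<nu>] B Es by simp
        then show ?thesis by (simp add: N.emeasure_eq_measure)
      qed
      show "signed_pos borel0 \<nu> E \<le> (SUP C\<in>\<U>. ennreal (\<nu> (C \<inter> E)))"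
        unfolding signed_pos_def
      proof (rule SUP_least, clarsimp)
        fix C assume C: "C \<in> borel0" "C \<subseteq> E"
        then have Cs: "C \<in> sets borel" using borel0_sets by auto
        show "ennreal (\<nu> C) \<le> (SUP C\<in>\<U>. ennreal (\<nu> (C \<inter> E)))"
        proof (rule ennreal_le_epsilon)
          fix e :: real assume e: "0 < e"
          have fin: "emeasure N (space N) \<noteq> \<infinity>" by simp
          obtain K where K: "K \<subseteq> C" "compact K" "emeasure N C < emeasure N K + ennreal (e / 2)"
          proof -
            have "\<exists>K\<in>{K. K \<subseteq> C \<and> compact K}. emeasure N C < emeasure N K + ennreal (e / 2)"
            \<comment> \<open>Subtraction in \<open>ennreal\<close> stops at 0, so there is no value
              strictly below a null measure; the empty set then serves as \<open>K\<close>.\<close>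
            proof (cases "emeasure N C = 0")
              case True
              then show ?thesis using e by (intro bexI[of _ "{}"]) auto
            next
              case False
              have "emeasure N C - ennreal (e / 2) < emeasure N C"
                using e False by (intro ennreal_between) (auto simp: N.emeasure_eq_measure zero_less_measure_iff)
              then obtain K where "K \<in> {K. K \<subseteq> C \<and> compact K}" "emeasure N C - ennreal (e / 2) < emeasure N K"
                using inner_regular[OF sN fin Cs] unfolding less_SUP_iff by (metis (no_types, lifting) less_SUP_iff)
              moreover have "measure N C - e / 2 < measure N K"
                if "ennreal (measure N C - e / 2) < ennreal (measure N K)"
                using that by (meson ennreal_leI not_less)
              ultimately show ?thesis
                using e by (intro bexI[of _ K])
                  (auto simp: N.emeasure_eq_measure ennreal_minus ennreal_less_iff simp flip: ennreal_plus)
            qed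
            then show ?thesis using that by blast
          qed
          have Ks: "K \<in> sets borel" using K by (intro borel_compact)
          obtain V where V: "K \<subseteq> V" "open V" "emeasure N V < emeasure N K + ennreal (e / 2)"
          proof -
            have "emeasure N K < emeasure N K + ennreal (e / 2)"
              using e by (auto simp: N.emeasure_eq_measure ennreal_less_iff simp flip: ennreal_plus)
            then have "(INF U \<in> {U. K \<subseteq> U \<and> open U}. emeasure N U) < emeasure N K + ennreal (e / 2)"
              using outer_regular[OF sN fin Ks] by simp
            then show ?thesis using that unfolding INF_less_iff by auto
          qed
          \<comment> \<open>The error is at most \<open>N (C - K) + N (V - K)\<close>, two halves of
            \<open>e\<close>.\<close>
          obtain D where D: "D \<in> \<U>" "K \<subseteq> D" "D \<subseteq> V" using cov[OF K(2) V(1,2)] by auto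
          have Ds: "D \<in> sets borel" and Vs: "V \<in> sets borel" using D Us V by auto
          have b: "(D \<inter> E) \<in> borel0" "K \<in> borel0" using R_Int[OF E Ds] R_subset[OF C(1) Ks K(1)] by (auto simp: Int_commute)
          have mC: "measure N (C - K) < e / 2"
            using K Cs Ks sN N.finite_measure_Diff[of C K] e
            by (auto simp: N.emeasure_eq_measure ennreal_less_iff simp flip: ennreal_plus)
          have mV: "measure N (V - K) < e / 2"
            using V Vs Ks sN N.finite_measure_Diff[of V K] e
            by (auto simp: N.emeasure_eq_measure ennreal_less_iff simp flip: ennreal_plus)
          have mD: "measure N (D - K) \<le> measure N (V - K)"
            using D Vs Ks Ds sN by (intro N.finite_measure_mono) auto
          have "K \<subseteq> D \<inter> E" using K C D by auto
          have "(C - K) \<inter> E = C - K" using C by auto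
          then have "\<nu> C = \<nu> K + \<nu> ((C - K) \<inter> E)"
            using F_Diff[OF C(1) b(2) K(1)] by simp
          moreover have "\<nu> (D \<inter> E) = \<nu> K + \<nu> ((D - K) \<inter> E)"
          proof -
            have "D \<inter> E - K = (D - K) \<inter> E" by auto
            then show ?thesis using F_Diff[OF b \<open>K \<subseteq> D \<inter> E\<close>] by simp
          qed
          ultimately have "\<nu> C \<le> \<nu> (D \<inter> E) + e"
            using absle[of "C - K"] absle[of "D - K"] mC mV mD Cs Ks Ds by (simp add: abs_le_iff)
          then have "ennreal (\<nu> C) \<le> ennreal (max 0 (\<nu> (D \<inter> E)) + e)" by (intro ennreal_leI) simp
          also have "\<dots> = ennreal (\<nu> (D \<inter> E)) + ennreal e"
            using e by (simp add: ennreal_max_0)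
          also have "\<dots> \<le> (SUP C\<in>\<U>. ennreal (\<nu> (C \<inter> E))) + ennreal e"
            by (intro add_right_mono SUP_upper D)
          finally show "ennreal (\<nu> C) \<le> (SUP C\<in>\<U>. ennreal (\<nu> (C \<inter> E))) + ennreal e" .
        qed
      qed
    qed
  qed
qed

section \<open>Kernels of Levy measures\<close>

text \<open>The measures may be infinite, so this is not a kernel into
  \<open>subprob_algebra\<close>; \<open>nn_integral_levy_kernel\<close> reduces it to one.\<close>

definition levy_kernel :: "'s measure \<Rightarrow> ('s \<Rightarrow> real measure) \<Rightarrow> bool" where
  "levy_kernel M \<kappa> \<longleftrightarrow> (\<forall>s\<in>space M. levy_measure (\<kappa> s)) \<and>
     (\<forall>B\<in>sets borel. (\<lambda>s. emeasure (\<kappa> s) B) \<in> borel_measurable M)"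

lemma levy_kernel_sets: "levy_kernel M \<kappa> \<Longrightarrow> s \<in> space M \<Longrightarrow> sets (\<kappa> s) = sets borel"
  by (simp add: levy_kernel_def levy_measure_def)

lemma levy_kernel_borel:
  "levy_kernel M \<kappa> \<Longrightarrow> s \<in> space M \<Longrightarrow> f \<in> borel_measurable borel \<Longrightarrow> f \<in> borel_measurable (\<kappa> s)"
  by (simp only: measurable_cong_sets[OF levy_kernel_sets refl])

lemma levy_kernelI:
  assumes levy: "\<And>s. s \<in> space M \<Longrightarrow> levy_measure (\<kappa> s)"
    and meas: "\<And>B. B \<in> borel0 \<Longrightarrow> (\<lambda>s. emeasure (\<kappa> s) B) \<in> borel_measurable M"
  shows "levy_kernel M \<kappa>"
  unfolding levy_kernel_def
proof (intro conjI ballI levy)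
  fix B :: "real set" assume B: "B \<in> sets borel"
  have "emeasure (\<kappa> s) B = (SUP n. emeasure (\<kappa> s) (B \<inter> off n))" if "s \<in> space M" for s
  proof -
    have l: "sets (\<kappa> s) = sets borel" "emeasure (\<kappa> s) {0} = 0"
      using levy[OF that] by (simp_all add: levy_measure_def)
    have "emeasure (\<kappa> s) B = emeasure (\<kappa> s) (B - {0})"
      using emeasure_Diff_null_set[of "{0}" "\<kappa> s" B] l B by (auto simp: null_sets_def)
    then show ?thesis using emeasure_Diff_zero_SUP[OF l(1) B] by simp
  qed
  moreover have "(\<lambda>s. SUP n. emeasure (\<kappa> s) (B \<inter> off n)) \<in> borel_measurable M"
    using meas[OF Int_off_borel0[OF B]] by measurable
  ultimately show "(\<lambda>s. emeasure (\<kappa> s) B) \<in> borel_measurable M"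
    by (subst measurable_cong) auto
qed

section \<open>Measurability of integrals against a kernel\<close>

lemma nn_integral_levy_kernel_fixed:
  assumes \<kappa>: "levy_kernel M \<kappa>" and g: "g \<in> borel_measurable borel"
  shows "(\<lambda>s. \<integral>\<^sup>+x. g x \<partial>\<kappa> s) \<in> borel_measurable M"
  using g
proof (induction rule: borel_measurable_induct)
  case (cong f g)
  then have "f = g" by auto
  then show ?case using cong by simp
next
  case (set A)
  have "(\<integral>\<^sup>+x. indicator A x \<partial>\<kappa> s) = emeasure (\<kappa> s) A" if "s \<in> space M" for s
    using set levy_kernel_sets[OF \<kappa> that] by simp
  then show ?case using \<kappa> set by (subst measurable_cong) (auto simp: levy_kernel_def)
next
  case (mult u c)
  have "(\<integral>\<^sup>+x. c * u x \<partial>\<kappa> s) = c * (\<integral>\<^sup>+x. u x \<partial>\<kappa> s)" if "s \<in> space M" for s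
    using mult(2) levy_kernel_borel[OF \<kappa> that] by (intro nn_integral_cmult)
  then show ?case using mult by (subst measurable_cong[where g="\<lambda>s. c * (\<integral>\<^sup>+x. u x \<partial>\<kappa> s)"]) auto
next
  case (add u v)
  have "(\<integral>\<^sup>+x. v x + u x \<partial>\<kappa> s) = (\<integral>\<^sup>+x. v x \<partial>\<kappa> s) + (\<integral>\<^sup>+x. u x \<partial>\<kappa> s)" if "s \<in> space M" for s
    using add(1,3) levy_kernel_borel[OF \<kappa> that] by (intro nn_integral_add)
  then show ?case using add
    by (subst measurable_cong[where g="\<lambda>s. (\<integral>\<^sup>+x. v x \<partial>\<kappa> s) + (\<integral>\<^sup>+x. u x \<partial>\<kappa> s)"]) auto
next
  case (seq U)
  have "(\<integral>\<^sup>+x. (SUP i. U i x) \<partial>\<kappa> s) = (SUP i. \<integral>\<^sup>+x. U i x \<partial>\<kappa> s)" if "s \<in> space M" for s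
    using seq by (intro nn_integral_monotone_convergence_SUP levy_kernel_borel[OF \<kappa> that]) auto
  then have "(\<lambda>s. \<integral>\<^sup>+x. (SUP i. U i x) \<partial>\<kappa> s) \<in> borel_measurable M"
    using seq by (subst measurable_cong[where g="\<lambda>s. SUP i. \<integral>\<^sup>+x. U i x \<partial>\<kappa> s"]) auto
  then show ?case using seq by (simp add: image_comp SUP_apply)
qed

text \<open>The density \<open>wgt x / (1 + m s)\<close>, with \<open>m s\<close> the weight of
  \<open>\<kappa> s\<close>, turns \<open>\<kappa>\<close> into a sub-probability kernel
  \<open>K\<close>. The integrand is multiplied by the reciprocal of the density, and measurability
  is known for \<open>K\<close>.\<close>

lemma nn_integral_levy_kernel:
  assumes \<kappa>: "levy_kernel M \<kappa>" and h: "(\<lambda>(s, x). h s x) \<in> borel_measurable (M \<Otimes>\<^sub>M borel)"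
  shows "(\<lambda>s. \<integral>\<^sup>+x. h s x \<partial>\<kappa> s) \<in> borel_measurable M"
proof -
  define m where "m s = enn2real (wint (\<kappa> s))" for s
  have [measurable]: "m \<in> borel_measurable M"
    unfolding m_def using nn_integral_levy_kernel_fixed[OF \<kappa>, of "\<lambda>x. ennreal (wgt x)"] by simp
  have m0: "0 \<le> m s" for s by (simp add: m_def)
  have mw: "wint (\<kappa> s) = ennreal (m s)" if "s \<in> space M" for s
    using \<kappa> that by (simp add: levy_kernel_def levy_measure_def m_def)
  define c where "c s x = wgt x / (1 + m s)" for s x
  have c0: "0 \<le> c s x" for s x using m0[of s] by (simp add: c_def)
  define K where "K s = density (\<kappa> s) (\<lambda>x. ennreal (c s x))" for s
  have sets: "sets (K s) = sets borel" if "s \<in> space M" for s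
    using levy_kernel_sets[OF \<kappa> that] by (simp add: K_def)
  have cm [measurable]: "(\<lambda>x. ennreal (c s x)) \<in> borel_measurable borel" for s
    unfolding c_def by measurable
  have em: "emeasure (K s) B = ennreal (1 / (1 + m s)) * (\<integral>\<^sup>+x. ennreal (wgt x) * indicator B x \<partial>\<kappa> s)"
    if s: "s \<in> space M" and B: "B \<in> sets borel" for s B
  proof -
    note [measurable_cong] = levy_kernel_sets[OF \<kappa> s]
    note [measurable] = B
    have "emeasure (K s) B = (\<integral>\<^sup>+x. ennreal (c s x) * indicator B x \<partial>\<kappa> s)"
      unfolding K_def by (intro emeasure_density) measurable
    also have "\<dots> = (\<integral>\<^sup>+x. ennreal (1 / (1 + m s)) * (ennreal (wgt x) * indicator B x) \<partial>\<kappa> s)"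
    proof (intro nn_integral_cong)
      fix x
      have "ennreal (c s x) = ennreal (1 / (1 + m s)) * ennreal (wgt x)"
        using m0[of s] by (subst ennreal_mult[symmetric]) (auto simp: c_def)
      then show "ennreal (c s x) * indicator B x = ennreal (1 / (1 + m s)) * (ennreal (wgt x) * indicator B x)"
        by (simp add: mult.assoc)
    qed
    also have "\<dots> = ennreal (1 / (1 + m s)) * (\<integral>\<^sup>+x. ennreal (wgt x) * indicator B x \<partial>\<kappa> s)"
      by (intro nn_integral_cmult) measurable
    finally show ?thesis .
  qed
  have Kmeas: "K \<in> measurable M (subprob_algebra borel)"
  proof (rule measurable_subprob_algebra)
    fix s assume s: "s \<in> space M"
    show "sets (K s) = sets borel" by (rule sets[OF s])
    have "space (K s) = UNIV" using sets_eq_imp_space_eq[OF sets[OF s]] by simp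
    then have "emeasure (K s) (space (K s)) = ennreal (1 / (1 + m s)) * ennreal (m s)"
      using em[OF s, of UNIV] mw[OF s] by simp
    also have "\<dots> \<le> 1"
      using m0[of s] by (simp add: ennreal_mult[symmetric] ennreal_le_1)
    finally show "subprob_space (K s)"
      using \<open>space (K s) = UNIV\<close> by (intro subprob_spaceI) auto
  next
    fix B :: "real set" assume B: "B \<in> sets borel"
    note [measurable] = B
    have "(\<lambda>s. \<integral>\<^sup>+x. ennreal (wgt x) * indicator B x \<partial>\<kappa> s) \<in> borel_measurable M"
      by (rule nn_integral_levy_kernel_fixed[OF \<kappa>]) measurable
    then have "(\<lambda>s. ennreal (1 / (1 + m s)) * (\<integral>\<^sup>+x. ennreal (wgt x) * indicator B x \<partial>\<kappa> s)) \<in> borel_measurable M"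
      by measurable
    then show "(\<lambda>s. emeasure (K s) B) \<in> borel_measurable M"
      using em[OF _ B] by (subst measurable_cong) auto
  qed
  \<comment> \<open>The indicator excludes 0, where the density vanishes and has no reciprocal;
    \<open>\<kappa> s\<close> has no mass there.\<close>
  define k where "k s x = h s x * ennreal ((1 + m s) / wgt x) * indicator (- {0}) x" for s x
  have "(\<lambda>(s, x). k s x) \<in> borel_measurable (M \<Otimes>\<^sub>M borel)"
    unfolding k_def using h by measurable
  then have "(\<lambda>s. \<integral>\<^sup>+x. k s x \<partial>K s) \<in> borel_measurable M"
    by (rule nn_integral_measurable_subprob_algebra2[OF _ Kmeas])
  moreover have "(\<integral>\<^sup>+x. k s x \<partial>K s) = (\<integral>\<^sup>+x. h s x \<partial>\<kappa> s)" if s: "s \<in> space M" for s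
  proof -
    note [measurable_cong] = levy_kernel_sets[OF \<kappa> s]
    have hs [measurable]: "h s \<in> borel_measurable borel"
      using measurable_compose[OF measurable_Pair1'[OF s] h] by simp
    have [measurable]: "k s \<in> borel_measurable borel"
      unfolding k_def by measurable
    have "(\<integral>\<^sup>+x. k s x \<partial>K s) = (\<integral>\<^sup>+x. ennreal (c s x) * k s x \<partial>\<kappa> s)"
      unfolding K_def by (intro nn_integral_density) measurable
    also have "\<dots> = (\<integral>\<^sup>+x. h s x \<partial>\<kappa> s)"
    proof (rule nn_integral_cong_AE)
      have "{0} \<in> null_sets (\<kappa> s)"
        using \<kappa> s by (auto simp: levy_kernel_def levy_measure_def null_sets_def)
      then have "AE x in \<kappa> s. x \<notin> {0}" by (rule AE_not_in)
      then show "AE x in \<kappa> s. ennreal (c s x) * k s x = h s x"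
      proof (eventually_elim)
        fix x :: real assume "x \<notin> {0}"
        then have w: "wgt x > 0" "x \<noteq> 0" by auto
        have "W / (1 + m s) * ((1 + m s) / W) = 1" if "W > 0" for W using that m0[of s] by simp
        from this[OF w(1)] have "c s x * ((1 + m s) / wgt x) = 1" unfolding c_def .
        then have "ennreal (c s x) * ennreal ((1 + m s) / wgt x) = 1"
          using c0[of s x] m0[of s] by (subst ennreal_mult[symmetric]) auto
        then show "ennreal (c s x) * k s x = h s x"
          using w unfolding k_def by (simp add: mult.left_commute)
      qed
    qed
    finally show ?thesis .
  qed
  ultimately show ?thesis by (subst measurable_cong[symmetric]) auto
qed

lemma complex_integrable_iff:
  fixes f :: "'a \<Rightarrow> complex"
  shows "integrable M f \<longleftrightarrow> integrable M (\<lambda>x. Re (f x)) \<and> integrable M (\<lambda>x. Im (f x))"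
proof safe
  assume "integrable M (\<lambda>x. Re (f x))" "integrable M (\<lambda>x. Im (f x))"
  then have "integrable M (\<lambda>x. of_real (Re (f x)) + \<i> * of_real (Im (f x)))" by simp
  then show "integrable M f" by (simp flip: complex_eq)
qed simp_all

text \<open>The image of \<open>M(ds) \<kappa>(s, dx)\<close> under
  \<open>(s, x) \<mapsto> x * f s\<close>. For the Jordan kernels and a simple function
  \<open>f\<close>, the two images are the positive and negative jump measures of the integral of
  \<open>f\<close>, up to mass at 0.\<close>

definition kernel_image :: "'s measure \<Rightarrow> ('s \<Rightarrow> real measure) \<Rightarrow> ('s \<Rightarrow> real) \<Rightarrow> real measure" where
  "kernel_image M \<kappa> f =
     measure_of UNIV (sets borel) (\<lambda>B. \<integral>\<^sup>+s. emeasure (\<kappa> s) {x. x * f s \<in> B} \<partial>M)"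

section \<open>Fubini for the image of a kernel\<close>

lemma sets_kernel_image [simp, measurable_cong]: "sets (kernel_image M \<kappa> f) = sets borel"
  using sigma_algebra.sigma_sets_eq[OF sets.sigma_algebra_axioms, of "borel :: real measure"]
  by (simp add: kernel_image_def)

lemma scale_vimage_borel: 
  assumes "B \<in> sets borel" 
  shows "{x::real. x * c \<in> B} \<in> sets borel"
proof -
  have "(\<lambda>x::real. x * c) \<in> borel_measurable borel" by measurable
  from measurable_sets[OF this assms] show ?thesis by (simp add: vimage_def)
qed

context
  fixes M :: "'s measure" and \<kappa> and f :: "'s \<Rightarrow> real"
  assumes \<kappa>: "levy_kernel M \<kappa>" and f [measurable]: "f \<in> borel_measurable M"
begin

lemma nn_integral_levy_kernel_scaled [measurable]:
  assumes [measurable]: "g \<in> borel_measurable borel"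
  shows "(\<lambda>s. \<integral>\<^sup>+x. g (x * f s) \<partial>\<kappa> s) \<in> borel_measurable M"
  by (rule nn_integral_levy_kernel[OF \<kappa>]) measurable

lemma emeasure_kernel_image:
  assumes B: "B \<in> sets borel"
  shows "emeasure (kernel_image M \<kappa> f) B = (\<integral>\<^sup>+s. emeasure (\<kappa> s) {x. x * f s \<in> B} \<partial>M)"
proof -
  have em: "(\<lambda>s. emeasure (\<kappa> s) {x. x * f s \<in> C}) \<in> borel_measurable M" if C: "C \<in> sets borel" for C
  proof -
    have "(\<lambda>s. \<integral>\<^sup>+x. indicator C (x * f s) \<partial>\<kappa> s) \<in> borel_measurable M"
      using C by (intro nn_integral_levy_kernel_scaled) auto
    moreover have "(\<integral>\<^sup>+x. indicator C (x * f s) \<partial>\<kappa> s) = emeasure (\<kappa> s) {x. x * f s \<in> C}" if s: "s \<in> space M" for s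
    proof -
      have "(\<integral>\<^sup>+x. indicator C (x * f s) \<partial>\<kappa> s) = (\<integral>\<^sup>+x. indicator {x. x * f s \<in> C} x \<partial>\<kappa> s)"
        by (intro nn_integral_cong) (simp add: indicator_def)
      then show ?thesis using scale_vimage_borel[OF C] levy_kernel_sets[OF \<kappa> s] by simp
    qed
    ultimately show ?thesis by (subst measurable_cong[symmetric]) auto
  qed
  have "countably_additive (sets borel) (\<lambda>B. \<integral>\<^sup>+s. emeasure (\<kappa> s) {x. x * f s \<in> B} \<partial>M)"
    unfolding countably_additive_def
  proof (intro allI impI)
    fix A :: "nat \<Rightarrow> real set"
    assume A: "range A \<subseteq> sets borel" "disjoint_family A"
    have "(\<Sum>i. \<integral>\<^sup>+s. emeasure (\<kappa> s) {x. x * f s \<in> A i} \<partial>M) = (\<integral>\<^sup>+s. (\<Sum>i. emeasure (\<kappa> s) {x. x * f s \<in> A i}) \<partial>M)"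
      using A em by (intro nn_integral_suminf[symmetric]) auto
    also have "\<dots> = (\<integral>\<^sup>+s. emeasure (\<kappa> s) {x. x * f s \<in> (\<Union>i. A i)} \<partial>M)"
    proof (intro nn_integral_cong)
      fix s assume s: "s \<in> space M"
      have "(\<Sum>i. emeasure (\<kappa> s) {x. x * f s \<in> A i}) = emeasure (\<kappa> s) (\<Union>i. {x. x * f s \<in> A i})"
        using A levy_kernel_sets[OF \<kappa> s]
        by (intro suminf_emeasure) (auto simp: disjoint_family_on_def intro!: scale_vimage_borel)
      also have "(\<Union>i. {x. x * f s \<in> A i}) = {x. x * f s \<in> (\<Union>i. A i)}" by auto
      finally show "(\<Sum>i. emeasure (\<kappa> s) {x. x * f s \<in> A i}) = emeasure (\<kappa> s) {x. x * f s \<in> (\<Union>i. A i)}" .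
    qed
    finally show "(\<Sum>i. \<integral>\<^sup>+s. emeasure (\<kappa> s) {x. x * f s \<in> A i} \<partial>M) = (\<integral>\<^sup>+s. emeasure (\<kappa> s) {x. x * f s \<in> (\<Union>i. A i)} \<partial>M)" .
  qed
  then show ?thesis
    unfolding kernel_image_def
    using B sets.sigma_algebra_axioms[of "borel :: real measure"]
    by (intro emeasure_measure_of_sigma) (auto simp: positive_def)
qed

lemma nn_integral_kernel_image:
  assumes g: "g \<in> borel_measurable borel"
  shows "(\<integral>\<^sup>+x. g x \<partial>kernel_image M \<kappa> f) = (\<integral>\<^sup>+s. \<integral>\<^sup>+x. g (x * f s) \<partial>\<kappa> s \<partial>M)"
  using g
proof (induction rule: borel_measurable_induct)
  case (cong f g)
  then have "f = g" by auto
  then show ?case using cong by simp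
next
  case (set A)
  have "(\<integral>\<^sup>+x. indicator A (x * f s) \<partial>\<kappa> s) = emeasure (\<kappa> s) {x. x * f s \<in> A}" if s: "s \<in> space M" for s
  proof -
    have "(\<integral>\<^sup>+x. indicator A (x * f s) \<partial>\<kappa> s) = (\<integral>\<^sup>+x. indicator {x. x * f s \<in> A} x \<partial>\<kappa> s)"
      by (intro nn_integral_cong) (simp add: indicator_def)
    then show ?thesis using scale_vimage_borel[OF set] levy_kernel_sets[OF \<kappa> s] by simp
  qed
  then show ?case using set by (simp add: emeasure_kernel_image cong: nn_integral_cong)
next
  case (mult u c)
  have [measurable]: "u \<in> borel_measurable borel" by fact
  have "(\<integral>\<^sup>+x. c * u (x * f s) \<partial>\<kappa> s) = c * (\<integral>\<^sup>+x. u (x * f s) \<partial>\<kappa> s)" if s: "s \<in> space M" for s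
  proof -
    note [measurable_cong] = levy_kernel_sets[OF \<kappa> s]
    show ?thesis by (intro nn_integral_cmult) measurable
  qed
  then show ?case using mult by (simp add: nn_integral_cmult cong: nn_integral_cong)
next
  case (add u v)
  have [measurable]: "u \<in> borel_measurable borel" "v \<in> borel_measurable borel" by fact+
  have "(\<integral>\<^sup>+x. v (x * f s) + u (x * f s) \<partial>\<kappa> s) = (\<integral>\<^sup>+x. v (x * f s) \<partial>\<kappa> s) + (\<integral>\<^sup>+x. u (x * f s) \<partial>\<kappa> s)"
    if s: "s \<in> space M" for s
  proof -
    note [measurable_cong] = levy_kernel_sets[OF \<kappa> s]
    show ?thesis by (intro nn_integral_add) measurable
  qed
  then show ?case using add by (simp add: nn_integral_add cong: nn_integral_cong)
next
  case (seq U)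
  have [measurable]: "U i \<in> borel_measurable borel" for i using seq by auto
  have inc: "incseq (\<lambda>i x. U i (x * f s))" for s
    using seq(3) by (auto simp: incseq_def le_fun_def)
  have S: "(\<integral>\<^sup>+x. (SUP i. U i (x * f s)) \<partial>\<kappa> s) = (SUP i. \<integral>\<^sup>+x. U i (x * f s) \<partial>\<kappa> s)" if s: "s \<in> space M" for s
  proof -
    note [measurable_cong] = levy_kernel_sets[OF \<kappa> s]
    show ?thesis by (intro nn_integral_monotone_convergence_SUP inc) measurable
  qed
  have "(\<integral>\<^sup>+s. (SUP i. \<integral>\<^sup>+x. U i (x * f s) \<partial>\<kappa> s) \<partial>M) = (SUP i. \<integral>\<^sup>+s. \<integral>\<^sup>+x. U i (x * f s) \<partial>\<kappa> s \<partial>M)"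
    using inc by (intro nn_integral_monotone_convergence_SUP)
      (auto simp: incseq_def le_fun_def intro!: nn_integral_mono)
  then have "(\<integral>\<^sup>+s. \<integral>\<^sup>+x. (SUP i. U i (x * f s)) \<partial>\<kappa> s \<partial>M) = (SUP i. \<integral>\<^sup>+s. \<integral>\<^sup>+x. U i (x * f s) \<partial>\<kappa> s \<partial>M)"
    by (simp add: S cong: nn_integral_cong)
  moreover have "(\<integral>\<^sup>+x. (SUP i. U i x) \<partial>kernel_image M \<kappa> f) = (SUP i. \<integral>\<^sup>+x. U i x \<partial>kernel_image M \<kappa> f)"
    using seq by (intro nn_integral_monotone_convergence_SUP) auto
  ultimately show ?case using seq by (simp add: image_comp SUP_apply)
qed

lemma kernel_image_nonneg:
  fixes g :: "real \<Rightarrow> real"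
  assumes g [measurable]: "g \<in> borel_measurable borel" and g0: "\<And>x. 0 \<le> g x"
    and int: "integrable (kernel_image M \<kappa> f) g"
  shows "AE s in M. integrable (\<kappa> s) (\<lambda>x. g (x * f s))"
    and "integrable M (\<lambda>s. LINT x|\<kappa> s. g (x * f s))"
    and "(LINT x|kernel_image M \<kappa> f. g x) = (LINT s|M. LINT x|\<kappa> s. g (x * f s))"
proof -
  let ?I = "\<lambda>s. \<integral>\<^sup>+x. ennreal (g (x * f s)) \<partial>\<kappa> s"
  have eq: "(\<integral>\<^sup>+x. ennreal (g x) \<partial>kernel_image M \<kappa> f) = (\<integral>\<^sup>+s. ?I s \<partial>M)"
    by (rule nn_integral_kernel_image) measurable
  have fin: "(\<integral>\<^sup>+s. ?I s \<partial>M) < \<infinity>"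
    using int eq by (simp add: real_integrable_def less_top)
  have I [measurable]: "?I \<in> borel_measurable M"
    by (rule nn_integral_levy_kernel_scaled) measurable
  have ae: "AE s in M. ?I s < \<infinity>"
    using nn_integral_PInf_AE[OF I] fin by (simp add: less_top)
  have L: "(LINT x|\<kappa> s. g (x * f s)) = enn2real (?I s)" if s: "s \<in> space M" for s
  proof -
    note [measurable_cong] = levy_kernel_sets[OF \<kappa> s]
    show ?thesis using g0 by (intro integral_eq_nn_integral) auto
  qed
  show "AE s in M. integrable (\<kappa> s) (\<lambda>x. g (x * f s))"
    using ae AE_space
  proof eventually_elim
    case (elim s)
    note [measurable_cong] = levy_kernel_sets[OF \<kappa> elim(2)]
    show ?case using elim g0 by (intro integrableI_nonneg) auto
  qed
  have "(\<integral>\<^sup>+s. ennreal (enn2real (?I s)) \<partial>M) = (\<integral>\<^sup>+s. ?I s \<partial>M)"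
    using ae by (intro nn_integral_cong_AE) auto
  note e = this
  have "integrable M (\<lambda>s. enn2real (?I s))"
    using e fin by (intro integrableI_nonneg) auto
  then show "integrable M (\<lambda>s. LINT x|\<kappa> s. g (x * f s))"
    by (subst Bochner_Integration.integrable_cong[OF refl L])
  have "(LINT s|M. LINT x|\<kappa> s. g (x * f s)) = (LINT s|M. enn2real (?I s))"
    by (intro Bochner_Integration.integral_cong refl L)
  also have "\<dots> = enn2real (\<integral>\<^sup>+s. ?I s \<partial>M)"
    unfolding e[symmetric] by (intro integral_eq_nn_integral) auto
  also have "\<dots> = (LINT x|kernel_image M \<kappa> f. g x)"
    using eq g0 by (subst integral_eq_nn_integral) auto
  finally show "(LINT x|kernel_image M \<kappa> f. g x) = (LINT s|M. LINT x|\<kappa> s. g (x * f s))" by simp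
qed

lemma kernel_image_real:
  fixes g :: "real \<Rightarrow> real"
  assumes int: "integrable (kernel_image M \<kappa> f) g"
  shows "AE s in M. integrable (\<kappa> s) (\<lambda>x. g (x * f s))"
    and "integrable M (\<lambda>s. LINT x|\<kappa> s. g (x * f s))"
    and "(LINT x|kernel_image M \<kappa> f. g x) = (LINT s|M. LINT x|\<kappa> s. g (x * f s))"
proof -
  have g [measurable]: "g \<in> borel_measurable borel" using int by (auto dest: borel_measurable_integrable)
  let ?p = "\<lambda>x. max 0 (g x)" and ?n = "\<lambda>x. max 0 (- g x)"
  have pi: "integrable (kernel_image M \<kappa> f) ?p" "integrable (kernel_image M \<kappa> f) ?n" using int by auto
  note P = kernel_image_nonneg[of ?p, OF _ _ pi(1)] and N = kernel_image_nonneg[of ?n, OF _ _ pi(2)]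
  have gd: "(\<lambda>x. g (x * c)) = (\<lambda>x. ?p (x * c) - ?n (x * c))" for c by auto
  have ae: "AE s in M. integrable (\<kappa> s) (\<lambda>x. ?p (x * f s)) \<and> integrable (\<kappa> s) (\<lambda>x. ?n (x * f s))"
    using P(1) N(1) by simp
  show "AE s in M. integrable (\<kappa> s) (\<lambda>x. g (x * f s))"
    using ae
  proof eventually_elim
    case (elim s)
    then show ?case by (subst gd) (intro Bochner_Integration.integrable_diff, auto)
  qed
  have ae2: "AE s in M. (LINT x|\<kappa> s. g (x * f s)) = (LINT x|\<kappa> s. ?p (x * f s)) - (LINT x|\<kappa> s. ?n (x * f s))"
    using ae
  proof eventually_elim
    case (elim s)
    then show ?case by (subst gd, subst Bochner_Integration.integral_diff) auto
  qed
  have meas: "(\<lambda>s. LINT x|\<kappa> s. g (x * f s)) \<in> borel_measurable M"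
  proof -
    \<comment> \<open>A divergent integral has the value 0, so the inner integral is written as a
      case distinction between measurable extended integrals; finiteness almost everywhere alone
      would not give measurability.\<close>
    have "(LINT x|\<kappa> s. g (x * f s)) = (if (\<integral>\<^sup>+x. ennreal \<bar>g (x * f s)\<bar> \<partial>\<kappa> s) < \<infinity>
        then enn2real (\<integral>\<^sup>+x. ennreal (g (x * f s)) \<partial>\<kappa> s) - enn2real (\<integral>\<^sup>+x. ennreal (- g (x * f s)) \<partial>\<kappa> s) else 0)"
      if s: "s \<in> space M" for s
    proof -
      note [measurable_cong] = levy_kernel_sets[OF \<kappa> s]
      have "(\<integral>\<^sup>+x. ennreal \<bar>g (x * f s)\<bar> \<partial>\<kappa> s) < \<infinity> \<longleftrightarrow> integrable (\<kappa> s) (\<lambda>x. g (x * f s))"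
        by (simp add: integrable_iff_bounded)
      then show ?thesis by (auto simp: real_lebesgue_integral_def not_integrable_integral_eq)
    qed
    moreover have "(\<lambda>s. if (\<integral>\<^sup>+x. ennreal \<bar>g (x * f s)\<bar> \<partial>\<kappa> s) < \<infinity>
        then enn2real (\<integral>\<^sup>+x. ennreal (g (x * f s)) \<partial>\<kappa> s) - enn2real (\<integral>\<^sup>+x. ennreal (- g (x * f s)) \<partial>\<kappa> s) else 0)
        \<in> borel_measurable M"
      using nn_integral_levy_kernel_scaled[of "\<lambda>x. ennreal \<bar>g x\<bar>"] nn_integral_levy_kernel_scaled[of "\<lambda>x. ennreal (g x)"]
        nn_integral_levy_kernel_scaled[of "\<lambda>x. ennreal (- g x)"] by measurable
    ultimately show ?thesis by (subst measurable_cong) auto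
  qed
  have pm: "?p \<in> borel_measurable borel" "?n \<in> borel_measurable borel" by measurable
  show "integrable M (\<lambda>s. LINT x|\<kappa> s. g (x * f s))"
    using P(2)[OF pm(1)] N(2)[OF pm(2)] ae2 meas
    by (subst integrable_cong_AE[OF meas _ ae2]) auto
  have "(LINT s|M. LINT x|\<kappa> s. g (x * f s)) =
      (LINT s|M. (LINT x|\<kappa> s. ?p (x * f s)) - (LINT x|\<kappa> s. ?n (x * f s)))"
    using P(2)[OF pm(1)] N(2)[OF pm(2)] ae2 meas by (intro integral_cong_AE) auto
  also have "\<dots> = (LINT x|kernel_image M \<kappa> f. ?p x) - (LINT x|kernel_image M \<kappa> f. ?n x)"
    using P(2,3)[OF pm(1)] N(2,3)[OF pm(2)] by (subst Bochner_Integration.integral_diff) auto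
  also have "\<dots> = (LINT x|kernel_image M \<kappa> f. ?p x - ?n x)"
    by (rule Bochner_Integration.integral_diff[OF pi, symmetric])
  also have "(\<lambda>x. ?p x - ?n x) = g" by auto
  finally show "(LINT x|kernel_image M \<kappa> f. g x) = (LINT s|M. LINT x|\<kappa> s. g (x * f s))" by simp
qed

end

context
  fixes M :: "'s measure" and \<kappa> and f :: "'s \<Rightarrow> real"
  assumes \<kappa>: "levy_kernel M \<kappa>" and f [measurable]: "f \<in> borel_measurable M"
begin

lemmas kernel_image_real' = kernel_image_real[OF \<kappa> f]
lemmas nn_integral_levy_kernel_scaled' = nn_integral_levy_kernel_scaled[OF \<kappa> f]
lemma kernel_image_complex:
  fixes g :: "real \<Rightarrow> complex"
  assumes int: "integrable (kernel_image M \<kappa> f) g"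
  shows "integrable M (\<lambda>s. LINT x|\<kappa> s. g (x * f s))"
    and "(LINT x|kernel_image M \<kappa> f. g x) = (LINT s|M. LINT x|\<kappa> s. g (x * f s))"
proof -
  have g [measurable]: "g \<in> borel_measurable borel"
    using borel_measurable_integrable[OF int] unfolding measurable_cong_sets[OF sets_kernel_image refl] .
  have i: "integrable (kernel_image M \<kappa> f) (\<lambda>x. Re (g x))" "integrable (kernel_image M \<kappa> f) (\<lambda>x. Im (g x))"
    using integrable_Re[OF int] integrable_Im[OF int] .
  note Re = kernel_image_real'[OF i(1)] and Im = kernel_image_real'[OF i(2)]
  let ?J = "\<lambda>s. LINT x|\<kappa> s. g (x * f s)"
  let ?K = "\<lambda>s. Complex (LINT x|\<kappa> s. Re (g (x * f s))) (LINT x|\<kappa> s. Im (g (x * f s)))"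
  have JK: "?J s = (if integrable (\<kappa> s) (\<lambda>x. Re (g (x * f s))) \<and> integrable (\<kappa> s) (\<lambda>x. Im (g (x * f s))) then ?K s else 0)"
    if s: "s \<in> space M" for s
  proof -
    note [measurable_cong] = levy_kernel_sets[OF \<kappa> s]
    have "integrable (\<kappa> s) (\<lambda>x. Re (g (x * f s))) \<and> integrable (\<kappa> s) (\<lambda>x. Im (g (x * f s))) \<longleftrightarrow> integrable (\<kappa> s) (\<lambda>x. g (x * f s))"
      by (rule complex_integrable_iff[symmetric])
    then show ?thesis
      by (cases "integrable (\<kappa> s) (\<lambda>x. g (x * f s))") (auto intro!: complex_eqI simp: not_integrable_integral_eq)
  qed
  have K: "integrable M ?K" using Re(2) Im(2) by (subst complex_integrable_iff) simp
  have ae: "AE s in M. ?J s = ?K s"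
    using Re(1) Im(1) AE_space
  proof eventually_elim
    case (elim s)
    then show ?case using JK[of s] by simp
  qed
  have iff: "integrable (\<kappa> s) (\<lambda>x. k (g (x * f s))) \<longleftrightarrow> (\<integral>\<^sup>+x. ennreal \<bar>k (g (x * f s))\<bar> \<partial>\<kappa> s) < \<infinity>"
    if s: "s \<in> space M" and [measurable]: "k \<in> borel_measurable borel" for s and k :: "complex \<Rightarrow> real"
  proof -
    note [measurable_cong] = levy_kernel_sets[OF \<kappa> s]
    show ?thesis by (simp add: integrable_iff_bounded)
  qed
  have Km [measurable]: "?K \<in> borel_measurable M" using K by simp
  have [measurable]: "(\<lambda>s. \<integral>\<^sup>+x. ennreal \<bar>Re (g (x * f s))\<bar> \<partial>\<kappa> s) \<in> borel_measurable M"
    "(\<lambda>s. \<integral>\<^sup>+x. ennreal \<bar>Im (g (x * f s))\<bar> \<partial>\<kappa> s) \<in> borel_measurable M"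
    using nn_integral_levy_kernel_scaled'[of "\<lambda>x. ennreal \<bar>Re (g x)\<bar>"] nn_integral_levy_kernel_scaled'[of "\<lambda>x. ennreal \<bar>Im (g x)\<bar>"]
    by simp_all
  have "(\<lambda>s. if (\<integral>\<^sup>+x. ennreal \<bar>Re (g (x * f s))\<bar> \<partial>\<kappa> s) < \<infinity> \<and>
      (\<integral>\<^sup>+x. ennreal \<bar>Im (g (x * f s))\<bar> \<partial>\<kappa> s) < \<infinity> then ?K s else 0) \<in> borel_measurable M"
    by measurable
  then have meas: "?J \<in> borel_measurable M"
    using JK iff[of _ Re] iff[of _ Im] by (subst measurable_cong) auto
  show "integrable M ?J" using K by (subst integrable_cong_AE[OF meas _ ae]) auto
  have "(LINT s|M. ?J s) = (LINT s|M. ?K s)" by (intro integral_cong_AE meas Km ae)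
  also have "\<dots> = (LINT x|kernel_image M \<kappa> f. g x)"
    using Re(3) Im(3) K int by (simp add: complex_eq_iff flip: integral_Re integral_Im)
  finally show "(LINT x|kernel_image M \<kappa> f. g x) = (LINT s|M. ?J s)" by simp
qed

end

text \<open>The fibres outside \<open>A\<close> are sent to 0, where \<open>g\<close>
  vanishes.\<close>

lemma kernel_image_indicator:
  assumes \<kappa>: "levy_kernel M \<kappa>" and A: "A \<in> sets M"
    and g: "g \<in> borel_measurable borel" "g 0 = 0"
  shows "(\<integral>\<^sup>+x. g x \<partial>kernel_image M \<kappa> (indicator A)) = (\<integral>\<^sup>+s\<in>A. (\<integral>\<^sup>+x. g x \<partial>\<kappa> s) \<partial>M)"
proof -
  have "(\<integral>\<^sup>+x. g x \<partial>kernel_image M \<kappa> (indicator A)) = (\<integral>\<^sup>+s. \<integral>\<^sup>+x. g (x * indicator A s) \<partial>\<kappa> s \<partial>M)"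
    using A g by (intro nn_integral_kernel_image \<kappa>) auto
  also have "\<dots> = (\<integral>\<^sup>+s\<in>A. (\<integral>\<^sup>+x. g x \<partial>\<kappa> s) \<partial>M)"
    using g(2) by (intro nn_integral_cong) (simp add: indicator_def)
  finally show ?thesis .
qed

lemma emeasure_kernel_image_indicator:
  assumes \<kappa>: "levy_kernel M \<kappa>" and A: "A \<in> sets M" and B: "B \<in> borel0"
  shows "emeasure (kernel_image M \<kappa> (indicator A)) B = (\<integral>\<^sup>+s\<in>A. emeasure (\<kappa> s) B \<partial>M)"
proof -
  have Bs: "B \<in> sets borel" using B borel0_sets by auto
  have "emeasure (kernel_image M \<kappa> (indicator A)) B = (\<integral>\<^sup>+x. indicator B x \<partial>kernel_image M \<kappa> (indicator A))"
    using Bs by simp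
  also have "\<dots> = (\<integral>\<^sup>+s\<in>A. (\<integral>\<^sup>+x. indicator B x \<partial>\<kappa> s) \<partial>M)"
    using borel0_zero[OF B] Bs by (intro kernel_image_indicator \<kappa> A) (auto simp: indicator_def)
  also have "\<dots> = (\<integral>\<^sup>+s\<in>A. emeasure (\<kappa> s) B \<partial>M)"
    using Bs levy_kernel_sets[OF \<kappa>] by (intro nn_integral_cong) simp
  finally show ?thesis .
qed

lemma levy_measure_borel0_finite:
  assumes "levy_measure M" "B \<in> borel0"
  shows "emeasure M B < \<infinity>"
  using assms by (intro emeasure_borel0_finite) (auto simp: levy_measure_def)

lemma measure_kernel_image_indicator:
  assumes \<kappa>: "levy_kernel M \<kappa>" and A: "A \<in> sets M" and B: "B \<in> borel0"
    and fin: "(\<integral>\<^sup>+s\<in>A. emeasure (\<kappa> s) B \<partial>M) < \<infinity>"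
  shows "set_integrable M A (\<lambda>s. measure (\<kappa> s) B)"
    and "(LINT s:A|M. measure (\<kappa> s) B) = measure (kernel_image M \<kappa> (indicator A)) B"
proof -
  have Bs: "B \<in> sets borel" using B borel0_sets by auto
  have m [measurable]: "(\<lambda>s. emeasure (\<kappa> s) B) \<in> borel_measurable M"
    using \<kappa> Bs by (auto simp: levy_kernel_def)
  note [measurable] = A
  have meas: "(\<lambda>s. measure (\<kappa> s) B) \<in> borel_measurable M"
    unfolding measure_def by measurable
  have eq: "ennreal (indicator A s * measure (\<kappa> s) B) = emeasure (\<kappa> s) B * indicator A s" if "s \<in> space M" for s
  proof -
    have "emeasure (\<kappa> s) B < \<infinity>"
      using \<kappa> that by (intro levy_measure_borel0_finite B) (simp add: levy_kernel_def)
    then have "emeasure (\<kappa> s) B = ennreal (measure (\<kappa> s) B)"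
      by (intro emeasure_eq_ennreal_measure) simp
    then show ?thesis by (simp add: indicator_def)
  qed
  have e: "(\<integral>\<^sup>+s. ennreal (indicator A s * measure (\<kappa> s) B) \<partial>M) = (\<integral>\<^sup>+s\<in>A. emeasure (\<kappa> s) B \<partial>M)"
    using eq by (intro nn_integral_cong)
  show "set_integrable M A (\<lambda>s. measure (\<kappa> s) B)"
    unfolding set_integrable_def using meas fin e
    by (intro integrableI_nonneg) auto
  show "(LINT s:A|M. measure (\<kappa> s) B) = measure (kernel_image M \<kappa> (indicator A)) B"
    unfolding set_lebesgue_integral_def measure_def[of "kernel_image M \<kappa> (indicator A)"]
      emeasure_kernel_image_indicator[OF \<kappa> A B] e[symmetric]
    using meas by (simp add: integral_eq_nn_integral)
qed

section \<open>The common core of the three settings\<close>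

lemma quasi_levy_type_signed: "quasi_levy_type \<nu> \<Longrightarrow> signed_measure_on borel0 \<nu>"
  using signed_off_iff by (simp add: quasi_levy_type_def)

lemma quasi_levy_typeD:
  assumes "quasi_levy_type \<nu>"
  shows "levy_measure (qlt_pos \<nu>)" "levy_measure (qlt_neg \<nu>)"
    "\<And>B. B \<in> borel0 \<Longrightarrow> \<nu> B = measure (qlt_pos \<nu>) B - measure (qlt_neg \<nu>) B"
proof -
  note \<nu> = quasi_levy_type_signed[OF assms]
  interpret signed_ring UNIV "sets borel" borel0 \<nu> by (rule signed_ring_borel0[OF \<nu>])
  have "wint (qlt_pos \<nu>) + wint (qlt_neg \<nu>) < \<infinity>"
    using assms nn_integral_qlt_abs[OF \<nu>, of "\<lambda>x. ennreal (wgt x)"] by (simp add: quasi_levy_type_def)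
  then have f: "wint (qlt_pos \<nu>) < \<infinity>" "wint (qlt_neg \<nu>) < \<infinity>"
    by auto
  have z: "{C \<in> borel0. C \<subseteq> {0}} = {{}}"
    using borel0_zero R_empty by (auto simp: subset_singleton_iff)
  have "emeasure (qlt_pos \<nu>) {0} = 0" "emeasure (qlt_neg \<nu>) {0} = 0"
    by (simp_all add: emeasure_qlt_pos[OF \<nu>] emeasure_qlt_neg[OF \<nu>] signed_pos_def signed_neg_def z F_empty)
  then show "levy_measure (qlt_pos \<nu>)" "levy_measure (qlt_neg \<nu>)"
    using f sets_qlt_pos[OF \<nu>] sets_qlt_neg[OF \<nu>] by (simp_all add: levy_measure_def)
  fix B assume B: "B \<in> borel0"
  then have "B \<in> sets borel" using borel0_sets by auto
  then show "\<nu> B = measure (qlt_pos \<nu>) B - measure (qlt_neg \<nu>) B"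
    using jordan[OF B] by (simp add: measure_def emeasure_qlt_pos[OF \<nu>] emeasure_qlt_neg[OF \<nu>])
qed

lemma measurable_qlt_pos:
  assumes \<nu>: "\<And>s. s \<in> space M \<Longrightarrow> quasi_levy_type (\<rho> s)"
    and m: "\<And>B. B \<in> borel0 \<Longrightarrow> (\<lambda>s. \<rho> s B) \<in> borel_measurable M"
  shows "levy_kernel M (\<lambda>s. qlt_pos (\<rho> s))"
proof (rule levy_kernelI)
  show "levy_measure (qlt_pos (\<rho> s))" if "s \<in> space M" for s
    using quasi_levy_typeD(1)[OF \<nu>[OF that]] .
  obtain \<U> :: "real set set" where U: "countable \<U>" "{} \<in> \<U>" "\<U> \<subseteq> sets borel"
    "\<And>\<nu> E. signed_measure_on borel0 \<nu> \<Longrightarrow> E \<in> borel0 \<Longrightarrow>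
       signed_pos borel0 \<nu> E = (SUP C\<in>\<U>. ennreal (\<nu> (C \<inter> E)))"
    by (rule ex_countable_approximating_family) blast
  fix E :: "real set" assume E: "E \<in> borel0"
  have "emeasure (qlt_pos (\<rho> s)) E = (SUP C\<in>\<U>. ennreal (\<rho> s (C \<inter> E)))" if "s \<in> space M" for s
    using emeasure_qlt_pos[OF quasi_levy_type_signed[OF \<nu>[OF that]]] U(4)[OF quasi_levy_type_signed[OF \<nu>[OF that]] E]
      E borel0_sets by auto
  moreover have "(\<lambda>s. SUP C\<in>\<U>. ennreal (\<rho> s (C \<inter> E))) \<in> borel_measurable M"
  proof (intro borel_measurable_SUP U)
    fix C assume "C \<in> \<U>"
    then have "C \<inter> E \<in> borel0" using U(3) E borel0_sets by (intro borel0_subset[OF E]) auto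
    from m[OF this] show "(\<lambda>s. ennreal (\<rho> s (C \<inter> E))) \<in> borel_measurable M" by measurable
  qed
  ultimately show "(\<lambda>s. emeasure (qlt_pos (\<rho> s)) E) \<in> borel_measurable M"
    by (subst measurable_cong) auto
qed

lemma quasi_levy_type_uminus: "quasi_levy_type \<nu> \<Longrightarrow> quasi_levy_type (\<lambda>B. - \<nu> B)"
  by (simp add: quasi_levy_type_def qlt_uminus signed_measure_on_uminus)

lemma measurable_qlt_neg:
  assumes \<nu>: "\<And>s. s \<in> space M \<Longrightarrow> quasi_levy_type (\<rho> s)"
    and m: "\<And>B. B \<in> borel0 \<Longrightarrow> (\<lambda>s. \<rho> s B) \<in> borel_measurable M"
  shows "levy_kernel M (\<lambda>s. qlt_neg (\<rho> s))"
  using measurable_qlt_pos[of M "\<lambda>s B. - \<rho> s B"] quasi_levy_type_uminus \<nu> m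
  by (simp add: qlt_uminus)

text \<open>What the integration theory below extracts from a setting. The kernels are the Jordan
  parts also when a setting supplies some other decomposition, because \<open>V_fun\<close> and
  \<open>U_fun\<close> are defined through \<open>qlt_abs\<close>, \<open>qlt_pos\<close> and
  \<open>qlt_neg\<close>. The disintegration of \<open>F\<close> is asked for on
  \<open>borel0\<close> only, where a quasi-Levy type measure carries its information.\<close>

locale qid_core =
  fixes P :: "'w measure" and S :: "'s set" and R :: "'s set set"
    and \<Lambda> :: "'s set \<Rightarrow> 'w \<Rightarrow> real"
    and \<nu>0 \<nu>1 :: "'s set \<Rightarrow> real" and F :: "'s set \<Rightarrow> real set \<Rightarrow> real"
    and lam :: "'s measure" and a \<sigma>2 :: "'s \<Rightarrow> real" and \<rho> :: "'s \<Rightarrow> real set \<Rightarrow> real"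
  assumes chars: "qid_characteristics P S R \<Lambda> \<nu>0 \<nu>1 F lam a \<sigma>2"
    and qlt: "\<And>s. s \<in> S \<Longrightarrow> quasi_levy_type (\<rho> s)"
    and kernel_pos: "levy_kernel lam (\<lambda>s. qlt_pos (\<rho> s))"
    and kernel_neg: "levy_kernel lam (\<lambda>s. qlt_neg (\<rho> s))"
    and weight_finite: "\<And>A. A \<in> R \<Longrightarrow> (\<integral>\<^sup>+s\<in>A. wint (qlt_abs (\<rho> s)) \<partial>lam) < \<infinity>"
    and F_eq: "\<And>A B. A \<in> R \<Longrightarrow> B \<in> borel0 \<Longrightarrow> F A B = (LINT s:A|lam. \<rho> s B)"

section \<open>Reduction of the three settings to the common core\<close>

lemma qid_characteristics_space:
  assumes "qid_characteristics P S R \<Lambda> \<nu>0 \<nu>1 F lam a \<sigma>2"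
  shows "space lam = S" "R \<subseteq> sets lam" "S \<in> sets lam"
proof -
  have s: "sets lam = sigma_sets S R" and R: "R \<subseteq> Pow S"
    using assms by (auto simp: qid_characteristics_def qid_random_measure_def delta_ring_def
        ring_of_sets_def semiring_of_sets_def subset_class_def)
  have "sets lam = sets (sigma S R)" using s R by simp
  from sets_eq_imp_space_eq[OF this] R show "space lam = S" by (simp add: space_measure_of_conv)
  show "R \<subseteq> sets lam" using s by auto
  show "S \<in> sets lam" using \<open>space lam = S\<close> sets.top[of lam] by simp
qed

lemma signed_measure_on_diff:
  assumes G: "\<And>B. B \<in> R \<Longrightarrow> B \<in> sets G \<and> emeasure G B < \<infinity>"
    and M: "\<And>B. B \<in> R \<Longrightarrow> B \<in> sets M \<and> emeasure M B < \<infinity>"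
    and R: "{} \<in> R" and eq: "\<And>B. B \<in> R \<Longrightarrow> \<nu> B = measure G B - measure M B"
  shows "signed_measure_on R \<nu>"
  unfolding signed_measure_on_def
proof (intro conjI allI impI)
  show "\<nu> {} = 0" using eq[OF R] by simp
  fix A :: "nat \<Rightarrow> 'a set"
  assume A: "range A \<subseteq> R" "disjoint_family A" "(\<Union>n. A n) \<in> R"
  have "(\<lambda>n. measure G (A n)) sums measure G (\<Union>n. A n)"
    using A G by (intro measure_UNION) (auto simp: less_top)
  moreover have "(\<lambda>n. measure M (A n)) sums measure M (\<Union>n. A n)"
    using A M by (intro measure_UNION) (auto simp: less_top)
  ultimately have "(\<lambda>n. measure G (A n) - measure M (A n)) sums (measure G (\<Union>n. A n) - measure M (\<Union>n. A n))"
    by (rule sums_diff)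
  moreover have "(\<lambda>n. \<nu> (A n)) = (\<lambda>n. measure G (A n) - measure M (A n))"
    using A(1) eq by (auto simp: fun_eq_iff)
  ultimately show "(\<lambda>n. \<nu> (A n)) sums \<nu> (\<Union>n. A n)"
    using eq[OF A(3)] by simp
qed

lemma qlt_diff:
  assumes G: "levy_measure G" and M: "levy_measure M"
    and eq: "\<And>B. B \<in> borel0 \<Longrightarrow> \<nu> B = measure G B - measure M B"
  shows "quasi_levy_type \<nu>"
    and "wint (qlt_abs \<nu>) \<le> wint G + wint M"
proof -
  have sets: "sets G = sets borel" "sets M = sets borel" using G M by (auto simp: levy_measure_def)
  note fin = levy_measure_borel0_finite[OF G] levy_measure_borel0_finite[OF M]
  have \<nu>: "signed_measure_on borel0 \<nu>"
    using fin sets borel0_sets eq by (intro signed_measure_on_diff[of borel0 G M]) (auto simp: borel0_def)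
  have "qlt_pos \<nu> \<le> G"
    using eq by (intro qlt_pos_le \<nu> sets fin) auto
  then have 1: "wint (qlt_pos \<nu>) \<le> wint G"
    using sets sets_qlt_pos[OF \<nu>] by (intro nn_integral_mono_measure) auto
  have "qlt_pos (\<lambda>B. - \<nu> B) \<le> M"
    using eq by (intro qlt_pos_le signed_measure_on_uminus \<nu> sets fin) auto
  then have 2: "wint (qlt_neg \<nu>) \<le> wint M"
    using sets sets_qlt_neg[OF \<nu>] unfolding qlt_uminus by (intro nn_integral_mono_measure) auto
  show le: "wint (qlt_abs \<nu>) \<le> wint G + wint M"
    using nn_integral_qlt_abs[OF \<nu>, of "\<lambda>x. ennreal (wgt x)"] add_mono[OF 1 2] by simp
  moreover have "wint G + wint M < \<infinity>"
    using G M by (simp add: levy_measure_def)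
  ultimately have "wint (qlt_abs \<nu>) < \<infinity>" by (rule le_less_trans)
  then show "quasi_levy_type \<nu>"
    using \<nu> signed_off_iff by (simp add: quasi_levy_type_def)
qed

text \<open>The image of the kernel \<open>\<rho>G\<close> under the indicator of \<open>A\<close>
  agrees with the Levy measure \<open>G A\<close> on \<open>borel0\<close>, so the weight of
  \<open>\<rho>G\<close> integrates over \<open>A\<close> to that of \<open>G A\<close>, which is
  finite; likewise for \<open>\<rho>M\<close>. The Jordan parts of \<open>\<rho> s\<close> lie below
  \<open>\<rho>G s\<close> and \<open>\<rho>M s\<close>.\<close>

lemma setting_A_core:
  assumes "setting_A P S R \<Lambda> \<nu>0 \<nu>1 F lam a \<sigma>2 \<rho>"
  shows "qid_core P S R \<Lambda> \<nu>0 \<nu>1 F lam a \<sigma>2 \<rho>"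
proof -
  have chars: "qid_characteristics P S R \<Lambda> \<nu>0 \<nu>1 F lam a \<sigma>2"
    using assms by (simp add: setting_A_def)
  note sp = qid_characteristics_space[OF chars]
  from assms obtain G M \<rho>G \<rho>M where
    GM: "\<forall>A\<in>R. levy_measure (G A) \<and> levy_measure (M A)"
    and F: "\<forall>A\<in>R. \<forall>B\<in>borel0. F A B = measure (G A) B - measure (M A) B"
    and lev: "\<forall>s\<in>S. levy_measure (\<rho>G s) \<and> levy_measure (\<rho>M s)"
    and meas: "\<forall>B\<in>borel0. (\<lambda>s. emeasure (\<rho>G s) B) \<in> borel_measurable lam \<and>
      (\<lambda>s. emeasure (\<rho>M s) B) \<in> borel_measurable lam"
    and e: "\<forall>A\<in>R. \<forall>B\<in>borel0. emeasure (G A) B = (\<integral>\<^sup>+s\<in>A. emeasure (\<rho>G s) B \<partial>lam) \<and>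
      emeasure (M A) B = (\<integral>\<^sup>+s\<in>A. emeasure (\<rho>M s) B \<partial>lam)"
    and \<rho>: "\<forall>s\<in>S. \<forall>B\<in>borel0. \<rho> s B = measure (\<rho>G s) B - measure (\<rho>M s) B"
    unfolding setting_A_def by (elim conjE exE) (rule that; assumption)
  have GM: "levy_measure (G A)" "levy_measure (M A)" if "A \<in> R" for A
    using GM that by auto
  have lev: "levy_measure (\<rho>G s)" "levy_measure (\<rho>M s)" if "s \<in> S" for s
    using lev that by auto
  have meas: "(\<lambda>s. emeasure (\<rho>G s) B) \<in> borel_measurable lam" "(\<lambda>s. emeasure (\<rho>M s) B) \<in> borel_measurable lam"
    if "B \<in> borel0" for B
    using meas that by auto
  have eG: "emeasure (G A) B = (\<integral>\<^sup>+s\<in>A. emeasure (\<rho>G s) B \<partial>lam)" if "A \<in> R" "B \<in> borel0" for A B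
    using e that by blast
  have eM: "emeasure (M A) B = (\<integral>\<^sup>+s\<in>A. emeasure (\<rho>M s) B \<partial>lam)" if "A \<in> R" "B \<in> borel0" for A B
    using e that by blast
  have \<rho>: "\<rho> s B = measure (\<rho>G s) B - measure (\<rho>M s) B" if "s \<in> S" "B \<in> borel0" for s B
    using \<rho> that by blast
  have K: "levy_kernel lam \<rho>G" "levy_kernel lam \<rho>M"
    using lev meas sp by (auto intro!: levy_kernelI)
  have qlt: "quasi_levy_type (\<rho> s)" if "s \<in> S" for s
    using qlt_diff(1)[OF lev[OF that] \<rho>[OF that]] .
  have \<rho>m: "(\<lambda>s. \<rho> s B) \<in> borel_measurable lam" if B: "B \<in> borel0" for B
  proof -
    have "(\<lambda>s. measure (\<rho>G s) B - measure (\<rho>M s) B) \<in> borel_measurable lam"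
      unfolding measure_def using meas[OF B] by measurable
    then show ?thesis using \<rho>[OF _ B] sp(1) by (subst measurable_cong) auto
  qed
  have ker: "levy_kernel lam (\<lambda>s. qlt_pos (\<rho> s))" "levy_kernel lam (\<lambda>s. qlt_neg (\<rho> s))"
    using measurable_qlt_pos measurable_qlt_neg qlt \<rho>m sp(1) by auto
  have fin: "(\<integral>\<^sup>+s\<in>A. wint (\<kappa> s) \<partial>lam) < \<infinity>"
    if k: "levy_kernel lam \<kappa>" and H: "levy_measure H" and A: "A \<in> R"
      and e: "\<And>B. B \<in> borel0 \<Longrightarrow> emeasure H B = (\<integral>\<^sup>+s\<in>A. emeasure (\<kappa> s) B \<partial>lam)" for \<kappa> H A
  proof -
    have As: "A \<in> sets lam" using A sp by auto
    have "(\<integral>\<^sup>+s\<in>A. wint (\<kappa> s) \<partial>lam) = wint (kernel_image lam \<kappa> (indicator A))"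
      by (intro kernel_image_indicator[symmetric] k As) auto
    also have "\<dots> = wint H"
      using H e by (intro nn_integral_eq_off_zero) (auto simp: levy_measure_def emeasure_kernel_image_indicator[OF k As])
    also have "\<dots> < \<infinity>" using H by (simp add: levy_measure_def)
    finally show ?thesis .
  qed
  show ?thesis
  proof
    show "(\<integral>\<^sup>+s\<in>A. wint (qlt_abs (\<rho> s)) \<partial>lam) < \<infinity>" if A: "A \<in> R" for A
    proof -
      have As [measurable]: "A \<in> sets lam" using A sp by auto
      have m: "(\<lambda>s. \<integral>\<^sup>+x. ennreal (wgt x) \<partial>\<rho>G s) \<in> borel_measurable lam"
        "(\<lambda>s. \<integral>\<^sup>+x. ennreal (wgt x) \<partial>\<rho>M s) \<in> borel_measurable lam"
        by (intro nn_integral_levy_kernel_fixed K wgt_measurable)+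
      have "(\<integral>\<^sup>+s\<in>A. wint (qlt_abs (\<rho> s)) \<partial>lam)
        \<le> (\<integral>\<^sup>+s. (wint (\<rho>G s)) * indicator A s + wint (\<rho>M s) * indicator A s \<partial>lam)"
      proof (rule nn_integral_mono)
        fix s assume "s \<in> space lam"
        then have s: "s \<in> S" using sp by simp
        show "wint (qlt_abs (\<rho> s)) * indicator A s
          \<le> wint (\<rho>G s) * indicator A s + wint (\<rho>M s) * indicator A s"
          using qlt_diff(2)[OF lev[OF s] \<rho>[OF s]] by (auto simp: indicator_def)
      qed
      also have "\<dots> = (\<integral>\<^sup>+s\<in>A. wint (\<rho>G s) \<partial>lam) + (\<integral>\<^sup>+s\<in>A. wint (\<rho>M s) \<partial>lam)"
        by (intro nn_integral_add borel_measurable_times_ennreal borel_measurable_indicator m As)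
      also have "\<dots> < \<infinity>"
        unfolding infinity_ennreal_def ennreal_add_less_top
        using fin[OF K(1) GM(1)[OF A] A eG[OF A]] fin[OF K(2) GM(2)[OF A] A eM[OF A]]
        unfolding infinity_ennreal_def by (rule conjI)
      finally show ?thesis .
    qed
    show "F A B = (LINT s:A|lam. \<rho> s B)" if A: "A \<in> R" and B: "B \<in> borel0" for A B
    proof -
      have As: "A \<in> sets lam" using A sp by auto
      have AS: "A \<subseteq> S" using sets.sets_into_space[OF As] sp by simp
      note mG = measure_kernel_image_indicator[OF K(1) As B]
        and mM = measure_kernel_image_indicator[OF K(2) As B]
      have f: "(\<integral>\<^sup>+s\<in>A. emeasure (\<rho>G s) B \<partial>lam) < \<infinity>" "(\<integral>\<^sup>+s\<in>A. emeasure (\<rho>M s) B \<partial>lam) < \<infinity>"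
        using levy_measure_borel0_finite[OF GM(1)[OF A] B] levy_measure_borel0_finite[OF GM(2)[OF A] B]
        unfolding eG[OF A B] eM[OF A B] .
      have "(LINT s:A|lam. \<rho> s B) = (LINT s:A|lam. measure (\<rho>G s) B - measure (\<rho>M s) B)"
        by (rule set_lebesgue_integral_cong[OF As]) (use \<rho>[OF _ B] AS in blast)
      also have "\<dots> = (LINT s:A|lam. measure (\<rho>G s) B) - (LINT s:A|lam. measure (\<rho>M s) B)"
        using mG(1)[OF f(1)] mM(1)[OF f(2)] by (rule set_integral_diff(2))
      also have "\<dots> = measure (G A) B - measure (M A) B"
        unfolding mG(2)[OF f(1)] mM(2)[OF f(2)]
        by (simp add: measure_def emeasure_kernel_image_indicator[OF _ As B] K eG[OF A B] eM[OF A B])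
      finally show ?thesis using F A B by simp
    qed
  qed (fact chars qlt ker)+
qed

lemma rect_variation_upper:
  fixes C :: "nat \<Rightarrow> 's set" and D :: "nat \<Rightarrow> real set"
  assumes "\<And>i. C i \<in> R" "\<And>i. C i \<subseteq> A" "\<And>i. D i \<in> sets borel" "disjoint_family (\<lambda>i. C i \<times> D i)"
  shows "(\<Sum>i. ennreal \<bar>K (C i) (D i)\<bar>) \<le> rect_variation R K A"
proof (rule suminf_le_const)
  fix n
  have "disjoint_family_on (\<lambda>i. C i \<times> D i) {..<n}"
    using assms(4) by (rule disjoint_family_on_mono[rotated]) auto
  then show "(\<Sum>i<n. ennreal \<bar>K (C i) (D i)\<bar>) \<le> rect_variation R K A"
    unfolding rect_variation_def using assms(1-3)
    by (intro SUP_upper2[where i="({..<n}, C, D)"]) auto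
qed auto

text \<open>
  A measurable selection of sets that almost realise the supremum turns the total mass of the
  positive parts into a sum over disjoint rectangles.
\<close>

lemma nn_integral_qlt_pos_le_rect_variation:
  assumes R: "sigma_algebra S R" "sets lam = R" "space lam = S"
    and \<rho>: "\<And>s. s \<in> S \<Longrightarrow> quasi_levy_type (\<rho> s)"
    and m: "\<And>B. B \<in> borel0 \<Longrightarrow> (\<lambda>s. \<rho> s B) \<in> borel_measurable lam"
    and K: "\<And>A B. A \<in> R \<Longrightarrow> B \<in> borel0 \<Longrightarrow> set_integrable lam A (\<lambda>s. \<rho> s B) \<and> K A B = (LINT s:A|lam. \<rho> s B)"
  shows "(\<integral>\<^sup>+s. emeasure (qlt_pos (\<rho> s)) UNIV \<partial>lam) \<le> 2 * rect_variation R K S"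
proof -
  interpret sigma_algebra S R by fact
  obtain \<U> :: "real set set" where U: "countable \<U>" "{} \<in> \<U>" "\<U> \<subseteq> sets borel"
    "\<And>\<nu> E. signed_measure_on borel0 \<nu> \<Longrightarrow> E \<in> borel0 \<Longrightarrow>
       signed_pos borel0 \<nu> E = (SUP C\<in>\<U>. ennreal (\<nu> (C \<inter> E)))"
    by (rule ex_countable_approximating_family) blast
  define u where "u = from_nat_into \<U>"
  have "\<U> \<noteq> {}" using U(2) by blast
  then have ru: "range u = \<U>" unfolding u_def using U(1) by (rule range_from_nat_into)
  have ker: "levy_kernel lam (\<lambda>s. qlt_pos (\<rho> s))"
    using measurable_qlt_pos \<rho> m R(3) by auto
  have E: "(\<integral>\<^sup>+s. emeasure (qlt_pos (\<rho> s)) E \<partial>lam) \<le> 2 * rect_variation R K S" if E: "E \<in> borel0" for E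
  proof -
    have Es: "E \<in> sets borel" using E borel0_sets by auto
    have uE: "u i \<inter> E \<in> borel0" for i
      using ru U(3) Es by (intro borel0_subset[OF E]) auto
    have [measurable]: "(\<lambda>s. emeasure (qlt_pos (\<rho> s)) E) \<in> borel_measurable lam"
      using ker Es by (auto simp: levy_kernel_def)
    have [measurable]: "(\<lambda>s. \<rho> s (u i \<inter> E)) \<in> borel_measurable lam" for i
      by (rule m[OF uE])
    \<comment> \<open>Half of a positive value is exceeded by some member of the family, whence the
      factor 2; if the value is 0, the index of the empty set serves.\<close>
    have sel: "\<exists>i. emeasure (qlt_pos (\<rho> s)) E \<le> 2 * ennreal (\<rho> s (u i \<inter> E)) \<and> 0 \<le> \<rho> s (u i \<inter> E)"
      if s: "s \<in> S" for s
    proof -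
      note \<nu> = quasi_levy_type_signed[OF \<rho>[OF s]]
      interpret sr: signed_ring UNIV "sets borel" borel0 "\<rho> s" by (rule signed_ring_borel0[OF \<nu>])
      have e: "emeasure (qlt_pos (\<rho> s)) E = (SUP C\<in>\<U>. ennreal (\<rho> s (C \<inter> E)))"
        using emeasure_qlt_pos[OF \<nu> Es] U(4)[OF \<nu> E] by simp
      show ?thesis
      proof (cases "emeasure (qlt_pos (\<rho> s)) E = 0")
        case True
        obtain i where "u i = {}" using U(2) ru by (metis rangeE)
        then show ?thesis using True sr.F_empty by (intro exI[of _ i]) simp
      next
        case False
        have "emeasure (qlt_pos (\<rho> s)) E < \<infinity>"
          by (rule levy_measure_borel0_finite[OF quasi_levy_typeD(1)[OF \<rho>[OF s]] E])
        then obtain r where r: "emeasure (qlt_pos (\<rho> s)) E = ennreal r" "r > 0"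
          using False by (cases "emeasure (qlt_pos (\<rho> s)) E") (auto simp: less_le)
        have "ennreal (r / 2) < ennreal r" using r by (intro ennreal_lessI) auto
        then have "ennreal (r / 2) < (SUP C\<in>\<U>. ennreal (\<rho> s (C \<inter> E)))" using e r by simp
        then obtain C where C: "C \<in> \<U>" "ennreal (r / 2) < ennreal (\<rho> s (C \<inter> E))"
          unfolding less_SUP_iff by auto
        then have lt: "r / 2 < \<rho> s (C \<inter> E)" by (meson ennreal_leI not_less)
        obtain i where i: "u i = C" using C(1) ru by (metis rangeE)
        have "ennreal r \<le> ennreal (2 * \<rho> s (C \<inter> E))" using lt by (intro ennreal_leI) auto
        also have "\<dots> = 2 * ennreal (\<rho> s (C \<inter> E))" using lt r by (simp add: ennreal_mult)
        finally show ?thesis using r lt i by (intro exI[of _ i]) auto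
      qed
    qed
    define good where "good i = {s \<in> space lam. emeasure (qlt_pos (\<rho> s)) E \<le> 2 * ennreal (\<rho> s (u i \<inter> E)) \<and> 0 \<le> \<rho> s (u i \<inter> E)}" for i
    have good [measurable]: "good i \<in> sets lam" for i
      unfolding good_def by measurable
    \<comment> \<open>Each point is assigned to its first good index, a measurable choice.\<close>
    define A where "A = disjointed good"
    have A: "A i \<in> sets lam" for i 
    proof -
      have "range good \<subseteq> sets lam" using good by blast
      then have "range (disjointed good) \<subseteq> sets lam" by (rule sets.range_disjointed_sets)
      then show ?thesis unfolding A_def by blast
    qed
    have UA: "(\<Union>i. A i) = S"
    proof -
      have "(\<Union>i. good i) = S"
      proof
        show "(\<Union>i. good i) \<subseteq> S" using R(3) by (auto simp: good_def)
        show "S \<subseteq> (\<Union>i. good i)"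
        proof
          fix s assume s: "s \<in> S"
          from sel[OF s] obtain i where "emeasure (qlt_pos (\<rho> s)) E \<le> 2 * ennreal (\<rho> s (u i \<inter> E))" "0 \<le> \<rho> s (u i \<inter> E)"
            by blast
          then have "s \<in> good i" using s R(3) by (simp add: good_def)
          then show "s \<in> (\<Union>i. good i)" by blast
        qed
      qed
      then show ?thesis unfolding A_def UN_disjointed_eq .
    qed
    have dA: "disjoint_family A" unfolding A_def by (rule disjoint_family_disjointed)
    have Ag: "A i \<subseteq> good i" for i unfolding A_def by (rule disjointed_subset)
    \<comment> \<open>On \<open>A i\<close> the density is nonnegative, so its integral is the
      absolute value of the measure of the rectangle.\<close>
    have KA: "(\<integral>\<^sup>+s\<in>A i. ennreal (\<rho> s (u i \<inter> E)) \<partial>lam) = ennreal \<bar>K (A i) (u i \<inter> E)\<bar>" for i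
    proof -
      have k: "set_integrable lam (A i) (\<lambda>s. \<rho> s (u i \<inter> E))" "K (A i) (u i \<inter> E) = (LINT s:A i|lam. \<rho> s (u i \<inter> E))"
        using K[of "A i" "u i \<inter> E"] A R uE by auto
      have nn: "0 \<le> indicator (A i) s * \<rho> s (u i \<inter> E)" for s
        using Ag[of i] by (auto simp: good_def indicator_def)
      have "(\<integral>\<^sup>+s\<in>A i. ennreal (\<rho> s (u i \<inter> E)) \<partial>lam) = (\<integral>\<^sup>+s. ennreal (indicator (A i) s * \<rho> s (u i \<inter> E)) \<partial>lam)"
        by (intro nn_integral_cong) (simp add: indicator_def)
      also have "\<dots> = ennreal (LINT s|lam. indicator (A i) s * \<rho> s (u i \<inter> E))"
        using k(1) nn by (intro nn_integral_eq_integral) (auto simp: set_integrable_def)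
      also have "(LINT s|lam. indicator (A i) s * \<rho> s (u i \<inter> E)) = \<bar>K (A i) (u i \<inter> E)\<bar>"
        using k(2) nn by (simp add: set_lebesgue_integral_def integral_nonneg_AE)
      finally show ?thesis .
    qed
    have "(\<integral>\<^sup>+s. emeasure (qlt_pos (\<rho> s)) E \<partial>lam) = (\<integral>\<^sup>+s\<in>(\<Union>i. A i). emeasure (qlt_pos (\<rho> s)) E \<partial>lam)"
      using UA R(3) by (intro nn_integral_cong) simp
    also have "\<dots> = (\<Sum>i. \<integral>\<^sup>+s\<in>A i. emeasure (qlt_pos (\<rho> s)) E \<partial>lam)"
      using A dA by (intro nn_integral_disjoint_family) auto
    also have "\<dots> \<le> (\<Sum>i. 2 * ennreal \<bar>K (A i) (u i \<inter> E)\<bar>)"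
    proof (intro suminf_le)
      fix i
      have "(\<integral>\<^sup>+s\<in>A i. emeasure (qlt_pos (\<rho> s)) E \<partial>lam) \<le> (\<integral>\<^sup>+s. 2 * (ennreal (\<rho> s (u i \<inter> E)) * indicator (A i) s) \<partial>lam)"
        using Ag[of i] by (intro nn_integral_mono) (auto simp: good_def indicator_def)
      also have "\<dots> = 2 * ennreal \<bar>K (A i) (u i \<inter> E)\<bar>"
        unfolding KA[symmetric] by (intro nn_integral_cmult borel_measurable_times_ennreal borel_measurable_indicator A) measurable
      finally show "(\<integral>\<^sup>+s\<in>A i. emeasure (qlt_pos (\<rho> s)) E \<partial>lam) \<le> 2 * ennreal \<bar>K (A i) (u i \<inter> E)\<bar>" .
    qed auto
    also have "\<dots> = 2 * (\<Sum>i. ennreal \<bar>K (A i) (u i \<inter> E)\<bar>)" by (rule ennreal_suminf_cmult)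
    also have "\<dots> \<le> 2 * rect_variation R K S"
    proof (intro mult_left_mono rect_variation_upper)
      show "disjoint_family (\<lambda>i. A i \<times> (u i \<inter> E))"
        using dA by (auto simp: disjoint_family_on_def)
      show "A i \<in> R" for i using A R(2) by simp
      show "A i \<subseteq> S" for i using UA by blast
      show "u i \<inter> E \<in> sets borel" for i using uE borel0_sets by blast
    qed simp
    finally show ?thesis .
  qed
  have "(\<integral>\<^sup>+s. emeasure (qlt_pos (\<rho> s)) UNIV \<partial>lam) = (\<integral>\<^sup>+s. (SUP n. emeasure (qlt_pos (\<rho> s)) (off n)) \<partial>lam)"
  proof (intro nn_integral_cong)
    fix s assume "s \<in> space lam"
    then have l: "levy_measure (qlt_pos (\<rho> s))" using R \<rho> quasi_levy_typeD(1) by auto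
    then have s: "sets (qlt_pos (\<rho> s)) = sets borel" "emeasure (qlt_pos (\<rho> s)) {0} = 0" by (auto simp: levy_measure_def)
    have "emeasure (qlt_pos (\<rho> s)) (UNIV - {0}) = emeasure (qlt_pos (\<rho> s)) UNIV"
      using s by (intro emeasure_Diff_null_set) (auto simp: null_sets_def)
    then show "emeasure (qlt_pos (\<rho> s)) UNIV = (SUP n. emeasure (qlt_pos (\<rho> s)) (off n))"
      using emeasure_Diff_zero_SUP[OF s(1), of UNIV] by simp
  qed
  also have "\<dots> = (SUP n. \<integral>\<^sup>+s. emeasure (qlt_pos (\<rho> s)) (off n) \<partial>lam)"
  proof (intro nn_integral_monotone_convergence_SUP_AE AE_I2)
    fix n s assume "s \<in> space lam"
    then show "emeasure (qlt_pos (\<rho> s)) (off n) \<le> emeasure (qlt_pos (\<rho> s)) (off (Suc n))"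
      using incseq_off levy_kernel_sets[OF ker] by (intro emeasure_mono) (auto simp: incseq_def)
  next
    show "(\<lambda>s. emeasure (qlt_pos (\<rho> s)) (off n)) \<in> borel_measurable lam" for n
      using ker by (auto simp: levy_kernel_def)
  qed
  also have "\<dots> \<le> 2 * rect_variation R K S"
    by (intro SUP_least E off_borel0)
  finally show ?thesis .
qed

text \<open>The weight is at most 1, so it is enough that the total masses of both Jordan parts are
  integrable. The estimate by the variation over rectangles applies to \<open>\<rho>\<close>, and to
  its negative for \<open>qlt_neg\<close>.\<close>

lemma setting_B_core:
  assumes "setting_B P S R \<Lambda> \<nu>0 \<nu>1 F lam a \<sigma>2 \<rho>"
  shows "qid_core P S R \<Lambda> \<nu>0 \<nu>1 F lam a \<sigma>2 \<rho>"
proof -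
  have chars: "qid_characteristics P S R \<Lambda> \<nu>0 \<nu>1 F lam a \<sigma>2" and sig: "sigma_algebra S R"
    and rv: "rect_variation R F S < \<infinity>"
    and qlt: "\<forall>s\<in>S. quasi_levy_type (\<rho> s) \<and> signed_measure_on (sets borel) (\<rho> s)"
    and m: "\<forall>B\<in>sets borel. (\<lambda>s. \<rho> s B) \<in> borel_measurable lam"
    and F: "\<forall>A\<in>R. \<forall>B\<in>sets borel. set_integrable lam A (\<lambda>s. \<rho> s B) \<and> F A B = (LINT s:A|lam. \<rho> s B)"
    using assms unfolding setting_B_def by - (elim conjE, assumption)+
  have qlt: "quasi_levy_type (\<rho> s)" if "s \<in> S" for s
    using qlt that by simp
  note sp = qid_characteristics_space[OF chars]
  have sets: "sets lam = R"
    using chars sigma_algebra.sigma_sets_eq[OF sig] by (simp add: qid_characteristics_def)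
  have m0: "(\<lambda>s. \<rho> s B) \<in> borel_measurable lam" if "B \<in> borel0" for B
    using m that borel0_sets by auto
  have F0: "set_integrable lam A (\<lambda>s. \<rho> s B) \<and> F A B = (LINT s:A|lam. \<rho> s B)"
    if "A \<in> R" "B \<in> borel0" for A B using F that borel0_sets by blast
  have ker: "levy_kernel lam (\<lambda>s. qlt_pos (\<rho> s))" "levy_kernel lam (\<lambda>s. qlt_neg (\<rho> s))"
    using measurable_qlt_pos measurable_qlt_neg qlt m0 sp(1) by auto
  have p: "(\<integral>\<^sup>+s. emeasure (qlt_pos (\<rho> s)) UNIV \<partial>lam) < \<infinity>"
    using rv by (intro le_less_trans[OF nn_integral_qlt_pos_le_rect_variation[OF sig sets sp(1) qlt m0 F0]])
      (auto simp: ennreal_mult_less_top)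
  have "rect_variation R (\<lambda>A B. - F A B) S = rect_variation R F S"
    by (simp add: rect_variation_def)
  moreover have "(\<integral>\<^sup>+s. emeasure (qlt_pos (\<lambda>B. - \<rho> s B)) UNIV \<partial>lam) \<le> 2 * rect_variation R (\<lambda>A B. - F A B) S"
  proof (rule nn_integral_qlt_pos_le_rect_variation[OF sig sets sp(1)])
    show "quasi_levy_type (\<lambda>B. - \<rho> s B)" if "s \<in> S" for s
      using qlt[OF that] by (rule quasi_levy_type_uminus)
    show "(\<lambda>s. - \<rho> s B) \<in> borel_measurable lam" if "B \<in> borel0" for B
      using m0[OF that] by measurable
    show "set_integrable lam A (\<lambda>s. - \<rho> s B) \<and> - F A B = (LINT s:A|lam. - \<rho> s B)"
      if "A \<in> R" "B \<in> borel0" for A B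
      using F0[OF that] by (simp add: set_integrable_def set_lebesgue_integral_def)
  qed
  ultimately have "(\<integral>\<^sup>+s. emeasure (qlt_neg (\<rho> s)) UNIV \<partial>lam) \<le> 2 * rect_variation R F S"
    unfolding qlt_uminus by simp
  moreover have "2 * rect_variation R F S < \<infinity>"
    using rv by (simp add: ennreal_mult_less_top)
  ultimately have n: "(\<integral>\<^sup>+s. emeasure (qlt_neg (\<rho> s)) UNIV \<partial>lam) < \<infinity>"
    by (rule le_less_trans)
  show ?thesis
  proof
    fix A assume A: "A \<in> R"
    have mm: "(\<lambda>s. emeasure (qlt_pos (\<rho> s)) UNIV) \<in> borel_measurable lam" "(\<lambda>s. emeasure (qlt_neg (\<rho> s)) UNIV) \<in> borel_measurable lam"
      using ker by (auto simp: levy_kernel_def)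
    have "(\<integral>\<^sup>+s\<in>A. wint (qlt_abs (\<rho> s)) \<partial>lam)
      \<le> (\<integral>\<^sup>+s. emeasure (qlt_pos (\<rho> s)) UNIV + emeasure (qlt_neg (\<rho> s)) UNIV \<partial>lam)"
    proof (rule nn_integral_mono)
      fix s assume "s \<in> space lam"
      then have s: "s \<in> S" using sp by simp
      note \<nu> = quasi_levy_type_signed[OF qlt[OF s]]
      have "wint (qlt_abs (\<rho> s)) * indicator A s \<le> wint (qlt_abs (\<rho> s))"
        by (simp add: indicator_def)
      also have "\<dots> \<le> (\<integral>\<^sup>+x. 1 \<partial>qlt_abs (\<rho> s))"
        by (intro nn_integral_mono) (simp add: ennreal_le_1)
      also have "\<dots> = emeasure (qlt_pos (\<rho> s)) UNIV + emeasure (qlt_neg (\<rho> s)) UNIV"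
        using sets_eq_imp_space_eq[OF sets_qlt_abs[OF \<nu>]] emeasure_qlt_abs[OF \<nu>, of UNIV] by simp
      finally show "wint (qlt_abs (\<rho> s)) * indicator A s
        \<le> emeasure (qlt_pos (\<rho> s)) UNIV + emeasure (qlt_neg (\<rho> s)) UNIV" .
    qed
    also have "\<dots> = (\<integral>\<^sup>+s. emeasure (qlt_pos (\<rho> s)) UNIV \<partial>lam) + (\<integral>\<^sup>+s. emeasure (qlt_neg (\<rho> s)) UNIV \<partial>lam)"
      by (intro nn_integral_add mm)
    also have "\<dots> < \<infinity>"
      using p n unfolding infinity_ennreal_def ennreal_add_less_top by (rule conjI)
    finally show "(\<integral>\<^sup>+s\<in>A. wint (qlt_abs (\<rho> s)) \<partial>lam) < \<infinity>" .
  next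
    show "F A B = (LINT s:A|lam. \<rho> s B)" if "A \<in> R" "B \<in> borel0" for A B
      using F0[OF that] by simp
  qed (fact chars qlt ker)+
qed

text \<open>Strips the weight from an equality between signed measures. Moving the negative terms
  across gives positive measures \<open>K = p + N\<close> and \<open>L = n + P\<close> with equal
  weighted versions; dividing by the weight on \<open>B\<close>, which avoids 0, gives
  \<open>K B = L B\<close>.\<close>

lemma weighted_signed_eq:
  fixes p n P N :: "real measure"
  assumes sets: "sets p = sets borel" "sets n = sets borel" "sets P = sets borel" "sets N = sets borel"
    and fin: "wint p < \<infinity>" "wint n < \<infinity>"
      "wint P < \<infinity>" "wint N < \<infinity>"
    and eq: "\<And>C. C \<in> sets borel \<Longrightarrow> (LINT x|p. indicator C x * wgt x) - (LINT x|n. indicator C x * wgt x)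
      = (LINT x|P. indicator C x * wgt x) - (LINT x|N. indicator C x * wgt x)"
    and B: "B \<in> borel0"
  shows "measure p B - measure n B = measure P B - measure N B"
proof -
  obtain K where K: "sets K = sets p" "\<And>B. B \<in> sets p \<Longrightarrow> emeasure K B = emeasure p B + emeasure N B"
    using ex_sum_measure[of p N] sets by metis
  obtain L where L: "sets L = sets n" "\<And>B. B \<in> sets n \<Longrightarrow> emeasure L B = emeasure n B + emeasure P B"
    using ex_sum_measure[of n P] sets by metis
  have sKL: "sets K = sets borel" "sets L = sets borel" using K L sets by auto
  have nK: "(\<integral>\<^sup>+x. h x \<partial>K) = (\<integral>\<^sup>+x. h x \<partial>p) + (\<integral>\<^sup>+x. h x \<partial>N)" if "h \<in> borel_measurable borel" for h
    using K sets that measurable_cong_sets[OF sKL(1) refl] by (intro nn_integral_sum_measure) auto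
  have nL: "(\<integral>\<^sup>+x. h x \<partial>L) = (\<integral>\<^sup>+x. h x \<partial>n) + (\<integral>\<^sup>+x. h x \<partial>P)" if "h \<in> borel_measurable borel" for h
    using L sets that measurable_cong_sets[OF sKL(2) refl] by (intro nn_integral_sum_measure) auto
  have e: "(\<integral>\<^sup>+x. ennreal (indicator C x * wgt x) \<partial>M) = ennreal (LINT x|M. indicator C x * wgt x)"
    if C: "C \<in> sets borel" and M: "sets M = sets borel" "wint M < \<infinity>" for C M
  proof (rule nn_integral_eq_integral)
    note [measurable_cong] = M(1)
    note [measurable] = C
    have i: "integrable M wgt"
      using M(2) by (intro integrableI_nonneg) auto
    show "integrable M (\<lambda>x. indicator C x * wgt x)"
      by (rule Bochner_Integration.integrable_bound[OF i]) (auto simp: indicator_def)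
  qed auto
  have D: "density K (\<lambda>x. ennreal (wgt x)) = density L (\<lambda>x. ennreal (wgt x))"
  proof (rule measure_eqI)
    fix C assume "C \<in> sets (density K (\<lambda>x. ennreal (wgt x)))"
    then have C: "C \<in> sets borel" using sKL by simp
    note [measurable] = C
    have d: "emeasure (density M (\<lambda>x. ennreal (wgt x))) C = (\<integral>\<^sup>+x. ennreal (indicator C x * wgt x) \<partial>M)"
      if M: "sets M = sets borel" for M
    proof -
      note [measurable_cong] = M
      have "emeasure (density M (\<lambda>x. ennreal (wgt x))) C = (\<integral>\<^sup>+x. ennreal (wgt x) * indicator C x \<partial>M)"
        by (intro emeasure_density) measurable
      also have "\<dots> = (\<integral>\<^sup>+x. ennreal (indicator C x * wgt x) \<partial>M)"
        by (intro nn_integral_cong) (simp add: indicator_def)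
      finally show ?thesis .
    qed
    have m: "(\<lambda>x. ennreal (indicator C x * wgt x)) \<in> borel_measurable borel" by measurable
    have i0: "0 \<le> (LINT x|M. indicator C x * wgt x)" for M :: "real measure" 
      by (intro integral_nonneg_AE) auto
    have "(\<integral>\<^sup>+x. ennreal (indicator C x * wgt x) \<partial>K) = (\<integral>\<^sup>+x. ennreal (indicator C x * wgt x) \<partial>L)"
      unfolding nK[OF m] nL[OF m] e[OF C sets(1) fin(1)] e[OF C sets(2) fin(2)] e[OF C sets(3) fin(3)] e[OF C sets(4) fin(4)]
      using eq[OF C] i0 by (simp flip: ennreal_plus)
    then show "emeasure (density K (\<lambda>x. ennreal (wgt x))) C = emeasure (density L (\<lambda>x. ennreal (wgt x))) C"
      using d[OF sKL(1)] d[OF sKL(2)] by simp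
  qed (simp add: sKL)
  have Bs: "B \<in> sets borel" using B borel0_sets by auto
  note [measurable] = Bs
  \<comment> \<open>The quotient is 0 off \<open>B\<close>, and on \<open>B\<close> the weight is
    positive.\<close>
  have recover: "emeasure M B = (\<integral>\<^sup>+x. ennreal (indicator B x / wgt x) \<partial>density M (\<lambda>x. ennreal (wgt x)))"
    if M: "sets M = sets borel" for M
  proof -
    note [measurable_cong] = M
    have "(\<integral>\<^sup>+x. ennreal (indicator B x / wgt x) \<partial>density M (\<lambda>x. ennreal (wgt x))) =
       (\<integral>\<^sup>+x. ennreal (wgt x) * ennreal (indicator B x / wgt x) \<partial>M)"
      by (intro nn_integral_density) measurable
    also have "\<dots> = (\<integral>\<^sup>+x. indicator B x \<partial>M)"
    proof (intro nn_integral_cong)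
      fix x
      show "ennreal (wgt x) * ennreal (indicator B x / wgt x) = indicator B x"
      proof (cases "x \<in> B")
        case True
        then have "wgt x > 0" using borel0_zero[OF B] by (intro wgt_pos) auto
        moreover have "ennreal W * ennreal (1 / W) = 1" if "W > 0" for W
          using that by (subst ennreal_mult[symmetric]) auto
        ultimately show ?thesis using True by simp
      qed simp
    qed
    also have "\<dots> = emeasure M B" using Bs M by simp
    finally show ?thesis by simp
  qed
  have "emeasure K B = emeasure L B" unfolding recover[OF sKL(1)] recover[OF sKL(2)] D ..
  then have "emeasure p B + emeasure N B = emeasure n B + emeasure P B"
    using K(2)[of B] L(2)[of B] sets Bs by simp
  moreover have "emeasure M B = ennreal (measure M B)" if "sets M = sets borel" "wint M < \<infinity>" for M
    using emeasure_borel0_finite[OF that B] by (intro emeasure_eq_ennreal_measure) simp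
  ultimately have "ennreal (measure p B + measure N B) = ennreal (measure n B + measure P B)"
    using sets fin by simp
  then show ?thesis by (subst (asm) ennreal_inj) (simp_all add: measure_nonneg)
qed

text \<open>Only the weighted form \<open>J_form\<close> is disintegrated by hypothesis;
  \<open>weighted_signed_eq\<close> recovers \<open>F A\<close> itself. The weight of
  \<open>\<rho> s\<close> is at most 2, so its integrability reduces to the finiteness of
  \<open>lam\<close>.\<close>

lemma setting_C_core:
  assumes "setting_C P S R \<Lambda> \<nu>0 \<nu>1 F lam a \<sigma>2 \<rho>"
  shows "qid_core P S R \<Lambda> \<nu>0 \<nu>1 F lam a \<sigma>2 \<rho>"
proof -
  have chars: "qid_characteristics P S R \<Lambda> \<nu>0 \<nu>1 F lam a \<sigma>2" and sig: "sigma_algebra S R"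
    and rv: "rect_variation R (J_form F) S < \<infinity>"
    and em: "\<forall>A\<in>R. emeasure lam A = signed_abs R \<nu>0 A + ennreal (\<nu>1 A) + rect_variation R (J_form F) A"
    and qlt: "\<forall>s\<in>S. quasi_levy_type (\<rho> s)"
    and m: "\<forall>B\<in>sets borel. (\<lambda>s. emeasure (qlt_pos (\<rho> s)) B) \<in> borel_measurable lam \<and>
                      (\<lambda>s. emeasure (qlt_neg (\<rho> s)) B) \<in> borel_measurable lam"
    and le2: "\<forall>s\<in>S. (wint (qlt_abs (\<rho> s))) \<le> 2"
    and J: "\<forall>A\<in>R. \<forall>B\<in>sets borel.
         set_integrable lam A (\<lambda>s. qlt_integral (\<rho> s) (\<lambda>x. indicator B x * wgt x)) \<and>
         J_form F A B = (LINT s:A|lam. qlt_integral (\<rho> s) (\<lambda>x. indicator B x * wgt x))"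
    using assms unfolding setting_C_def by - (elim conjE, assumption)+
  have qlt: "quasi_levy_type (\<rho> s)" if "s \<in> S" for s
    using qlt that by simp
  have J: "J_form F A B = (LINT s:A|lam. qlt_integral (\<rho> s) (\<lambda>x. indicator B x * wgt x))"
    if "A \<in> R" "B \<in> sets borel" for A B using J that by blast
  note sp = qid_characteristics_space[OF chars]
  have sets: "sets lam = R"
    using chars sigma_algebra.sigma_sets_eq[OF sig] by (simp add: qid_characteristics_def)
  interpret sigma_algebra S R by fact
  interpret \<nu>0: signed_ring S R R \<nu>0
    using chars by unfold_locales (auto simp: qid_characteristics_def)
  have ker: "levy_kernel lam (\<lambda>s. qlt_pos (\<rho> s))" "levy_kernel lam (\<lambda>s. qlt_neg (\<rho> s))"
    using m quasi_levy_typeD(1,2)[OF qlt] sp(1) unfolding levy_kernel_def by blast+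
  \<comment> \<open>\<open>S\<close> belongs to \<open>R\<close> here, so \<open>\<nu>0\<close> has
    finite variation on the whole space.\<close>
  have lamS: "emeasure lam S < \<infinity>"
    using bspec[OF em top] rv \<nu>0.signed_abs_eq[OF top] \<nu>0.signed_pos_finite[OF top] \<nu>0.signed_neg_finite[OF top] by simp
  have wf: "(\<integral>\<^sup>+s\<in>A. wint (qlt_abs (\<rho> s)) \<partial>lam) < \<infinity>" if A: "A \<in> R" for A
  proof -
    have "(\<integral>\<^sup>+s\<in>A. wint (qlt_abs (\<rho> s)) \<partial>lam) \<le> (\<integral>\<^sup>+s. 2 \<partial>lam)"
      using le2 sp by (intro nn_integral_mono) (simp add: indicator_def)
    also have "\<dots> < \<infinity>" using lamS sp by (simp add: ennreal_mult_less_top)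
    finally show ?thesis .
  qed
  show ?thesis
  proof
    fix A B assume A: "A \<in> R" and B: "B \<in> borel0"
    have As: "A \<in> sets lam" and AS: "A \<subseteq> S" using A sets sets_into_space by auto
    have qF: "quasi_levy_type (F A)"
      using chars A by (auto simp: qid_characteristics_def qid_triplet_def)
    let ?P = "kernel_image lam (\<lambda>s. qlt_pos (\<rho> s)) (indicator A)"
    let ?N = "kernel_image lam (\<lambda>s. qlt_neg (\<rho> s)) (indicator A)"
    have absd: "wint (qlt_pos (\<rho> s)) \<le> wint (qlt_abs (\<rho> s))"
      "wint (qlt_neg (\<rho> s)) \<le> wint (qlt_abs (\<rho> s))" if "s \<in> S" for s
      using nn_integral_qlt_abs[OF quasi_levy_type_signed[OF qlt[OF that]], of "\<lambda>x. ennreal (wgt x)"] by simp_all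
    have le: "(\<integral>\<^sup>+s\<in>A. wint (\<kappa> s) \<partial>lam) < \<infinity>"
      if "\<And>s. s \<in> S \<Longrightarrow> (wint (\<kappa> s)) \<le> wint (qlt_abs (\<rho> s))" for \<kappa>
      using that sp by (intro le_less_trans[OF nn_integral_mono wf[OF A]] mult_right_mono) auto
    have fP: "wint ?P < \<infinity>" and fN: "wint ?N < \<infinity>"
      using le[OF absd(1)] le[OF absd(2)] kernel_image_indicator[OF ker(1) As, of "\<lambda>x. ennreal (wgt x)"]
        kernel_image_indicator[OF ker(2) As, of "\<lambda>x. ennreal (wgt x)"] by simp_all
    have "measure (qlt_pos (F A)) B - measure (qlt_neg (F A)) B = measure ?P B - measure ?N B"
    proof (rule weighted_signed_eq)
      fix C :: "real set" assume C: "C \<in> sets borel"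
      note [measurable] = C
      have i: "integrable M (\<lambda>x. indicator C x * wgt x)"
        if "sets M = sets borel" "wint M < \<infinity>" for M
      proof -
        note [measurable_cong] = that(1)
        have i: "integrable M wgt"
          using that(2) by (intro integrableI_nonneg) auto
        show "integrable M (\<lambda>x. indicator C x * wgt x)"
          by (rule Bochner_Integration.integrable_bound[OF i]) (auto simp: indicator_def)
      qed
      have ind: "indicator A \<in> borel_measurable lam" using As by simp
      note kp = kernel_image_real[OF ker(1) ind i[OF sets_kernel_image fP]]
        and kn = kernel_image_real[OF ker(2) ind i[OF sets_kernel_image fN]]
      have z: "(LINT x|M. indicator C (x * indicator A s) * wgt (x * indicator A s)) = indicator A s * (LINT x|M. indicator C x * wgt x)" for M s
        by (simp add: indicator_def)
      have "(LINT x|?P. indicator C x * wgt x) - (LINT x|?N. indicator C x * wgt x)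
          = (LINT s|lam. indicator A s * (LINT x|qlt_pos (\<rho> s). indicator C x * wgt x)
              - indicator A s * (LINT x|qlt_neg (\<rho> s). indicator C x * wgt x))"
        unfolding kp(3) kn(3) z
        by (rule Bochner_Integration.integral_diff[OF kp(2)[unfolded z] kn(2)[unfolded z], symmetric])
      also have "\<dots> = J_form F A C"
        unfolding J[OF A C] set_lebesgue_integral_def qlt_integral_def
        by (simp add: right_diff_distrib)
      finally show "(LINT x|qlt_pos (F A). indicator C x * wgt x) - (LINT x|qlt_neg (F A). indicator C x * wgt x)
        = (LINT x|?P. indicator C x * wgt x) - (LINT x|?N. indicator C x * wgt x)"
        by (simp add: J_form_def qlt_integral_def)
    qed (use quasi_levy_typeD[OF qF] fP fN B in \<open>simp_all add: levy_measure_def\<close>)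
    then have "F A B = measure ?P B - measure ?N B" using quasi_levy_typeD(3)[OF qF B] by simp
    also have "\<dots> = (LINT s:A|lam. measure (qlt_pos (\<rho> s)) B) - (LINT s:A|lam. measure (qlt_neg (\<rho> s)) B)"
    proof -
      have "emeasure ?P B < \<infinity>" "emeasure ?N B < \<infinity>"
        using emeasure_borel0_finite[OF _ fP B] emeasure_borel0_finite[OF _ fN B] by auto
      then show ?thesis
        using measure_kernel_image_indicator(2)[OF ker(1) As B] measure_kernel_image_indicator(2)[OF ker(2) As B]
        by (simp add: emeasure_kernel_image_indicator ker As B)
    qed
    also have "\<dots> = (LINT s:A|lam. measure (qlt_pos (\<rho> s)) B - measure (qlt_neg (\<rho> s)) B)"
    proof (rule set_integral_diff(2)[symmetric])
      have "emeasure ?P B < \<infinity>" "emeasure ?N B < \<infinity>"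
        using emeasure_borel0_finite[OF _ fP B] emeasure_borel0_finite[OF _ fN B] by auto
      then show "set_integrable lam A (\<lambda>s. measure (qlt_pos (\<rho> s)) B)" "set_integrable lam A (\<lambda>s. measure (qlt_neg (\<rho> s)) B)"
        using measure_kernel_image_indicator(1)[OF ker(1) As B] measure_kernel_image_indicator(1)[OF ker(2) As B]
        by (simp_all add: emeasure_kernel_image_indicator ker As B)
    qed
    also have "\<dots> = (LINT s:A|lam. \<rho> s B)"
      by (rule set_lebesgue_integral_cong[OF As]) (use quasi_levy_typeD(3)[OF qlt B] AS in auto)
    finally show "F A B = (LINT s:A|lam. \<rho> s B)" .
  qed (fact chars qlt ker wf)+
qed

section \<open>Compound Poisson distributions\<close>

lemma real_distribution_convolution:
  assumes "real_distribution M" "real_distribution N"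
  shows "real_distribution (M \<star> N)"
proof -
  interpret M: real_distribution M by fact
  interpret N: real_distribution N by fact
  interpret pair_prob_space M N ..
  have "prob_space (M \<star> N)"
    unfolding convolution_def by (intro prob_space_distr) measurable
  then show ?thesis by (simp add: real_distribution_def real_distribution_axioms_def)
qed

lemma char_convolution:
  assumes "real_distribution M" "real_distribution N"
  shows "char (M \<star> N) t = char M t * char N t"
proof -
  interpret M: real_distribution M by fact
  interpret N: real_distribution N by fact
  interpret pair_prob_space M N ..
  have i: "integrable (M \<Otimes>\<^sub>M N) (\<lambda>(x, y). iexp (t * (x + y)))"
    by (intro P.integrable_const_bound[where B=1]) (auto simp: split_beta')
  have "char (M \<star> N) t = (CLINT z|M \<Otimes>\<^sub>M N. (\<lambda>(x, y). iexp (t * (x + y))) z)"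
    unfolding char_def convolution_def by (subst integral_distr) (auto simp: split_beta')
  also have "\<dots> = (CLINT x|M. CLINT y|N. iexp (t * (x + y)))"
    using integral_fst'[OF i] by simp
  also have "\<dots> = (CLINT x|M. iexp (t * x) * char N t)"
    unfolding char_def by (simp add: distrib_left exp_add)
  also have "\<dots> = char M t * char N t"
    unfolding char_def by simp
  finally show ?thesis .
qed

primrec conv_power :: "real measure \<Rightarrow> nat \<Rightarrow> real measure" where
  "conv_power M 0 = return borel 0"
| "conv_power M (Suc n) = (M \<star> conv_power M n)"

lemma real_distribution_return: "real_distribution (return borel x)"
  by (simp add: real_distribution_def real_distribution_axioms_def prob_space_return)

lemma char_return: "char (return borel x) t = iexp (t * x)"
  unfolding char_def by (subst integral_return) auto

lemma real_distribution_conv_power: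
  "real_distribution M \<Longrightarrow> real_distribution (conv_power M n)"
  by (induction n) (simp_all add: real_distribution_return real_distribution_convolution)

lemma char_conv_power: "real_distribution M \<Longrightarrow> char (conv_power M n) t = char M t ^ n"
  by (induction n) (simp_all add: char_return char_convolution real_distribution_conv_power)

text \<open>Applied through the Poisson mixture to \<open>exp z\<close>, \<open>exp (- z)\<close>
  and \<open>(1 + |z|) powr p\<close>; submultiplicativity replaces explicit moments of
  sums.\<close>

lemma nn_integral_conv_power_le:
  assumes M: "real_distribution M" and h: "h \<in> borel_measurable borel"
    and h0: "h 0 \<le> 1" and sub: "\<And>x y. h (x + y) \<le> h x * h y"
  shows "(\<integral>\<^sup>+x. h x \<partial>conv_power M n) \<le> (\<integral>\<^sup>+x. h x \<partial>M) ^ n"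
proof (induction n)
  case 0
  show ?case using h h0 by (simp add: nn_integral_return)
next
  case (Suc n)
  interpret M: real_distribution M by fact
  interpret N: real_distribution "conv_power M n" by (rule real_distribution_conv_power[OF M])
  have "(\<integral>\<^sup>+x. h x \<partial>conv_power M (Suc n)) = (\<integral>\<^sup>+x. \<integral>\<^sup>+y. h (x + y) \<partial>conv_power M n \<partial>M)"
    using h by (simp add: nn_integral_convolution M.finite_measure_axioms N.finite_measure_axioms)
  also have "\<dots> \<le> (\<integral>\<^sup>+x. \<integral>\<^sup>+y. h x * h y \<partial>conv_power M n \<partial>M)"
    by (intro nn_integral_mono sub)
  also have "\<dots> = (\<integral>\<^sup>+x. h x * (\<integral>\<^sup>+y. h y \<partial>conv_power M n) \<partial>M)"
    using h by (intro nn_integral_cong nn_integral_cmult) simp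
  also have "\<dots> = (\<integral>\<^sup>+x. h x \<partial>M) * (\<integral>\<^sup>+y. h y \<partial>conv_power M n)"
    using h by (intro nn_integral_multc) simp
  also have "\<dots> \<le> (\<integral>\<^sup>+x. h x \<partial>M) * (\<integral>\<^sup>+x. h x \<partial>M) ^ n"
    by (intro mult_left_mono Suc) simp
  finally show ?case by simp
qed

lemma measurable_conv_power:
  "real_distribution M \<Longrightarrow> conv_power M \<in> measurable (measure_pmf p) (subprob_algebra borel)"
  using real_distribution_conv_power[of M]
  by (auto simp: space_subprob_algebra real_distribution_def real_distribution_axioms_def
      intro: prob_space_imp_subprob_space)

text \<open>The law of a sum with a Poisson number of terms. Both the characteristic function and
  the bound for \<open>h\<close> are values of the generating function
  \<open>exp (c * y - c)\<close>, at \<open>y = char M t\<close> and at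
  \<open>y = b\<close>.\<close>

lemma poisson_mixture:
  fixes M :: "real measure" and c :: real
  assumes M: "real_distribution M" and c: "0 < c"
  defines "D \<equiv> measure_pmf (poisson_pmf c) \<bind> conv_power M"
  shows "real_distribution D"
    and "\<And>t. char D t = exp (of_real c * (char M t - 1))"
    and "\<And>h b. h \<in> borel_measurable borel \<Longrightarrow> h 0 \<le> 1 \<Longrightarrow> (\<And>x y. h (x + y) \<le> h x * h y) \<Longrightarrow>
       (\<integral>\<^sup>+x. h x \<partial>M) \<le> ennreal b \<Longrightarrow> 0 \<le> b \<Longrightarrow> (\<integral>\<^sup>+x. h x \<partial>D) \<le> ennreal (exp (c * b - c))"
proof -
  note cm = measurable_conv_power[OF M, of "poisson_pmf c"]
  interpret M: real_distribution M by fact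
  interpret C: real_distribution "conv_power M n" for n by (rule real_distribution_conv_power[OF M])
  have "prob_space D"
    unfolding D_def using C.prob_space_axioms by (intro measure_pmf.prob_space_bind[OF _ cm]) simp
  moreover have sD: "sets D = sets borel"
    unfolding D_def by (rule sets_bind) auto
  ultimately show D: "real_distribution D"
    by (simp add: real_distribution_def real_distribution_axioms_def)
  interpret D: real_distribution D by (rule D)
  \<comment> \<open>The interchange is stated for bounded real functions, so the characteristic
    function is treated through cosine and sine.\<close>
  have bnd: "(LINT x|D. f x) = (LINT n|measure_pmf (poisson_pmf c). LINT x|conv_power M n. f x)"
    if "f \<in> borel_measurable borel" "\<And>x. \<bar>f x\<bar> \<le> 1" for f :: "real \<Rightarrow> real"
    unfolding D_def using that C.emeasure_space_1
    by (intro integral_bind[OF _ _ cm, where B=1 and B'=1]) (auto simp: measure_pmf.finite_measure_axioms)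
  let ?\<phi> = "char M"
  have pw: "norm (?\<phi> t ^ n) \<le> 1" for t n
    using M.cmod_char_le_1[of t] by (simp add: norm_power power_le_one)
  show "char D t = exp (of_real c * (?\<phi> t - 1))" for t
  proof -
    have int: "integrable (measure_pmf (poisson_pmf c)) (\<lambda>n. ?\<phi> t ^ n)"
      using pw by (intro measure_pmf.integrable_const_bound[where B=1]) auto
    have "char D t = (CLINT n|measure_pmf (poisson_pmf c). ?\<phi> t ^ n)"
    proof (rule complex_eqI)
      have "Re (char D t) = (LINT x|D. cos (t * x))"
        unfolding char_def by (subst integral_Re[symmetric]) (auto intro!: D.integrable_iexp simp: Re_exp)
      also have "\<dots> = (LINT n|measure_pmf (poisson_pmf c). LINT x|conv_power M n. cos (t * x))"
        by (rule bnd) auto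
      also have "\<dots> = (LINT n|measure_pmf (poisson_pmf c). Re (?\<phi> t ^ n))"
      proof (intro Bochner_Integration.integral_cong refl)
        fix n
        show "(LINT x|conv_power M n. cos (t * x)) = Re (?\<phi> t ^ n)"
          unfolding char_conv_power[OF M, of n t, symmetric] char_def[of "conv_power M n"]
          by (subst integral_Re[symmetric]) (auto intro!: C.integrable_iexp simp: Re_exp)
      qed
      also have "\<dots> = Re (CLINT n|measure_pmf (poisson_pmf c). ?\<phi> t ^ n)"
        by (rule integral_Re[OF int])
      finally show "Re (char D t) = Re (CLINT n|measure_pmf (poisson_pmf c). ?\<phi> t ^ n)" .
    next
      have "Im (char D t) = (LINT x|D. sin (t * x))"
        unfolding char_def by (subst integral_Im[symmetric]) (auto intro!: D.integrable_iexp simp: Im_exp)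
      also have "\<dots> = (LINT n|measure_pmf (poisson_pmf c). LINT x|conv_power M n. sin (t * x))"
        by (rule bnd) auto
      also have "\<dots> = (LINT n|measure_pmf (poisson_pmf c). Im (?\<phi> t ^ n))"
      proof (intro Bochner_Integration.integral_cong refl)
        fix n
        show "(LINT x|conv_power M n. sin (t * x)) = Im (?\<phi> t ^ n)"
          unfolding char_conv_power[OF M, of n t, symmetric] char_def[of "conv_power M n"]
          by (subst integral_Im[symmetric]) (auto intro!: C.integrable_iexp simp: Im_exp)
      qed
      also have "\<dots> = Im (CLINT n|measure_pmf (poisson_pmf c). ?\<phi> t ^ n)"
        by (rule integral_Im[OF int])
      finally show "Im (char D t) = Im (CLINT n|measure_pmf (poisson_pmf c). ?\<phi> t ^ n)" .
    qed
    also have "\<dots> = (CLINT n|count_space UNIV. pmf (poisson_pmf c) n *\<^sub>R ?\<phi> t ^ n)"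
      unfolding measure_pmf_eq_density by (subst integral_density) auto
    also have "\<dots> = (\<Sum>n. pmf (poisson_pmf c) n *\<^sub>R ?\<phi> t ^ n)"
    proof (rule integral_count_space_nat)
      show "integrable (count_space UNIV) (\<lambda>n. pmf (poisson_pmf c) n *\<^sub>R ?\<phi> t ^ n)"
        using int unfolding measure_pmf_eq_density by (subst (asm) integrable_density) auto
    qed
    also have "\<dots> = (\<Sum>n. of_real (exp (- c)) * ((of_real c * ?\<phi> t) ^ n /\<^sub>R fact n))"
      using c by (intro suminf_cong) (simp add: scaleR_conv_of_real power_mult_distrib field_simps)
    also have "\<dots> = of_real (exp (- c)) * exp (of_real c * ?\<phi> t)"
      by (subst suminf_mult) (auto simp: summable_exp_generic exp_def)
    also have "\<dots> = exp (of_real c * (?\<phi> t - 1))"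
      by (simp add: right_diff_distrib exp_diff exp_of_real exp_minus field_simps flip: exp_of_real)
    finally show ?thesis .
  qed
  fix h :: "real \<Rightarrow> ennreal" and b :: real
  assume h: "h \<in> borel_measurable borel" "h 0 \<le> 1" "\<And>x y. h (x + y) \<le> h x * h y"
    and b: "(\<integral>\<^sup>+x. h x \<partial>M) \<le> ennreal b" "0 \<le> b"
  have "(\<integral>\<^sup>+x. h x \<partial>D) = (\<integral>\<^sup>+n. \<integral>\<^sup>+x. h x \<partial>conv_power M n \<partial>measure_pmf (poisson_pmf c))"
    unfolding D_def by (rule nn_integral_bind[OF h(1) cm])
  also have "\<dots> \<le> (\<integral>\<^sup>+n. ennreal (b ^ n) \<partial>measure_pmf (poisson_pmf c))"
  proof (rule nn_integral_mono)
    fix n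
    have "(\<integral>\<^sup>+x. h x \<partial>conv_power M n) \<le> (\<integral>\<^sup>+x. h x \<partial>M) ^ n"
      by (rule nn_integral_conv_power_le[OF M h])
    also have "\<dots> \<le> ennreal b ^ n" by (intro power_mono b) simp
    finally show "(\<integral>\<^sup>+x. h x \<partial>conv_power M n) \<le> ennreal (b ^ n)" using b by (simp add: ennreal_power)
  qed
  also have "\<dots> = (\<integral>\<^sup>+n. ennreal (pmf (poisson_pmf c) n) * ennreal (b ^ n) \<partial>count_space UNIV)"
    by (rule nn_integral_measure_pmf)
  also have "\<dots> = (\<Sum>n. ennreal (exp (- c) * ((c * b) ^ n /\<^sub>R fact n)))"
    using c b by (simp add: nn_integral_count_space_nat ennreal_mult[symmetric] power_mult_distrib field_simps)
  also have "\<dots> = ennreal (\<Sum>n. exp (- c) * ((c * b) ^ n /\<^sub>R fact n))"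
    using c b by (intro suminf_ennreal2 summable_mult summable_exp_generic) auto
  also have "(\<Sum>n. exp (- c) * ((c * b) ^ n /\<^sub>R fact n)) = exp (- c) * exp (c * b)"
    unfolding suminf_mult[OF summable_exp_generic] exp_def ..
  also have "\<dots> = exp (c * b - c)" by (simp flip: exp_add)
  finally show "(\<integral>\<^sup>+x. h x \<partial>D) \<le> ennreal (exp (c * b - c))" .
qed

text \<open>The jump measure is normalised to a probability and its mass becomes the Poisson
  parameter; without mass the law is the point mass at 0. The exponent
  \<open>b - measure \<nu> UNIV\<close> stands for the integral of \<open>h - 1\<close>, so it can
  stay bounded when the mass grows without bound.\<close>

lemma compound_poisson:
  fixes \<nu> :: "real measure"
  assumes \<nu>: "finite_measure \<nu>" "sets \<nu> = sets borel"
  obtains D where "real_distribution D"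
    "\<And>t. char D t = exp (CLINT x|\<nu>. iexp (t * x) - 1)"
    "\<And>h b. h \<in> borel_measurable borel \<Longrightarrow> h 0 = 1 \<Longrightarrow> (\<And>x y. h (x + y) \<le> h x * h y) \<Longrightarrow>
       (\<integral>\<^sup>+x. h x \<partial>\<nu>) \<le> ennreal b \<Longrightarrow> 0 \<le> b \<Longrightarrow> (\<integral>\<^sup>+x. h x \<partial>D) \<le> ennreal (exp (b - measure \<nu> UNIV))"
proof (cases "measure \<nu> UNIV = 0")
  case True
  interpret finite_measure \<nu> by fact
  have sp: "space \<nu> = UNIV" using sets_eq_imp_space_eq[OF \<nu>(2)] by simp
  have z: "emeasure \<nu> (space \<nu>) = 0" using True sp by (simp add: emeasure_eq_measure)
  have "(CLINT x|\<nu>. iexp (t * x) - 1) = 0" for t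
  proof -
    have "AE x in \<nu>. iexp (t * x) - 1 = 0"
      using z by (intro AE_I[where N="space \<nu>"]) auto
    then show ?thesis by (rule integral_eq_zero_AE)
  qed
  then show ?thesis
    using True by (intro that[of "return borel 0"])
      (auto simp: real_distribution_return char_return nn_integral_return)
next
  case False
  interpret finite_measure \<nu> by fact
  define c where "c = measure \<nu> UNIV"
  have c: "c > 0" using False by (simp add: c_def zero_less_measure_iff)
  have sp: "space \<nu> = UNIV" using sets_eq_imp_space_eq[OF \<nu>(2)] by simp
  define M where "M = scale_measure (ennreal (1 / c)) \<nu>"
  have M: "real_distribution M"
  proof -
    have "emeasure M (space M) = 1"
      using c sp by (simp add: M_def space_scale_measure emeasure_eq_measure c_def[symmetric] ennreal_mult[symmetric])
    then show ?thesis
      using \<nu> by (auto simp: real_distribution_def real_distribution_axioms_def M_def intro!: prob_spaceI)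
  qed
  have nnM: "(\<integral>\<^sup>+x. h x \<partial>M) = ennreal (1 / c) * (\<integral>\<^sup>+x. h x \<partial>\<nu>)" if "h \<in> borel_measurable borel" for h
    unfolding M_def using that \<nu> by (intro nn_integral_scale_measure) (simp only: measurable_cong_sets[OF \<nu>(2) refl])
  have Md: "M = density \<nu> (\<lambda>_. ennreal (1 / c))"
    unfolding M_def by (rule measure_eqI) (auto simp: emeasure_density nn_integral_cmult_indicator)
  have chM: "of_real c * (char M t - 1) = (CLINT x|\<nu>. iexp (t * x) - 1)" for t
  proof -
    note [measurable_cong] = \<nu>(2)
    have i: "integrable \<nu> (\<lambda>x. iexp (t * x))"
      by (intro integrable_const_bound[where B=1]) auto
    have "char M t = (CLINT x|\<nu>. (1 / c) *\<^sub>R iexp (t * x))"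
      unfolding char_def Md using c by (subst integral_density) auto
    also have "\<dots> = (1 / c) *\<^sub>R (CLINT x|\<nu>. iexp (t * x))" by simp
    finally have "of_real c * char M t = (CLINT x|\<nu>. iexp (t * x))"
      using c by (simp add: scaleR_conv_of_real)
    moreover have "(CLINT x|\<nu>. iexp (t * x) - 1) = (CLINT x|\<nu>. iexp (t * x)) - of_real c"
      using i sp by (subst Bochner_Integration.integral_diff) (auto simp: c_def scaleR_conv_of_real)
    ultimately show ?thesis by (simp add: right_diff_distrib)
  qed
  note D = poisson_mixture[OF M c]
  show ?thesis
  proof (rule that[OF D(1)])
    show "char (measure_pmf (poisson_pmf c) \<bind> conv_power M) t = exp (CLINT x|\<nu>. iexp (t * x) - 1)" for t
      unfolding D(2) chM ..
    fix h :: "real \<Rightarrow> ennreal" and b :: real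
    assume h: "h \<in> borel_measurable borel" "h 0 = 1" "\<And>x y. h (x + y) \<le> h x * h y"
      and b: "(\<integral>\<^sup>+x. h x \<partial>\<nu>) \<le> ennreal b" "0 \<le> b"
    have "(\<integral>\<^sup>+x. h x \<partial>M) \<le> ennreal (1 / c) * ennreal b"
      unfolding nnM[OF h(1)] by (intro mult_left_mono b) simp
    also have "\<dots> = ennreal (b / c)" using b c by (subst ennreal_mult[symmetric]) auto
    finally have "(\<integral>\<^sup>+x. h x \<partial>M) \<le> ennreal (b / c)" .
    from D(3)[OF h(1) _ h(3) this] h(2) b c
    show "(\<integral>\<^sup>+x. h x \<partial>(measure_pmf (poisson_pmf c) \<bind> conv_power M)) \<le> ennreal (exp (b - measure \<nu> UNIV))"
      by (simp add: c_def[symmetric])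
  qed
qed

section \<open>Infinitely divisible distributions and their moments\<close>

text \<open>The Levy-Khintchine integrand with the truncation \<open>tau\<close>.\<close>

definition lk :: "real \<Rightarrow> real \<Rightarrow> complex" where
  "lk \<theta> x = iexp (\<theta> * x) - 1 - \<i> * of_real (\<theta> * tau x)"

section \<open>Estimates for the Levy-Khintchine integrand and the exponential\<close>

lemma tau_measurable [measurable]: "tau \<in> borel_measurable borel"
  unfolding tau_def[abs_def] by measurable

lemma lk_measurable [measurable]: "lk \<theta> \<in> borel_measurable borel"
  unfolding lk_def[abs_def] by measurable

lemma abs_tau_le: "\<bar>tau x\<bar> \<le> 1"
  by (simp add: tau_def)

lemma norm_iexp_diff_le: "norm (iexp y - 1 - \<i> * of_real y) \<le> y\<^sup>2"
proof -
  have "(\<Sum>k\<le>Suc 0. (\<i> * of_real y) ^ k / fact k) = 1 + \<i> * complex_of_real y" by simp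
  then have "norm (iexp y - (1 + \<i> * of_real y)) \<le> \<bar>y\<bar> ^ 2 / 2"
    using iexp_approx1[of y "Suc 0"] by (simp add: numeral_2_eq_2)
  also have "\<dots> \<le> y\<^sup>2" by simp
  finally show ?thesis by (simp add: diff_diff_add)
qed

text \<open>For \<open>|x| \<le> 1\<close> the truncation is the identity and the integrand is of
  second order, which accounts for \<open>\<theta>\<^sup>2\<close>; for larger \<open>x\<close> its
  three terms are bounded by 1, 1 and \<open>|\<theta>|\<close>.\<close>

lemma norm_lk_le: "norm (lk \<theta> x) \<le> (2 + \<bar>\<theta>\<bar> + \<theta>\<^sup>2) * min 1 (x\<^sup>2)"
proof (cases "\<bar>x\<bar> \<le> 1")
  case True
  then have x: "x\<^sup>2 \<le> 1" by (simp add: abs_square_le_1)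
  have "norm (lk \<theta> x) \<le> (\<theta> * x)\<^sup>2"
    using norm_iexp_diff_le[of "\<theta> * x"] True by (simp add: lk_def tau_def)
  also have "\<dots> \<le> (2 + \<bar>\<theta>\<bar> + \<theta>\<^sup>2) * x\<^sup>2"
    by (simp add: power_mult_distrib mult_right_mono)
  finally show ?thesis using x by simp
next
  case False
  then have x: "x\<^sup>2 > 1" by (simp add: abs_square_less_1 not_le[symmetric] abs_square_le_1)
  have "norm (lk \<theta> x) \<le> norm (iexp (\<theta> * x)) + norm (1::complex) + norm (\<i> * of_real (\<theta> * tau x))"
    unfolding lk_def by (meson add_right_mono norm_triangle_ineq4 order_trans)
  also have "\<dots> \<le> 2 + \<bar>\<theta>\<bar>"
    using abs_tau_le[of x] by (simp add: norm_mult abs_mult mult_left_le del: of_real_mult)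
  also have "\<dots> \<le> 2 + \<bar>\<theta>\<bar> + \<theta>\<^sup>2" by simp
  finally show ?thesis using x by simp
qed

text \<open>For \<open>y = - z < 0\<close> the claim is
  \<open>1 \<le> (1 - z + z\<^sup>2) * exp z\<close>; with the quadratic Taylor minorant in place of
  \<open>exp z\<close> the product becomes a polynomial with constant term 1 and nonnegative
  coefficients.\<close>

lemma exp_quadratic_bound:
  assumes "\<bar>y::real\<bar> \<le> 1"
  shows "exp y - 1 - y \<le> y\<^sup>2"
proof (cases "0 \<le> y")
  case True
  then show ?thesis using exp_bound[of y] assms by (simp add: power2_eq_square)
next
  case False
  define z where "z = - y"
  have z: "0 \<le> z" using False by (simp add: z_def)
  have "1 \<le> (1 - z + z\<^sup>2) * (1 + z + z\<^sup>2 / 2)"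
  proof -
    have "(1 - z + z\<^sup>2) * (1 + z + z\<^sup>2 / 2) = 1 + z\<^sup>2 / 2 + z^3 / 2 + z^4 / 2"
      by (simp add: field_simps power2_eq_square power3_eq_cube power4_eq_xxxx)
    then show ?thesis using z by simp
  qed
  also have "\<dots> \<le> (1 - z + z\<^sup>2) * exp z"
  proof (rule mult_left_mono)
    show "1 + z + z\<^sup>2 / 2 \<le> exp z" using z by (rule exp_lower_Taylor_quadratic)
    have "1 - z + z\<^sup>2 = (z - 1/2)\<^sup>2 + 3/4" by (simp add: power2_eq_square algebra_simps)
    then show "0 \<le> 1 - z + z\<^sup>2" by simp
  qed
  finally have "exp (- z) * 1 \<le> exp (- z) * ((1 - z + z\<^sup>2) * exp z)" by (intro mult_left_mono) auto
  also have "\<dots> = 1 - z + z\<^sup>2" by (simp add: exp_minus)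
  finally show ?thesis by (simp add: z_def)
qed

text \<open>
  The law is a weak limit of compensated compound Poisson laws, with jumps of modulus less than
  \<open>1 / (n + 1)\<close> removed; the uniform exponential moments give tightness.
\<close>

lemma small_jumps:
  fixes \<nu> :: "real measure"
  assumes s\<nu>: "sets \<nu> = sets borel" and conc: "AE x in \<nu>. \<bar>x\<bar> \<le> 1"
    and v: "(\<integral>\<^sup>+x. ennreal (x\<^sup>2) \<partial>\<nu>) \<le> ennreal v" "0 \<le> v"
  obtains D where "real_distribution D" "\<And>t. char D t = exp (CLINT x|\<nu>. lk t x)"
    "(\<integral>\<^sup>+z. ennreal (exp z) \<partial>D) \<le> ennreal (exp v)" "(\<integral>\<^sup>+z. ennreal (exp (- z)) \<partial>D) \<le> ennreal (exp v)"
proof -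
  note [measurable_cong] = s\<nu>
  have sp: "space \<nu> = UNIV" using sets_eq_imp_space_eq[OF s\<nu>] by simp
  have i2: "integrable \<nu> (\<lambda>x. x\<^sup>2)"
    using v by (intro integrableI_nonneg) (auto intro: le_less_trans)
  have i2v: "(LINT x|\<nu>. x\<^sup>2) \<le> v"
    using v nn_integral_eq_integral[OF i2] by simp
  define A where "A n = {x::real. 1 / real (Suc n) \<le> \<bar>x\<bar> \<and> \<bar>x\<bar> \<le> 1}" for n
  have [measurable]: "A n \<in> sets borel" for n unfolding A_def by measurable
  define \<mu> where "\<mu> n = density \<nu> (\<lambda>x. ennreal (indicator (A n) x))" for n
  have s\<mu> [measurable_cong]: "sets (\<mu> n) = sets borel" for n by (simp add: \<mu>_def s\<nu>)
  have sp\<mu>: "space (\<mu> n) = UNIV" for n using sp by (simp add: \<mu>_def)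
  have A2: "indicator (A n) x \<le> (real (Suc n))\<^sup>2 * x\<^sup>2" for n x
  proof (cases "x \<in> A n")
    case True
    then have "1 \<le> real (Suc n) * \<bar>x\<bar>" by (simp add: A_def field_simps)
    then have "1 \<le> (real (Suc n) * \<bar>x\<bar>)\<^sup>2" by (simp add: one_le_power)
    then show ?thesis using True by (simp add: power_mult_distrib)
  qed simp
  have iA: "integrable \<nu> (\<lambda>x. indicator (A n) x * g x)"
    if [measurable]: "g \<in> borel_measurable borel" and "\<And>x. x \<in> A n \<Longrightarrow> norm (g x) \<le> B" for n B and g :: "real \<Rightarrow> real"
  proof (rule Bochner_Integration.integrable_bound)
    show "integrable \<nu> (\<lambda>x. \<bar>B\<bar> * ((real (Suc n))\<^sup>2 * x\<^sup>2))"
      using i2 by simp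
    show "AE x in \<nu>. norm (indicator (A n) x * g x) \<le> norm (\<bar>B\<bar> * ((real (Suc n))\<^sup>2 * x\<^sup>2))"
    proof (intro AE_I2)
      fix x
      have "norm (indicator (A n) x * g x) \<le> indicator (A n) x * \<bar>B\<bar>"
        using that(2)[of x] by (auto simp: indicator_def)
      also have "\<dots> \<le> \<bar>B\<bar> * ((real (Suc n))\<^sup>2 * x\<^sup>2)"
        using mult_right_mono[OF A2[of n x], of "\<bar>B\<bar>"] by (simp add: mult.commute)
      finally show "norm (indicator (A n) x * g x) \<le> norm (\<bar>B\<bar> * ((real (Suc n))\<^sup>2 * x\<^sup>2))"
        by (simp add: abs_mult)
    qed
  qed measurable
  have fin: "finite_measure (\<mu> n)" for n
  proof (rule finite_measureI)
    have "emeasure (\<mu> n) (space (\<mu> n)) = (\<integral>\<^sup>+x. ennreal (indicator (A n) x * 1) \<partial>\<nu>)"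
      unfolding sp\<mu> \<mu>_def by (subst emeasure_density) (auto simp: indicator_def intro!: nn_integral_cong)
    also have "\<dots> < \<infinity>"
      using iA[of "\<lambda>_. 1" n 1] unfolding integrable_iff_bounded by (simp add: abs_mult)
    finally show "emeasure (\<mu> n) (space (\<mu> n)) \<noteq> \<infinity>" by simp
  qed
  have \<mu>nn: "(\<integral>\<^sup>+x. h x \<partial>\<mu> n) = (\<integral>\<^sup>+x. ennreal (indicator (A n) x) * h x \<partial>\<nu>)" if "h \<in> borel_measurable borel" for h n
    unfolding \<mu>_def using that by (subst nn_integral_density) (auto simp: measurable_cong_sets[OF s\<nu> refl])
  define m where "m n = (LINT x|\<nu>. indicator (A n) x * x)" for n
  have ix: "integrable \<nu> (\<lambda>x. indicator (A n) x * x)" for n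
    by (rule iA[of _ _ 1]) (auto simp: A_def)
  have ic: "integrable \<nu> (\<lambda>x. indicator (A n) x *\<^sub>R (iexp (t * x) - 1))" for n t
  proof (rule Bochner_Integration.integrable_bound)
    show "integrable \<nu> (\<lambda>x. indicator (A n) x * (2::real))" by (rule iA[of _ _ 2]) auto
    show "AE x in \<nu>. norm (indicator (A n) x *\<^sub>R (iexp (t * x) - 1)) \<le> norm (indicator (A n) x * (2::real))"
      using norm_triangle_ineq4[of "iexp (t * x)" 1 for x] by (auto simp: indicator_def intro!: AE_I2)
  qed measurable
  have "\<exists>C. real_distribution C \<and> (\<forall>t. char C t = exp (CLINT x|\<mu> n. iexp (t * x) - 1)) \<and>
      (\<forall>h b. h \<in> borel_measurable borel \<longrightarrow> h 0 = 1 \<longrightarrow> (\<forall>x y. h (x + y) \<le> h x * h y) \<longrightarrow>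
       (\<integral>\<^sup>+x. h x \<partial>\<mu> n) \<le> ennreal b \<longrightarrow> 0 \<le> b \<longrightarrow> (\<integral>\<^sup>+x. h x \<partial>C) \<le> ennreal (exp (b - measure (\<mu> n) UNIV)))" for n
    by (rule compound_poisson[OF fin[of n] s\<mu>[of n]]) blast
  then obtain C where C: "\<And>n. real_distribution (C n)"
    "\<And>n t. char (C n) t = exp (CLINT x|\<mu> n. iexp (t * x) - 1)"
    "\<And>n h b. h \<in> borel_measurable borel \<Longrightarrow> h 0 = 1 \<Longrightarrow> (\<And>x y. h (x + y) \<le> h x * h y) \<Longrightarrow>
       (\<integral>\<^sup>+x. h x \<partial>\<mu> n) \<le> ennreal b \<Longrightarrow> 0 \<le> b \<Longrightarrow> (\<integral>\<^sup>+x. h x \<partial>C n) \<le> ennreal (exp (b - measure (\<mu> n) UNIV))"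
    by metis
  define D where "D n = (C n \<star> return borel (- m n))" for n
  have D: "real_distribution (D n)" for n
    unfolding D_def by (intro real_distribution_convolution real_distribution_return C)
  \<comment> \<open>On \<open>A n\<close> the truncation is the identity, so shifting by the mean
    \<open>m n\<close> is exactly the compensation contained in \<open>lk\<close>.\<close>
  have ilk: "indicator (A n) x *\<^sub>R lk t x = indicator (A n) x *\<^sub>R (iexp (t * x) - 1) - \<i> * of_real (t * (indicator (A n) x * x))" for n t x
    by (auto simp: lk_def tau_def A_def indicator_def)
  have chD: "char (D n) t = exp (CLINT x|\<nu>. indicator (A n) x *\<^sub>R lk t x)" for n t
  proof -
    have "(CLINT x|\<mu> n. iexp (t * x) - 1) = (CLINT x|\<nu>. indicator (A n) x *\<^sub>R (iexp (t * x) - 1))"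
      unfolding \<mu>_def by (subst integral_density) auto
    then have "char (D n) t = exp ((CLINT x|\<nu>. indicator (A n) x *\<^sub>R (iexp (t * x) - 1)) - \<i> * of_real (t * m n))"
      unfolding D_def char_convolution[OF C(1) real_distribution_return] C(2) char_return
      by (simp only: exp_add[symmetric]) simp
    also have "(CLINT x|\<nu>. indicator (A n) x *\<^sub>R (iexp (t * x) - 1)) - \<i> * of_real (t * m n)
      = (CLINT x|\<nu>. indicator (A n) x *\<^sub>R lk t x)"
    proof -
      have i: "integrable \<nu> (\<lambda>x. \<i> * complex_of_real (t * (indicator (A n) x * x)))"
        by (intro integrable_mult_right integrable_of_real ix)
      have "(CLINT x|\<nu>. \<i> * complex_of_real (t * (indicator (A n) x * x))) = \<i> * of_real (t * m n)"
        unfolding m_def by (simp only: integral_mult_right_zero integral_complex_of_real)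
      then show ?thesis unfolding ilk Bochner_Integration.integral_diff[OF ic i] by (simp only:)
    qed
    finally show ?thesis .
  qed
  have momD: "(\<integral>\<^sup>+z. ennreal (exp (\<epsilon> * z)) \<partial>D n) \<le> ennreal (exp v)" if \<epsilon>: "\<epsilon> = 1 \<or> \<epsilon> = - 1" for \<epsilon> n
  proof -
    interpret C: real_distribution "C n" by (rule C(1))
    interpret rt: real_distribution "return borel (- m n)" by (rule real_distribution_return)
    have e1: "\<bar>\<epsilon>\<bar> = 1" "\<epsilon>\<^sup>2 = 1" using \<epsilon> by (metis abs_1 abs_minus_cancel, metis one_power2 power2_minus)
    have ie: "integrable \<nu> (\<lambda>x. indicator (A n) x * exp (\<epsilon> * x))"
    proof (rule iA[of _ _ "exp 1"])
      fix x assume "x \<in> A n"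
      then have "\<bar>\<epsilon> * x\<bar> \<le> 1" using e1 by (simp add: A_def abs_mult)
      then show "norm (exp (\<epsilon> * x)) \<le> exp 1" by simp
    qed measurable
    have i1: "integrable \<nu> (\<lambda>x. indicator (A n) x * (1::real))" by (rule iA[of _ _ 1]) auto
    define b where "b = (LINT x|\<nu>. indicator (A n) x * exp (\<epsilon> * x))"
    have b0: "0 \<le> b" unfolding b_def by (intro integral_nonneg_AE) auto
    have "(\<integral>\<^sup>+x. ennreal (exp (\<epsilon> * x)) \<partial>\<mu> n) = (\<integral>\<^sup>+x. ennreal (indicator (A n) x * exp (\<epsilon> * x)) \<partial>\<nu>)"
      by (subst \<mu>nn) (auto intro!: nn_integral_cong simp: indicator_def)
    also have "\<dots> = ennreal b"
      unfolding b_def by (rule nn_integral_eq_integral[OF ie]) auto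
    finally have nb: "(\<integral>\<^sup>+x. ennreal (exp (\<epsilon> * x)) \<partial>\<mu> n) \<le> ennreal b" by simp
    have "emeasure (\<mu> n) UNIV = (\<integral>\<^sup>+x. ennreal (indicator (A n) x * 1) \<partial>\<nu>)"
      unfolding \<mu>_def by (subst emeasure_density) (auto simp: s\<nu>)
    also have "\<dots> = ennreal (LINT x|\<nu>. indicator (A n) x * 1)"
      by (rule nn_integral_eq_integral[OF i1]) auto
    finally have c: "measure (\<mu> n) UNIV = (LINT x|\<nu>. indicator (A n) x * 1)"
      by (simp add: measure_def integral_nonneg_AE)
    have CC: "(\<integral>\<^sup>+x. ennreal (exp (\<epsilon> * x)) \<partial>C n) \<le> ennreal (exp (b - measure (\<mu> n) UNIV))"
      by (rule C(3)[OF _ _ _ nb b0]) (auto simp: distrib_left exp_add ennreal_mult)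
    have "(\<integral>\<^sup>+z. ennreal (exp (\<epsilon> * z)) \<partial>D n) = (\<integral>\<^sup>+x. \<integral>\<^sup>+y. ennreal (exp (\<epsilon> * (x + y))) \<partial>return borel (- m n) \<partial>C n)"
      unfolding D_def by (intro nn_integral_convolution) (auto simp: C.finite_measure_axioms rt.finite_measure_axioms)
    also have "\<dots> = (\<integral>\<^sup>+x. ennreal (exp (- \<epsilon> * m n)) * ennreal (exp (\<epsilon> * x)) \<partial>C n)"
      by (intro nn_integral_cong) (simp add: nn_integral_return ennreal_mult[symmetric] exp_add[symmetric] algebra_simps)
    also have "\<dots> = ennreal (exp (- \<epsilon> * m n)) * (\<integral>\<^sup>+x. ennreal (exp (\<epsilon> * x)) \<partial>C n)"
      by (intro nn_integral_cmult) measurable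
    also have "\<dots> \<le> ennreal (exp (- \<epsilon> * m n)) * ennreal (exp (b - measure (\<mu> n) UNIV))"
      by (intro mult_left_mono CC) simp
    also have "\<dots> = ennreal (exp (b - measure (\<mu> n) UNIV - \<epsilon> * m n))"
      by (simp add: ennreal_mult[symmetric] exp_add[symmetric] algebra_simps)
    \<comment> \<open>Mass and mean together compensate the exponential, leaving the integrand
      \<open>exp (\<epsilon> * x) - 1 - \<epsilon> * x\<close>. It is at most
      \<open>x\<^sup>2\<close> for jumps of modulus at most 1, so the bound \<open>v\<close> is
      uniform in \<open>n\<close>.\<close>
    also have "b - measure (\<mu> n) UNIV - \<epsilon> * m n = (LINT x|\<nu>. indicator (A n) x * (exp (\<epsilon> * x) - 1 - \<epsilon> * x))"
      unfolding b_def c m_def using ie i1 ix[of n]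
      by (simp add: right_diff_distrib mult.left_commute[of _ \<epsilon>] Bochner_Integration.integral_diff)
    also have "(LINT x|\<nu>. indicator (A n) x * (exp (\<epsilon> * x) - 1 - \<epsilon> * x)) \<le> (LINT x|\<nu>. x\<^sup>2)"
    proof (rule integral_mono_AE[OF _ i2])
      show "integrable \<nu> (\<lambda>x. indicator (A n) x * (exp (\<epsilon> * x) - 1 - \<epsilon> * x))"
        using ie i1 ix[of n] by (simp add: right_diff_distrib mult.left_commute[of _ \<epsilon>])
      show "AE x in \<nu>. indicator (A n) x * (exp (\<epsilon> * x) - 1 - \<epsilon> * x) \<le> x\<^sup>2"
      proof (intro AE_I2)
        fix x
        show "indicator (A n) x * (exp (\<epsilon> * x) - 1 - \<epsilon> * x) \<le> x\<^sup>2"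
        proof (cases "x \<in> A n")
          case True
          then have "\<bar>\<epsilon> * x\<bar> \<le> 1" using e1 by (simp add: A_def abs_mult)
          from exp_quadratic_bound[OF this] show ?thesis using True e1 by (simp add: power_mult_distrib)
        qed simp
      qed
    qed
    also have "\<dots> \<le> v" by (rule i2v)
    finally show ?thesis by (simp add: ennreal_leI)
  qed
  have tight: "tight D"
    unfolding tight_def
  proof (intro conjI allI impI D)
    fix e :: real assume e: "e > 0"
    \<comment> \<open>Markov's inequality with both exponential moments bounds the mass outside the
      interval by \<open>2 * exp (v - K)\<close>; the logarithm makes this at most
      \<open>e / 2\<close>, and the maximum with 1 keeps the interval nonempty.\<close>
    define K where "K = max 1 (v + ln (4 / e))"
    have K: "K > 0" "2 * exp (v - K) < e"
    proof -
      have "exp (v - K) \<le> exp (- ln (4 / e))" by (simp add: K_def)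
      also have "\<dots> = e / 4" using e by (simp add: exp_minus)
      finally show "2 * exp (v - K) < e" using e by simp
    qed (simp add: K_def)
    have "measure (D n) {-K<..K} > 1 - e" for n
    proof -
      interpret D: real_distribution "D n" by (rule D)
      have "emeasure (D n) (UNIV - {-K<..K}) = (\<integral>\<^sup>+x. indicator (UNIV - {-K<..K}) x \<partial>D n)"
        by (rule nn_integral_indicator[symmetric]) auto
      also have "\<dots> \<le> (\<integral>\<^sup>+x. ennreal (exp (- K)) * (ennreal (exp (1 * x)) + ennreal (exp (- 1 * x))) \<partial>D n)"
      proof (rule nn_integral_mono)
        fix x
        show "indicator (UNIV - {-K<..K}) x \<le> ennreal (exp (- K)) * (ennreal (exp (1 * x)) + ennreal (exp (- 1 * x)))"
        proof (cases "x \<in> UNIV - {-K<..K}")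
          case True
          then have "K \<le> x \<or> K \<le> - x" by auto
          then have "exp K \<le> exp x \<or> exp K \<le> exp (- x)" by auto
          then have "exp K \<le> exp x + exp (- x)" by (smt (verit) exp_ge_zero)
          then have "exp (- K) * exp K \<le> exp (- K) * (exp x + exp (- x))" by (rule mult_left_mono) simp
          then have "1 \<le> exp (- K) * (exp x + exp (- x))" by (simp add: exp_minus)
          then have "ennreal 1 \<le> ennreal (exp (- K) * (exp x + exp (- x)))" by (rule ennreal_leI)
          then show ?thesis using True by (simp add: ennreal_mult)
        qed simp
      qed
      also have "\<dots> = ennreal (exp (- K)) * ((\<integral>\<^sup>+x. ennreal (exp (1 * x)) \<partial>D n) + (\<integral>\<^sup>+x. ennreal (exp (- 1 * x)) \<partial>D n))"
        by (subst nn_integral_cmult, simp, subst nn_integral_add) auto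
      also have "\<dots> \<le> ennreal (exp (- K)) * (ennreal (exp v) + ennreal (exp v))"
        by (intro mult_left_mono add_mono momD) auto
      also have "\<dots> = ennreal (2 * exp (v - K))"
        by (simp add: ennreal_mult[symmetric] ennreal_plus[symmetric] exp_add[symmetric] distrib_left del: ennreal_plus)
      finally have "measure (D n) (UNIV - {-K<..K}) \<le> 2 * exp (v - K)"
        by (simp add: D.emeasure_eq_measure)
      moreover have "measure (D n) (UNIV - {-K<..K}) = 1 - measure (D n) {-K<..K}"
        using D.prob_compl[of "{-K<..K}"] by simp
      ultimately show ?thesis using K by simp
    qed
    then show "\<exists>a b. a < b \<and> (\<forall>n. 1 - e < measure (D n) {a<..b})"
      using K by (intro exI[of _ "-K"] exI[of _ K]) auto
  qed
  obtain r M where r: "strict_mono (r :: nat \<Rightarrow> nat)" and M: "real_distribution M" and wc: "weak_conv_m (D \<circ> id \<circ> r) M"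
    using tight_imp_convergent_subsubsequence[OF tight strict_mono_id] by blast
  have Dr: "\<And>k. real_distribution ((D \<circ> id \<circ> r) k)" using D by simp
  interpret M: real_distribution M by (rule M)
  show thesis
  proof (rule that[OF M])
    fix t
    have "(\<lambda>n. CLINT x|\<nu>. indicator (A n) x *\<^sub>R lk t x) \<longlonglongrightarrow> (CLINT x|\<nu>. lk t x)"
    proof (rule integral_dominated_convergence)
      show "integrable \<nu> (\<lambda>x. (2 + \<bar>t\<bar> + t\<^sup>2) * x\<^sup>2)" using i2 by simp
      show "AE x in \<nu>. norm (indicator (A n) x *\<^sub>R lk t x) \<le> (2 + \<bar>t\<bar> + t\<^sup>2) * x\<^sup>2" for n
      proof (intro AE_I2)
        fix x
        have "norm (indicator (A n) x *\<^sub>R lk t x) \<le> norm (lk t x)" by (simp add: indicator_def)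
        also have "\<dots> \<le> (2 + \<bar>t\<bar> + t\<^sup>2) * min 1 (x\<^sup>2)" by (rule norm_lk_le)
        also have "\<dots> \<le> (2 + \<bar>t\<bar> + t\<^sup>2) * x\<^sup>2" by (intro mult_left_mono) auto
        finally show "norm (indicator (A n) x *\<^sub>R lk t x) \<le> (2 + \<bar>t\<bar> + t\<^sup>2) * x\<^sup>2" .
      qed
      show "AE x in \<nu>. (\<lambda>n. indicator (A n) x *\<^sub>R lk t x) \<longlonglongrightarrow> lk t x"
        using conc
      proof eventually_elim
        fix x :: real assume x: "\<bar>x\<bar> \<le> 1"
        show "(\<lambda>n. indicator (A n) x *\<^sub>R lk t x) \<longlonglongrightarrow> lk t x"
        proof (cases "x = 0")
          case True
          then show ?thesis by (simp add: lk_def tau_def)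
        next
          case False
          then obtain N where N: "inverse (real (Suc N)) < \<bar>x\<bar>" using reals_Archimedean[of "\<bar>x\<bar>"] by auto
          have "x \<in> A n" if "n \<ge> N" for n
          proof -
            have "1 / real (Suc n) \<le> 1 / real (Suc N)" using that by (simp add: frac_le)
            then show ?thesis using N x by (simp add: A_def inverse_eq_divide)
          qed
          then have "eventually (\<lambda>n. indicator (A n) x *\<^sub>R lk t x = lk t x) sequentially"
            unfolding eventually_sequentially by (intro exI[of _ N]) auto
          then show ?thesis by (rule tendsto_eventually)
        qed
      qed
    qed measurable
    then have "(\<lambda>n. char (D n) t) \<longlonglongrightarrow> exp (CLINT x|\<nu>. lk t x)"
      unfolding chD by (rule tendsto_exp)
    from LIMSEQ_subseq_LIMSEQ[OF this r]
    have "(\<lambda>n. char ((D \<circ> id \<circ> r) n) t) \<longlonglongrightarrow> exp (CLINT x|\<nu>. lk t x)" by (simp add: comp_def)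
    with levy_continuity1[OF Dr M wc] show "char M t = exp (CLINT x|\<nu>. lk t x)"
      by (rule LIMSEQ_unique)
  next
    have mom: "(\<integral>\<^sup>+z. ennreal (exp (\<epsilon> * z)) \<partial>M) \<le> ennreal (exp v)" if \<epsilon>: "\<epsilon> = 1 \<or> \<epsilon> = - 1" for \<epsilon>
    proof -
      \<comment> \<open>Weak convergence tests bounded continuous functions only, so the exponential
        is truncated at \<open>k\<close>; the bound is independent of \<open>k\<close> and passes to
        the supremum.\<close>
      have le: "(\<integral>\<^sup>+z. ennreal (min (real k) (exp (\<epsilon> * z))) \<partial>M) \<le> ennreal (exp v)" for k :: nat
      proof -
        let ?f = "\<lambda>z. min (real k) (exp (\<epsilon> * z))"
        have f0: "0 \<le> ?f z" for z by simp
        have "(\<lambda>n. LINT z|(D \<circ> id \<circ> r) n. ?f z) \<longlonglongrightarrow> (LINT z|M. ?f z)"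
          by (rule weak_conv_imp_integral_bdd_continuous_conv[OF Dr M wc, where B="real k"])
            (auto intro!: continuous_min continuous_intros)
        moreover have "(LINT z|(D \<circ> id \<circ> r) n. ?f z) \<le> exp v" for n
        proof -
          interpret D: real_distribution "D (r n)" by (rule D)
          have "integrable (D (r n)) ?f" by (rule D.integrable_const_bound[where B="real k"]) auto
          then have "ennreal (LINT z|D (r n). ?f z) = (\<integral>\<^sup>+z. ennreal (?f z) \<partial>D (r n))"
            by (subst nn_integral_eq_integral) auto
          also have "\<dots> \<le> (\<integral>\<^sup>+z. ennreal (exp (\<epsilon> * z)) \<partial>D (r n))"
            by (intro nn_integral_mono ennreal_leI) simp
          also have "\<dots> \<le> ennreal (exp v)" by (rule momD[OF \<epsilon>])
          finally have "(LINT z|D (r n). ?f z) \<le> exp v" by simp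
          then show ?thesis by simp
        qed
        ultimately have "(LINT z|M. ?f z) \<le> exp v" by (intro LIMSEQ_le_const2) auto
        moreover have "integrable M ?f" by (rule M.integrable_const_bound[where B="real k"]) auto
        then have "(\<integral>\<^sup>+z. ennreal (?f z) \<partial>M) = ennreal (LINT z|M. ?f z)"
          by (rule nn_integral_eq_integral) auto
        ultimately show ?thesis by (simp add: ennreal_leI)
      qed
      have "(SUP k::nat. ennreal (min (real k) (exp (\<epsilon> * z)))) = ennreal (exp (\<epsilon> * z))" for z
      proof (rule antisym)
        show "(SUP k::nat. ennreal (min (real k) (exp (\<epsilon> * z)))) \<le> ennreal (exp (\<epsilon> * z))"
          by (intro SUP_least ennreal_leI) simp
        obtain k :: nat where "exp (\<epsilon> * z) \<le> real k" using real_arch_simple by blast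
        then have "ennreal (exp (\<epsilon> * z)) = ennreal (min (real k) (exp (\<epsilon> * z)))" by simp
        then show "ennreal (exp (\<epsilon> * z)) \<le> (SUP k::nat. ennreal (min (real k) (exp (\<epsilon> * z))))"
          by (rule ord_eq_le_trans) (rule SUP_upper, simp)
      qed
      then have "(\<integral>\<^sup>+z. ennreal (exp (\<epsilon> * z)) \<partial>M) = (\<integral>\<^sup>+z. (SUP k::nat. ennreal (min (real k) (exp (\<epsilon> * z)))) \<partial>M)"
        by simp
      also have "\<dots> = (SUP k::nat. \<integral>\<^sup>+z. ennreal (min (real k) (exp (\<epsilon> * z))) \<partial>M)"
        by (intro nn_integral_monotone_convergence_SUP) (auto simp: incseq_def le_fun_def intro!: ennreal_leI)
      also have "\<dots> \<le> ennreal (exp v)" by (intro SUP_least le)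
      finally show ?thesis .
    qed
    show "(\<integral>\<^sup>+z. ennreal (exp z) \<partial>M) \<le> ennreal (exp v)" "(\<integral>\<^sup>+z. ennreal (exp (- z)) \<partial>M) \<le> ennreal (exp v)"
      using mom[of 1] mom[of "-1"] by auto
  qed
qed

text \<open>The integrand of \<open>V_fun\<close> as a function of the scaled jump. It dominates the
  weight \<open>wgt\<close>, so one bound serves both the existence of the law and its
  moments.\<close>

definition vpow :: "real \<Rightarrow> real \<Rightarrow> real" where
  "vpow p x = (if \<bar>x\<bar> > 1 then \<bar>x\<bar> powr p else \<bar>x\<bar>\<^sup>2)"

abbreviation vint :: "real \<Rightarrow> real measure \<Rightarrow> ennreal" where "vint p M \<equiv> \<integral>\<^sup>+x. ennreal (vpow p x) \<partial>M"

abbreviation moment :: "real \<Rightarrow> real measure \<Rightarrow> ennreal" where "moment p M \<equiv> \<integral>\<^sup>+x. ennreal (\<bar>x\<bar> powr p) \<partial>M"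

section \<open>Majorants of power functions that are compatible with convolution\<close>

lemma vpow_measurable [measurable]: "vpow p \<in> borel_measurable borel"
  unfolding vpow_def[abs_def] by measurable

lemma vpow_nonneg: "0 \<le> vpow p x"
  by (simp add: vpow_def)

lemma wgt_le_vpow: "0 \<le> p \<Longrightarrow> min 1 (x\<^sup>2) \<le> vpow p x"
  using ge_one_powr_ge_zero[of "\<bar>x\<bar>" p] by (auto simp: vpow_def)

lemma powr_add_le:
  fixes x y p :: real
  assumes "0 \<le> p"
  shows "\<bar>x + y\<bar> powr p \<le> 2 powr p * (\<bar>x\<bar> powr p + \<bar>y\<bar> powr p)"
proof -
  have *: "\<bar>x + y\<bar> powr p \<le> 2 powr p * (\<bar>x\<bar> powr p + \<bar>y\<bar> powr p)" if "\<bar>y\<bar> \<le> \<bar>x\<bar>" for x y :: real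
  proof -
    have "\<bar>x + y\<bar> powr p \<le> (2 * \<bar>x\<bar>) powr p"
      using that assms by (intro powr_mono2) auto
    also have "\<dots> = 2 powr p * \<bar>x\<bar> powr p" by (simp add: powr_mult)
    also have "\<dots> \<le> 2 powr p * (\<bar>x\<bar> powr p + \<bar>y\<bar> powr p)" by (intro mult_left_mono) auto
    finally show ?thesis .
  qed
  show ?thesis
    using *[of y x] *[of x y] by (cases "\<bar>y\<bar> \<le> \<bar>x\<bar>") (auto simp: add.commute)
qed

text \<open>The majorant has the form \<open>\<eta>\<close> plus a multiple of a function that
  vanishes at 0, so that an exponential moment close to 1 yields a moment close to
  \<open>\<eta>\<close>. Below \<open>h\<close> the power is at most \<open>\<eta>\<close>; above
  \<open>h\<close> the exponential, minorised by one term of its series, dominates.\<close>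

lemma powr_le_cosh:
  fixes p \<eta> :: real
  assumes p: "0 < p" and \<eta>: "0 < \<eta>"
  obtains C where "0 \<le> C" "\<And>z::real. \<bar>z\<bar> powr p \<le> \<eta> + C * (exp z + exp (- z) - 2)"
proof -
  define h where "h = \<eta> powr (1 / p)"
  have h: "h > 0" "h powr p = \<eta>" using p \<eta> by (auto simp: h_def powr_powr)
  obtain k :: nat where k: "p \<le> real k" using real_arch_simple by blast
  \<comment> \<open>The hyperbolic expression equals
    \<open>(1 - exp (- |z|))\<^sup>2 * exp |z|\<close>, and \<open>q\<close> is a lower bound for
    its first factor when \<open>|z| > h\<close>.\<close>
  define q where "q = (1 - exp (- h))\<^sup>2"
  have q: "q > 0" using h by (simp add: q_def)
  define C where "C = h powr (p - real k) * fact k / q"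
  have C: "0 \<le> C" using q by (simp add: C_def)
  show thesis
  proof (rule that[OF C])
    fix z :: real
    let ?g = "exp z + exp (- z) - 2"
    have g: "?g = (1 - exp (- \<bar>z\<bar>))\<^sup>2 * exp \<bar>z\<bar>"
    proof -
      have "(1 - exp (- y))\<^sup>2 * exp y = exp y + exp (- y) - 2" for y :: real
        by (simp add: power2_eq_square algebra_simps flip: exp_add)
      from this[of "\<bar>z\<bar>"] show ?thesis by (cases "0 \<le> z") auto
    qed
    have g0: "0 \<le> ?g" unfolding g by simp
    show "\<bar>z\<bar> powr p \<le> \<eta> + C * ?g"
    proof (cases "\<bar>z\<bar> \<le> h")
      case True
      then have "\<bar>z\<bar> powr p \<le> h powr p" using p by (intro powr_mono2) auto
      then show ?thesis using h C g0 by (simp add: add_increasing2)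
    next
      case False
      then have z: "h < \<bar>z\<bar>" by simp
      have "\<bar>z\<bar> ^ k / fact k \<le> exp \<bar>z\<bar>"
      proof -
        have "(\<lambda>n. \<bar>z\<bar> ^ n /\<^sub>R fact n) sums exp \<bar>z\<bar>" by (rule exp_converges)
        then have "sum (\<lambda>n. \<bar>z\<bar> ^ n /\<^sub>R fact n) {k} \<le> exp \<bar>z\<bar>"
          by (subst sums_unique, assumption, intro sum_le_suminf) (auto simp: sums_iff)
        then show ?thesis by (simp add: divide_inverse mult.commute)
      qed
      then have k1: "\<bar>z\<bar> ^ k \<le> fact k * exp \<bar>z\<bar>" by (simp add: field_simps)
      have q1: "q \<le> (1 - exp (- \<bar>z\<bar>))\<^sup>2"
        unfolding q_def using z h by (intro power_mono) auto
      \<comment> \<open>The exponent is rounded up to an integer \<open>k\<close>; the leftover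
        power \<open>p - k\<close> is nonpositive, hence decreasing in \<open>|z|\<close>, and is
        taken at \<open>h\<close>.\<close>
      have "\<bar>z\<bar> powr p = \<bar>z\<bar> powr (p - real k) * \<bar>z\<bar> ^ k"
        using z h by (simp add: powr_diff powr_realpow field_simps)
      also have "\<dots> \<le> h powr (p - real k) * \<bar>z\<bar> ^ k"
        using z h k by (intro mult_right_mono powr_mono2') auto
      also have "\<dots> \<le> h powr (p - real k) * (fact k * exp \<bar>z\<bar>)"
        by (intro mult_left_mono k1) auto
      also have "\<dots> = C * (q * exp \<bar>z\<bar>)" using q by (simp add: C_def)
      also have "\<dots> \<le> C * ?g"
        unfolding g using C by (intro mult_left_mono mult_right_mono q1) auto
      also have "\<dots> \<le> \<eta> + C * ?g" using \<eta> by simp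
      finally show ?thesis .
    qed
  qed
qed

text \<open>The analogue for large jumps, which may have no exponential moments. Above
  \<open>h\<close> the difference \<open>(1 + |z|) powr p - 1\<close> is at least the fraction
  \<open>d\<close> of \<open>(1 + |z|) powr p\<close>.\<close>

lemma powr_le_one_plus_powr:
  fixes p \<eta> :: real
  assumes p: "0 < p" and \<eta>: "0 < \<eta>"
  obtains C where "0 \<le> C" "\<And>z::real. \<bar>z\<bar> powr p \<le> \<eta> + C * ((1 + \<bar>z\<bar>) powr p - 1)"
proof -
  define h where "h = \<eta> powr (1 / p)"
  have h: "h > 0" "h powr p = \<eta>" using p \<eta> by (auto simp: h_def powr_powr)
  define d where "d = 1 - (1 + h) powr (- p)"
  have "(1 + h) powr (- p) < (1 + h) powr 0" using p h by (intro powr_less_mono) auto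
  then have d: "d > 0" using h by (simp add: d_def)
  show thesis
  proof (rule that[of "1 / d"])
    fix z :: real
    have g0: "1 \<le> (1 + \<bar>z\<bar>) powr p" using p by (intro ge_one_powr_ge_zero) auto
    show "\<bar>z\<bar> powr p \<le> \<eta> + 1 / d * ((1 + \<bar>z\<bar>) powr p - 1)"
    proof (cases "\<bar>z\<bar> \<le> h")
      case True
      then have "\<bar>z\<bar> powr p \<le> h powr p" using p by (intro powr_mono2) auto
      then show ?thesis using h d g0 by (simp add: add_increasing2)
    next
      case False
      have "(1 + \<bar>z\<bar>) powr (- p) \<le> (1 + h) powr (- p)" using False p h by (intro powr_mono2') auto
      then have "(1 + \<bar>z\<bar>) powr p * (1 + \<bar>z\<bar>) powr (- p) \<le> (1 + \<bar>z\<bar>) powr p * (1 - d)"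
        by (intro mult_left_mono) (auto simp: d_def)
      moreover have "(1 + \<bar>z\<bar>) powr p * (1 + \<bar>z\<bar>) powr (- p) = 1" by (simp flip: powr_add)
      ultimately have "d * (1 + \<bar>z\<bar>) powr p \<le> (1 + \<bar>z\<bar>) powr p - 1" by (simp add: algebra_simps)
      then have "(1 + \<bar>z\<bar>) powr p \<le> 1 / d * ((1 + \<bar>z\<bar>) powr p - 1)" using d by (simp add: field_simps)
      moreover have "\<bar>z\<bar> powr p \<le> (1 + \<bar>z\<bar>) powr p" using p by (intro powr_mono2) auto
      ultimately show ?thesis using \<eta> by linarith
    qed
  qed (use d in simp)
qed

lemma ennreal_le_diff:
  assumes "a + ennreal b \<le> ennreal c" "0 \<le> b"
  shows "a \<le> ennreal (c - b)"
proof -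
  have "a \<noteq> \<top>" using assms by (auto simp: top_unique)
  then obtain r where r: "a = ennreal r" "0 \<le> r" by (cases a) auto
  then have le: "ennreal (r + b) \<le> ennreal c" using assms by simp
  show ?thesis
  proof (cases "0 \<le> c")
    case True
    then have "r + b \<le> c" using le by simp
    then show ?thesis unfolding r(1) by (intro ennreal_leI) simp
  next
    case False
    then have "r + b \<le> 0" using le r assms by (simp add: ennreal_neg)
    then have "r = 0" using r assms by linarith
    then show ?thesis using r by simp
  qed
qed

section \<open>Moments of infinitely divisible laws\<close>

lemma nn_moment_convolution:
  assumes "real_distribution M" "real_distribution N" "0 \<le> p"
  shows "moment p (M \<star> N) \<le>
    ennreal (2 powr p) * (moment p M + moment p N)"
proof -
  interpret M: real_distribution M by fact
  interpret N: real_distribution N by fact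
  have "moment p (M \<star> N) = (\<integral>\<^sup>+x. \<integral>\<^sup>+y. ennreal (\<bar>x + y\<bar> powr p) \<partial>N \<partial>M)"
    by (intro nn_integral_convolution) (auto simp: M.finite_measure_axioms N.finite_measure_axioms)
  also have "\<dots> \<le> (\<integral>\<^sup>+x. \<integral>\<^sup>+y. ennreal (2 powr p) * (ennreal (\<bar>x\<bar> powr p) + ennreal (\<bar>y\<bar> powr p)) \<partial>N \<partial>M)"
  proof (intro nn_integral_mono)
    fix x y
    have "ennreal (\<bar>x + y\<bar> powr p) \<le> ennreal (2 powr p * (\<bar>x\<bar> powr p + \<bar>y\<bar> powr p))"
      by (intro ennreal_leI powr_add_le assms)
    then show "ennreal (\<bar>x + y\<bar> powr p) \<le> ennreal (2 powr p) * (ennreal (\<bar>x\<bar> powr p) + ennreal (\<bar>y\<bar> powr p))"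
      by (simp add: ennreal_mult)
  qed
  also have "\<dots> = (\<integral>\<^sup>+x. ennreal (2 powr p) * (ennreal (\<bar>x\<bar> powr p) + (\<integral>\<^sup>+y. ennreal (\<bar>y\<bar> powr p) \<partial>N)) \<partial>M)"
    using N.emeasure_space_1 by (simp add: nn_integral_cmult nn_integral_add)
  also have "\<dots> = ennreal (2 powr p) * (moment p M + moment p N)"
    using M.emeasure_space_1 by (simp add: nn_integral_cmult nn_integral_add)
  finally show ?thesis .
qed

text \<open>Jumps of modulus at most 1 come from \<open>small_jumps\<close>, the others from a
  compound Poisson law, and a shift repairs the truncation. Each of the three contributes a moment
  \<open>\<eta>\<close> plus a multiple of an exponential minus 1. The constant \<open>C\<close>
  depends on \<open>p\<close> and \<open>\<epsilon>\<close> only, so it serves all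
  \<open>\<nu>\<close> and \<open>V\<close>.\<close>

lemma infinitely_divisible:
  fixes p \<epsilon> :: real
  assumes p: "0 < p" and \<epsilon>: "0 < \<epsilon>"
  obtains C where "0 \<le> C"
    "\<And>\<nu> V. sets \<nu> = sets borel \<Longrightarrow> 0 \<le> V \<Longrightarrow> (vint p \<nu>) \<le> ennreal V \<Longrightarrow>
      \<exists>D. real_distribution D \<and> (\<forall>t. char D t = exp (CLINT x|\<nu>. lk t x)) \<and>
        moment p D \<le> ennreal (\<epsilon> + C * (exp (C * V) - 1))"
proof -
  \<comment> \<open>Three contributions of \<open>\<eta>\<close>, each enlarged by
    \<open>2 powr p\<close> in two successive convolutions, add up to
    \<open>\<epsilon>\<close>.\<close>
  define \<eta> where "\<eta> = \<epsilon> / (3 * 4 powr p)"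
  have \<eta>: "\<eta> > 0" using \<epsilon> by (simp add: \<eta>_def)
  obtain C1 where C1: "0 \<le> C1" "\<And>z::real. \<bar>z\<bar> powr p \<le> \<eta> + C1 * (exp z + exp (- z) - 2)"
    using powr_le_cosh[OF p \<eta>] by blast
  obtain C2 where C2: "0 \<le> C2" "\<And>z::real. \<bar>z\<bar> powr p \<le> \<eta> + C2 * ((1 + \<bar>z\<bar>) powr p - 1)"
    using powr_le_one_plus_powr[OF p \<eta>] by blast
  \<comment> \<open>A single constant serves as the rate in the exponent, where
    \<open>2 powr p\<close> occurs, and as the factor in front, where \<open>3 * C1\<close> collects
    the small jumps and the shift.\<close>
  define C where "C = max (2 powr p) (4 powr p * (3 * C1 + C2))"
  have "2 powr p \<ge> 1" using p by (intro ge_one_powr_ge_zero) auto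
  then have C: "1 \<le> C" "2 powr p \<le> C" "4 powr p * (3 * C1 + C2) \<le> C" by (auto simp: C_def)
  show thesis
  proof (rule that[of C])
    show "0 \<le> C" using C by simp
    fix \<nu> :: "real measure" and V
    assume s\<nu>: "sets \<nu> = sets borel" and V: "0 \<le> V" "vint p \<nu> \<le> ennreal V"
    note [measurable_cong] = s\<nu>
    have sp: "space \<nu> = UNIV" using sets_eq_imp_space_eq[OF s\<nu>] by simp
    have w: "(\<integral>\<^sup>+x. ennreal (min 1 (x\<^sup>2)) \<partial>\<nu>) < \<infinity>"
    proof -
      have "(\<integral>\<^sup>+x. ennreal (min 1 (x\<^sup>2)) \<partial>\<nu>) \<le> vint p \<nu>"
        using p by (intro nn_integral_mono ennreal_leI wgt_le_vpow) simp
      also have "\<dots> < \<infinity>" using V by (auto intro: le_less_trans)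
      finally show ?thesis .
    qed
    have iw: "integrable \<nu> (\<lambda>x. min 1 (x\<^sup>2))" using w by (intro integrableI_nonneg) auto
    define Sm where "Sm = {x::real. \<bar>x\<bar> \<le> 1}"
    define Bg where "Bg = {x::real. 1 < \<bar>x\<bar>}"
    have [measurable]: "Sm \<in> sets borel" "Bg \<in> sets borel" unfolding Sm_def Bg_def by measurable
    define \<nu>s where "\<nu>s = density \<nu> (\<lambda>x. ennreal (indicator Sm x))"
    define \<nu>b where "\<nu>b = density \<nu> (\<lambda>x. ennreal (indicator Bg x))"
    have ss: "sets \<nu>s = sets borel" "sets \<nu>b = sets borel" by (simp_all add: \<nu>s_def \<nu>b_def s\<nu>)
    note [measurable_cong] = ss
    have nnd: "(\<integral>\<^sup>+x. h x \<partial>density \<nu> (\<lambda>x. ennreal (indicator A x))) = (\<integral>\<^sup>+x. ennreal (indicator A x) * h x \<partial>\<nu>)"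
      if [measurable]: "h \<in> borel_measurable borel" "A \<in> sets borel" for h and A :: "real set"
      by (intro nn_integral_density) measurable
    have cd: "(CLINT x|density \<nu> (\<lambda>x. ennreal (indicator A x)). g x) = (CLINT x|\<nu>. indicator A x *\<^sub>R g x)"
      if [measurable]: "g \<in> borel_measurable borel" "A \<in> sets borel" for g and A :: "real set"
      by (intro integral_density) auto
    have vs: "(\<integral>\<^sup>+x. ennreal (x\<^sup>2) \<partial>\<nu>s) \<le> ennreal V"
    proof -
      have "(\<integral>\<^sup>+x. ennreal (x\<^sup>2) \<partial>\<nu>s) = (\<integral>\<^sup>+x. ennreal (indicator Sm x) * ennreal (x\<^sup>2) \<partial>\<nu>)"
        unfolding \<nu>s_def by (intro nnd) measurable
      also have "\<dots> \<le> vint p \<nu>"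
        by (intro nn_integral_mono) (auto simp: indicator_def Sm_def vpow_def)
      finally show ?thesis using V by simp
    qed
    have concs: "AE x in \<nu>s. \<bar>x\<bar> \<le> 1"
      unfolding \<nu>s_def by (subst AE_density) (auto simp: indicator_def Sm_def)
    obtain DS where DS: "real_distribution DS" "\<And>t. char DS t = exp (CLINT x|\<nu>s. lk t x)"
      "(\<integral>\<^sup>+z. ennreal (exp z) \<partial>DS) \<le> ennreal (exp V)" "(\<integral>\<^sup>+z. ennreal (exp (- z)) \<partial>DS) \<le> ennreal (exp V)"
      by (rule small_jumps[OF ss(1) concs vs V(1)]) blast
    interpret DS: real_distribution DS by (rule DS(1))
    have momS: "moment p DS \<le> ennreal (\<eta> + 2 * C1 * (exp V - 1))"
    proof -
      \<comment> \<open>The constant subtracted in the majorant is kept on the left, since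
        subtraction of reals does not commute with \<open>ennreal\<close>; it is removed by
        \<open>ennreal_le_diff\<close> at the end.\<close>
      have "moment p DS + ennreal (2 * C1) = (\<integral>\<^sup>+z. ennreal (\<bar>z\<bar> powr p) + ennreal (2 * C1) \<partial>DS)"
        using DS.emeasure_space_1 by (subst nn_integral_add) auto
      also have "\<dots> \<le> (\<integral>\<^sup>+z. ennreal \<eta> + ennreal C1 * (ennreal (exp z) + ennreal (exp (- z))) \<partial>DS)"
      proof (rule nn_integral_mono)
        fix z
        have "ennreal (\<bar>z\<bar> powr p) + ennreal (2 * C1) = ennreal (\<bar>z\<bar> powr p + 2 * C1)"
          using C1 by simp
        also have "\<dots> \<le> ennreal (\<eta> + C1 * (exp z + exp (- z)))"
          using C1(2)[of z] by (intro ennreal_leI) (simp add: algebra_simps)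
        also have "\<dots> = ennreal \<eta> + ennreal C1 * (ennreal (exp z) + ennreal (exp (- z)))"
          using \<eta> C1(1) by (simp add: ennreal_mult)
        finally show "ennreal (\<bar>z\<bar> powr p) + ennreal (2 * C1) \<le> ennreal \<eta> + ennreal C1 * (ennreal (exp z) + ennreal (exp (- z)))" .
      qed
      also have "\<dots> = ennreal \<eta> + ennreal C1 * ((\<integral>\<^sup>+z. ennreal (exp z) \<partial>DS) + (\<integral>\<^sup>+z. ennreal (exp (- z)) \<partial>DS))"
        using DS.emeasure_space_1 by (simp add: nn_integral_add nn_integral_cmult)
      also have "\<dots> \<le> ennreal \<eta> + ennreal C1 * (ennreal (exp V) + ennreal (exp V))"
        by (intro add_left_mono mult_left_mono add_mono DS) simp
      also have "\<dots> = ennreal (\<eta> + C1 * (exp V + exp V))"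
        using \<eta> C1(1) by (simp add: ennreal_mult flip: mult_2)
      finally have "moment p DS \<le> ennreal (\<eta> + C1 * (exp V + exp V) - 2 * C1)"
        by (rule ennreal_le_diff) (use C1(1) in simp)
      also have "\<eta> + C1 * (exp V + exp V) - 2 * C1 = \<eta> + 2 * C1 * (exp V - 1)"
        by (simp add: algebra_simps)
      finally show ?thesis .
    qed
    have eb: "(\<integral>\<^sup>+x. ennreal (indicator Bg x) \<partial>\<nu>) \<le> ennreal V"
    proof -
      have "(\<integral>\<^sup>+x. ennreal (indicator Bg x) \<partial>\<nu>) \<le> vint p \<nu>"
        using p by (intro nn_integral_mono ennreal_leI) (auto simp: indicator_def Bg_def vpow_def ge_one_powr_ge_zero)
      then show ?thesis using V by simp
    qed
    have fb: "finite_measure \<nu>b"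
    proof (rule finite_measureI)
      have "emeasure \<nu>b (space \<nu>b) = (\<integral>\<^sup>+x. ennreal (indicator Bg x) \<partial>\<nu>)"
        unfolding \<nu>b_def by (subst emeasure_density) (auto intro!: nn_integral_cong simp: sp)
      then show "emeasure \<nu>b (space \<nu>b) \<noteq> \<infinity>" using eb by (auto simp: top_unique)
    qed
    have "\<exists>C. real_distribution C \<and> (\<forall>t. char C t = exp (CLINT x|\<nu>b. iexp (t * x) - 1)) \<and>
      (\<forall>h b. h \<in> borel_measurable borel \<longrightarrow> h 0 = 1 \<longrightarrow> (\<forall>x y. h (x + y) \<le> h x * h y) \<longrightarrow>
       (\<integral>\<^sup>+x. h x \<partial>\<nu>b) \<le> ennreal b \<longrightarrow> 0 \<le> b \<longrightarrow> (\<integral>\<^sup>+x. h x \<partial>C) \<le> ennreal (exp (b - measure \<nu>b UNIV)))"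
      by (rule compound_poisson[OF fb ss(2)]) blast
    then obtain DB where DB1: "real_distribution DB"
      and DB2: "\<forall>t. char DB t = exp (CLINT x|\<nu>b. iexp (t * x) - 1)"
      and DB3: "\<forall>h b. h \<in> borel_measurable borel \<longrightarrow> h 0 = 1 \<longrightarrow> (\<forall>x y. h (x + y) \<le> h x * h y) \<longrightarrow>
         (\<integral>\<^sup>+x. h x \<partial>\<nu>b) \<le> ennreal b \<longrightarrow> 0 \<le> b \<longrightarrow> (\<integral>\<^sup>+x. h x \<partial>DB) \<le> ennreal (exp (b - measure \<nu>b UNIV))"
      by (elim exE conjE)
    note DB = DB1 DB2[rule_format] DB3[rule_format]
    interpret DB: real_distribution DB by (rule DB(1))
    have subm: "ennreal ((1 + \<bar>x + y\<bar>) powr p) \<le> ennreal ((1 + \<bar>x\<bar>) powr p) * ennreal ((1 + \<bar>y\<bar>) powr p)" for x y :: real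
    proof -
      have "1 + \<bar>x + y\<bar> \<le> (1 + \<bar>x\<bar>) * (1 + \<bar>y\<bar>)"
      proof -
        have "(1 + \<bar>x\<bar>) * (1 + \<bar>y\<bar>) = 1 + \<bar>x\<bar> + \<bar>y\<bar> + \<bar>x\<bar> * \<bar>y\<bar>" by (simp add: algebra_simps)
        moreover have "0 \<le> \<bar>x\<bar> * \<bar>y\<bar>" by simp
        ultimately show ?thesis using abs_triangle_ineq[of x y] by linarith
      qed
      then have "(1 + \<bar>x + y\<bar>) powr p \<le> ((1 + \<bar>x\<bar>) * (1 + \<bar>y\<bar>)) powr p"
        using p by (intro powr_mono2) auto
      also have "\<dots> = (1 + \<bar>x\<bar>) powr p * (1 + \<bar>y\<bar>) powr p" by (simp add: powr_mult)
      finally show ?thesis by (simp add: ennreal_leI flip: ennreal_mult)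
    qed
    \<comment> \<open>On the large jumps \<open>1 + |x|\<close> is below \<open>2 * |x|\<close>,
      which puts \<open>2 powr p\<close> into the exponent.\<close>
    have momB1: "(\<integral>\<^sup>+z. ennreal ((1 + \<bar>z\<bar>) powr p) \<partial>DB) \<le> ennreal (exp (2 powr p * V))"
    proof -
      have "(\<integral>\<^sup>+x. ennreal ((1 + \<bar>x\<bar>) powr p) \<partial>\<nu>b) = (\<integral>\<^sup>+x. ennreal (indicator Bg x) * ennreal ((1 + \<bar>x\<bar>) powr p) \<partial>\<nu>)"
        unfolding \<nu>b_def by (intro nnd) measurable
      also have "\<dots> \<le> (\<integral>\<^sup>+x. ennreal (2 powr p) * ennreal (vpow p x) \<partial>\<nu>)"
      proof (rule nn_integral_mono)
        fix x
        show "ennreal (indicator Bg x) * ennreal ((1 + \<bar>x\<bar>) powr p) \<le> ennreal (2 powr p) * ennreal (vpow p x)"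
        proof (cases "x \<in> Bg")
          case True
          then have x: "1 < \<bar>x\<bar>" by (simp add: Bg_def)
          then have "(1 + \<bar>x\<bar>) powr p \<le> (2 * \<bar>x\<bar>) powr p" using p by (intro powr_mono2) auto
          also have "\<dots> = 2 powr p * vpow p x" using x by (simp add: powr_mult vpow_def)
          finally show ?thesis using True vpow_nonneg[of p x] by (simp add: ennreal_leI flip: ennreal_mult)
        qed simp
      qed
      also have "\<dots> = ennreal (2 powr p) * vint p \<nu>"
        by (intro nn_integral_cmult) measurable
      also have "\<dots> \<le> ennreal (2 powr p) * ennreal V" by (intro mult_left_mono V) simp
      also have "\<dots> = ennreal (2 powr p * V)" using V by (simp add: ennreal_mult)
      finally have "(\<integral>\<^sup>+z. ennreal ((1 + \<bar>z\<bar>) powr p) \<partial>DB) \<le> ennreal (exp (2 powr p * V - measure \<nu>b UNIV))"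
        using V(1) by (intro DB(3) subm) auto
      also have "\<dots> \<le> ennreal (exp (2 powr p * V))" by (intro ennreal_leI) simp
      finally show ?thesis .
    qed
    have momB: "moment p DB \<le> ennreal (\<eta> + C2 * (exp (2 powr p * V) - 1))"
    proof -
      have "moment p DB + ennreal C2 = (\<integral>\<^sup>+z. ennreal (\<bar>z\<bar> powr p) + ennreal C2 \<partial>DB)"
        using DB.emeasure_space_1 by (subst nn_integral_add) auto
      also have "\<dots> \<le> (\<integral>\<^sup>+z. ennreal \<eta> + ennreal C2 * ennreal ((1 + \<bar>z\<bar>) powr p) \<partial>DB)"
      proof (rule nn_integral_mono)
        fix z
        have "ennreal (\<bar>z\<bar> powr p) + ennreal C2 = ennreal (\<bar>z\<bar> powr p + C2)" using C2 by simp
        also have "\<dots> \<le> ennreal (\<eta> + C2 * (1 + \<bar>z\<bar>) powr p)"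
          using C2(2)[of z] by (intro ennreal_leI) (simp add: algebra_simps)
        also have "\<dots> = ennreal \<eta> + ennreal C2 * ennreal ((1 + \<bar>z\<bar>) powr p)"
          using \<eta> C2(1) by (simp add: ennreal_mult)
        finally show "ennreal (\<bar>z\<bar> powr p) + ennreal C2 \<le> ennreal \<eta> + ennreal C2 * ennreal ((1 + \<bar>z\<bar>) powr p)" .
      qed
      also have "\<dots> = ennreal \<eta> + ennreal C2 * (\<integral>\<^sup>+z. ennreal ((1 + \<bar>z\<bar>) powr p) \<partial>DB)"
        using DB.emeasure_space_1 by (simp add: nn_integral_add nn_integral_cmult)
      also have "\<dots> \<le> ennreal \<eta> + ennreal C2 * ennreal (exp (2 powr p * V))"
        by (intro add_left_mono mult_left_mono momB1) simp
      also have "\<dots> = ennreal (\<eta> + C2 * exp (2 powr p * V))"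
        using \<eta> C2(1) by (simp add: ennreal_mult)
      finally have "moment p DB \<le> ennreal (\<eta> + C2 * exp (2 powr p * V) - C2)"
        by (rule ennreal_le_diff) (use C2(1) in simp)
      also have "\<eta> + C2 * exp (2 powr p * V) - C2 = \<eta> + C2 * (exp (2 powr p * V) - 1)"
        by (simp add: algebra_simps)
      finally show ?thesis .
    qed
    \<comment> \<open>The compound Poisson exponent lacks the term \<open>tau\<close> that
      \<open>lk\<close> subtracts on the large jumps; the shift by \<open>- d\<close> supplies
      it.\<close>
    define d where "d = (LINT x|\<nu>. indicator Bg x * tau x)"
    have iBg: "integrable \<nu> (\<lambda>x. indicator Bg x * (1::real))"
      using eb by (intro integrableI_nonneg) (auto intro: le_less_trans)
    have id: "integrable \<nu> (\<lambda>x. indicator Bg x * tau x)"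
      using abs_tau_le by (intro Bochner_Integration.integrable_bound[OF iBg]) (auto simp: indicator_def)
    have dV: "\<bar>d\<bar> \<le> V"
    proof -
      have "\<bar>d\<bar> \<le> (LINT x|\<nu>. indicator Bg x * 1)"
        unfolding d_def
        using integral_abs_bound[of \<nu> "\<lambda>x. indicator Bg x * tau x"] id iBg abs_tau_le
        by (intro order_trans[OF integral_abs_bound] integral_mono) (auto simp: indicator_def)
      also have "\<dots> \<le> V"
        using eb V(1) nn_integral_eq_integral[OF iBg] by simp
      finally show ?thesis .
    qed
    \<comment> \<open>The majorant of \<open>powr_le_cosh\<close> is reused at \<open>V\<close>,
      which puts the shift into the same form as the other two contributions.\<close>
    have dp: "\<bar>d\<bar> powr p \<le> \<eta> + C1 * (exp V - 1)"
    proof -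
      have "\<bar>d\<bar> powr p \<le> \<bar>V\<bar> powr p" using dV p by (intro powr_mono2) auto
      also have "\<dots> \<le> \<eta> + C1 * (exp V + exp (- V) - 2)" by (rule C1)
      also have "\<dots> \<le> \<eta> + C1 * (exp V - 1)"
        using V(1) C1(1) by (intro add_left_mono mult_left_mono) auto
      finally show ?thesis .
    qed
    define D where "D = ((DS \<star> DB) \<star> return borel (- d))"
    have DSB: "real_distribution (DS \<star> DB)" by (intro real_distribution_convolution DS DB)
    have D: "real_distribution D"
      unfolding D_def by (intro real_distribution_convolution DSB real_distribution_return)
    have ilk: "integrable \<nu> (\<lambda>x. lk t x)" for t
    proof (rule Bochner_Integration.integrable_bound)
      show "integrable \<nu> (\<lambda>x. (2 + \<bar>t\<bar> + t\<^sup>2) * min 1 (x\<^sup>2))" using iw by simp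
      show "AE x in \<nu>. norm (lk t x) \<le> norm ((2 + \<bar>t\<bar> + t\<^sup>2) * min 1 (x\<^sup>2))"
        using norm_lk_le by (intro AE_I2) (simp add: abs_mult)
    qed measurable
    have isb: "integrable \<nu> (\<lambda>x. indicator A x *\<^sub>R lk t x)" if "A \<in> sets borel" for A :: "real set" and t
      using that s\<nu> by (intro integrable_mult_indicator ilk) simp
    have chD: "char D t = exp (CLINT x|\<nu>. lk t x)" for t
    proof -
      have i: "integrable \<nu> (\<lambda>x. \<i> * complex_of_real (t * (indicator Bg x * tau x)))"
        by (intro integrable_mult_right integrable_of_real id)
      have e: "indicator Bg x *\<^sub>R (iexp (t * x) - 1) = indicator Bg x *\<^sub>R lk t x + \<i> * complex_of_real (t * (indicator Bg x * tau x))" for x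
        by (simp add: lk_def indicator_def)
      have "(CLINT x|\<nu>b. iexp (t * x) - 1) = (CLINT x|\<nu>. indicator Bg x *\<^sub>R (iexp (t * x) - 1))"
        unfolding \<nu>b_def by (intro cd) auto
      also have "\<dots> = (CLINT x|\<nu>. indicator Bg x *\<^sub>R lk t x) + (CLINT x|\<nu>. \<i> * complex_of_real (t * (indicator Bg x * tau x)))"
        unfolding e by (intro Bochner_Integration.integral_add isb i) measurable
      also have "(CLINT x|\<nu>. \<i> * complex_of_real (t * (indicator Bg x * tau x))) = \<i> * of_real (t * d)"
        unfolding d_def by (simp only: integral_mult_right_zero integral_complex_of_real)
      finally have B: "(CLINT x|\<nu>b. iexp (t * x) - 1) = (CLINT x|\<nu>. indicator Bg x *\<^sub>R lk t x) + \<i> * of_real (t * d)" .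
      have S: "(CLINT x|\<nu>s. lk t x) = (CLINT x|\<nu>. indicator Sm x *\<^sub>R lk t x)"
        unfolding \<nu>s_def by (intro cd) auto
      have "(CLINT x|\<nu>. indicator Sm x *\<^sub>R lk t x) + (CLINT x|\<nu>. indicator Bg x *\<^sub>R lk t x)
          = (CLINT x|\<nu>. indicator Sm x *\<^sub>R lk t x + indicator Bg x *\<^sub>R lk t x)"
        by (intro Bochner_Integration.integral_add[symmetric] isb) measurable
      also have "(\<lambda>x. indicator Sm x *\<^sub>R lk t x + indicator Bg x *\<^sub>R lk t x) = lk t"
        by (auto simp: fun_eq_iff Sm_def Bg_def indicator_def)
      finally have sum: "(CLINT x|\<nu>. indicator Sm x *\<^sub>R lk t x) + (CLINT x|\<nu>. indicator Bg x *\<^sub>R lk t x) = (CLINT x|\<nu>. lk t x)" .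
      have "char D t = exp ((CLINT x|\<nu>. indicator Sm x *\<^sub>R lk t x)
          + ((CLINT x|\<nu>. indicator Bg x *\<^sub>R lk t x) + \<i> * of_real (t * d)) + \<i> * of_real (t * - d))"
        unfolding D_def char_convolution[OF DSB real_distribution_return] char_convolution[OF DS(1) DB(1)]
          DS(2) DB(2) B S char_return by (simp only: exp_add)
      also have "\<dots> = exp (CLINT x|\<nu>. lk t x)"
        unfolding sum[symmetric] by simp
      finally show ?thesis .
    qed
    have "moment p D \<le>
        ennreal (2 powr p) * (moment p (DS \<star> DB) + moment p (return borel (- d)))"
      unfolding D_def using p by (intro nn_moment_convolution DSB real_distribution_return) simp
    also have "\<dots> \<le> ennreal (2 powr p) * (ennreal (2 powr p) * (moment p DS + moment p DB) + ennreal (\<bar>d\<bar> powr p))"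
      using p by (intro mult_left_mono add_mono nn_moment_convolution DS DB) (auto simp: nn_integral_return)
    also have "\<dots> \<le> ennreal (2 powr p) * (ennreal (2 powr p) * (ennreal (\<eta> + 2 * C1 * (exp V - 1)) + ennreal (\<eta> + C2 * (exp (2 powr p * V) - 1))) + ennreal (\<eta> + C1 * (exp V - 1)))"
      by (intro mult_left_mono add_mono momS momB ennreal_leI dp) auto
    also have "\<dots> = ennreal (2 powr p * (2 powr p * ((\<eta> + 2 * C1 * (exp V - 1)) + (\<eta> + C2 * (exp (2 powr p * V) - 1))) + (\<eta> + C1 * (exp V - 1))))"
    proof -
      have "0 \<le> \<eta> + 2 * C1 * (exp V - 1)" "0 \<le> \<eta> + C2 * (exp (2 powr p * V) - 1)" "0 \<le> \<eta> + C1 * (exp V - 1)"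
        using \<eta> C1(1) C2(1) V(1) by simp_all
      moreover have "ennreal k * (ennreal k * (ennreal x + ennreal y) + ennreal z) = ennreal (k * (k * (x + y) + z))"
        if "0 \<le> k" "0 \<le> x" "0 \<le> y" "0 \<le> z" for k x y z
        using that by (simp add: ennreal_mult)
      ultimately show ?thesis by (metis powr_ge_zero)
    qed
    also have "\<dots> \<le> ennreal (\<epsilon> + C * (exp (C * V) - 1))"
    proof (rule ennreal_leI)
      define E where "E = exp (C * V) - 1"
      have "V \<le> C * V" using mult_right_mono[OF C(1) V(1)] by simp
      then have E1: "exp V - 1 \<le> E" by (simp add: E_def)
      have E2: "exp (2 powr p * V) - 1 \<le> E" using C(2) V(1) by (simp add: E_def mult_right_mono)
      have "1 \<le> exp V" using V(1) by simp
      then have E0: "0 \<le> E" using E1 by linarith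
      have p1: "1 \<le> 2 powr p" by fact
      have p4: "2 powr p * 2 powr p = 4 powr p" by (simp flip: powr_mult)
      \<comment> \<open>The shift enters only one convolution; an extra factor
        \<open>2 powr p\<close> aligns it with the other two terms.\<close>
      have third: "\<eta> + C1 * (exp V - 1) \<le> 2 powr p * (\<eta> + C1 * E)"
      proof -
        have "\<eta> + C1 * (exp V - 1) \<le> \<eta> + C1 * E" using C1(1) E1 by (simp add: mult_left_mono)
        also have "\<dots> \<le> 2 powr p * (\<eta> + C1 * E)"
          using mult_right_mono[OF p1, of "\<eta> + C1 * E"] \<eta> C1(1) E0 by simp
        finally show ?thesis .
      qed
      have "2 powr p * (2 powr p * ((\<eta> + 2 * C1 * (exp V - 1)) + (\<eta> + C2 * (exp (2 powr p * V) - 1))) + (\<eta> + C1 * (exp V - 1)))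
        \<le> 2 powr p * (2 powr p * ((\<eta> + 2 * C1 * E) + (\<eta> + C2 * E)) + 2 powr p * (\<eta> + C1 * E))"
        using C1(1) C2(1) E1 E2 by (intro mult_left_mono add_mono third) auto
      also have "\<dots> = 2 powr p * 2 powr p * (3 * \<eta> + (3 * C1 + C2) * E)"
        by (simp add: algebra_simps)
      also have "\<dots> = \<epsilon> + 4 powr p * (3 * C1 + C2) * E"
        unfolding p4 by (simp add: \<eta>_def algebra_simps)
      also have "\<dots> \<le> \<epsilon> + C * E" using C(3) E0 by (simp add: mult_right_mono)
      finally show "2 powr p * (2 powr p * ((\<eta> + 2 * C1 * (exp V - 1)) + (\<eta> + C2 * (exp (2 powr p * V) - 1))) + (\<eta> + C1 * (exp V - 1)))
        \<le> \<epsilon> + C * (exp (C * V) - 1)" by (simp add: E_def)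
    qed
    finally show "\<exists>D. real_distribution D \<and> (\<forall>t. char D t = exp (CLINT x|\<nu>. lk t x)) \<and>
        moment p D \<le> ennreal (\<epsilon> + C * (exp (C * V) - 1))"
      using D chD by blast
  qed
qed

definition normal_moment :: "real \<Rightarrow> real" where
  "normal_moment p = (LINT x|std_normal_distribution. \<bar>x\<bar> powr p)"

section \<open>Gaussian moments and the comparison of a law with an infinitely divisible one\<close>

lemma std_normal_moment_finite:
  assumes "0 \<le> p"
  shows "moment p std_normal_distribution = ennreal (normal_moment p)"
    and "0 \<le> normal_moment p"
proof -
  interpret real_distribution std_normal_distribution by (rule real_dist_normal_dist)
  obtain k :: nat where k: "p \<le> real k" using real_arch_simple by blast
  have "integrable std_normal_distribution (\<lambda>x. \<bar>x\<bar> powr p)"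
  proof (rule Bochner_Integration.integrable_bound)
    show "integrable std_normal_distribution (\<lambda>x. 1 + x ^ (2 * k))"
      using integrable_std_normal_distribution_moment[of "2 * k"] by simp
    show "AE x in std_normal_distribution. norm (\<bar>x\<bar> powr p) \<le> norm (1 + x ^ (2 * k))"
    proof (intro AE_I2)
      fix x :: real
      have e: "0 \<le> x ^ (2 * k)" by (simp add: power_mult)
      have "\<bar>x\<bar> powr p \<le> 1 + x ^ (2 * k)"
      proof (cases "\<bar>x\<bar> \<le> 1")
        case True
        then have "\<bar>x\<bar> powr p \<le> 1 powr p" using assms by (intro powr_mono2) auto
        then show ?thesis using e by (simp only: powr_one_eq_one)
      next
        case False
        then have "\<bar>x\<bar> powr p \<le> \<bar>x\<bar> powr real (2 * k)" using k by (intro powr_mono) auto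
        also have "\<dots> = \<bar>x\<bar> ^ (2 * k)" using False by (intro powr_realpow) auto
        also have "\<dots> = x ^ (2 * k)" by (rule power_even_abs) simp
        finally show ?thesis by simp
      qed
      then show "norm (\<bar>x\<bar> powr p) \<le> norm (1 + x ^ (2 * k))" using e by simp
    qed
  qed measurable
  then show "moment p std_normal_distribution = ennreal (normal_moment p)"
    unfolding normal_moment_def by (rule nn_integral_eq_integral) auto
  show "0 \<le> normal_moment p" unfolding normal_moment_def by (intro integral_nonneg_AE) auto
qed

text \<open>
  Adding the independent variable with law \<^term>\<open>Dn\<close> turns the law \<^term>\<open>DX\<close> into an
  infinitely divisible one; since \<^term>\<open>Dn\<close> puts mass at least \<open>1/2\<close> near 0, moments of the sum
  control those of the summand.
\<close>

lemma moment_compare: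
  fixes p :: real
  assumes p: "0 < p" and DX: "real_distribution DX" and Dn: "real_distribution Dn" and Dp: "real_distribution Dp"
    and ch: "\<And>t. char DX t * char Dn t = iexp (t * \<gamma>) * exp (- of_real (t\<^sup>2 / 2 * a)) * char Dp t"
    and a: "0 \<le> a" and \<beta>: "0 < \<beta>"
    and mn: "moment p Dn \<le> ennreal \<beta>"
    and mp: "moment p Dp \<le> ennreal \<beta>"
  shows "moment p DX \<le>
    ennreal (2 * (2 powr p * (2 powr p * (2 powr p * (\<bar>\<gamma>\<bar> powr p + a powr (p / 2) * normal_moment p) + \<beta>) + 2 * \<beta>)))"
proof -
  interpret DX: real_distribution DX by fact
  interpret Dn: real_distribution Dn by fact
  interpret N: real_distribution std_normal_distribution by (rule real_dist_normal_dist)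
  define G where "G = distr std_normal_distribution borel (\<lambda>x. sqrt a * x)"
  have G: "real_distribution G"
    unfolding G_def real_distribution_def real_distribution_axioms_def
    by (auto intro!: N.prob_space_distr)
  have chG: "char G t = exp (- of_real (t\<^sup>2 / 2 * a))" for t
  proof -
    have "char G t = char std_normal_distribution (t * sqrt a)"
      unfolding G_def char_def by (subst integral_distr) (auto simp: mult.assoc)
    also have "\<dots> = exp (- of_real (t\<^sup>2 / 2 * a))"
      unfolding char_std_normal_distribution using a
      by (simp add: power_mult_distrib mult.commute flip: exp_of_real)
    finally show ?thesis .
  qed
  have mG: "moment p G = ennreal (a powr (p / 2) * normal_moment p)"
  proof -
    have "moment p G = (\<integral>\<^sup>+x. ennreal (\<bar>sqrt a * x\<bar> powr p) \<partial>std_normal_distribution)"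
      unfolding G_def by (intro nn_integral_distr) auto
    also have "\<dots> = (\<integral>\<^sup>+x. ennreal (a powr (p / 2)) * ennreal (\<bar>x\<bar> powr p) \<partial>std_normal_distribution)"
    proof (intro nn_integral_cong)
      fix x
      have "\<bar>sqrt a * x\<bar> powr p = a powr (p / 2) * \<bar>x\<bar> powr p"
        using a by (simp add: abs_mult powr_mult powr_powr flip: powr_half_sqrt)
      then show "ennreal (\<bar>sqrt a * x\<bar> powr p) = ennreal (a powr (p / 2)) * ennreal (\<bar>x\<bar> powr p)"
        by (simp add: ennreal_mult)
    qed
    also have "\<dots> = ennreal (a powr (p / 2)) * ennreal (normal_moment p)"
      using p by (subst nn_integral_cmult) (auto simp: std_normal_moment_finite)
    finally show ?thesis using p by (simp add: ennreal_mult std_normal_moment_finite)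
  qed
  define D where "D = ((return borel \<gamma> \<star> G) \<star> Dp)"
  have rG: "real_distribution (return borel \<gamma> \<star> G)"
    by (intro real_distribution_convolution real_distribution_return G)
  have D: "real_distribution D" unfolding D_def by (intro real_distribution_convolution rG Dp)
  have XY: "real_distribution (DX \<star> Dn)" by (intro real_distribution_convolution DX Dn)
  have "DX \<star> Dn = D"
  proof (rule Levy_uniqueness[OF XY D])
    show "char (DX \<star> Dn) = char D"
      unfolding fun_eq_iff D_def
      by (simp only: char_convolution[OF DX Dn] ch char_convolution[OF rG Dp]
          char_convolution[OF real_distribution_return G] char_return chG simp_thms)
  qed
  let ?B = "2 powr p * (2 powr p * (\<bar>\<gamma>\<bar> powr p + a powr (p / 2) * normal_moment p) + \<beta>)"
  have N0: "0 \<le> normal_moment p" using std_normal_moment_finite[of p] p by simp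
  have B0: "0 \<le> ?B" using N0 \<beta> by simp
  have sum: "moment p (DX \<star> Dn) \<le> ennreal ?B"
  proof -
    have "moment p D \<le>
       ennreal (2 powr p) * (moment p (return borel \<gamma> \<star> G) + moment p Dp)"
      unfolding D_def using p by (intro nn_moment_convolution rG Dp) simp
    also have "\<dots> \<le> ennreal (2 powr p) * (ennreal (2 powr p) * (moment p (return borel \<gamma>) + moment p G) + ennreal \<beta>)"
      using p by (intro mult_left_mono add_mono nn_moment_convolution real_distribution_return G mp) simp_all
    also have "\<dots> = ennreal ?B"
      using N0 \<beta> by (simp add: nn_integral_return mG ennreal_mult)
    finally show ?thesis using \<open>DX \<star> Dn = D\<close> by simp
  qed
  \<comment> \<open>At twice its bound the moment of \<open>Dn\<close> leaves, by Markov's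
    inequality, at most mass \<open>1/2\<close> outside \<open>E\<close>.\<close>
  define E where "E = {y::real. \<bar>y\<bar> powr p \<le> 2 * \<beta>}"
  have [measurable]: "E \<in> sets borel" unfolding E_def by measurable
  have half: "ennreal (1 / 2) \<le> emeasure Dn E"
  proof -
    have "ennreal (2 * \<beta>) * emeasure Dn (UNIV - E) = (\<integral>\<^sup>+y. ennreal (2 * \<beta>) * indicator (UNIV - E) y \<partial>Dn)"
      by (simp add: nn_integral_cmult_indicator)
    also have "\<dots> \<le> (\<integral>\<^sup>+y. ennreal (\<bar>y\<bar> powr p) \<partial>Dn)"
      by (intro nn_integral_mono) (auto simp: E_def indicator_def intro!: ennreal_leI)
    also have "\<dots> \<le> ennreal \<beta>" by (rule mn)
    finally have "2 * \<beta> * measure Dn (UNIV - E) \<le> \<beta>"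
      using \<beta> by (simp add: Dn.emeasure_eq_measure flip: ennreal_mult)
    then have "measure Dn (UNIV - E) \<le> 1 / 2" using \<beta> by (simp add: field_simps)
    moreover have "measure Dn (UNIV - E) = 1 - measure Dn E" using Dn.prob_compl[of E] by simp
    ultimately have "1 / 2 \<le> measure Dn E" by simp
    then show ?thesis unfolding Dn.emeasure_eq_measure by (rule ennreal_leI)
  qed
  let ?m = "\<integral>\<^sup>+z. ennreal (\<bar>z\<bar> powr p) \<partial>DX"
  have "ennreal (1 / 2) * ?m \<le> ?m * emeasure Dn E"
    using mult_right_mono[OF half, of ?m] by (simp add: mult.commute)
  also have "\<dots> = (\<integral>\<^sup>+x. ennreal (\<bar>x\<bar> powr p) * emeasure Dn E \<partial>DX)"
    by (intro nn_integral_multc[symmetric]) measurable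
  also have "\<dots> = (\<integral>\<^sup>+x. \<integral>\<^sup>+y. ennreal (\<bar>x\<bar> powr p) * indicator E y \<partial>Dn \<partial>DX)"
    by (simp add: nn_integral_cmult_indicator)
  also have "\<dots> \<le> (\<integral>\<^sup>+x. \<integral>\<^sup>+y. ennreal (2 powr p) * (ennreal (\<bar>x + y\<bar> powr p) + ennreal (2 * \<beta>)) \<partial>Dn \<partial>DX)"
  proof (intro nn_integral_mono)
    fix x y
    show "ennreal (\<bar>x\<bar> powr p) * indicator E y \<le> ennreal (2 powr p) * (ennreal (\<bar>x + y\<bar> powr p) + ennreal (2 * \<beta>))"
    proof (cases "y \<in> E")
      case True
      have "\<bar>x\<bar> powr p \<le> 2 powr p * (\<bar>x + y\<bar> powr p + \<bar>- y\<bar> powr p)"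
        using powr_add_le[of p "x + y" "- y"] p by simp
      also have "\<dots> \<le> 2 powr p * (\<bar>x + y\<bar> powr p + 2 * \<beta>)"
        using True by (intro mult_left_mono add_left_mono) (auto simp: E_def)
      finally have "ennreal (\<bar>x\<bar> powr p) \<le> ennreal (2 powr p * (\<bar>x + y\<bar> powr p + 2 * \<beta>))" by (rule ennreal_leI)
      then show ?thesis using True \<beta> by (simp add: ennreal_mult)
    qed simp
  qed
  also have "\<dots> = (\<integral>\<^sup>+z. ennreal (2 powr p) * (ennreal (\<bar>z\<bar> powr p) + ennreal (2 * \<beta>)) \<partial>(DX \<star> Dn))"
    by (intro nn_integral_convolution[symmetric]) (auto simp: DX.finite_measure_axioms Dn.finite_measure_axioms)
  also have "\<dots> = ennreal (2 powr p) * (moment p (DX \<star> Dn) + ennreal (2 * \<beta>))"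
  proof -
    interpret C: real_distribution "DX \<star> Dn" by (rule XY)
    show ?thesis using C.emeasure_space_1 by (simp add: nn_integral_cmult nn_integral_add)
  qed
  also have "\<dots> \<le> ennreal (2 powr p) * (ennreal ?B + ennreal (2 * \<beta>))"
    by (intro mult_left_mono add_right_mono sum) simp
  also have "\<dots> = ennreal (2 powr p * (?B + 2 * \<beta>))"
  proof -
    have "ennreal k * (ennreal x + ennreal y) = ennreal (k * (x + y))" if "0 \<le> k" "0 \<le> x" "0 \<le> y" for k x y
      using that by (simp add: ennreal_mult)
    from this[OF powr_ge_zero B0] show ?thesis using \<beta> by (meson less_imp_le mult_nonneg_nonneg zero_le_numeral)
  qed
  finally have h: "ennreal (1 / 2) * ?m \<le> ennreal (2 powr p * (?B + 2 * \<beta>))" .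
  have "ennreal 2 * ennreal (1 / 2) = 1" by (subst ennreal_mult[symmetric]) auto
  then have "?m = ennreal 2 * (ennreal (1 / 2) * ?m)"
    by (simp only: mult.assoc[symmetric] mult_1)
  also have "\<dots> \<le> ennreal 2 * ennreal (2 powr p * (?B + 2 * \<beta>))" by (intro mult_left_mono h) simp
  also have "\<dots> = ennreal (2 * (2 powr p * (?B + 2 * \<beta>)))"
    using B0 \<beta> by (intro ennreal_mult[symmetric]) auto
  finally show ?thesis .
qed

text \<open>Laws whose triplet has size at most \<open>V\<close> in every component. The pair
  \<open>\<nu>p\<close>, \<open>\<nu>n\<close> need be neither mutually singular nor free of mass at
  0, where \<open>vpow\<close> and \<open>lk\<close> vanish; the images of the Jordan kernels are of
  this general kind.\<close>

definition qid_law :: "real \<Rightarrow> real \<Rightarrow> real measure \<Rightarrow> bool" where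
  "qid_law p V D \<longleftrightarrow> real_distribution D \<and> (\<exists>\<gamma> a \<nu>p \<nu>n. sets \<nu>p = sets borel \<and> sets \<nu>n = sets borel \<and>
     \<bar>\<gamma>\<bar> \<le> V \<and> 0 \<le> a \<and> a \<le> V \<and> vint p \<nu>p \<le> ennreal V \<and> vint p \<nu>n \<le> ennreal V \<and>
     (\<forall>t. char D t = exp (\<i> * of_real (t * \<gamma>) - of_real (t\<^sup>2 / 2 * a) + (CLINT x|\<nu>p. lk t x) - (CLINT x|\<nu>n. lk t x))))"

text \<open>The bound of \<open>moment_compare\<close> with drift and variance replaced by their
  common bound \<open>V\<close>.\<close>

definition moment_bound :: "real \<Rightarrow> real \<Rightarrow> real \<Rightarrow> real" where
  "moment_bound p V \<beta> = 2 * (2 powr p * (2 powr p * (2 powr p * (V powr p + V powr (p / 2) * normal_moment p) + \<beta>) + 2 * \<beta>))"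

section \<open>Moments of quasi-infinitely divisible laws\<close>

lemma qid_law_moment:
  fixes p \<epsilon> :: real
  assumes p: "0 < p" and \<epsilon>: "0 < \<epsilon>"
  shows "\<exists>C\<ge>0. \<forall>D V. qid_law p V D \<longrightarrow> moment p D \<le> ennreal (moment_bound p V (\<epsilon> + C * (exp (C * V) - 1)))"
proof -
  obtain C where C: "0 \<le> C" and ex: "\<And>\<nu> V. sets \<nu> = sets borel \<Longrightarrow> 0 \<le> V \<Longrightarrow> (vint p \<nu>) \<le> ennreal V \<Longrightarrow>
      \<exists>D. real_distribution D \<and> (\<forall>t. char D t = exp (CLINT x|\<nu>. lk t x)) \<and>
        moment p D \<le> ennreal (\<epsilon> + C * (exp (C * V) - 1))"
    by (rule infinitely_divisible[OF p \<epsilon>]) blast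
  show ?thesis
  proof (intro exI[of _ C] conjI allI impI)
    fix D V assume D: "qid_law p V D"
    define \<beta> where \<beta>: "\<beta> = \<epsilon> + C * (exp (C * V) - 1)"
    obtain \<gamma> a \<nu>p \<nu>n where \<nu>: "sets \<nu>p = sets borel" "sets \<nu>n = sets borel"
      and \<gamma>: "\<bar>\<gamma>\<bar> \<le> V" and a0: "0 \<le> a" and a: "a \<le> V"
      and vp: "vint p \<nu>p \<le> ennreal V" and vn: "vint p \<nu>n \<le> ennreal V"
      and chD: "\<And>t. char D t = exp (\<i> * of_real (t * \<gamma>) - of_real (t\<^sup>2 / 2 * a) + (CLINT x|\<nu>p. lk t x) - (CLINT x|\<nu>n. lk t x))"
      using D unfolding qid_law_def by blast
    have V: "0 \<le> V" using \<gamma> by linarith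
    obtain Dp where Dp: "real_distribution Dp" "\<And>t. char Dp t = exp (CLINT x|\<nu>p. lk t x)"
        "moment p Dp \<le> ennreal \<beta>"
      using ex[OF \<nu>(1) V vp] unfolding \<beta> by blast
    obtain Dn where Dn: "real_distribution Dn" "\<And>t. char Dn t = exp (CLINT x|\<nu>n. lk t x)"
        "moment p Dn \<le> ennreal \<beta>"
      using ex[OF \<nu>(2) V vn] unfolding \<beta> by blast
    have "0 \<le> C * (exp (C * V) - 1)" using C V by simp
    then have \<beta>0: "0 < \<beta>" using \<epsilon> \<beta> by simp
    have N0: "0 \<le> normal_moment p" using std_normal_moment_finite[of p] p by simp
    have "moment p D \<le>
      ennreal (2 * (2 powr p * (2 powr p * (2 powr p * (\<bar>\<gamma>\<bar> powr p + a powr (p / 2) * normal_moment p) + \<beta>) + 2 * \<beta>)))"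
    proof (rule moment_compare[OF p _ Dn(1) Dp(1) _ a0 \<beta>0 Dn(3) Dp(3)])
      show "real_distribution D" using D by (simp add: qid_law_def)
      fix t
      have "char D t * char Dn t = exp (\<i> * of_real (t * \<gamma>) + (- of_real (t\<^sup>2 / 2 * a)) + (CLINT x|\<nu>p. lk t x))"
        unfolding Dn(2) chD by (simp only: exp_add[symmetric]) simp
      then show "char D t * char Dn t = iexp (t * \<gamma>) * exp (- of_real (t\<^sup>2 / 2 * a)) * char Dp t"
        unfolding Dp(2) by (simp only: exp_add)
    qed
    also have "\<dots> \<le> ennreal (moment_bound p V \<beta>)"
      unfolding moment_bound_def using \<gamma> a a0 p N0
      by (intro ennreal_leI mult_left_mono add_mono order_refl mult_right_mono powr_mono2) auto
    finally show "moment p D \<le> ennreal (moment_bound p V (\<epsilon> + C * (exp (C * V) - 1)))" unfolding \<beta> .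
  qed (rule C)
qed

lemma qid_law_moment_bounded:
  assumes p: "0 < p"
  shows "\<exists>B. \<forall>D. qid_law p V D \<longrightarrow> moment p D \<le> ennreal B"
  using qid_law_moment[OF p zero_less_one] by blast

lemma qid_law_moment_small:
  assumes p: "0 < p" and \<epsilon>: "0 < \<epsilon>"
  shows "\<exists>V>0. \<forall>D. qid_law p V D \<longrightarrow> moment p D \<le> ennreal \<epsilon>"
proof -
  \<comment> \<open>As \<open>V\<close> decreases to 0, the bound tends to
    \<open>2 * 2 powr p * (2 powr p + 2) * \<epsilon>0\<close>, which is half of
    \<open>\<epsilon>\<close>; the limit is thus strictly below \<open>\<epsilon>\<close>.\<close>
  define \<epsilon>0 where "\<epsilon>0 = \<epsilon> / (2 * (2 * (2 powr p * (2 powr p + 2))))"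
  have \<epsilon>0: "0 < \<epsilon>0" using \<epsilon> by (simp add: \<epsilon>0_def add_pos_pos)
  obtain C where C: "0 \<le> C" and bd:
    "\<And>D V. qid_law p V D \<Longrightarrow> moment p D \<le> ennreal (moment_bound p V (\<epsilon>0 + C * (exp (C * V) - 1)))"
    using qid_law_moment[OF p \<epsilon>0] by blast
  define f where "f V = moment_bound p V (\<epsilon>0 + C * (exp (C * V) - 1))" for V
  have pw: "((\<lambda>V::real. V powr q) \<longlongrightarrow> 0) (at_right 0)" if "0 < q" for q
    using that by (intro tendsto_zero_powrI[where b=q] tendsto_const tendsto_ident_at)
      (auto simp: eventually_at_filter)
  have ex: "((\<lambda>V::real. exp (C * V)) \<longlongrightarrow> exp (C * 0)) (at_right 0)"
    by (intro tendsto_intros)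
  let ?L = "2 * (2 powr p * (2 powr p * (2 powr p * (0 + 0 * normal_moment p)
     + (\<epsilon>0 + C * (exp (C * 0) - 1))) + 2 * (\<epsilon>0 + C * (exp (C * 0) - 1))))"
  have "(f \<longlongrightarrow> ?L) (at_right 0)"
    unfolding f_def[abs_def] moment_bound_def using p by (intro tendsto_intros pw ex) auto
  also have "?L = \<epsilon> / 2"
  proof -
    have "2 * (2 powr p * (2 powr p + 2)) \<noteq> 0" by (simp add: add_pos_pos less_imp_neq[symmetric])
    moreover have "K * (\<epsilon> / (2 * K)) = \<epsilon> / 2" if "K \<noteq> 0" for K using that by simp
    ultimately have "2 * (2 powr p * (2 powr p + 2)) * \<epsilon>0 = \<epsilon> / 2" unfolding \<epsilon>0_def by blast
    then show ?thesis by (simp add: algebra_simps)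
  qed
  finally have "eventually (\<lambda>V. f V < \<epsilon>) (at_right 0)"
    by (rule order_tendstoD(2)) (use \<epsilon> in simp)
  then obtain V where V: "0 < V" "f V < \<epsilon>"
    unfolding eventually_at_right_field using dense by blast
  show ?thesis
  proof (intro exI[of _ V] conjI allI impI)
    fix D assume "qid_law p V D"
    from bd[OF this] have "moment p D \<le> ennreal (f V)" by (simp only: f_def)
    also have "\<dots> \<le> ennreal \<epsilon>" using V by (intro ennreal_leI) simp
    finally show "moment p D \<le> ennreal \<epsilon>" .
  qed (rule V(1))
qed

section \<open>Convergence in probability\<close>

text \<open>The mean of \<open>min 1 |X|\<close>. The map sending \<open>X\<close>, \<open>Y\<close>
  to \<open>pd\<close> of their difference metrises convergence in probability, up to almost sure
  equality.\<close>

definition pd :: "'w measure \<Rightarrow> ('w \<Rightarrow> real) \<Rightarrow> ennreal" where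
  "pd P X = (\<integral>\<^sup>+w. ennreal (min 1 \<bar>X w\<bar>) \<partial>P)"

section \<open>The metric of convergence in probability\<close>

context prob_space
begin

lemma pd_le_one: "pd M X \<le> 1"
proof -
  have "pd M X \<le> (\<integral>\<^sup>+w. 1 \<partial>M)"
    unfolding pd_def by (intro nn_integral_mono) (simp add: ennreal_le_1)
  then show ?thesis by (simp add: emeasure_space_1)
qed

lemma pd_triangle:
  assumes [measurable]: "X \<in> borel_measurable M" "Y \<in> borel_measurable M"
  shows "pd M (\<lambda>w. X w + Y w) \<le> pd M X + pd M Y"
proof -
  have "pd M (\<lambda>w. X w + Y w) \<le> (\<integral>\<^sup>+w. ennreal (min 1 \<bar>X w\<bar>) + ennreal (min 1 \<bar>Y w\<bar>) \<partial>M)"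
    unfolding pd_def by (intro nn_integral_mono) (auto simp flip: ennreal_plus intro!: ennreal_leI)
  also have "\<dots> = pd M X + pd M Y"
    unfolding pd_def by (intro nn_integral_add) measurable
  finally show ?thesis .
qed

lemma pd_scale:
  assumes [measurable]: "X \<in> borel_measurable M"
  shows "pd M (\<lambda>w. c * X w) \<le> ennreal (max 1 \<bar>c\<bar>) * pd M X"
proof -
  have "min 1 \<bar>c * x\<bar> \<le> max 1 \<bar>c\<bar> * min 1 \<bar>x\<bar>" for x
  proof (cases "\<bar>x\<bar> \<le> 1")
    case True
    have "\<bar>c * x\<bar> \<le> max 1 \<bar>c\<bar> * \<bar>x\<bar>" by (simp add: abs_mult mult_right_mono)
    then show ?thesis using True by (simp add: min.coboundedI2)
  next
    case False
    then show ?thesis by simp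
  qed
  then have "pd M (\<lambda>w. c * X w) \<le> (\<integral>\<^sup>+w. ennreal (max 1 \<bar>c\<bar>) * ennreal (min 1 \<bar>X w\<bar>) \<partial>M)"
    unfolding pd_def by (intro nn_integral_mono) (simp flip: ennreal_mult' add: ennreal_leI)
  also have "\<dots> = ennreal (max 1 \<bar>c\<bar>) * pd M X"
    unfolding pd_def by (intro nn_integral_cmult) measurable
  finally show ?thesis .
qed

lemma pd_minus: "pd M (\<lambda>w. - X w) = pd M X"
  by (simp add: pd_def)

lemma pd_diff_commute: "pd M (\<lambda>w. X w - Y w) = pd M (\<lambda>w. Y w - X w)"
  by (simp add: pd_def abs_minus_commute)

lemma pd_triangle_diff:
  assumes [measurable]: "X \<in> borel_measurable M" "Y \<in> borel_measurable M" "Z \<in> borel_measurable M"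
  shows "pd M (\<lambda>w. X w - Z w) \<le> pd M (\<lambda>w. X w - Y w) + pd M (\<lambda>w. Y w - Z w)"
  using pd_triangle[of "\<lambda>w. X w - Y w" "\<lambda>w. Y w - Z w"] by simp

lemma pd_cong_AE: "AE w in M. X w = Y w \<Longrightarrow> pd M X = pd M Y"
  unfolding pd_def by (rule nn_integral_cong_AE) auto

lemma pd_eq_0_AE:
  assumes [measurable]: "X \<in> borel_measurable M" and "pd M X = 0"
  shows "AE w in M. X w = 0"
proof -
  have "AE w in M. ennreal (min 1 \<bar>X w\<bar>) = 0"
    using assms(2) unfolding pd_def by (subst (asm) nn_integral_0_iff_AE) auto
  then show ?thesis by eventually_elim (auto simp: ennreal_eq_0_iff min_def split: if_splits)
qed

lemma prob_le_pd:
  assumes [measurable]: "X \<in> borel_measurable M" and e: "0 < e"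
  shows "ennreal (min 1 e) * ennreal (prob {w\<in>space M. \<bar>X w\<bar> > e}) \<le> pd M X"
proof -
  have "ennreal (min 1 e) * ennreal (prob {w\<in>space M. \<bar>X w\<bar> > e}) = (\<integral>\<^sup>+w. ennreal (min 1 e) * indicator {w\<in>space M. \<bar>X w\<bar> > e} w \<partial>M)"
    by (subst nn_integral_cmult_indicator) (auto simp: emeasure_eq_measure)
  also have "\<dots> \<le> pd M X"
    unfolding pd_def by (intro nn_integral_mono) (auto simp: indicator_def intro!: ennreal_leI)
  finally show ?thesis .
qed

lemma pd_le_prob:
  assumes [measurable]: "X \<in> borel_measurable M" and e: "0 \<le> e"
  shows "pd M X \<le> ennreal (e + prob {w\<in>space M. \<bar>X w\<bar> > e})"
proof -
  have "pd M X \<le> (\<integral>\<^sup>+w. ennreal e + indicator {w\<in>space M. \<bar>X w\<bar> > e} w \<partial>M)"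
    unfolding pd_def
  proof (rule nn_integral_mono)
    fix w assume w: "w \<in> space M"
    show "ennreal (min 1 \<bar>X w\<bar>) \<le> ennreal e + indicator {w\<in>space M. \<bar>X w\<bar> > e} w"
    proof (cases "\<bar>X w\<bar> > e")
      case True
      have "ennreal (min 1 \<bar>X w\<bar>) \<le> 1" by (simp add: ennreal_le_1)
      then show ?thesis using True w by (simp add: add_increasing)
    next
      case False
      then show ?thesis by (simp add: ennreal_leI)
    qed
  qed
  also have "\<dots> = ennreal e + ennreal (prob {w\<in>space M. \<bar>X w\<bar> > e})"
    by (subst nn_integral_add) (auto simp: emeasure_space_1 simp flip: emeasure_eq_measure)
  finally show ?thesis using e by simp
qed

section \<open>Almost sure subsequences, completeness and uniqueness of limits\<close>

lemma tendsto_0_ennrealI: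
  fixes f :: "nat \<Rightarrow> ennreal"
  assumes "\<And>e. 0 < e \<Longrightarrow> eventually (\<lambda>n. f n \<le> ennreal e) sequentially"
  shows "f \<longlonglongrightarrow> 0"
proof (rule order_tendstoI)
  fix a :: ennreal assume "0 < a"
  then obtain r where r: "0 < ennreal r" "ennreal r < a"
    by (metis dense ennreal_cases less_top not_less_zero top_neq_ennreal order.strict_trans2 le_less)
  then have "0 < r" by simp
  from assms[OF this] show "eventually (\<lambda>n. f n < a) sequentially"
    by eventually_elim (use r in auto)
qed auto

lemma tendsto_in_prob_iff_pd:
  assumes [measurable]: "\<And>n. X n \<in> borel_measurable M" "Y \<in> borel_measurable M"
  shows "tendsto_in_prob M X Y \<longleftrightarrow> (\<lambda>n. pd M (\<lambda>w. X n w - Y w)) \<longlonglongrightarrow> 0"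
proof
  assume t: "tendsto_in_prob M X Y"
  show "(\<lambda>n. pd M (\<lambda>w. X n w - Y w)) \<longlonglongrightarrow> 0"
  proof (rule tendsto_0_ennrealI)
    fix e :: real assume e: "0 < e"
    have "(\<lambda>n. prob {w\<in>space M. \<bar>X n w - Y w\<bar> > e / 2}) \<longlonglongrightarrow> 0"
      by (rule t[unfolded tendsto_in_prob_def, rule_format]) (use e in simp)
    then have "eventually (\<lambda>n. prob {w\<in>space M. \<bar>X n w - Y w\<bar> > e / 2} < e / 2) sequentially"
      by (rule order_tendstoD(2)) (use e in simp)
    then show "eventually (\<lambda>n. pd M (\<lambda>w. X n w - Y w) \<le> ennreal e) sequentially"
    proof eventually_elim
      case (elim n)
      have "pd M (\<lambda>w. X n w - Y w) \<le> ennreal (e / 2 + prob {w\<in>space M. \<bar>X n w - Y w\<bar> > e / 2})"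
        using e by (intro pd_le_prob) auto
      also have "\<dots> \<le> ennreal e" using elim by (intro ennreal_leI) simp
      finally show ?case .
    qed
  qed
next
  assume t: "(\<lambda>n. pd M (\<lambda>w. X n w - Y w)) \<longlonglongrightarrow> 0"
  show "tendsto_in_prob M X Y"
    unfolding tendsto_in_prob_def
  proof (intro allI impI)
    fix e :: real assume e: "0 < e"
    show "(\<lambda>n. prob {w\<in>space M. \<bar>X n w - Y w\<bar> > e}) \<longlonglongrightarrow> 0"
    proof (rule LIMSEQ_I)
      fix d :: real assume d: "0 < d"
      have "0 < ennreal (min 1 e * d)" using e d by simp
      from order_tendstoD(2)[OF t this]
      obtain N where N: "\<And>n. n \<ge> N \<Longrightarrow> pd M (\<lambda>w. X n w - Y w) < ennreal (min 1 e * d)"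
        by (auto simp: eventually_sequentially)
      show "\<exists>N. \<forall>n\<ge>N. norm (prob {w\<in>space M. \<bar>X n w - Y w\<bar> > e} - 0) < d"
      proof (intro exI[of _ N] allI impI)
        fix n assume n: "N \<le> n"
        have "ennreal (min 1 e * prob {w\<in>space M. \<bar>X n w - Y w\<bar> > e}) = ennreal (min 1 e) * ennreal (prob {w\<in>space M. \<bar>X n w - Y w\<bar> > e})"
          using e by (intro ennreal_mult) auto
        also have "\<dots> \<le> pd M (\<lambda>w. X n w - Y w)"
          using e by (intro prob_le_pd) auto
        also have "\<dots> < ennreal (min 1 e * d)" by (rule N[OF n])
        finally have "min 1 e * prob {w\<in>space M. \<bar>X n w - Y w\<bar> > e} < min 1 e * d"
          using e d by (subst (asm) ennreal_less_iff) auto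
        moreover have "0 < min 1 e" using e by simp
        ultimately have "prob {w\<in>space M. \<bar>X n w - Y w\<bar> > e} < d" using mult_less_cancel_left_pos by blast
        then show "norm (prob {w\<in>space M. \<bar>X n w - Y w\<bar> > e} - 0) < d" by simp
      qed
    qed
  qed
qed

lemma AE_summable_of_pd:
  assumes [measurable]: "\<And>k. Z k \<in> borel_measurable M" and le: "\<And>k. pd M (Z k) \<le> ennreal ((1/2) ^ k)"
  shows "AE w in M. summable (\<lambda>k. min 1 \<bar>Z k w\<bar>)"
proof -
  have "(\<integral>\<^sup>+w. (\<Sum>k. ennreal (min 1 \<bar>Z k w\<bar>)) \<partial>M) = (\<Sum>k. pd M (Z k))"
    unfolding pd_def by (intro nn_integral_suminf) measurable
  also have "\<dots> \<le> (\<Sum>k. ennreal ((1/2) ^ k))" by (intro suminf_le le) auto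
  also have "\<dots> = ennreal (\<Sum>k. (1/2) ^ k)" by (intro suminf_ennreal2) (auto intro: summable_geometric)
  also have "\<dots> < \<infinity>" by simp
  finally have "AE w in M. (\<Sum>k. ennreal (min 1 \<bar>Z k w\<bar>)) \<noteq> \<infinity>"
    by (intro nn_integral_PInf_AE) auto
  then show ?thesis
    by eventually_elim (auto intro!: summable_suminf_not_top)
qed

lemma summable_min_one:
  fixes f :: "nat \<Rightarrow> real"
  assumes "summable (\<lambda>k. min 1 \<bar>f k\<bar>)"
  shows "summable (\<lambda>k. \<bar>f k\<bar>)"
proof -
  have "(\<lambda>k. min 1 \<bar>f k\<bar>) \<longlonglongrightarrow> 0" using assms by (rule summable_LIMSEQ_zero)
  then have "eventually (\<lambda>k. min 1 \<bar>f k\<bar> < 1) sequentially" by (rule order_tendstoD) simp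
  then have "eventually (\<lambda>k. min 1 \<bar>f k\<bar> = \<bar>f k\<bar>) sequentially" by eventually_elim auto
  from summable_cong[OF this] assms show ?thesis by simp
qed

lemma ex_fast_subsequence:
  fixes Q :: "nat \<Rightarrow> nat \<Rightarrow> bool"
  assumes "\<And>k. \<exists>N. \<forall>n\<ge>N. Q k n"
  obtains r where "strict_mono (r :: nat \<Rightarrow> nat)" "\<And>k. \<forall>n\<ge>r k. Q k n"
proof -
  have "\<exists>r. \<forall>k. (\<forall>n\<ge>r k. Q k n) \<and> r k < r (Suc k)"
  proof (rule dependent_nat_choice)
    show "\<exists>x. \<forall>n\<ge>x. Q 0 n" by (rule assms)
    fix x k assume "\<forall>n\<ge>x. Q k n"
    obtain N where "\<forall>n\<ge>N. Q (Suc k) n" using assms by blast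
    then show "\<exists>y. (\<forall>n\<ge>y. Q (Suc k) n) \<and> x < y"
      by (intro exI[of _ "max N (Suc x)"]) auto
  qed
  then show thesis using that strict_mono_Suc_iff by blast
qed

text \<open>A subsequence is chosen so fast that the truncated distances have summable means; almost
  surely they are then summable, and their terms vanish.\<close>

lemma tendsto_in_prob_subseq_AE:
  assumes [measurable]: "\<And>n. X n \<in> borel_measurable M" "Y \<in> borel_measurable M"
    and t: "(\<lambda>n. pd M (\<lambda>w. X n w - Y w)) \<longlonglongrightarrow> 0"
  obtains r where "strict_mono (r :: nat \<Rightarrow> nat)" "AE w in M. (\<lambda>k. X (r k) w) \<longlonglongrightarrow> Y w"
proof -
  have "\<exists>N. \<forall>n\<ge>N. pd M (\<lambda>w. X n w - Y w) \<le> ennreal ((1/2) ^ k)" for k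
    using order_tendstoD(2)[OF t, of "ennreal ((1/2) ^ k)"] by (auto simp: eventually_sequentially intro: less_imp_le)
  then obtain r where r: "strict_mono (r :: nat \<Rightarrow> nat)" "\<And>k. \<forall>n\<ge>r k. pd M (\<lambda>w. X n w - Y w) \<le> ennreal ((1/2) ^ k)"
    using ex_fast_subsequence[of "\<lambda>k n. pd M (\<lambda>w. X n w - Y w) \<le> ennreal ((1/2) ^ k)"] by blast
  have "AE w in M. summable (\<lambda>k. min 1 \<bar>X (r k) w - Y w\<bar>)"
    using r(2) by (intro AE_summable_of_pd) auto
  then have "AE w in M. (\<lambda>k. X (r k) w) \<longlonglongrightarrow> Y w"
  proof eventually_elim
    case (elim w)
    then have "(\<lambda>k. \<bar>X (r k) w - Y w\<bar>) \<longlonglongrightarrow> 0"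
      by (intro summable_LIMSEQ_zero summable_min_one)
    then show ?case by (simp add: LIM_zero_iff tendsto_rabs_zero_iff)
  qed
  with r(1) show thesis by (rule that)
qed

lemma AE_tendsto_pd:
  assumes [measurable]: "\<And>n. X n \<in> borel_measurable M" "Y \<in> borel_measurable M"
    and ae: "AE w in M. (\<lambda>k. X k w) \<longlonglongrightarrow> Y w"
  shows "(\<lambda>n. pd M (\<lambda>w. X n w - Y w)) \<longlonglongrightarrow> 0"
proof -
  have "(\<lambda>n. \<integral>\<^sup>+w. ennreal (min 1 \<bar>X n w - Y w\<bar>) \<partial>M) \<longlonglongrightarrow> (\<integral>\<^sup>+w. 0 \<partial>M)"
  proof (rule nn_integral_dominated_convergence[where w="\<lambda>_. 1"])
    show "AE w in M. (\<lambda>n. ennreal (min 1 \<bar>X n w - Y w\<bar>)) \<longlonglongrightarrow> 0"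
      using ae
    proof eventually_elim
      case (elim w)
      then have "(\<lambda>n. \<bar>X n w - Y w\<bar>) \<longlonglongrightarrow> 0" by (simp add: LIM_zero_iff tendsto_rabs_zero_iff)
      then have "(\<lambda>n. min 1 \<bar>X n w - Y w\<bar>) \<longlonglongrightarrow> min 1 0" by (intro tendsto_min tendsto_const)
      then show ?case using tendsto_ennrealI by fastforce
    qed
  qed (auto simp: emeasure_space_1 ennreal_le_1)
  then show ?thesis by (simp add: pd_def)
qed

text \<open>The increments along a fast subsequence are almost surely absolutely summable, which
  gives the limit; the Cauchy property carries the convergence over to the whole sequence.\<close>

lemma pd_Cauchy_converges:
  assumes [measurable]: "\<And>n. X n \<in> borel_measurable M"
    and cau: "\<And>e. 0 < e \<Longrightarrow> \<exists>N. \<forall>m\<ge>N. \<forall>n\<ge>N. pd M (\<lambda>w. X m w - X n w) \<le> ennreal e"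
  obtains Y where "Y \<in> borel_measurable M" "(\<lambda>n. pd M (\<lambda>w. X n w - Y w)) \<longlonglongrightarrow> 0"
proof -
  have "\<exists>N. \<forall>n\<ge>N. \<forall>m\<ge>n. pd M (\<lambda>w. X m w - X n w) \<le> ennreal ((1/2) ^ k)" for k
  proof -
    obtain N where "\<forall>m\<ge>N. \<forall>n\<ge>N. pd M (\<lambda>w. X m w - X n w) \<le> ennreal ((1/2) ^ k)"
      using cau[of "(1/2) ^ k"] by auto
    then show ?thesis by (intro exI[of _ N]) auto
  qed
  then obtain r where r: "strict_mono (r :: nat \<Rightarrow> nat)"
      "\<And>k. \<forall>n\<ge>r k. \<forall>m\<ge>n. pd M (\<lambda>w. X m w - X n w) \<le> ennreal ((1/2) ^ k)"
    using ex_fast_subsequence[of "\<lambda>k n. \<forall>m\<ge>n. pd M (\<lambda>w. X m w - X n w) \<le> ennreal ((1/2) ^ k)"] by blast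
  have le: "pd M (\<lambda>w. X (r (Suc k)) w - X (r k) w) \<le> ennreal ((1/2) ^ k)" for k
    using r(2)[of k] strict_mono_leD[OF r(1), of k "Suc k"] by simp
  have "AE w in M. summable (\<lambda>k. min 1 \<bar>X (r (Suc k)) w - X (r k) w\<bar>)"
    using le by (intro AE_summable_of_pd) auto
  then have conv: "AE w in M. convergent (\<lambda>k. X (r k) w)"
  proof eventually_elim
    case (elim w)
    then have "summable (\<lambda>k. \<bar>X (r (Suc k)) w - X (r k) w\<bar>)" by (rule summable_min_one)
    then have "summable (\<lambda>k. X (r (Suc k)) w - X (r k) w)" by (rule summable_rabs_cancel)
    then have "convergent (\<lambda>n. \<Sum>k<n. X (r (Suc k)) w - X (r k) w)" by (simp add: summable_iff_convergent)
    then have "convergent (\<lambda>n. X (r n) w - X (r 0) w)" by (simp add: sum_lessThan_telescope[of "\<lambda>k. X (r k) w"])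
    then have "convergent (\<lambda>n. (X (r n) w - X (r 0) w) + X (r 0) w)" by (intro convergent_add convergent_const)
    then show ?case by simp
  qed
  define Y where "Y w = lim (\<lambda>k. X (r k) w)" for w
  have Y [measurable]: "Y \<in> borel_measurable M" unfolding Y_def[abs_def] by measurable
  have "AE w in M. (\<lambda>k. X (r k) w) \<longlonglongrightarrow> Y w"
    using conv by eventually_elim (simp add: Y_def convergent_LIMSEQ_iff)
  from AE_tendsto_pd[OF _ Y this] have tr: "(\<lambda>k. pd M (\<lambda>w. X (r k) w - Y w)) \<longlonglongrightarrow> 0" by simp
  have "(\<lambda>n. pd M (\<lambda>w. X n w - Y w)) \<longlonglongrightarrow> 0"
  proof (rule tendsto_0_ennrealI)
    fix e :: real assume e: "0 < e"
    obtain N where N: "\<forall>m\<ge>N. \<forall>n\<ge>N. pd M (\<lambda>w. X m w - X n w) \<le> ennreal (e / 2)"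
      using cau[of "e / 2"] e by auto
    have "eventually (\<lambda>k. pd M (\<lambda>w. X (r k) w - Y w) < ennreal (e / 2)) sequentially"
      using e by (intro order_tendstoD(2)[OF tr]) simp
    then have "eventually (\<lambda>k. pd M (\<lambda>w. X (r k) w - Y w) < ennreal (e / 2) \<and> k \<ge> N) sequentially"
      using eventually_ge_at_top[of N] by eventually_elim auto
    then obtain k where k: "pd M (\<lambda>w. X (r k) w - Y w) < ennreal (e / 2)" "k \<ge> N"
      by (auto simp: eventually_sequentially)
    have rk: "r k \<ge> N" using k(2) strict_mono_imp_increasing[OF r(1), of k] by linarith
    have "pd M (\<lambda>w. X n w - Y w) \<le> ennreal e" if n: "n \<ge> N" for n
    proof -
      have "pd M (\<lambda>w. X n w - Y w) \<le> pd M (\<lambda>w. X n w - X (r k) w) + pd M (\<lambda>w. X (r k) w - Y w)"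
        by (intro pd_triangle_diff) auto
      also have "\<dots> \<le> ennreal (e / 2) + ennreal (e / 2)"
        using N n rk k by (intro add_mono) auto
      also have "\<dots> = ennreal e" using e by (simp flip: ennreal_plus)
      finally show ?thesis .
    qed
    then show "eventually (\<lambda>n. pd M (\<lambda>w. X n w - Y w) \<le> ennreal e) sequentially"
      unfolding eventually_sequentially by blast
  qed
  with Y show thesis by (rule that)
qed

lemma pd_limit_unique:
  assumes [measurable]: "\<And>n. X n \<in> borel_measurable M" "Y \<in> borel_measurable M" "Z \<in> borel_measurable M"
    and "(\<lambda>n. pd M (\<lambda>w. X n w - Y w)) \<longlonglongrightarrow> 0" "(\<lambda>n. pd M (\<lambda>w. X n w - Z w)) \<longlonglongrightarrow> 0"
  shows "AE w in M. Y w = Z w"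
proof -
  have "(\<lambda>n. pd M (\<lambda>w. X n w - Y w) + pd M (\<lambda>w. X n w - Z w)) \<longlonglongrightarrow> 0 + 0"
    using assms by (intro tendsto_add)
  moreover have "pd M (\<lambda>w. Y w - Z w) \<le> pd M (\<lambda>w. X n w - Y w) + pd M (\<lambda>w. X n w - Z w)" for n
    using pd_triangle_diff[of Y "X n" Z] by (simp add: pd_diff_commute[of Y])
  ultimately have "pd M (\<lambda>w. Y w - Z w) \<le> 0 + 0"
    by (intro LIMSEQ_le_const) auto
  then have "AE w in M. Y w - Z w = 0" by (intro pd_eq_0_AE) auto
  then show ?thesis by eventually_elim simp
qed

lemma pd_tendsto_lincomb:
  assumes [measurable]: "\<And>n. X n \<in> borel_measurable M" "\<And>n. X' n \<in> borel_measurable M"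
    "Y \<in> borel_measurable M" "Y' \<in> borel_measurable M"
    and t: "(\<lambda>n. pd M (\<lambda>w. X n w - Y w)) \<longlonglongrightarrow> 0" "(\<lambda>n. pd M (\<lambda>w. X' n w - Y' w)) \<longlonglongrightarrow> 0"
  shows "(\<lambda>n. pd M (\<lambda>w. (\<alpha> * X n w + \<beta> * X' n w) - (\<alpha> * Y w + \<beta> * Y' w))) \<longlonglongrightarrow> 0"
proof (rule tendsto_sandwich[OF _ _ tendsto_const])
  show "eventually (\<lambda>n. pd M (\<lambda>w. (\<alpha> * X n w + \<beta> * X' n w) - (\<alpha> * Y w + \<beta> * Y' w)) \<le>
      ennreal (max 1 \<bar>\<alpha>\<bar>) * pd M (\<lambda>w. X n w - Y w) + ennreal (max 1 \<bar>\<beta>\<bar>) * pd M (\<lambda>w. X' n w - Y' w)) sequentially"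
  proof (intro always_eventually allI)
    fix n
    have "pd M (\<lambda>w. (\<alpha> * X n w + \<beta> * X' n w) - (\<alpha> * Y w + \<beta> * Y' w))
      = pd M (\<lambda>w. \<alpha> * (X n w - Y w) + \<beta> * (X' n w - Y' w))" by (simp add: algebra_simps)
    also have "\<dots> \<le> pd M (\<lambda>w. \<alpha> * (X n w - Y w)) + pd M (\<lambda>w. \<beta> * (X' n w - Y' w))"
      by (intro pd_triangle) auto
    also have "\<dots> \<le> ennreal (max 1 \<bar>\<alpha>\<bar>) * pd M (\<lambda>w. X n w - Y w) + ennreal (max 1 \<bar>\<beta>\<bar>) * pd M (\<lambda>w. X' n w - Y' w)"
      by (intro add_mono pd_scale) auto
    finally show "pd M (\<lambda>w. (\<alpha> * X n w + \<beta> * X' n w) - (\<alpha> * Y w + \<beta> * Y' w)) \<le>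
      ennreal (max 1 \<bar>\<alpha>\<bar>) * pd M (\<lambda>w. X n w - Y w) + ennreal (max 1 \<bar>\<beta>\<bar>) * pd M (\<lambda>w. X' n w - Y' w)" .
  qed
  have "(\<lambda>n. ennreal (max 1 \<bar>\<alpha>\<bar>) * pd M (\<lambda>w. X n w - Y w) + ennreal (max 1 \<bar>\<beta>\<bar>) * pd M (\<lambda>w. X' n w - Y' w))
     \<longlonglongrightarrow> ennreal (max 1 \<bar>\<alpha>\<bar>) * 0 + ennreal (max 1 \<bar>\<beta>\<bar>) * 0"
    by (intro tendsto_add ennreal_tendsto_cmult t) auto
  then show "(\<lambda>n. ennreal (max 1 \<bar>\<alpha>\<bar>) * pd M (\<lambda>w. X n w - Y w) + ennreal (max 1 \<bar>\<beta>\<bar>) * pd M (\<lambda>w. X' n w - Y' w)) \<longlonglongrightarrow> 0"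
    by simp
qed auto

text \<open>Levy's continuity theorem gives weak convergence to the point mass at 0. It is tested
  with the bounded continuous function \<open>min 1 |x|\<close>, whose mean is
  \<open>pd\<close>.\<close>

lemma char_tendsto_one_pd:
  assumes [measurable]: "\<And>n. X n \<in> borel_measurable M"
    and ch: "\<And>t. (\<lambda>n. char (distr M borel (X n)) t) \<longlonglongrightarrow> 1"
  shows "(\<lambda>n. pd M (X n)) \<longlonglongrightarrow> 0"
proof -
  have rX: "real_distribution (distr M borel (X n))" for n by (rule real_distribution_distr) simp
  have r0: "real_distribution (return borel (0::real))"
    by (simp add: real_distribution_def real_distribution_axioms_def prob_space_return)
  have "char (return borel 0) t = 1" for t
    unfolding char_def by (subst integral_return) auto
  then have "weak_conv_m (\<lambda>n. distr M borel (X n)) (return borel 0)"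
    using ch by (intro levy_continuity rX r0) simp
  then have "(\<lambda>n. LINT x|distr M borel (X n). min 1 \<bar>x\<bar>) \<longlonglongrightarrow> (LINT x|return borel (0::real). min 1 \<bar>x\<bar>)"
    by (intro weak_conv_imp_integral_bdd_continuous_conv[OF rX r0, where B=1])
      (auto intro!: continuous_min continuous_intros)
  also have "(LINT x|return borel (0::real). min 1 \<bar>x\<bar>) = 0"
    by (subst integral_return) auto
  finally have "(\<lambda>n. ennreal (LINT x|distr M borel (X n). min 1 \<bar>x\<bar>)) \<longlonglongrightarrow> ennreal 0"
    by (rule tendsto_ennrealI)
  moreover have "ennreal (LINT x|distr M borel (X n). min 1 \<bar>x\<bar>) = pd M (X n)" for n
  proof -
    have "integrable M (\<lambda>w. min 1 \<bar>X n w\<bar>)" by (rule integrable_const_bound[where B=1]) auto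
    then show ?thesis
      unfolding pd_def by (subst integral_distr) (auto simp: nn_integral_eq_integral)
  qed
  ultimately show ?thesis by simp
qed

end

section \<open>The modular\<close>

lemma tau_clamp: "tau x = max (- 1) (min 1 x)"
  by (auto simp: tau_def max_def min_def abs_if)

text \<open>For \<open>|x| \<le> 1\<close> the expression compares \<open>tau\<close> with the
  identity at \<open>x * u\<close>, an error of second order; for larger \<open>x\<close> its two
  terms are bounded by 1 and \<open>|u|\<close>.\<close>

lemma tau_diff_le: "\<bar>tau (x * u) - u * tau x\<bar> \<le> (1 + \<bar>u\<bar> + u\<^sup>2) * wgt x"
proof (cases "\<bar>x\<bar> \<le> 1")
  case True
  then have x: "x\<^sup>2 \<le> 1" by (simp add: abs_square_le_1)
  have "\<bar>tau y - y\<bar> \<le> y\<^sup>2" for y :: real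
  proof (cases "\<bar>y\<bar> \<le> 1")
    case False
    have "\<bar>tau y - y\<bar> \<le> \<bar>y\<bar>" by (auto simp: tau_clamp)
    also have "\<dots> \<le> \<bar>y\<bar> * \<bar>y\<bar>" using False mult_right_mono[of 1 "\<bar>y\<bar>" "\<bar>y\<bar>"] by simp
    finally show ?thesis by (simp add: power2_eq_square)
  qed (simp add: tau_def)
  from this[of "x * u"] have "\<bar>tau (x * u) - u * tau x\<bar> \<le> u\<^sup>2 * x\<^sup>2"
    using True by (simp add: tau_def power_mult_distrib mult.commute)
  also have "\<dots> \<le> (1 + \<bar>u\<bar> + u\<^sup>2) * x\<^sup>2" by (intro mult_right_mono) auto
  finally show ?thesis using x by simp
next
  case False
  then have x: "x\<^sup>2 > 1" by (simp add: not_le[symmetric] abs_square_le_1)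
  have "\<bar>tau (x * u) - u * tau x\<bar> \<le> \<bar>tau (x * u)\<bar> + \<bar>u\<bar> * \<bar>tau x\<bar>"
    using abs_triangle_ineq4[of "tau (x * u)" "u * tau x"] by (simp add: abs_mult)
  also have "\<dots> \<le> 1 + \<bar>u\<bar> * 1"
    by (intro add_mono mult_left_mono abs_tau_le) auto
  also have "\<dots> \<le> 1 + \<bar>u\<bar> + u\<^sup>2" by simp
  finally show ?thesis using x by simp
qed

text \<open>Up to \<open>|y| = 1/2\<close> the truncation is linear at \<open>y\<close> and at
  \<open>2 * y\<close>, so nothing remains. Beyond that, the difference is at most 1 while the
  weight is at least \<open>1/4\<close>.\<close>

lemma tau_double_le: "\<bar>tau (2 * y) - 2 * tau y\<bar> \<le> 4 * wgt y"
proof (cases "\<bar>y\<bar> \<le> 1/2")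
  case True
  then show ?thesis by (auto simp: tau_def)
next
  case False
  have "(1/2)\<^sup>2 \<le> \<bar>y\<bar>\<^sup>2" using False by (intro power_mono) auto
  then have "1 \<le> 4 * wgt y" by (simp add: power2_eq_square)
  moreover have "\<bar>tau (2 * y) - 2 * tau y\<bar> \<le> 1"
  proof (cases "0 < y")
    case True
    then have "tau (2 * y) = 1" "1 / 2 \<le> tau y" "tau y \<le> 1" using False by (auto simp: tau_clamp)
    then show ?thesis by linarith
  next
    case neg: False
    then have "tau (2 * y) = - 1" "tau y \<le> - 1 / 2" "- 1 \<le> tau y" using False by (auto simp: tau_clamp)
    then show ?thesis by linarith
  qed
  ultimately show ?thesis by linarith
qed

lemma wgt_scale_le: "wgt (x * u) \<le> (1 + u\<^sup>2) * wgt x"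
proof (cases "x\<^sup>2 \<le> 1")
  case True
  have "wgt (x * u) \<le> u\<^sup>2 * x\<^sup>2" by (simp add: power_mult_distrib mult.commute)
  also have "\<dots> \<le> (1 + u\<^sup>2) * x\<^sup>2" by (intro mult_right_mono) auto
  finally show ?thesis using True by simp
next
  case False
  then show ?thesis by (simp add: min.coboundedI1)
qed

lemma vpow_abs: "vpow p (x * \<bar>u\<bar>) = vpow p (x * u)"
  by (simp add: vpow_def abs_mult)

lemma vpow_mono:
  assumes "\<bar>x\<bar> \<le> \<bar>y\<bar>" "0 \<le> p"
  shows "vpow p x \<le> vpow p y"
proof -
  consider "\<bar>y\<bar> \<le> 1" | "\<bar>x\<bar> \<le> 1" "\<bar>y\<bar> > 1" | "\<bar>x\<bar> > 1" "\<bar>y\<bar> > 1" using assms by linarith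
  then show ?thesis
  proof cases
    case 1
    then show ?thesis using assms power_mono[OF assms(1), of 2] by (simp add: vpow_def)
  next
    case 2
    have "x\<^sup>2 \<le> 1" using 2 by (simp add: abs_square_le_1)
    also have "1 \<le> \<bar>y\<bar> powr p" using 2 assms by (intro ge_one_powr_ge_zero) auto
    finally show ?thesis using 2 by (simp add: vpow_def)
  next
    case 3
    then show ?thesis using assms by (simp add: vpow_def powr_mono2)
  qed
qed

text \<open>In the quadratic range the factor is 4 and in the power range \<open>2 powr p\<close>.
  In between, for \<open>1/2 < |y| \<le> 1\<close>, doubling crosses from one range into the other,
  and the product of both factors covers this.\<close>

lemma vpow_double:
  assumes "0 \<le> p"
  shows "vpow p (2 * y) \<le> 4 * 2 powr p * vpow p y"
proof -
  have p1: "1 \<le> 2 powr p" using assms by (intro ge_one_powr_ge_zero) auto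
  consider "\<bar>y\<bar> \<le> 1/2" | "1/2 < \<bar>y\<bar>" "\<bar>y\<bar> \<le> 1" | "\<bar>y\<bar> > 1" by linarith
  then show ?thesis
  proof cases
    case 1
    then have "vpow p (2 * y) = 4 * y\<^sup>2" "vpow p y = y\<^sup>2" by (auto simp: vpow_def abs_mult power_mult_distrib)
    then show ?thesis using mult_right_mono[OF p1, of "4 * y\<^sup>2"] by simp
  next
    case 2
    have "(1/2)\<^sup>2 \<le> \<bar>y\<bar>\<^sup>2" using 2 by (intro power_mono) auto
    then have y: "1 \<le> 4 * y\<^sup>2" by (simp add: power2_eq_square)
    have "vpow p (2 * y) = \<bar>2 * y\<bar> powr p" using 2 by (simp add: vpow_def abs_mult)
    also have "\<dots> \<le> 2 powr p" using 2 assms by (intro powr_mono2) (auto simp: abs_mult)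
    also have "\<dots> \<le> 2 powr p * (4 * y\<^sup>2)" using mult_left_mono[OF y, of "2 powr p"] by simp
    also have "\<dots> = 4 * 2 powr p * vpow p y" using 2 by (simp add: vpow_def)
    finally show ?thesis .
  next
    case 3
    have "vpow p (2 * y) = 2 powr p * \<bar>y\<bar> powr p" using 3 by (simp add: vpow_def abs_mult powr_mult)
    also have "\<dots> \<le> 4 * 2 powr p * vpow p y" using 3 by (simp add: vpow_def)
    finally show ?thesis .
  qed
qed

lemma vpow_zero_eq: "vpow 0 x = wgt x"
proof (cases "\<bar>x\<bar> \<le> 1")
  case True
  then have "x\<^sup>2 \<le> 1" by (simp add: abs_square_le_1)
  then show ?thesis using True by (simp add: vpow_def)
next
  case False
  then have "1 < x\<^sup>2" by (simp add: not_le[symmetric] abs_square_le_1)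
  then show ?thesis using False by (auto simp: vpow_def)
qed

lemma norm_qlt_integral_le:
  fixes g :: "real \<Rightarrow> 'b::{banach, second_countable_topology}"
  assumes \<nu>: "quasi_levy_type \<nu>" and g: "g \<in> borel_measurable borel"
  shows "ennreal (norm (qlt_integral \<nu> g)) \<le> (\<integral>\<^sup>+x. ennreal (norm (g x)) \<partial>qlt_abs \<nu>)"
proof -
  \<comment> \<open>A divergent Bochner integral is 0 by default, so the bound holds for every
    \<open>g\<close>.\<close>
  have *: "ennreal (norm (integral\<^sup>L M g)) \<le> (\<integral>\<^sup>+x. ennreal (norm (g x)) \<partial>M)" for M
    by (cases "integrable M g") (auto simp: not_integrable_integral_eq integral_norm_bound_ennreal)
  have "ennreal (norm (qlt_integral \<nu> g)) \<le> ennreal (norm (integral\<^sup>L (qlt_pos \<nu>) g) + norm (integral\<^sup>L (qlt_neg \<nu>) g))"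
    unfolding qlt_integral_def by (intro ennreal_leI norm_triangle_ineq4)
  also have "\<dots> = ennreal (norm (integral\<^sup>L (qlt_pos \<nu>) g)) + ennreal (norm (integral\<^sup>L (qlt_neg \<nu>) g))"
    by simp
  also have "\<dots> \<le> (\<integral>\<^sup>+x. ennreal (norm (g x)) \<partial>qlt_pos \<nu>) + (\<integral>\<^sup>+x. ennreal (norm (g x)) \<partial>qlt_neg \<nu>)"
    by (intro add_mono *)
  also have "\<dots> = (\<integral>\<^sup>+x. ennreal (norm (g x)) \<partial>qlt_abs \<nu>)"
    using g by (intro nn_integral_qlt_abs[symmetric] quasi_levy_type_signed \<nu>) measurable
  finally show ?thesis .
qed

lemma levy_integrable:
  fixes g :: "real \<Rightarrow> 'b::{banach, second_countable_topology}"
  assumes M: "levy_measure M" and g: "g \<in> borel_measurable borel" and le: "\<And>x. norm (g x) \<le> C * wgt x"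
  shows "integrable M g"
proof -
  have s: "sets M = sets borel" using M by (simp add: levy_measure_def)
  note [measurable_cong] = s
  have i: "integrable M wgt"
    using M by (intro integrableI_nonneg) (auto simp: levy_measure_def)
  have gm: "g \<in> borel_measurable M" using g by (simp only: measurable_cong_sets[OF s refl])
  show ?thesis
  proof (rule Bochner_Integration.integrable_bound)
    show "integrable M (\<lambda>x. C * wgt x)" using i by simp
    show "AE x in M. norm (g x) \<le> norm (C * wgt x)" using le by (intro AE_I2) (metis abs_ge_self order_trans real_norm_def)
  qed (rule gm)
qed

section \<open>Growth and doubling of the drift term\<close>

lemma qlt_integral_add:
  fixes g h :: "real \<Rightarrow> 'b::{banach, second_countable_topology}"
  assumes \<nu>: "quasi_levy_type \<nu>" and "g \<in> borel_measurable borel" "\<And>x. norm (g x) \<le> C * wgt x"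
    "h \<in> borel_measurable borel" "\<And>x. norm (h x) \<le> C' * wgt x"
  shows "qlt_integral \<nu> (\<lambda>x. g x + h x) = qlt_integral \<nu> g + qlt_integral \<nu> h"
  using levy_integrable[OF quasi_levy_typeD(1)[OF \<nu>] assms(2,3)] levy_integrable[OF quasi_levy_typeD(1)[OF \<nu>] assms(4,5)]
    levy_integrable[OF quasi_levy_typeD(2)[OF \<nu>] assms(2,3)] levy_integrable[OF quasi_levy_typeD(2)[OF \<nu>] assms(4,5)]
  by (simp add: qlt_integral_def)

text \<open>In \<open>U(2v) - 2 U(v)\<close> the terms linear in \<open>v\<close> cancel, including
  the one with \<open>a\<close>. The integral of \<open>tau (2 * (x * v)) - 2 * tau (x * v)\<close>
  remains, which \<open>tau_double_le\<close> bounds by the weight.\<close>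

lemma U_fun_double:
  assumes \<nu>: "quasi_levy_type (\<rho> s)"
  shows "ennreal \<bar>U_fun a \<rho> (2 * v) s\<bar> \<le> 2 * ennreal \<bar>U_fun a \<rho> v s\<bar> + 4 * (\<integral>\<^sup>+x. ennreal (wgt (x * v)) \<partial>qlt_abs (\<rho> s))"
proof -
  have m: "(\<lambda>x. tau (x * u) - c * tau x) \<in> borel_measurable borel" "(\<lambda>x. tau (2 * (x * u)) - 2 * tau (x * u)) \<in> borel_measurable borel" for u c
    by measurable
  have 1: "qlt_integral (\<rho> s) (\<lambda>x. 2 * (tau (x * v) - v * tau x)) = 2 * qlt_integral (\<rho> s) (\<lambda>x. tau (x * v) - v * tau x)"
    unfolding qlt_integral_def integral_mult_right_zero by (simp only: right_diff_distrib)
  have bd: "norm (tau (2 * (x * v)) - 2 * tau (x * v)) \<le> (4 * (1 + v\<^sup>2)) * wgt x" for x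
  proof -
    have "norm (tau (2 * (x * v)) - 2 * tau (x * v)) \<le> 4 * wgt (x * v)" using tau_double_le[of "x * v"] by simp
    also have "\<dots> \<le> 4 * ((1 + v\<^sup>2) * wgt x)" by (intro mult_left_mono wgt_scale_le) simp
    finally show ?thesis by (simp only: mult.assoc)
  qed
  have "qlt_integral (\<rho> s) (\<lambda>x. tau (x * (2 * v)) - 2 * v * tau x) =
      qlt_integral (\<rho> s) (\<lambda>x. 2 * (tau (x * v) - v * tau x) + (tau (2 * (x * v)) - 2 * tau (x * v)))"
    by (intro arg_cong[of _ _ "qlt_integral (\<rho> s)"]) (auto simp: fun_eq_iff algebra_simps)
  also have "\<dots> = qlt_integral (\<rho> s) (\<lambda>x. 2 * (tau (x * v) - v * tau x)) + qlt_integral (\<rho> s) (\<lambda>x. tau (2 * (x * v)) - 2 * tau (x * v))"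
  proof (rule qlt_integral_add[OF \<nu>])
    show "norm (2 * (tau (x * v) - v * tau x)) \<le> (2 * (1 + \<bar>v\<bar> + v\<^sup>2)) * wgt x" for x
    proof -
      have "norm (2 * (tau (x * v) - v * tau x)) = 2 * \<bar>tau (x * v) - v * tau x\<bar>"
        by (simp only: real_norm_def abs_mult abs_numeral)
      also have "\<dots> \<le> 2 * ((1 + \<bar>v\<bar> + v\<^sup>2) * wgt x)" by (intro mult_left_mono tau_diff_le) simp
      finally show ?thesis by (simp only: mult.assoc)
    qed
    show "norm (tau (2 * (x * v)) - 2 * tau (x * v)) \<le> (4 * (1 + v\<^sup>2)) * wgt x" for x by (rule bd)
  qed measurable
  finally have "U_fun a \<rho> (2 * v) s = 2 * U_fun a \<rho> v s + qlt_integral (\<rho> s) (\<lambda>x. tau (2 * (x * v)) - 2 * tau (x * v))"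
    unfolding U_fun_def 1 by (simp only: distrib_left mult.assoc add.assoc)
  moreover have gen: "x = 2 * y + z \<Longrightarrow> \<bar>x\<bar> \<le> 2 * \<bar>y\<bar> + norm z" for x y z :: real by auto
  ultimately have "ennreal \<bar>U_fun a \<rho> (2 * v) s\<bar> \<le> ennreal (2 * \<bar>U_fun a \<rho> v s\<bar> + norm (qlt_integral (\<rho> s) (\<lambda>x. tau (2 * (x * v)) - 2 * tau (x * v))))"
    using gen by (intro ennreal_leI) blast
  also have "\<dots> = 2 * ennreal \<bar>U_fun a \<rho> v s\<bar> + ennreal (norm (qlt_integral (\<rho> s) (\<lambda>x. tau (2 * (x * v)) - 2 * tau (x * v))))"
    by (simp add: ennreal_mult)
  also have "\<dots> \<le> 2 * ennreal \<bar>U_fun a \<rho> v s\<bar> + (\<integral>\<^sup>+x. ennreal (norm (tau (2 * (x * v)) - 2 * tau (x * v))) \<partial>qlt_abs (\<rho> s))"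
    by (intro add_left_mono norm_qlt_integral_le \<nu>) measurable
  also have "\<dots> \<le> 2 * ennreal \<bar>U_fun a \<rho> v s\<bar> + (\<integral>\<^sup>+x. 4 * ennreal (wgt (x * v)) \<partial>qlt_abs (\<rho> s))"
  proof (intro add_left_mono nn_integral_mono)
    fix x
    have "ennreal (norm (tau (2 * (x * v)) - 2 * tau (x * v))) \<le> ennreal (4 * wgt (x * v))"
      using tau_double_le[of "x * v"] by (intro ennreal_leI) simp
    then show "ennreal (norm (tau (2 * (x * v)) - 2 * tau (x * v))) \<le> 4 * ennreal (wgt (x * v))"
      by (simp add: ennreal_mult)
  qed
  also have "(\<integral>\<^sup>+x. 4 * ennreal (wgt (x * v)) \<partial>qlt_abs (\<rho> s)) = 4 * (\<integral>\<^sup>+x. ennreal (wgt (x * v)) \<partial>qlt_abs (\<rho> s))"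
    by (intro nn_integral_cmult) (simp only: measurable_cong_sets[OF sets_qlt_abs[OF quasi_levy_type_signed[OF \<nu>]] refl], measurable)
  finally show ?thesis .
qed

lemma U_fun_bound:
  assumes \<nu>: "quasi_levy_type (\<rho> s)"
  shows "ennreal \<bar>U_fun a \<rho> u s\<bar> \<le> ennreal (1 + \<bar>u\<bar> + u\<^sup>2) * (ennreal \<bar>a s\<bar> + wint (qlt_abs (\<rho> s)))"
proof -
  have m: "(\<lambda>x. ennreal (wgt x)) \<in> borel_measurable (qlt_abs (\<rho> s))"
    using wgt_measurable by (simp only: measurable_cong_sets[OF sets_qlt_abs[OF quasi_levy_type_signed[OF \<nu>]] refl])
  have "ennreal \<bar>U_fun a \<rho> u s\<bar> \<le> ennreal ((1 + \<bar>u\<bar> + u\<^sup>2) * \<bar>a s\<bar> + norm (qlt_integral (\<rho> s) (\<lambda>x. tau (x * u) - u * tau x)))"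
  proof (rule ennreal_leI)
    have "\<bar>U_fun a \<rho> u s\<bar> \<le> \<bar>u\<bar> * \<bar>a s\<bar> + norm (qlt_integral (\<rho> s) (\<lambda>x. tau (x * u) - u * tau x))"
      unfolding U_fun_def by (metis abs_mult abs_triangle_ineq real_norm_def)
    moreover have "\<bar>u\<bar> * \<bar>a s\<bar> \<le> (1 + \<bar>u\<bar> + u\<^sup>2) * \<bar>a s\<bar>" by (intro mult_right_mono) auto
    ultimately show "\<bar>U_fun a \<rho> u s\<bar> \<le> (1 + \<bar>u\<bar> + u\<^sup>2) * \<bar>a s\<bar> + norm (qlt_integral (\<rho> s) (\<lambda>x. tau (x * u) - u * tau x))"
      by linarith
  qed
  also have "\<dots> = ennreal (1 + \<bar>u\<bar> + u\<^sup>2) * ennreal \<bar>a s\<bar> + ennreal (norm (qlt_integral (\<rho> s) (\<lambda>x. tau (x * u) - u * tau x)))"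
  proof -
    have "ennreal (A * b + c) = ennreal A * ennreal b + ennreal c" if "0 \<le> A" "0 \<le> b" "0 \<le> c" for A b c
      using that by (simp add: ennreal_mult)
    from this[of "1 + \<bar>u\<bar> + u\<^sup>2" "\<bar>a s\<bar>" "norm (qlt_integral (\<rho> s) (\<lambda>x. tau (x * u) - u * tau x))"]
    show ?thesis by (meson abs_ge_zero add_nonneg_nonneg norm_ge_zero zero_le_one zero_le_power2)
  qed
  also have "\<dots> \<le> ennreal (1 + \<bar>u\<bar> + u\<^sup>2) * ennreal \<bar>a s\<bar> + (\<integral>\<^sup>+x. ennreal (norm (tau (x * u) - u * tau x)) \<partial>qlt_abs (\<rho> s))"
    by (intro add_left_mono norm_qlt_integral_le \<nu>) measurable
  also have "\<dots> \<le> ennreal (1 + \<bar>u\<bar> + u\<^sup>2) * ennreal \<bar>a s\<bar> + (\<integral>\<^sup>+x. ennreal (1 + \<bar>u\<bar> + u\<^sup>2) * ennreal (wgt x) \<partial>qlt_abs (\<rho> s))"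
  proof (intro add_left_mono nn_integral_mono)
    fix x
    have "ennreal (norm (tau (x * u) - u * tau x)) \<le> ennreal ((1 + \<bar>u\<bar> + u\<^sup>2) * wgt x)"
      using tau_diff_le[of x u] by (intro ennreal_leI) simp
    also have "\<dots> = ennreal (1 + \<bar>u\<bar> + u\<^sup>2) * ennreal (wgt x)" by (intro ennreal_mult) auto
    finally show "ennreal (norm (tau (x * u) - u * tau x)) \<le> ennreal (1 + \<bar>u\<bar> + u\<^sup>2) * ennreal (wgt x)" .
  qed
  also have "(\<integral>\<^sup>+x. ennreal (1 + \<bar>u\<bar> + u\<^sup>2) * ennreal (wgt x) \<partial>qlt_abs (\<rho> s)) = ennreal (1 + \<bar>u\<bar> + u\<^sup>2) * wint (qlt_abs (\<rho> s))"
    by (intro nn_integral_cmult m)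
  finally show ?thesis by (simp only: distrib_left)
qed

lemma V_fun_vpow: "V_fun \<rho> p u s = (\<integral>\<^sup>+x. ennreal (vpow p (x * u)) \<partial>qlt_abs (\<rho> s))"
  by (simp add: V_fun_def vpow_def)

section \<open>Monotonicity, doubling and continuity of the modular density\<close>

lemma V_fun_mono: "\<bar>u\<bar> \<le> \<bar>v\<bar> \<Longrightarrow> 0 \<le> p \<Longrightarrow> V_fun \<rho> p u s \<le> V_fun \<rho> p v s"
  unfolding V_fun_vpow by (intro nn_integral_mono ennreal_leI vpow_mono) (auto simp: abs_mult mult_left_mono)

lemma wgt_le_V_fun: "0 \<le> p \<Longrightarrow> (\<integral>\<^sup>+x. ennreal (wgt (x * u)) \<partial>qlt_abs (\<rho> s)) \<le> V_fun \<rho> p u s"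
  unfolding V_fun_vpow by (intro nn_integral_mono ennreal_leI wgt_le_vpow)

text \<open>The drift term of \<open>Phi_fun\<close>. The supremum over \<open>|c| \<le> 1\<close>
  makes it monotone in the modulus of \<open>u\<close>, which \<open>U_fun\<close> itself need not
  be because of its sign changes.\<close>

definition U_sup :: "('s \<Rightarrow> real) \<Rightarrow> ('s \<Rightarrow> real set \<Rightarrow> real) \<Rightarrow> real \<Rightarrow> 's \<Rightarrow> ennreal" where
  "U_sup a \<rho> u s = (SUP c\<in>{-1..1}. ennreal \<bar>U_fun a \<rho> (c * u) s\<bar>)"

lemma Phi_fun_eq: "Phi_fun a \<sigma> \<rho> p u s = U_sup a \<rho> u s + ennreal (u\<^sup>2 * \<sigma> s) + V_fun \<rho> p u s"
  by (simp add: Phi_fun_def U_sup_def)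

lemma U_sup_mono:
  assumes "0 \<le> u" "u \<le> v"
  shows "U_sup a \<rho> u s \<le> U_sup a \<rho> v s"
  unfolding U_sup_def
proof (rule SUP_least)
  fix c :: real assume c: "c \<in> {-1..1}"
  \<comment> \<open>The point \<open>c * u\<close> is reached from \<open>v\<close> by the smaller
    factor \<open>c * u / v\<close>; for \<open>v = 0\<close> both points are 0.\<close>
  define d where "d = (if v = 0 then 0 else c * u / v)"
  have "\<bar>c * u\<bar> \<le> 1 * v" unfolding abs_mult using c assms by (intro mult_mono) auto
  then have d: "d \<in> {-1..1}" "d * v = c * u" using assms by (auto simp: d_def abs_le_iff field_simps)
  show "ennreal \<bar>U_fun a \<rho> (c * u) s\<bar> \<le> (SUP c\<in>{-1..1}. ennreal \<bar>U_fun a \<rho> (c * v) s\<bar>)"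
    using d by (intro SUP_upper2[of d]) auto
qed

lemma Phi_fun_mono:
  assumes "0 \<le> u" "u \<le> v" "0 \<le> p" "0 \<le> \<sigma> s"
  shows "Phi_fun a \<sigma> \<rho> p u s \<le> Phi_fun a \<sigma> \<rho> p v s"
  unfolding Phi_fun_eq using assms
  by (intro add_mono U_sup_mono V_fun_mono ennreal_leI mult_right_mono power_mono) auto

text \<open>The doubling property stands in for subadditivity of the modular. Doubling the drift
  costs a factor 2 and a further \<open>4 * V_fun\<close>, the variance costs 4, and
  \<open>V_fun\<close> itself costs \<open>4 * 2 powr p\<close>.\<close>

lemma Phi_fun_double:
  assumes \<nu>: "quasi_levy_type (\<rho> s)" and p: "0 \<le> p" and \<sigma>: "0 \<le> \<sigma> s"
  shows "Phi_fun a \<sigma> \<rho> p (2 * u) s \<le> ennreal (8 * 2 powr p) * Phi_fun a \<sigma> \<rho> p u s"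
proof -
  have p1: "1 \<le> 2 powr p" using p by (intro ge_one_powr_ge_zero) auto
  have sa: "sets (qlt_abs (\<rho> s)) = sets borel" by (rule sets_qlt_abs[OF quasi_levy_type_signed[OF \<nu>]])
  have U: "U_sup a \<rho> (2 * u) s \<le> 2 * U_sup a \<rho> u s + 4 * V_fun \<rho> p u s"
    unfolding U_sup_def
  proof (rule SUP_least)
    fix c :: real assume c: "c \<in> {-1..1}"
    have "ennreal \<bar>U_fun a \<rho> (c * (2 * u)) s\<bar> \<le> 2 * ennreal \<bar>U_fun a \<rho> (c * u) s\<bar> + 4 * (\<integral>\<^sup>+x. ennreal (wgt (x * (c * u))) \<partial>qlt_abs (\<rho> s))"
      using U_fun_double[where \<rho>=\<rho> and s=s and a=a and v="c * u", OF \<nu>] by (simp add: mult.left_commute)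
    also have "\<dots> \<le> 2 * (SUP c\<in>{-1..1}. ennreal \<bar>U_fun a \<rho> (c * u) s\<bar>) + 4 * V_fun \<rho> p (c * u) s"
      by (intro add_mono mult_left_mono SUP_upper c wgt_le_V_fun p) auto
    also have "\<dots> \<le> 2 * (SUP c\<in>{-1..1}. ennreal \<bar>U_fun a \<rho> (c * u) s\<bar>) + 4 * V_fun \<rho> p u s"
    proof (intro add_left_mono mult_left_mono V_fun_mono p)
      have "\<bar>c\<bar> * \<bar>u\<bar> \<le> 1 * \<bar>u\<bar>" using c by (intro mult_right_mono) auto
      then show "\<bar>c * u\<bar> \<le> \<bar>u\<bar>" by (simp add: abs_mult)
    qed simp
    finally show "ennreal \<bar>U_fun a \<rho> (c * (2 * u)) s\<bar> \<le> 2 * (SUP c\<in>{-1..1}. ennreal \<bar>U_fun a \<rho> (c * u) s\<bar>) + 4 * V_fun \<rho> p u s" .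
  qed
  have V: "V_fun \<rho> p (2 * u) s \<le> ennreal (4 * 2 powr p) * V_fun \<rho> p u s"
  proof -
    have "V_fun \<rho> p (2 * u) s \<le> (\<integral>\<^sup>+x. ennreal (4 * 2 powr p) * ennreal (vpow p (x * u)) \<partial>qlt_abs (\<rho> s))"
      unfolding V_fun_vpow
    proof (rule nn_integral_mono)
      fix x
      have "ennreal (vpow p (x * (2 * u))) \<le> ennreal (4 * 2 powr p * vpow p (x * u))"
        using vpow_double[OF p, of "x * u"] by (intro ennreal_leI) (simp add: mult.left_commute)
      also have "\<dots> = ennreal (4 * 2 powr p) * ennreal (vpow p (x * u))"
        using vpow_nonneg by (intro ennreal_mult) auto
      finally show "ennreal (vpow p (x * (2 * u))) \<le> ennreal (4 * 2 powr p) * ennreal (vpow p (x * u))" .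
    qed
    also have "\<dots> = ennreal (4 * 2 powr p) * V_fun \<rho> p u s"
      unfolding V_fun_vpow by (intro nn_integral_cmult) (simp only: measurable_cong_sets[OF sa refl], measurable)
    finally show ?thesis .
  qed
  let ?C = "ennreal (8 * 2 powr p)"
  \<comment> \<open>Since \<open>2 powr p \<ge> 1\<close>, the constant \<open>8 * 2 powr p\<close>
    dominates \<open>4 + 4 * 2 powr p\<close>, the total coefficient of
    \<open>V_fun\<close>.\<close>
  have c: "(2::ennreal) \<le> ?C" "(4::ennreal) \<le> ?C" "(4::ennreal) + ennreal (4 * 2 powr p) \<le> ?C"
  proof -
    have "ennreal 2 \<le> ?C" "ennreal 4 \<le> ?C" "ennreal (4 + 4 * 2 powr p) \<le> ?C"
      using p1 by (intro ennreal_leI; linarith)+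
    then show "(2::ennreal) \<le> ?C" "(4::ennreal) \<le> ?C" "(4::ennreal) + ennreal (4 * 2 powr p) \<le> ?C"
      by (simp_all add: ennreal_plus)
  qed
  have "Phi_fun a \<sigma> \<rho> p (2 * u) s \<le> (2 * U_sup a \<rho> u s + 4 * V_fun \<rho> p u s) + 4 * ennreal (u\<^sup>2 * \<sigma> s) + ennreal (4 * 2 powr p) * V_fun \<rho> p u s"
  proof -
    have "ennreal ((2 * u)\<^sup>2 * \<sigma> s) = 4 * ennreal (u\<^sup>2 * \<sigma> s)"
      using \<sigma> by (simp add: power_mult_distrib ennreal_mult mult.assoc)
    then show ?thesis unfolding Phi_fun_eq by (intro add_mono U V) simp
  qed
  also have "\<dots> = 2 * U_sup a \<rho> u s + 4 * ennreal (u\<^sup>2 * \<sigma> s) + (4 + ennreal (4 * 2 powr p)) * V_fun \<rho> p u s"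
    by (simp only: distrib_left distrib_right ac_simps)
  also have "\<dots> \<le> ?C * U_sup a \<rho> u s + ?C * ennreal (u\<^sup>2 * \<sigma> s) + ?C * V_fun \<rho> p u s"
    by (intro add_mono mult_right_mono c) auto
  also have "\<dots> = ?C * Phi_fun a \<sigma> \<rho> p u s"
    unfolding Phi_fun_eq by (simp add: distrib_left)
  finally show ?thesis .
qed

lemma Phi_fun_add:
  assumes \<nu>: "quasi_levy_type (\<rho> s)" and p: "0 \<le> p" and \<sigma>: "0 \<le> \<sigma> s"
  shows "Phi_fun a \<sigma> \<rho> p \<bar>u + v\<bar> s \<le> ennreal (8 * 2 powr p) * (Phi_fun a \<sigma> \<rho> p \<bar>u\<bar> s + Phi_fun a \<sigma> \<rho> p \<bar>v\<bar> s)"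
proof -
  have "Phi_fun a \<sigma> \<rho> p \<bar>u + v\<bar> s \<le> Phi_fun a \<sigma> \<rho> p (2 * max \<bar>u\<bar> \<bar>v\<bar>) s"
    by (intro Phi_fun_mono p \<sigma>) auto
  also have "\<dots> \<le> ennreal (8 * 2 powr p) * Phi_fun a \<sigma> \<rho> p (max \<bar>u\<bar> \<bar>v\<bar>) s"
    by (rule Phi_fun_double[where \<rho>=\<rho> and s=s and \<sigma>=\<sigma>, OF \<nu> p \<sigma>])
  also have "\<dots> \<le> ennreal (8 * 2 powr p) * (Phi_fun a \<sigma> \<rho> p \<bar>u\<bar> s + Phi_fun a \<sigma> \<rho> p \<bar>v\<bar> s)"
    by (intro mult_left_mono) (auto simp: max_def add_increasing add_increasing2)
  finally show ?thesis .
qed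

lemma Phi_fun_power:
  assumes \<nu>: "quasi_levy_type (\<rho> s)" and p: "0 \<le> p" and \<sigma>: "0 \<le> \<sigma> s"
  shows "Phi_fun a \<sigma> \<rho> p (2 ^ n * u) s \<le> ennreal ((8 * 2 powr p) ^ n) * Phi_fun a \<sigma> \<rho> p u s"
proof (induction n)
  case 0
  show ?case by simp
next
  case (Suc n)
  have "Phi_fun a \<sigma> \<rho> p (2 ^ Suc n * u) s \<le> ennreal (8 * 2 powr p) * Phi_fun a \<sigma> \<rho> p (2 ^ n * u) s"
    using Phi_fun_double[where \<rho>=\<rho> and s=s and \<sigma>=\<sigma> and u="2 ^ n * u" and a=a, OF \<nu> p \<sigma>]
    by (simp add: mult.assoc)
  also have "\<dots> \<le> ennreal (8 * 2 powr p) * (ennreal ((8 * 2 powr p) ^ n) * Phi_fun a \<sigma> \<rho> p u s)"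
    by (intro mult_left_mono Suc) simp
  also have "\<dots> = ennreal ((8 * 2 powr p) ^ Suc n) * Phi_fun a \<sigma> \<rho> p u s"
    by (simp add: ennreal_mult mult.assoc)
  finally show ?case .
qed

lemma Phi_fun_scale:
  assumes \<nu>: "quasi_levy_type (\<rho> s)" and p: "0 \<le> p" and \<sigma>: "0 \<le> \<sigma> s" and n: "\<bar>c\<bar> \<le> 2 ^ n"
  shows "Phi_fun a \<sigma> \<rho> p \<bar>c * u\<bar> s \<le> ennreal ((8 * 2 powr p) ^ n) * Phi_fun a \<sigma> \<rho> p \<bar>u\<bar> s"
proof -
  have "\<bar>c * u\<bar> \<le> 2 ^ n * \<bar>u\<bar>" unfolding abs_mult using n by (intro mult_right_mono) auto
  then have "Phi_fun a \<sigma> \<rho> p \<bar>c * u\<bar> s \<le> Phi_fun a \<sigma> \<rho> p (2 ^ n * \<bar>u\<bar>) s"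
    by (intro Phi_fun_mono p \<sigma>) auto
  also note Phi_fun_power[where \<rho>=\<rho> and s=s and \<sigma>=\<sigma>, OF \<nu> p \<sigma>]
  finally show ?thesis .
qed

text \<open>Dominated convergence, with \<open>tau_diff_le\<close> as domination. Continuity serves
  twice: it reduces the supremum in \<open>U_sup\<close> to a countable one for measurability, and
  it makes \<open>U_sup\<close> vanish as \<open>u\<close> tends to 0.\<close>

lemma isCont_U_fun:
  assumes \<nu>: "quasi_levy_type (\<rho> s)"
  shows "isCont (\<lambda>u. U_fun a \<rho> u s) u"
proof -
  have I: "isCont (\<lambda>u. LINT x|M. tau (x * u) - u * tau x) u" if M: "levy_measure M" for M
    unfolding continuous_at_sequentially comp_def
  proof (intro allI impI)
    fix v assume v: "v \<longlonglongrightarrow> u"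
    have s: "sets M = sets borel" using M by (simp add: levy_measure_def)
    note [measurable_cong] = s
    have i: "integrable M wgt"
      using M by (intro integrableI_nonneg) (auto simp: levy_measure_def)
    obtain B where B: "\<And>n. \<bar>v n\<bar> \<le> B" using convergent_imp_Bseq[of v] v by (auto simp: convergent_def Bseq_def)
    show "(\<lambda>n. LINT x|M. tau (x * v n) - v n * tau x) \<longlonglongrightarrow> (LINT x|M. tau (x * u) - u * tau x)"
    proof (rule integral_dominated_convergence)
      show "integrable M (\<lambda>x. (1 + B + B\<^sup>2) * wgt x)" using i by simp
      show "AE x in M. (\<lambda>n. tau (x * v n) - v n * tau x) \<longlonglongrightarrow> tau (x * u) - u * tau x"
        unfolding tau_clamp by (intro AE_I2 tendsto_intros v)
      show "AE x in M. norm (tau (x * v n) - v n * tau x) \<le> (1 + B + B\<^sup>2) * wgt x" for n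
      proof (intro AE_I2)
        fix x
        have "norm (tau (x * v n) - v n * tau x) \<le> (1 + \<bar>v n\<bar> + (v n)\<^sup>2) * wgt x" using tau_diff_le by simp
        also have "\<dots> \<le> (1 + B + B\<^sup>2) * wgt x"
          using B[of n] power_mono[OF B[of n], of 2] by (intro mult_right_mono add_mono) auto
        finally show "norm (tau (x * v n) - v n * tau x) \<le> (1 + B + B\<^sup>2) * wgt x" .
      qed
    qed measurable
  qed
  show ?thesis
    unfolding U_fun_def qlt_integral_def
    by (intro continuous_intros I quasi_levy_typeD[OF \<nu>])
qed

lemma U_fun_zero: "U_fun a \<rho> 0 s = 0"
  by (simp add: U_fun_def qlt_integral_def tau_def)

lemma Phi_fun_zero: "Phi_fun a \<sigma> \<rho> p 0 s = 0"
  by (simp add: Phi_fun_eq U_sup_def U_fun_zero V_fun_vpow vpow_def)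

text \<open>The drift vanishes by continuity at 0, uniformly over the factors \<open>c\<close>. For
  \<open>V_fun\<close> the finite value at \<open>v\<close> supplies the integrable
  domination.\<close>

lemma Phi_fun_tendsto_0:
  assumes \<nu>: "quasi_levy_type (\<rho> s)" and p: "0 \<le> p" and \<sigma>: "0 \<le> \<sigma> s"
    and u: "u \<longlonglongrightarrow> 0" "\<And>n. \<bar>u n\<bar> \<le> v" and fin: "Phi_fun a \<sigma> \<rho> p v s < \<infinity>"
  shows "(\<lambda>n. Phi_fun a \<sigma> \<rho> p \<bar>u n\<bar> s) \<longlonglongrightarrow> 0"
proof -
  have sa: "sets (qlt_abs (\<rho> s)) = sets borel" by (rule sets_qlt_abs[OF quasi_levy_type_signed[OF \<nu>]])
  note [measurable_cong] = sa
  have v0: "0 \<le> v" using u(2)[of 0] by linarith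
  have U: "(\<lambda>n. U_sup a \<rho> \<bar>u n\<bar> s) \<longlonglongrightarrow> 0"
  proof (rule order_tendstoI)
    fix e :: ennreal assume "0 < e"
    then obtain r where r: "0 < r" "ennreal r < e"
      by (metis dense ennreal_cases less_top not_less_zero top_neq_ennreal order.strict_trans2 le_less ennreal_less_zero_iff)
    have "isCont (\<lambda>u. U_fun a \<rho> u s) 0" by (rule isCont_U_fun[where \<rho>=\<rho> and s=s, OF \<nu>])
    then obtain d where d: "d > 0" "\<And>y. \<bar>y\<bar> < d \<Longrightarrow> \<bar>U_fun a \<rho> y s\<bar> < r"
      using r(1) by (auto simp: continuous_at_eps_delta dist_real_def U_fun_zero)
    have "eventually (\<lambda>n. \<bar>u n\<bar> < d) sequentially"
      using tendstoD[OF u(1) d(1)] by (simp add: dist_real_def)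
    then show "eventually (\<lambda>n. U_sup a \<rho> \<bar>u n\<bar> s < e) sequentially"
    proof eventually_elim
      case (elim n)
      have "U_sup a \<rho> \<bar>u n\<bar> s \<le> ennreal r"
        unfolding U_sup_def
      proof (rule SUP_least, rule ennreal_leI, rule less_imp_le, rule d(2))
        fix c :: real assume "c \<in> {-1..1}"
        then have "\<bar>c\<bar> * \<bar>u n\<bar> \<le> 1 * \<bar>u n\<bar>" by (intro mult_right_mono) auto
        then show "\<bar>c * \<bar>u n\<bar>\<bar> < d" using elim by (simp add: abs_mult)
      qed
      then show ?case using r(2) by (rule le_less_trans)
    qed
  qed auto
  have "(\<lambda>n. ennreal (\<bar>u n\<bar>\<^sup>2 * \<sigma> s)) \<longlonglongrightarrow> ennreal (\<bar>0\<bar>\<^sup>2 * \<sigma> s)"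
    by (intro tendsto_ennrealI tendsto_intros u)
  then have S: "(\<lambda>n. ennreal (\<bar>u n\<bar>\<^sup>2 * \<sigma> s)) \<longlonglongrightarrow> 0" by simp
  have V: "(\<lambda>n. V_fun \<rho> p \<bar>u n\<bar> s) \<longlonglongrightarrow> 0"
  proof -
    have "(\<lambda>n. \<integral>\<^sup>+x. ennreal (vpow p (x * \<bar>u n\<bar>)) \<partial>qlt_abs (\<rho> s)) \<longlonglongrightarrow> (\<integral>\<^sup>+x. 0 \<partial>qlt_abs (\<rho> s))"
    proof (rule nn_integral_dominated_convergence[where w = "\<lambda>x. ennreal (vpow p (x * v))"])
      show "(\<integral>\<^sup>+x. ennreal (vpow p (x * v)) \<partial>qlt_abs (\<rho> s)) < \<infinity>"
        using fin by (simp add: Phi_fun_eq V_fun_vpow less_top)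
      show "AE x in qlt_abs (\<rho> s). ennreal (vpow p (x * \<bar>u n\<bar>)) \<le> ennreal (vpow p (x * v))" for n
        using u(2)[of n] v0 p by (intro AE_I2 ennreal_leI vpow_mono) (auto simp: abs_mult mult_left_mono)
      show "AE x in qlt_abs (\<rho> s). (\<lambda>n. ennreal (vpow p (x * \<bar>u n\<bar>))) \<longlonglongrightarrow> 0"
      proof (intro AE_I2)
        fix x
        have "(\<lambda>n. \<bar>x * \<bar>u n\<bar>\<bar>) \<longlonglongrightarrow> \<bar>x * \<bar>0\<bar>\<bar>" by (intro tendsto_intros u)
        then have t: "(\<lambda>n. \<bar>x * \<bar>u n\<bar>\<bar>) \<longlonglongrightarrow> 0" by simp
        then have "eventually (\<lambda>n. \<bar>x * \<bar>u n\<bar>\<bar> < 1) sequentially" by (rule order_tendstoD) simp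
        then have "eventually (\<lambda>n. ennreal (\<bar>x * \<bar>u n\<bar>\<bar>\<^sup>2) = ennreal (vpow p (x * \<bar>u n\<bar>))) sequentially"
          by eventually_elim (simp add: vpow_def)
        moreover have "(\<lambda>n. ennreal (\<bar>x * \<bar>u n\<bar>\<bar>\<^sup>2)) \<longlonglongrightarrow> ennreal (0\<^sup>2)"
          by (intro tendsto_ennrealI tendsto_power t)
        ultimately show "(\<lambda>n. ennreal (vpow p (x * \<bar>u n\<bar>))) \<longlonglongrightarrow> 0"
          by (simp add: Lim_transform_eventually)
      qed
    qed measurable
    then show ?thesis by (simp add: V_fun_vpow)
  qed
  have "(\<lambda>n. U_sup a \<rho> \<bar>u n\<bar> s + ennreal (\<bar>u n\<bar>\<^sup>2 * \<sigma> s) + V_fun \<rho> p \<bar>u n\<bar> s) \<longlonglongrightarrow> 0 + 0 + 0"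
    by (intro tendsto_add U S V)
  then show ?thesis by (simp add: Phi_fun_eq)
qed

text \<open>With exponent 0 the jump term integrates only the weight of \<open>x * u\<close>, which
  grows at most quadratically in \<open>u\<close>. The density is thus finite at every point and, as
  the right side shows, integrable over the sets of \<open>R\<close>.\<close>

lemma Phi_fun_zero_exponent_bound:
  assumes \<nu>: "quasi_levy_type (\<rho> s)" and \<sigma>: "0 \<le> \<sigma> s" and u: "0 \<le> u"
  shows "Phi_fun a \<sigma> \<rho> 0 u s \<le> ennreal (2 + u + 2 * u\<^sup>2) *
    (ennreal \<bar>a s\<bar> + ennreal (\<sigma> s) + wint (qlt_abs (\<rho> s)))"
proof -
  let ?W = "\<integral>\<^sup>+x. ennreal (wgt x) \<partial>qlt_abs (\<rho> s)"
  have sa: "sets (qlt_abs (\<rho> s)) = sets borel" by (rule sets_qlt_abs[OF quasi_levy_type_signed[OF \<nu>]])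
  have U: "U_sup a \<rho> u s \<le> ennreal (1 + u + u\<^sup>2) * (ennreal \<bar>a s\<bar> + ?W)"
    unfolding U_sup_def
  proof (rule SUP_least)
    fix c :: real assume c: "c \<in> {-1..1}"
    have "\<bar>c\<bar> * \<bar>u\<bar> \<le> 1 * \<bar>u\<bar>" using c by (intro mult_right_mono) auto
    then have cu: "\<bar>c * u\<bar> \<le> u" using u by (simp add: abs_mult)
    have "ennreal \<bar>U_fun a \<rho> (c * u) s\<bar> \<le> ennreal (1 + \<bar>c * u\<bar> + (c * u)\<^sup>2) * (ennreal \<bar>a s\<bar> + ?W)"
      by (rule U_fun_bound[where \<rho>=\<rho> and s=s, OF \<nu>])
    also have "\<dots> \<le> ennreal (1 + u + u\<^sup>2) * (ennreal \<bar>a s\<bar> + ?W)"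
      using cu power_mono[OF cu, of 2] by (intro mult_right_mono ennreal_leI add_mono) auto
    finally show "ennreal \<bar>U_fun a \<rho> (c * u) s\<bar> \<le> ennreal (1 + u + u\<^sup>2) * (ennreal \<bar>a s\<bar> + ?W)" .
  qed
  have V: "V_fun \<rho> 0 u s \<le> ennreal (1 + u\<^sup>2) * ?W"
  proof -
    have "V_fun \<rho> 0 u s \<le> (\<integral>\<^sup>+x. ennreal (1 + u\<^sup>2) * ennreal (wgt x) \<partial>qlt_abs (\<rho> s))"
      unfolding V_fun_vpow vpow_zero_eq
    proof (rule nn_integral_mono)
      fix x
      have "ennreal (wgt (x * u)) \<le> ennreal ((1 + u\<^sup>2) * wgt x)" by (intro ennreal_leI wgt_scale_le)
      also have "\<dots> = ennreal (1 + u\<^sup>2) * ennreal (wgt x)" by (intro ennreal_mult) auto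
      finally show "ennreal (wgt (x * u)) \<le> ennreal (1 + u\<^sup>2) * ennreal (wgt x)" .
    qed
    also have "\<dots> = ennreal (1 + u\<^sup>2) * ?W"
      using wgt_measurable by (intro nn_integral_cmult) (simp only: measurable_cong_sets[OF sa refl])
    finally show ?thesis .
  qed
  have "Phi_fun a \<sigma> \<rho> 0 u s \<le> ennreal (1 + u + u\<^sup>2) * (ennreal \<bar>a s\<bar> + ?W) + ennreal (u\<^sup>2) * ennreal (\<sigma> s) + ennreal (1 + u\<^sup>2) * ?W"
    unfolding Phi_fun_eq using \<sigma> by (intro add_mono U V) (simp add: ennreal_mult)
  also have "\<dots> = ennreal (1 + u + u\<^sup>2) * ennreal \<bar>a s\<bar> + ennreal (u\<^sup>2) * ennreal (\<sigma> s) + (ennreal (1 + u + u\<^sup>2) + ennreal (1 + u\<^sup>2)) * ?W"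
    by (simp only: distrib_left distrib_right ac_simps)
  also have "ennreal (1 + u + u\<^sup>2) + ennreal (1 + u\<^sup>2) = ennreal (2 + u + 2 * u\<^sup>2)"
    using u by (subst ennreal_plus[symmetric]) auto
  also have "ennreal (1 + u + u\<^sup>2) * ennreal \<bar>a s\<bar> + ennreal (u\<^sup>2) * ennreal (\<sigma> s) + ennreal (2 + u + 2 * u\<^sup>2) * ?W
     \<le> ennreal (2 + u + 2 * u\<^sup>2) * ennreal \<bar>a s\<bar> + ennreal (2 + u + 2 * u\<^sup>2) * ennreal (\<sigma> s) + ennreal (2 + u + 2 * u\<^sup>2) * ?W"
    using u by (intro add_mono mult_right_mono ennreal_leI) auto
  finally show ?thesis by (simp only: distrib_left)
qed

section \<open>Characteristic functions of integrals of simple functions\<close>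

lemma lk_zero [simp]: "lk \<theta> 0 = 0"
  by (simp add: lk_def tau_def)

lemma levy_kernel_integral_measurable:
  fixes h :: "'s \<Rightarrow> real \<Rightarrow> real"
  assumes \<kappa>: "levy_kernel M \<kappa>" and h [measurable]: "(\<lambda>(s, x). h s x) \<in> borel_measurable (M \<Otimes>\<^sub>M borel)"
  shows "(\<lambda>s. LINT x|\<kappa> s. h s x) \<in> borel_measurable M"
proof -
  have "(LINT x|\<kappa> s. h s x) = (if (\<integral>\<^sup>+x. ennreal \<bar>h s x\<bar> \<partial>\<kappa> s) < \<infinity>
      then enn2real (\<integral>\<^sup>+x. ennreal (h s x) \<partial>\<kappa> s) - enn2real (\<integral>\<^sup>+x. ennreal (- h s x) \<partial>\<kappa> s) else 0)"
    if s: "s \<in> space M" for s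
  proof -
    note [measurable_cong] = levy_kernel_sets[OF \<kappa> s]
    have [measurable]: "h s \<in> borel_measurable borel"
      using measurable_compose[OF measurable_Pair1'[OF s] h] by simp
    have "(\<integral>\<^sup>+x. ennreal \<bar>h s x\<bar> \<partial>\<kappa> s) < \<infinity> \<longleftrightarrow> integrable (\<kappa> s) (h s)"
      by (simp add: integrable_iff_bounded)
    then show ?thesis by (auto simp: real_lebesgue_integral_def not_integrable_integral_eq)
  qed
  moreover have "(\<lambda>s. if (\<integral>\<^sup>+x. ennreal \<bar>h s x\<bar> \<partial>\<kappa> s) < \<infinity>
      then enn2real (\<integral>\<^sup>+x. ennreal (h s x) \<partial>\<kappa> s) - enn2real (\<integral>\<^sup>+x. ennreal (- h s x) \<partial>\<kappa> s) else 0) \<in> borel_measurable M"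
  proof -
    have [measurable]: "(\<lambda>s. \<integral>\<^sup>+x. ennreal \<bar>h s x\<bar> \<partial>\<kappa> s) \<in> borel_measurable M"
      "(\<lambda>s. \<integral>\<^sup>+x. ennreal (h s x) \<partial>\<kappa> s) \<in> borel_measurable M"
      "(\<lambda>s. \<integral>\<^sup>+x. ennreal (- h s x) \<partial>\<kappa> s) \<in> borel_measurable M"
      by (intro nn_integral_levy_kernel[OF \<kappa>]; measurable)+
    show ?thesis by measurable
  qed
  ultimately show ?thesis by (subst measurable_cong) auto
qed

text \<open>The interval is parametrised by the whole line through \<open>tau\<close>, which fixes
  its points; density of the rationals in the line then gives a countable supremum.\<close>

lemma SUP_clamp_rational:
  fixes g :: "real \<Rightarrow> real"
  assumes g: "continuous_on UNIV g"
  shows "(SUP c\<in>{-1..1}. ennreal \<bar>g c\<bar>) = (SUP q\<in>\<rat>. ennreal \<bar>g (tau q)\<bar>)"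
proof (rule antisym)
  have t: "tau q \<in> {-1..1}" for q by (auto simp: tau_clamp)
  show "(SUP q\<in>\<rat>. ennreal \<bar>g (tau q)\<bar>) \<le> (SUP c\<in>{-1..1}. ennreal \<bar>g c\<bar>)"
    by (intro SUP_least SUP_upper t)
  let ?M = "SUP q\<in>\<rat>. ennreal \<bar>g (tau q)\<bar>"
  have ct: "continuous_on UNIV tau" unfolding tau_clamp[abs_def] by (intro continuous_intros)
  have "continuous_on UNIV (\<lambda>q. ennreal \<bar>g (tau q)\<bar>)"
    by (intro continuous_on_ennreal continuous_intros continuous_on_compose2[OF g ct]) auto
  then have "closed {q. ennreal \<bar>g (tau q)\<bar> \<le> ?M}"
    by (intro closed_Collect_le continuous_on_const)
  moreover have "\<rat> \<subseteq> {q. ennreal \<bar>g (tau q)\<bar> \<le> ?M}" by (auto intro: SUP_upper)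
  ultimately have "closure \<rat> \<subseteq> {q. ennreal \<bar>g (tau q)\<bar> \<le> ?M}" by (rule closure_minimal[rotated])
  moreover have "closure (\<rat> :: real set) = UNIV" by (rule Rats_closure_real)
  ultimately have all: "ennreal \<bar>g (tau q)\<bar> \<le> ?M" for q by blast
  show "(SUP c\<in>{-1..1}. ennreal \<bar>g c\<bar>) \<le> ?M"
  proof (rule SUP_least)
    fix c :: real assume "c \<in> {-1..1}"
    then have "tau c = c" by (auto simp: tau_clamp)
    then show "ennreal \<bar>g c\<bar> \<le> ?M" using all[of c] by simp
  qed
qed

section \<open>Characteristic exponents in the common core\<close>

context qid_core
begin

abbreviation "sint \<equiv> simple_integral_rm \<Lambda>"
abbreviation "Phi \<equiv> Phi_fun a \<sigma>2 \<rho>"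
abbreviation "LPhi \<equiv> L_Phi lam a \<sigma>2 \<rho>"
abbreviation "normPhi \<equiv> norm_Phi lam a \<sigma>2 \<rho>"
abbreviation "approx \<equiv> approximates_rm P R \<Lambda> lam"
abbreviation "integrable_Lam \<equiv> integrable_rm P R \<Lambda> lam"
abbreviation "image_pos \<equiv> kernel_image lam (\<lambda>s. qlt_pos (\<rho> s))"
abbreviation "image_neg \<equiv> kernel_image lam (\<lambda>s. qlt_neg (\<rho> s))"

lemmas space_lam = qid_characteristics_space(1)[OF chars]
  and R_sets = qid_characteristics_space(2)[OF chars]
  and S_sets = qid_characteristics_space(3)[OF chars]

lemma qlt_space: "s \<in> space lam \<Longrightarrow> quasi_levy_type (\<rho> s)"
  using qlt space_lam by simp

lemma prob_P: "prob_space P"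
  using chars by (simp add: qid_characteristics_def qid_random_measure_def)

sublocale P: prob_space P by (rule prob_P)

lemma a_measurable [measurable]: "a \<in> borel_measurable lam"
  and sigma2_measurable [measurable]: "\<sigma>2 \<in> borel_measurable lam"
  and sigma2_nonneg: "s \<in> space lam \<Longrightarrow> 0 \<le> \<sigma>2 s"
  using chars space_lam by (auto simp: qid_characteristics_def)

lemma ring_R: "ring_of_sets S R"
  and Lam_measurable: "A \<in> R \<Longrightarrow> \<Lambda> A \<in> borel_measurable P"
  and R_Inter: "\<And>A :: nat \<Rightarrow> 's set. range A \<subseteq> R \<Longrightarrow> (\<Inter>n. A n) \<in> R"
  using chars by (auto simp: qid_characteristics_def qid_random_measure_def delta_ring_def)

text \<open>Sets of the generated sigma-algebra need not lie in \<open>R\<close>, but their traces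
  on a member of \<open>R\<close> do. This makes the integral of a simple function over any such set
  an integral of another simple function.\<close>

lemma sets_Int_R:
  assumes A: "A \<in> sets lam" and B: "B \<in> R"
  shows "A \<inter> B \<in> R"
proof -
  interpret ring_of_sets S R by (rule ring_R)
  have "A \<in> sigma_sets S R" using A chars by (simp add: qid_characteristics_def)
  then show ?thesis
  proof induction
    case (Basic A)
    then show ?case using B by blast
  next
    case Empty
    then show ?case by simp
  next
    case (Compl A)
    have "(S - A) \<inter> B = B - A \<inter> B" using sets_into_space[OF B] by blast
    then show ?case using Diff[OF B Compl.IH] by simp
  next
    case (Union A)
    \<comment> \<open>Inside \<open>B\<close> a countable union is the complement of a countable
      intersection, and a delta-ring is closed under the latter.\<close>
    have "(\<Union>i. A i) \<inter> B = B - (\<Inter>i. B - A i \<inter> B)" by blast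
    moreover have "(\<Inter>i. B - A i \<inter> B) \<in> R" using Union B by (intro R_Inter) auto
    then have "B - (\<Inter>i. B - A i \<inter> B) \<in> R" by (rule Diff[OF B])
    ultimately show ?case by argo
  qed
qed

lemma nn_integral_abs_kernel:
  assumes s: "s \<in> space lam" and h: "h \<in> borel_measurable borel"
  shows "(\<integral>\<^sup>+x. h x \<partial>qlt_abs (\<rho> s)) = (\<integral>\<^sup>+x. h x \<partial>qlt_pos (\<rho> s)) + (\<integral>\<^sup>+x. h x \<partial>qlt_neg (\<rho> s))"
  by (rule nn_integral_qlt_abs[OF quasi_levy_type_signed[OF qlt_space[OF s]] h])

lemma measurable_abs_kernel:
  assumes f: "f \<in> borel_measurable lam" and g: "g \<in> borel_measurable borel"
  shows "(\<lambda>s. \<integral>\<^sup>+x. g (x * f s) \<partial>qlt_abs (\<rho> s)) \<in> borel_measurable lam"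
proof -
  note [measurable] = f g
  have "(\<lambda>s. (\<integral>\<^sup>+x. g (x * f s) \<partial>qlt_pos (\<rho> s)) + (\<integral>\<^sup>+x. g (x * f s) \<partial>qlt_neg (\<rho> s))) \<in> borel_measurable lam"
    by (intro borel_measurable_add nn_integral_levy_kernel_scaled kernel_pos kernel_neg f g)
  then show ?thesis
    by (rule measurable_cong[THEN iffD1, rotated]) (auto intro!: nn_integral_abs_kernel[symmetric] measurable_compose[OF _ g])
qed

lemma image_le_abs:
  assumes f: "f \<in> borel_measurable lam" and g: "g \<in> borel_measurable borel"
  shows "(\<integral>\<^sup>+x. g x \<partial>image_pos f) \<le> (\<integral>\<^sup>+s. \<integral>\<^sup>+x. g (x * f s) \<partial>qlt_abs (\<rho> s) \<partial>lam)"
    and "(\<integral>\<^sup>+x. g x \<partial>image_neg f) \<le> (\<integral>\<^sup>+s. \<integral>\<^sup>+x. g (x * f s) \<partial>qlt_abs (\<rho> s) \<partial>lam)"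
proof -
  have m: "(\<lambda>x. g (x * c)) \<in> borel_measurable borel" for c
    using g by measurable
  show "(\<integral>\<^sup>+x. g x \<partial>image_pos f) \<le> (\<integral>\<^sup>+s. \<integral>\<^sup>+x. g (x * f s) \<partial>qlt_abs (\<rho> s) \<partial>lam)"
    unfolding nn_integral_kernel_image[OF kernel_pos f g]
    by (intro nn_integral_mono) (simp add: nn_integral_abs_kernel[OF _ m])
  show "(\<integral>\<^sup>+x. g x \<partial>image_neg f) \<le> (\<integral>\<^sup>+s. \<integral>\<^sup>+x. g (x * f s) \<partial>qlt_abs (\<rho> s) \<partial>lam)"
    unfolding nn_integral_kernel_image[OF kernel_neg f g]
    by (intro nn_integral_mono) (simp add: nn_integral_abs_kernel[OF _ m])
qed

lemma integrable_lk:
  assumes M: "sets M = sets borel" and fin: "wint M < \<infinity>"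
  shows "integrable M (lk \<theta>)"
proof -
  note [measurable_cong] = M
  have i: "integrable M wgt" using fin by (intro integrableI_nonneg) auto
  show ?thesis
  proof (rule Bochner_Integration.integrable_bound)
    show "integrable M (\<lambda>x. (2 + \<bar>\<theta>\<bar> + \<theta>\<^sup>2) * wgt x)" using i by simp
    show "AE x in M. norm (lk \<theta> x) \<le> norm ((2 + \<bar>\<theta>\<bar> + \<theta>\<^sup>2) * wgt x)"
      using norm_lk_le by (intro AE_I2) (simp add: abs_mult)
  qed measurable
qed

lemma image_exponent:
  assumes f: "f \<in> borel_measurable lam"
    and fin: "(\<integral>\<^sup>+s. \<integral>\<^sup>+x. ennreal (wgt (x * f s)) \<partial>qlt_abs (\<rho> s) \<partial>lam) < \<infinity>"
  shows "integrable lam (\<lambda>s. qlt_integral (\<rho> s) (\<lambda>x. lk \<theta> (x * f s)))"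
    and "(CLINT x|image_pos f. lk \<theta> x) - (CLINT x|image_neg f. lk \<theta> x)
      = (CLINT s|lam. qlt_integral (\<rho> s) (\<lambda>x. lk \<theta> (x * f s)))"
    and "(wint (image_pos f)) < \<infinity>"
    and "(wint (image_neg f)) < \<infinity>"
proof -
  show fp: "(wint (image_pos f)) < \<infinity>"
    by (rule le_less_trans[OF image_le_abs(1)[OF f wgt_measurable] fin])
  show fn: "(wint (image_neg f)) < \<infinity>"
    by (rule le_less_trans[OF image_le_abs(2)[OF f wgt_measurable] fin])
  note p = kernel_image_complex[OF kernel_pos f integrable_lk[OF sets_kernel_image fp]]
    and n = kernel_image_complex[OF kernel_neg f integrable_lk[OF sets_kernel_image fn]]
  show "integrable lam (\<lambda>s. qlt_integral (\<rho> s) (\<lambda>x. lk \<theta> (x * f s)))"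
    unfolding qlt_integral_def by (intro Bochner_Integration.integrable_diff p(1) n(1))
  show "(CLINT x|image_pos f. lk \<theta> x) - (CLINT x|image_neg f. lk \<theta> x)
      = (CLINT s|lam. qlt_integral (\<rho> s) (\<lambda>x. lk \<theta> (x * f s)))"
    unfolding p(2) n(2) qlt_integral_def
    by (rule Bochner_Integration.integral_diff[OF p(1) n(1), symmetric])
qed

text \<open>The local characteristic exponent: its integral over \<open>A\<close> is the exponent of
  \<open>\<Lambda> A\<close>.\<close>

definition psi :: "real \<Rightarrow> 's \<Rightarrow> complex" where
  "psi \<theta> s = \<i> * of_real (\<theta> * a s) - of_real (\<theta>\<^sup>2 / 2 * \<sigma>2 s) + qlt_integral (\<rho> s) (lk \<theta>)"

lemma psi_zero [simp]: "psi 0 s = 0"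
  by (simp add: psi_def qlt_integral_def lk_def[abs_def])

text \<open>The images of the Jordan kernels represent \<open>F A\<close> on \<open>borel0\<close>.
  Positive mass at one point may cancel negative mass at another, so they need not be the Jordan
  parts of \<open>F A\<close>; \<open>qlt_integral_complex_diff\<close> shows that the integral of
  \<open>lk\<close> is the same for both representations.\<close>

lemma char_Lam:
  assumes A: "A \<in> R"
  shows "char (distr P borel (\<Lambda> A)) \<theta> = exp (CLINT s|lam. indicator A s *\<^sub>R psi \<theta> s)"
    and "integrable lam (\<lambda>s. indicator A s *\<^sub>R psi \<theta> s)"
proof -
  have As: "A \<in> sets lam" using A R_sets by auto
  have ind: "indicator A \<in> borel_measurable lam" using As by simp
  have sc: "(\<integral>\<^sup>+x. ennreal (wgt (x * indicator A s)) \<partial>M) = wint M * indicator A s" for M s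
    by (simp add: indicator_def)
  have fin: "(\<integral>\<^sup>+s. \<integral>\<^sup>+x. ennreal (wgt (x * indicator A s)) \<partial>qlt_abs (\<rho> s) \<partial>lam) < \<infinity>"
    unfolding sc by (rule weight_finite[OF A])
  note ex = image_exponent[OF ind fin]
  let ?P = "image_pos (indicator A)"
  let ?N = "image_neg (indicator A)"
  have tri: "qid_triplet (distr P borel (\<Lambda> A)) (\<nu>0 A) (\<nu>1 A) (F A)"
    and a: "set_integrable lam A a" "\<nu>0 A = (LINT s:A|lam. a s)"
    and \<sigma>: "set_integrable lam A \<sigma>2" "\<nu>1 A = (LINT s:A|lam. \<sigma>2 s)"
    using chars A by (auto simp: qid_characteristics_def)
  have qF: "quasi_levy_type (F A)" using tri by (simp add: qid_triplet_def)
  have finB: "emeasure ?P B < \<infinity>" "emeasure ?N B < \<infinity>" if "B \<in> borel0" for B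
    using emeasure_borel0_finite[OF _ ex(3) that] emeasure_borel0_finite[OF _ ex(4) that] by auto
  have FA: "F A B = measure ?P B - measure ?N B" if B: "B \<in> borel0" for B
  proof -
    have f: "(\<integral>\<^sup>+s\<in>A. emeasure (qlt_pos (\<rho> s)) B \<partial>lam) < \<infinity>" "(\<integral>\<^sup>+s\<in>A. emeasure (qlt_neg (\<rho> s)) B \<partial>lam) < \<infinity>"
      using finB[OF B] by (simp_all add: emeasure_kernel_image_indicator[OF kernel_pos As B] emeasure_kernel_image_indicator[OF kernel_neg As B])
    note mp = measure_kernel_image_indicator[OF kernel_pos As B f(1)]
      and mn = measure_kernel_image_indicator[OF kernel_neg As B f(2)]
    have "F A B = (LINT s:A|lam. \<rho> s B)" by (rule F_eq[OF A B])
    also have "\<dots> = (LINT s:A|lam. measure (qlt_pos (\<rho> s)) B - measure (qlt_neg (\<rho> s)) B)"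
      using sets.sets_into_space[OF As] quasi_levy_typeD(3)[OF qlt_space B]
      by (intro set_lebesgue_integral_cong As) blast
    also have "\<dots> = measure ?P B - measure ?N B"
      unfolding set_integral_diff(2)[OF mp(1) mn(1)] mp(2) mn(2) ..
    finally show ?thesis .
  qed
  have q: "qlt_integral (F A) (lk \<theta>) = (CLINT x|?P. lk \<theta> x) - (CLINT x|?N. lk \<theta> x)"
  proof (rule qlt_integral_complex_diff[OF quasi_levy_type_signed[OF qF] _ finB(1) _ finB(2) FA])
    show "integrable (qlt_pos (F A)) (lk \<theta>)" "integrable (qlt_neg (F A)) (lk \<theta>)"
      using quasi_levy_typeD[OF qF] by (auto intro!: integrable_lk simp: levy_measure_def)
    show "integrable ?P (lk \<theta>)" "integrable ?N (lk \<theta>)"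
      using ex(3,4) by (auto intro!: integrable_lk)
  qed auto
  have sl: "qlt_integral (\<rho> s) (\<lambda>x. lk \<theta> (x * indicator A s)) = indicator A s *\<^sub>R qlt_integral (\<rho> s) (lk \<theta>)" for s
    by (simp add: indicator_def qlt_integral_def)
  have iq: "integrable lam (\<lambda>s. indicator A s *\<^sub>R qlt_integral (\<rho> s) (lk \<theta>))"
    using ex(1)[where \<theta>=\<theta>] unfolding sl .
  have i1: "integrable lam (\<lambda>s. \<i> * complex_of_real (\<theta> * (indicator A s * a s)))"
    using a(1) unfolding set_integrable_def by (intro integrable_mult_right integrable_of_real) simp
  have i2: "integrable lam (\<lambda>s. complex_of_real (\<theta>\<^sup>2 / 2 * (indicator A s * \<sigma>2 s)))"
    using \<sigma>(1) unfolding set_integrable_def by (intro integrable_mult_right integrable_of_real) simp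
  have e: "indicator A s *\<^sub>R psi \<theta> s = \<i> * complex_of_real (\<theta> * (indicator A s * a s)) - complex_of_real (\<theta>\<^sup>2 / 2 * (indicator A s * \<sigma>2 s))
     + indicator A s *\<^sub>R qlt_integral (\<rho> s) (lk \<theta>)" for s
    by (simp add: psi_def indicator_def)
  show "integrable lam (\<lambda>s. indicator A s *\<^sub>R psi \<theta> s)"
    unfolding e by (intro Bochner_Integration.integrable_add Bochner_Integration.integrable_diff i1 i2 iq)
  have c1: "(CLINT s|lam. \<i> * complex_of_real (\<theta> * (indicator A s * a s))) = \<i> * of_real (\<theta> * \<nu>0 A)"
    unfolding a(2) set_lebesgue_integral_def by (simp only: integral_mult_right_zero integral_complex_of_real real_scaleR_def)
  have c2: "(CLINT s|lam. complex_of_real (\<theta>\<^sup>2 / 2 * (indicator A s * \<sigma>2 s))) = of_real (\<theta>\<^sup>2 / 2 * \<nu>1 A)"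
    unfolding \<sigma>(2) set_lebesgue_integral_def by (simp only: integral_mult_right_zero integral_complex_of_real real_scaleR_def)
  have "(CLINT s|lam. indicator A s *\<^sub>R psi \<theta> s) = \<i> * of_real (\<theta> * \<nu>0 A) - of_real (\<theta>\<^sup>2 / 2 * \<nu>1 A) + qlt_integral (F A) (lk \<theta>)"
    unfolding e Bochner_Integration.integral_add[OF Bochner_Integration.integrable_diff[OF i1 i2] iq]
      Bochner_Integration.integral_diff[OF i1 i2] c1 c2 q ex(2) sl ..
  then show "char (distr P borel (\<Lambda> A)) \<theta> = exp (CLINT s|lam. indicator A s *\<^sub>R psi \<theta> s)"
    using tri by (simp add: qid_triplet_def lk_def[abs_def])
qed

lemma simple_fun_nth: "simple_fun xs s = (\<Sum>i<length xs. fst (xs ! i) * indicator (snd (xs ! i)) s)"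
  by (simp add: simple_fun_def sum_list_sum_nth atLeast0LessThan case_prod_beta)

lemma simple_repD:
  assumes "simple_rep R xs" "i < length xs"
  shows "snd (xs ! i) \<in> R"
  using assms nth_mem[of i xs] by (cases "xs ! i") (auto simp: simple_rep_def)

lemma simple_integral_nth:
  assumes xs: "simple_rep R xs"
  shows "sint S xs w = (\<Sum>i<length xs. fst (xs ! i) * \<Lambda> (snd (xs ! i)) w)"
proof -
  have "S \<inter> snd (xs ! i) = snd (xs ! i)" if "i < length xs" for i
    using sets.sets_into_space[of "snd (xs ! i)" lam] simple_repD[OF xs that] R_sets space_lam by auto
  then show ?thesis
    by (simp add: simple_integral_rm_def sum_list_sum_nth atLeast0LessThan case_prod_beta)
qed

lemma simple_integral_measurable:
  assumes xs: "simple_rep R xs"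
  shows "sint S xs \<in> borel_measurable P"
proof -
  have "(\<lambda>w. \<Sum>i<length xs. fst (xs ! i) * \<Lambda> (snd (xs ! i)) w) \<in> borel_measurable P"
    by (intro borel_measurable_sum borel_measurable_times borel_measurable_const Lam_measurable simple_repD[OF xs]) auto
  moreover have "sint S xs = (\<lambda>w. \<Sum>i<length xs. fst (xs ! i) * \<Lambda> (snd (xs ! i)) w)"
    using simple_integral_nth[OF xs] by (rule ext)
  ultimately show ?thesis by simp
qed

lemma simple_fun_measurable [measurable]:
  assumes xs: "simple_rep R xs"
  shows "simple_fun xs \<in> borel_measurable lam"
  unfolding simple_fun_nth[abs_def]
  using simple_repD[OF xs] R_sets
  by (intro borel_measurable_sum borel_measurable_times borel_measurable_const borel_measurable_indicator) auto

lemma psi_simple_fun: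
  assumes xs: "simple_rep R xs"
  shows "psi (\<theta> * simple_fun xs s) s = (\<Sum>i<length xs. indicator (snd (xs ! i)) s *\<^sub>R psi (\<theta> * fst (xs ! i)) s)"
proof (cases "\<exists>i<length xs. s \<in> snd (xs ! i)")
  case True
  then obtain i where i: "i < length xs" "s \<in> snd (xs ! i)" by auto
  have "disjoint_family_on (\<lambda>j. snd (xs ! j)) {..<length xs}" using xs by (simp add: simple_rep_def)
  then have ind: "indicator (snd (xs ! j)) s = (if j = i then 1 else (0::real))" if "j < length xs" for j
    using i that unfolding disjoint_family_on_def by (fastforce simp: indicator_def)
  have "simple_fun xs s = (\<Sum>j<length xs. if j = i then fst (xs ! j) else 0)"
    unfolding simple_fun_nth by (intro sum.cong) (auto simp: ind)
  then have "simple_fun xs s = fst (xs ! i)" using i by simp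
  moreover have "(\<Sum>j<length xs. indicator (snd (xs ! j)) s *\<^sub>R psi (\<theta> * fst (xs ! j)) s) = (\<Sum>j<length xs. if j = i then psi (\<theta> * fst (xs ! j)) s else 0)"
    by (intro sum.cong) (auto simp: ind)
  ultimately show ?thesis using i by simp
next
  case False
  then have "indicator (snd (xs ! i)) s = (0::real)" if "i < length xs" for i using that by (auto simp: indicator_def)
  then show ?thesis unfolding simple_fun_nth by simp
qed

lemma char_simple_integral:
  assumes xs: "simple_rep R xs"
  shows "char (distr P borel (sint S xs)) \<theta> = exp (CLINT s|lam. psi (\<theta> * simple_fun xs s) s)"
    and "integrable lam (\<lambda>s. psi (\<theta> * simple_fun xs s) s)"
proof -
  let ?n = "length xs" and ?x = "\<lambda>i. fst (xs ! i)" and ?A = "\<lambda>i. snd (xs ! i)"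
  \<comment> \<open>Independence is given for infinite disjoint sequences, so the list is padded
    with empty sets.\<close>
  define B where "B i = (if i < ?n then ?A i else {})" for i
  have e: "{} \<in> R" using ring_R by (simp add: ring_of_sets_def semiring_of_sets_def semiring_of_sets_axioms_def)
  have B: "range B \<subseteq> R" "disjoint_family B"
    using simple_repD[OF xs] e xs by (auto simp: B_def simple_rep_def disjoint_family_on_def)
  then have "P.indep_vars (\<lambda>_. borel) (\<lambda>n. \<Lambda> (B n)) UNIV"
    using chars by (simp add: qid_characteristics_def qid_random_measure_def)
  then have "P.indep_vars (\<lambda>_. borel) (\<lambda>n. \<Lambda> (B n)) {..<?n}"
    by (rule P.indep_vars_subset) simp
  then have ind: "P.indep_vars (\<lambda>_. borel) (\<lambda>i w. ?x i * \<Lambda> (B i) w) {..<?n}"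
    by (rule P.indep_vars_compose2) auto
  have int: "integrable lam (\<lambda>s. indicator (?A i) s *\<^sub>R psi (\<theta> * ?x i) s)" if "i < ?n" for i
    by (rule char_Lam(2)[OF simple_repD[OF xs that]])
  have "sint S xs = (\<lambda>w. \<Sum>i<?n. ?x i * \<Lambda> (B i) w)"
    by (simp add: fun_eq_iff simple_integral_nth[OF xs] B_def)
  then have "char (distr P borel (sint S xs)) \<theta> = (\<Prod>i<?n. char (distr P borel (\<lambda>w. ?x i * \<Lambda> (B i) w)) \<theta>)"
    using P.char_distr_sum[OF ind] by simp
  also have "\<dots> = (\<Prod>i<?n. exp (CLINT s|lam. indicator (?A i) s *\<^sub>R psi (\<theta> * ?x i) s))"
  proof (intro prod.cong refl)
    fix i assume "i \<in> {..<?n}"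
    then have i: "i < ?n" by simp
    note [measurable] = Lam_measurable[OF simple_repD[OF xs i]]
    have "char (distr P borel (\<lambda>w. ?x i * \<Lambda> (?A i) w)) \<theta> = char (distr P borel (\<Lambda> (?A i))) (\<theta> * ?x i)"
      unfolding char_def by (subst (1 2) integral_distr) (auto simp: mult.assoc)
    then show "char (distr P borel (\<lambda>w. ?x i * \<Lambda> (B i) w)) \<theta> = exp (CLINT s|lam. indicator (?A i) s *\<^sub>R psi (\<theta> * ?x i) s)"
      using i by (simp add: B_def char_Lam(1)[OF simple_repD[OF xs i]])
  qed
  also have "\<dots> = exp (\<Sum>i<?n. CLINT s|lam. indicator (?A i) s *\<^sub>R psi (\<theta> * ?x i) s)"
    by (simp add: exp_sum)
  also have "(\<Sum>i<?n. CLINT s|lam. indicator (?A i) s *\<^sub>R psi (\<theta> * ?x i) s) = (CLINT s|lam. psi (\<theta> * simple_fun xs s) s)"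
    unfolding psi_simple_fun[OF xs] using int by (intro Bochner_Integration.integral_sum[symmetric]) auto
  finally show "char (distr P borel (sint S xs)) \<theta> = exp (CLINT s|lam. psi (\<theta> * simple_fun xs s) s)" .
  show "integrable lam (\<lambda>s. psi (\<theta> * simple_fun xs s) s)"
    unfolding psi_simple_fun[OF xs] using int by (intro Bochner_Integration.integrable_sum) auto
qed

text \<open>Scaling the argument by \<open>u\<close> is the same as scaling the jumps, except that
  the truncation becomes \<open>tau (x * u)\<close> in place of \<open>u * tau x\<close>. The
  difference is linear in \<open>\<theta>\<close> and joins the drift, which is the origin of
  \<open>U_fun\<close>.\<close>

lemma psi_scale:
  assumes s: "s \<in> space lam"
  shows "psi (\<theta> * u) s = \<i> * of_real (\<theta> * U_fun a \<rho> u s) - of_real (\<theta>\<^sup>2 / 2 * (u\<^sup>2 * \<sigma>2 s))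
    + qlt_integral (\<rho> s) (\<lambda>x. lk \<theta> (x * u))"
proof -
  note \<nu> = qlt_space[OF s]
  let ?h = "\<lambda>x. \<i> * complex_of_real (\<theta> * (tau (x * u) - u * tau x))"
  have "qlt_integral (\<rho> s) (lk (\<theta> * u)) = qlt_integral (\<rho> s) (\<lambda>x. lk \<theta> (x * u) + ?h x)"
    by (intro arg_cong[of _ _ "qlt_integral (\<rho> s)"]) (auto simp: fun_eq_iff lk_def algebra_simps)
  also have "\<dots> = qlt_integral (\<rho> s) (\<lambda>x. lk \<theta> (x * u)) + qlt_integral (\<rho> s) ?h"
  proof (rule qlt_integral_add[OF \<nu>])
    fix x
    have "norm (lk \<theta> (x * u)) \<le> (2 + \<bar>\<theta>\<bar> + \<theta>\<^sup>2) * wgt (x * u)" by (rule norm_lk_le)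
    also have "\<dots> \<le> (2 + \<bar>\<theta>\<bar> + \<theta>\<^sup>2) * ((1 + u\<^sup>2) * wgt x)" by (intro mult_left_mono wgt_scale_le) auto
    finally show "norm (lk \<theta> (x * u)) \<le> ((2 + \<bar>\<theta>\<bar> + \<theta>\<^sup>2) * (1 + u\<^sup>2)) * wgt x" by (simp only: mult.assoc)
    have "norm (?h x) = \<bar>\<theta>\<bar> * \<bar>tau (x * u) - u * tau x\<bar>"
      by (simp only: norm_mult norm_of_real norm_ii abs_mult mult_1)
    also have "\<dots> \<le> \<bar>\<theta>\<bar> * ((1 + \<bar>u\<bar> + u\<^sup>2) * wgt x)" by (intro mult_left_mono tau_diff_le) auto
    finally show "norm (?h x) \<le> (\<bar>\<theta>\<bar> * (1 + \<bar>u\<bar> + u\<^sup>2)) * wgt x" by (simp only: mult.assoc)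
  qed measurable
  also have "qlt_integral (\<rho> s) ?h = \<i> * of_real (\<theta> * qlt_integral (\<rho> s) (\<lambda>x. tau (x * u) - u * tau x))"
    unfolding qlt_integral_def integral_mult_right_zero integral_complex_of_real
    by (simp only: of_real_diff right_diff_distrib of_real_mult)
  finally show ?thesis
    by (simp add: psi_def U_fun_def algebra_simps power_mult_distrib)
qed

text \<open>Each of the three terms of \<open>psi_scale\<close> is matched with a summand of
  \<open>Phi_fun\<close>, the jump term by \<open>norm_lk_le\<close> and
  \<open>wgt_le_vpow\<close>.\<close>

lemma norm_psi_le:
  assumes s: "s \<in> space lam" and p: "0 \<le> p"
  shows "ennreal (norm (psi (\<theta> * u) s)) \<le> ennreal (2 + \<bar>\<theta>\<bar> + \<theta>\<^sup>2) * Phi p \<bar>u\<bar> s"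
proof -
  note \<nu> = qlt_space[OF s] and \<sigma> = sigma2_nonneg[OF s]
  let ?C = "2 + \<bar>\<theta>\<bar> + \<theta>\<^sup>2" and ?Q = "qlt_integral (\<rho> s) (\<lambda>x. lk \<theta> (x * u))"
  have sa: "sets (qlt_abs (\<rho> s)) = sets borel" by (rule sets_qlt_abs[OF quasi_levy_type_signed[OF \<nu>]])
  have "norm (psi (\<theta> * u) s) \<le> norm (\<i> * complex_of_real (\<theta> * U_fun a \<rho> u s)) + norm (complex_of_real (\<theta>\<^sup>2 / 2 * (u\<^sup>2 * \<sigma>2 s))) + norm ?Q"
    unfolding psi_scale[OF s] by (meson add_right_mono norm_triangle_ineq norm_triangle_ineq4 order_trans)
  also have "\<dots> = \<bar>\<theta>\<bar> * \<bar>U_fun a \<rho> u s\<bar> + \<theta>\<^sup>2 / 2 * (u\<^sup>2 * \<sigma>2 s) + norm ?Q"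
    using \<sigma> by (simp only: norm_mult norm_of_real norm_ii abs_mult mult_1) (simp add: abs_mult)
  also have "\<dots> \<le> ?C * \<bar>U_fun a \<rho> u s\<bar> + ?C * (\<bar>u\<bar>\<^sup>2 * \<sigma>2 s) + norm ?Q"
  proof (intro add_mono mult_right_mono order_refl)
    show "\<theta>\<^sup>2 / 2 * (u\<^sup>2 * \<sigma>2 s) \<le> ?C * (\<bar>u\<bar>\<^sup>2 * \<sigma>2 s)"
      unfolding power2_abs using \<sigma> by (intro mult_right_mono) (auto simp: add_increasing)
  qed auto
  finally have "ennreal (norm (psi (\<theta> * u) s)) \<le> ennreal (?C * \<bar>U_fun a \<rho> u s\<bar> + ?C * (\<bar>u\<bar>\<^sup>2 * \<sigma>2 s) + norm ?Q)"
    by (rule ennreal_leI)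
  also have "\<dots> = ennreal ?C * ennreal \<bar>U_fun a \<rho> u s\<bar> + ennreal ?C * ennreal (\<bar>u\<bar>\<^sup>2 * \<sigma>2 s) + ennreal (norm ?Q)"
  proof -
    have "ennreal (C * x + C * y + z) = ennreal C * ennreal x + ennreal C * ennreal y + ennreal z"
      if "0 \<le> C" "0 \<le> x" "0 \<le> y" "0 \<le> z" for C x y z using that by (simp add: ennreal_mult)
    from this[of ?C "\<bar>U_fun a \<rho> u s\<bar>" "\<bar>u\<bar>\<^sup>2 * \<sigma>2 s" "norm ?Q"] \<sigma> show ?thesis
      by (meson abs_ge_zero add_nonneg_nonneg mult_nonneg_nonneg norm_ge_zero zero_le_numeral zero_le_power2)
  qed
  also have "\<dots> \<le> ennreal ?C * U_sup a \<rho> \<bar>u\<bar> s + ennreal ?C * ennreal (\<bar>u\<bar>\<^sup>2 * \<sigma>2 s) + ennreal ?C * V_fun \<rho> p \<bar>u\<bar> s"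
  proof (intro add_mono order_refl mult_left_mono)
    \<comment> \<open>The factor \<open>c = sgn u\<close> recovers \<open>u\<close> from its
      modulus.\<close>
    show "ennreal \<bar>U_fun a \<rho> u s\<bar> \<le> U_sup a \<rho> \<bar>u\<bar> s"
      unfolding U_sup_def by (rule SUP_upper2[of "sgn u"]) (auto simp: sgn_if)
    have "ennreal (norm ?Q) \<le> (\<integral>\<^sup>+x. ennreal (norm (lk \<theta> (x * u))) \<partial>qlt_abs (\<rho> s))"
      by (rule norm_qlt_integral_le[OF \<nu>]) measurable
    also have "\<dots> \<le> (\<integral>\<^sup>+x. ennreal ?C * ennreal (vpow p (x * \<bar>u\<bar>)) \<partial>qlt_abs (\<rho> s))"
    proof (rule nn_integral_mono)
      fix x
      have "norm (lk \<theta> (x * u)) \<le> ?C * wgt (x * u)" by (rule norm_lk_le)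
      also have "\<dots> \<le> ?C * vpow p (x * u)" by (intro mult_left_mono wgt_le_vpow p) auto
      finally have "ennreal (norm (lk \<theta> (x * u))) \<le> ennreal (?C * vpow p (x * \<bar>u\<bar>))" unfolding vpow_abs by (rule ennreal_leI)
      also have "\<dots> = ennreal ?C * ennreal (vpow p (x * \<bar>u\<bar>))" using vpow_nonneg by (intro ennreal_mult) auto
      finally show "ennreal (norm (lk \<theta> (x * u))) \<le> ennreal ?C * ennreal (vpow p (x * \<bar>u\<bar>))" .
    qed
    also have "\<dots> = ennreal ?C * V_fun \<rho> p \<bar>u\<bar> s"
      unfolding V_fun_vpow by (intro nn_integral_cmult) (simp only: measurable_cong_sets[OF sa refl], measurable)
    finally show "ennreal (norm ?Q) \<le> ennreal ?C * V_fun \<rho> p \<bar>u\<bar> s" .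
  qed auto
  also have "\<dots> = ennreal ?C * Phi p \<bar>u\<bar> s"
    unfolding Phi_fun_eq by (simp only: distrib_left)
  finally show ?thesis .
qed

lemma U_fun_measurable:
  assumes f [measurable]: "f \<in> borel_measurable lam"
  shows "(\<lambda>s. U_fun a \<rho> (f s) s) \<in> borel_measurable lam"
proof -
  have "(\<lambda>s. LINT x|qlt_pos (\<rho> s). tau (x * f s) - f s * tau x) \<in> borel_measurable lam"
    by (rule levy_kernel_integral_measurable[OF kernel_pos]) measurable
  moreover have "(\<lambda>s. LINT x|qlt_neg (\<rho> s). tau (x * f s) - f s * tau x) \<in> borel_measurable lam"
    by (rule levy_kernel_integral_measurable[OF kernel_neg]) measurable
  ultimately show ?thesis
    unfolding U_fun_def qlt_integral_def by measurable
qed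

lemma Phi_fun_measurable:
  assumes f [measurable]: "f \<in> borel_measurable lam"
  shows "(\<lambda>s. Phi p \<bar>f s\<bar> s) \<in> borel_measurable lam"
proof -
  have "U_sup a \<rho> \<bar>f s\<bar> s = (SUP q\<in>\<rat>. ennreal \<bar>U_fun a \<rho> (tau q * \<bar>f s\<bar>) s\<bar>)" if s: "s \<in> space lam" for s
    unfolding U_sup_def
  proof (rule SUP_clamp_rational)
    have c: "continuous_on UNIV (\<lambda>u. U_fun a \<rho> u s)"
      using isCont_U_fun[where \<rho>=\<rho> and s=s, OF qlt_space[OF s]] by (simp add: continuous_at_imp_continuous_on)
    show "continuous_on UNIV (\<lambda>c. U_fun a \<rho> (c * \<bar>f s\<bar>) s)"
      by (rule continuous_on_compose2[OF c]) (auto intro!: continuous_intros)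
  qed
  moreover have "(\<lambda>s. SUP q\<in>\<rat>. ennreal \<bar>U_fun a \<rho> (tau q * \<bar>f s\<bar>) s\<bar>) \<in> borel_measurable lam"
  proof (intro borel_measurable_SUP countable_rat)
    fix q :: real
    have "(\<lambda>s. U_fun a \<rho> (tau q * \<bar>f s\<bar>) s) \<in> borel_measurable lam"
      by (rule U_fun_measurable) measurable
    then show "(\<lambda>s. ennreal \<bar>U_fun a \<rho> (tau q * \<bar>f s\<bar>) s\<bar>) \<in> borel_measurable lam" by measurable
  qed
  ultimately have [measurable]: "(\<lambda>s. U_sup a \<rho> \<bar>f s\<bar> s) \<in> borel_measurable lam"
    by (subst measurable_cong) auto
  have [measurable]: "(\<lambda>s. V_fun \<rho> p \<bar>f s\<bar> s) \<in> borel_measurable lam"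
    unfolding V_fun_vpow by (rule measurable_abs_kernel[of "\<lambda>s. \<bar>f s\<bar>" "\<lambda>x. ennreal (vpow p x)"]) measurable
  show ?thesis unfolding Phi_fun_eq by measurable
qed

end

section \<open>Simple functions\<close>

lemma ennreal_squeeze_zero:
  fixes f g :: "nat \<Rightarrow> ennreal"
  assumes "\<And>n. f n \<le> g n" "g \<longlonglongrightarrow> 0"
  shows "f \<longlonglongrightarrow> 0"
  by (rule tendsto_sandwich[of "\<lambda>_. 0" f sequentially g 0]) (use assms in auto)

lemma simple_fun_Nil [simp]: "simple_fun [] s = 0"
  and simple_fun_Cons [simp]: "simple_fun (p # xs) s = fst p * indicator (snd p) s + simple_fun xs s"
  and simple_fun_append [simp]: "simple_fun (xs @ ys) s = simple_fun xs s + simple_fun ys s"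
  by (simp_all add: simple_fun_def case_prod_beta)

lemma simple_integral_rm_Nil [simp]: "simple_integral_rm \<Lambda> A [] w = 0"
  and simple_integral_rm_Cons [simp]: "simple_integral_rm \<Lambda> A (p # xs) w = fst p * \<Lambda> (A \<inter> snd p) w + simple_integral_rm \<Lambda> A xs w"
  and simple_integral_rm_append [simp]: "simple_integral_rm \<Lambda> A (xs @ ys) w = simple_integral_rm \<Lambda> A xs w + simple_integral_rm \<Lambda> A ys w"
  by (simp_all add: simple_integral_rm_def case_prod_beta)

text \<open>Disjointness of indexed entries in the form that list induction can use.\<close>

lemma simple_rep_iff:
  "simple_rep R xs \<longleftrightarrow> (\<forall>p\<in>set xs. snd p \<in> R) \<and> sorted_wrt (\<lambda>p q. snd p \<inter> snd q = {}) xs"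
proof -
  have "disjoint_family_on (\<lambda>j. snd (xs ! j)) {..<length xs} \<longleftrightarrow> sorted_wrt (\<lambda>p q. snd p \<inter> snd q = {}) xs"
  proof
    assume d: "disjoint_family_on (\<lambda>j. snd (xs ! j)) {..<length xs}"
    show "sorted_wrt (\<lambda>p q. snd p \<inter> snd q = {}) xs"
      unfolding sorted_wrt_iff_nth_less using disjoint_family_onD[OF d] by simp
  next
    assume "sorted_wrt (\<lambda>p q. snd p \<inter> snd q = {}) xs"
    then have *: "snd (xs ! i) \<inter> snd (xs ! j) = {}" if "i < j" "j < length xs" for i j
      unfolding sorted_wrt_iff_nth_less using that by blast
    show "disjoint_family_on (\<lambda>j. snd (xs ! j)) {..<length xs}"
      unfolding disjoint_family_on_def
    proof (intro ballI impI)
      fix i j assume "i \<in> {..<length xs}" "j \<in> {..<length xs}" "i \<noteq> j"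
      then show "snd (xs ! i) \<inter> snd (xs ! j) = {}"
        using *[of i j] *[of j i] by (cases "i < j") (auto simp: Int_commute)
    qed
  qed
  then show ?thesis by (auto simp: simple_rep_def)
qed

definition restrict_rep :: "'s set \<Rightarrow> (real \<times> 's set) list \<Rightarrow> (real \<times> 's set) list" where
  "restrict_rep A xs = map (\<lambda>p. (fst p, A \<inter> snd p)) xs"

lemma simple_fun_restrict: "simple_fun (restrict_rep A xs) s = indicator A s * simple_fun xs s"
  by (induction xs) (auto simp: restrict_rep_def indicator_inter_arith algebra_simps)

section \<open>The modular and the smallness in probability of integrals\<close>

context qid_core
begin

sublocale R: ring_of_sets S R by (rule ring_R)

definition modular :: "real \<Rightarrow> ('s \<Rightarrow> real) \<Rightarrow> ennreal" where
  "modular p f = (\<integral>\<^sup>+s. Phi p \<bar>f s\<bar> s \<partial>lam)"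

lemma modular_mono:
  assumes "0 \<le> p" "AE s in lam. \<bar>f s\<bar> \<le> \<bar>g s\<bar>"
  shows "modular p f \<le> modular p g"
  unfolding modular_def
proof (rule nn_integral_mono_AE)
  show "AE s in lam. Phi p \<bar>f s\<bar> s \<le> Phi p \<bar>g s\<bar> s"
    using assms(2) AE_space by eventually_elim (simp add: Phi_fun_mono assms(1) sigma2_nonneg)
qed

lemma modular_add:
  assumes p: "0 \<le> p" and f: "f \<in> borel_measurable lam" and g: "g \<in> borel_measurable lam"
  shows "modular p (\<lambda>s. f s + g s) \<le> ennreal (8 * 2 powr p) * (modular p f + modular p g)"
proof -
  have "modular p (\<lambda>s. f s + g s) \<le> (\<integral>\<^sup>+s. ennreal (8 * 2 powr p) * (Phi p \<bar>f s\<bar> s + Phi p \<bar>g s\<bar> s) \<partial>lam)"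
    unfolding modular_def
    by (intro nn_integral_mono Phi_fun_add qlt_space sigma2_nonneg p)
  also have "\<dots> = ennreal (8 * 2 powr p) * (modular p f + modular p g)"
    unfolding modular_def
    using Phi_fun_measurable[OF f] Phi_fun_measurable[OF g]
    by (subst nn_integral_cmult) (auto simp: nn_integral_add)
  finally show ?thesis .
qed

lemma modular_scale:
  assumes p: "0 \<le> p" and f: "f \<in> borel_measurable lam" and c: "\<bar>c\<bar> \<le> 2 ^ n"
  shows "modular p (\<lambda>s. c * f s) \<le> ennreal ((8 * 2 powr p) ^ n) * modular p f"
proof -
  have "modular p (\<lambda>s. c * f s) \<le> (\<integral>\<^sup>+s. ennreal ((8 * 2 powr p) ^ n) * Phi p \<bar>f s\<bar> s \<partial>lam)"
    unfolding modular_def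
    by (intro nn_integral_mono Phi_fun_scale qlt_space sigma2_nonneg p c)
  also have "\<dots> = ennreal ((8 * 2 powr p) ^ n) * modular p f"
    unfolding modular_def by (intro nn_integral_cmult Phi_fun_measurable f)
  finally show ?thesis .
qed

lemma tendsto_pd_simple:
  assumes xs: "\<And>n. simple_rep R (xs n)" and p: "0 \<le> p"
    and lim: "(\<lambda>n. modular p (simple_fun (xs n))) \<longlonglongrightarrow> 0"
  shows "(\<lambda>n. pd P (sint S (xs n))) \<longlonglongrightarrow> 0"
proof (rule P.char_tendsto_one_pd)
  fix t :: real
  let ?I = "\<lambda>n. CLINT s|lam. psi (t * simple_fun (xs n) s) s"
  have "ennreal (norm (?I n)) \<le> ennreal (2 + \<bar>t\<bar> + t\<^sup>2) * modular p (simple_fun (xs n))" for n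
  proof -
    have "ennreal (norm (?I n)) \<le> (\<integral>\<^sup>+s. ennreal (norm (psi (t * simple_fun (xs n) s) s)) \<partial>lam)"
      by (rule integral_norm_bound_ennreal[OF char_simple_integral(2)[OF xs]])
    also have "\<dots> \<le> (\<integral>\<^sup>+s. ennreal (2 + \<bar>t\<bar> + t\<^sup>2) * Phi p \<bar>simple_fun (xs n) s\<bar> s \<partial>lam)"
      by (intro nn_integral_mono norm_psi_le p)
    also have "\<dots> = ennreal (2 + \<bar>t\<bar> + t\<^sup>2) * modular p (simple_fun (xs n))"
      unfolding modular_def by (intro nn_integral_cmult Phi_fun_measurable simple_fun_measurable xs)
    finally show ?thesis .
  qed
  moreover have "(\<lambda>n. ennreal (2 + \<bar>t\<bar> + t\<^sup>2) * modular p (simple_fun (xs n))) \<longlonglongrightarrow> 0"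
    using ennreal_tendsto_cmult[OF _ lim, of "ennreal (2 + \<bar>t\<bar> + t\<^sup>2)"] by simp
  ultimately have "(\<lambda>n. ennreal (norm (?I n))) \<longlonglongrightarrow> 0"
    by (rule ennreal_squeeze_zero)
  then have "(\<lambda>n. norm (?I n)) \<longlonglongrightarrow> 0" by (subst (asm) ennreal_tendsto_0_iff) auto
  then have "?I \<longlonglongrightarrow> 0" by (rule tendsto_norm_zero_cancel)
  then have "(\<lambda>n. exp (?I n)) \<longlonglongrightarrow> exp 0" by (rule tendsto_exp)
  then show "(\<lambda>n. char (distr P borel (sint S (xs n))) t) \<longlonglongrightarrow> 1"
    by (simp add: char_simple_integral(1)[OF xs])
qed (rule simple_integral_measurable[OF xs])

text \<open>Turns the statement on sequences into one that is uniform over all simple functions: a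
  sequence of counterexamples with modulars at most \<open>1 / (n + 1)\<close> would contradict
  \<open>tendsto_pd_simple\<close>.\<close>

lemma pd_simple_small:
  assumes p: "0 \<le> p" and e: "0 < \<epsilon>"
  shows "\<exists>\<delta>>0. \<forall>xs. simple_rep R xs \<longrightarrow> modular p (simple_fun xs) \<le> ennreal \<delta> \<longrightarrow>
    pd P (sint S xs) \<le> ennreal \<epsilon>"
proof (rule ccontr)
  assume *: "\<not> ?thesis"
  then have "\<forall>n. \<exists>xs. simple_rep R xs \<and> modular p (simple_fun xs) \<le> ennreal (inverse (real (Suc n))) \<and>
    ennreal \<epsilon> < pd P (sint S xs)"
    using positive_imp_inverse_positive[OF of_nat_0_less_iff[THEN iffD2, OF zero_less_Suc]]
    by (meson not_le)
  then have "\<exists>xs. \<forall>n. simple_rep R (xs n) \<and> modular p (simple_fun (xs n)) \<le> ennreal (inverse (real (Suc n))) \<and>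
    ennreal \<epsilon> < pd P (sint S (xs n))"
    by (rule choice)
  then obtain xs where xs: "\<And>n. simple_rep R (xs n)"
    "\<And>n. modular p (simple_fun (xs n)) \<le> ennreal (inverse (real (Suc n)))"
    "\<And>n. ennreal \<epsilon> < pd P (sint S (xs n))" by blast
  have "(\<lambda>n. ennreal (inverse (real (Suc n)))) \<longlonglongrightarrow> ennreal 0"
    by (intro tendsto_ennrealI LIMSEQ_inverse_real_of_nat)
  then have "(\<lambda>n. modular p (simple_fun (xs n))) \<longlonglongrightarrow> 0"
    unfolding ennreal_0 by (rule ennreal_squeeze_zero[OF xs(2)])
  from tendsto_pd_simple[OF xs(1) p this]
  have "eventually (\<lambda>n. pd P (sint S (xs n)) < ennreal \<epsilon>) sequentially"
    by (rule order_tendstoD(2)) (simp add: e)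
  then obtain n where "pd P (sint S (xs n)) < ennreal \<epsilon>"
    by (auto simp: eventually_sequentially)
  then show False using xs(3)[of n] by (simp add: not_less_iff_gr_or_eq)
qed

lemma simple_rep_restrict:
  assumes A: "A \<in> sets lam" and xs: "simple_rep R xs"
  shows "simple_rep R (restrict_rep A xs)"
  using xs sets_Int_R[OF A] unfolding simple_rep_iff restrict_rep_def
  by (auto simp: sorted_wrt_map elim!: sorted_wrt_mono_rel[rotated])

lemma simple_integral_restrict:
  assumes A: "A \<in> sets lam"
  shows "sint A xs = sint S (restrict_rep A xs)"
proof
  have "A \<subseteq> S" using sets.sets_into_space[OF A] space_lam by simp
  then have "S \<inter> (A \<inter> C) = A \<inter> C" for C by blast
  then show "sint A xs w = sint S (restrict_rep A xs) w" for w
    by (induction xs) (simp_all add: restrict_rep_def)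
qed

lemma simple_integral_measurable' [measurable]:
  assumes "A \<in> sets lam" "simple_rep R xs"
  shows "sint A xs \<in> borel_measurable P"
  unfolding simple_integral_restrict[OF assms(1)]
  by (intro simple_integral_measurable simple_rep_restrict assms)

section \<open>Almost sure additivity and linear combinations\<close>

lemma Lam_empty: "AE w in P. \<Lambda> {} w = 0"
  and Lam_Un: "D \<in> R \<Longrightarrow> E \<in> R \<Longrightarrow> D \<inter> E = {} \<Longrightarrow> AE w in P. \<Lambda> (D \<union> E) w = \<Lambda> D w + \<Lambda> E w"
proof -
  have s: "AE w in P. (\<lambda>n. \<Lambda> (A n) w) sums \<Lambda> (\<Union>n. A n) w"
    if "range A \<subseteq> R" "disjoint_family A" "(\<Union>n. A n) \<in> R" for A :: "nat \<Rightarrow> 's set"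
    using chars that by (simp add: qid_characteristics_def qid_random_measure_def)
  show e: "AE w in P. \<Lambda> {} w = 0"
  proof -
    \<comment> \<open>The empty set is a disjoint union of countably many copies of itself, and a
      constant series converges only if its terms are 0.\<close>
    have "AE w in P. (\<lambda>n :: nat. \<Lambda> {} w) sums \<Lambda> {} w"
      using s[of "\<lambda>_. {}"] by (simp add: disjoint_family_on_def)
    then show ?thesis
    proof eventually_elim
      fix w assume "(\<lambda>n :: nat. \<Lambda> {} w) sums \<Lambda> {} w"
      then show "\<Lambda> {} w = 0"
        using summable_LIMSEQ_zero[OF sums_summable] LIMSEQ_unique[OF tendsto_const] by blast
    qed
  qed
  assume DE: "D \<in> R" "E \<in> R" "D \<inter> E = {}"
  define A :: "nat \<Rightarrow> 's set" where A_eq: "A n = (if n = 0 then D else if n = 1 then E else {})" for n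
  have A: "range A \<subseteq> R" "disjoint_family A" using DE by (auto simp: A_eq disjoint_family_on_def)
  have "A 0 = D" "A 1 = E" by (simp_all add: A_eq)
  then have "D \<subseteq> (\<Union>n. A n)" "E \<subseteq> (\<Union>n. A n)" by blast+
  moreover have "(\<Union>n. A n) \<subseteq> D \<union> E" by (auto simp: A_eq split: if_splits)
  ultimately have U: "(\<Union>n. A n) = D \<union> E" by blast
  have UR: "(\<Union>n. A n) \<in> R" unfolding U using DE by blast
  show "AE w in P. \<Lambda> (D \<union> E) w = \<Lambda> D w + \<Lambda> E w"
    using s[OF A UR] e
  proof (eventually_elim)
    fix w assume w: "(\<lambda>n. \<Lambda> (A n) w) sums \<Lambda> (\<Union>n. A n) w" "\<Lambda> {} w = 0"
    have "(\<lambda>n. \<Lambda> (A n) w) sums (\<Sum>n\<in>{0, 1}. \<Lambda> (A n) w)"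
      by (rule sums_finite) (auto simp: A_eq w(2))
    then have "(\<lambda>n. \<Lambda> (A n) w) sums (\<Lambda> D w + \<Lambda> E w)" by (simp add: A_eq)
    from sums_unique2[OF w(1) this] show "\<Lambda> (D \<union> E) w = \<Lambda> D w + \<Lambda> E w" by (simp only: U)
  qed
qed

text \<open>Adding a term on \<open>C\<close> to a disjoint list: each entry \<open>B\<close> is
  split along \<open>C\<close>, and the remainder \<open>C - B\<close> is passed on to the rest of
  the list. The clause on \<open>D\<close> says that the new sets lie within \<open>C\<close> and
  the old sets, phrased as the disjointness that the next induction step needs. The integrals agree
  only almost surely, since \<open>\<Lambda>\<close> is additive only almost surely.\<close>

lemma refine_insert:
  assumes "simple_rep R zs" "C \<in> R"
  shows "\<exists>us. simple_rep R us \<and>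
    (\<forall>D. D \<inter> C = {} \<longrightarrow> (\<forall>p\<in>set zs. D \<inter> snd p = {}) \<longrightarrow> (\<forall>p\<in>set us. D \<inter> snd p = {})) \<and>
    (\<forall>s. simple_fun us s = x * indicator C s + simple_fun zs s) \<and>
    (\<forall>A\<in>sets lam. AE w in P. sint A us w = x * \<Lambda> (A \<inter> C) w + sint A zs w)"
  using assms
proof (induction zs arbitrary: C)
  case Nil
  then show ?case by (intro exI[of _ "[(x, C)]"]) (simp add: simple_rep_iff)
next
  case (Cons q zs)
  obtain y B where q: "q = (y, B)" by (cases q)
  have B: "B \<in> R" and zs: "simple_rep R zs" and Bz: "\<And>p. p \<in> set zs \<Longrightarrow> B \<inter> snd p = {}"
    using Cons.prems(1) by (auto simp: q simple_rep_iff)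
  from Cons.IH[OF zs R.Diff[OF Cons.prems(2) B]] obtain us where us: "simple_rep R us"
    and dis: "\<forall>D. D \<inter> (C - B) = {} \<longrightarrow> (\<forall>p\<in>set zs. D \<inter> snd p = {}) \<longrightarrow> (\<forall>p\<in>set us. D \<inter> snd p = {})"
    and sf: "\<forall>s. simple_fun us s = x * indicator (C - B) s + simple_fun zs s"
    and si: "\<forall>A\<in>sets lam. AE w in P. sint A us w = x * \<Lambda> (A \<inter> (C - B)) w + sint A zs w"
    by (elim exE conjE)
  note sf = sf[rule_format] and si = si[rule_format]
  have dis: "\<forall>p\<in>set us. D \<inter> snd p = {}" if "D \<inter> (C - B) = {}" "\<forall>p\<in>set zs. D \<inter> snd p = {}" for D
    using dis that by blast
  \<comment> \<open>The overlap carries the sum of both coefficients.\<close>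
  let ?us = "(y, B - C) # (y + x, B \<inter> C) # us"
  have "\<forall>p\<in>set us. (B - C) \<inter> snd p = {}" "\<forall>p\<in>set us. (B \<inter> C) \<inter> snd p = {}"
    using Bz by (intro dis; blast)+
  then have "simple_rep R ?us"
    using us B Cons.prems(2) by (auto simp: simple_rep_iff)
  moreover have "\<forall>p\<in>set ?us. D \<inter> snd p = {}" if "D \<inter> C = {}" "\<forall>p\<in>set (q # zs). D \<inter> snd p = {}" for D
    using dis[of D] that by (auto simp: q)
  moreover have "simple_fun ?us s = x * indicator C s + simple_fun (q # zs) s" for s
    by (simp add: sf q indicator_def)
  moreover have "AE w in P. sint A ?us w = x * \<Lambda> (A \<inter> C) w + sint A (q # zs) w"
    if A: "A \<in> sets lam" for A
  proof -
    have "A \<inter> (B - C) \<in> R" "A \<inter> (B \<inter> C) \<in> R" "A \<inter> (C - B) \<in> R"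
      using B Cons.prems(2) by (auto intro!: sets_Int_R[OF A])
    moreover have "A \<inter> (B - C) \<union> A \<inter> (B \<inter> C) = A \<inter> B" "A \<inter> (C - B) \<union> A \<inter> (B \<inter> C) = A \<inter> C" by blast+
    ultimately have "AE w in P. \<Lambda> (A \<inter> B) w = \<Lambda> (A \<inter> (B - C)) w + \<Lambda> (A \<inter> (B \<inter> C)) w"
      "AE w in P. \<Lambda> (A \<inter> C) w = \<Lambda> (A \<inter> (C - B)) w + \<Lambda> (A \<inter> (B \<inter> C)) w"
      using Lam_Un[of "A \<inter> (B - C)" "A \<inter> (B \<inter> C)"] Lam_Un[of "A \<inter> (C - B)" "A \<inter> (B \<inter> C)"] by auto
    then show ?thesis using si[OF A] by eventually_elim (simp add: q algebra_simps)
  qed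
  ultimately show ?case by blast
qed

lemma refine_rep:
  assumes "\<forall>p\<in>set xs. snd p \<in> R"
  shows "\<exists>zs. simple_rep R zs \<and> (\<forall>s. simple_fun zs s = simple_fun xs s) \<and>
    (\<forall>A\<in>sets lam. AE w in P. sint A zs w = sint A xs w)"
  using assms
proof (induction xs)
  case Nil
  then show ?case by (intro exI[of _ "[]"]) (simp add: simple_rep_iff)
next
  case (Cons p xs)
  then obtain zs where zs: "simple_rep R zs" "\<And>s. simple_fun zs s = simple_fun xs s"
    "\<And>A. A \<in> sets lam \<Longrightarrow> AE w in P. sint A zs w = sint A xs w" by auto
  from refine_insert[OF zs(1), of "snd p" "fst p"] Cons.prems obtain us where us: "simple_rep R us"
    "\<And>s. simple_fun us s = fst p * indicator (snd p) s + simple_fun zs s"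
    "\<And>A. A \<in> sets lam \<Longrightarrow> AE w in P. sint A us w = fst p * \<Lambda> (A \<inter> snd p) w + sint A zs w"
    by auto
  have "AE w in P. sint A us w = sint A (p # xs) w" if "A \<in> sets lam" for A
    using us(3)[OF that] zs(3)[OF that] by eventually_elim simp
  then show ?case using us zs(2) by (intro exI[of _ us]) auto
qed

lemma simple_lincomb:
  assumes xs: "simple_rep R xs" and ys: "simple_rep R ys"
  shows "\<exists>zs. simple_rep R zs \<and> (\<forall>s. simple_fun zs s = \<alpha> * simple_fun xs s + \<beta> * simple_fun ys s) \<and>
    (\<forall>A\<in>sets lam. AE w in P. sint A zs w = \<alpha> * sint A xs w + \<beta> * sint A ys w)"
proof -
  \<comment> \<open>The scaled lists are concatenated; their sets may overlap, which
    \<open>refine_rep\<close> repairs.\<close>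
  let ?sc = "\<lambda>c. map (\<lambda>p. (c * fst p, snd p))"
  have "simple_fun (?sc c us) s = c * simple_fun us s" for c us and s :: 's
    by (induction us) (simp_all add: algebra_simps)
  moreover have "sint A (?sc c us) w = c * sint A us w" for c us A w
    by (induction us) (simp_all add: algebra_simps)
  moreover have "\<forall>p\<in>set (?sc \<alpha> xs @ ?sc \<beta> ys). snd p \<in> R"
    using xs ys by (auto simp: simple_rep_iff)
  ultimately show ?thesis using refine_rep[of "?sc \<alpha> xs @ ?sc \<beta> ys"] by simp
qed

lemma simple_integral_split:
  assumes A: "A \<in> sets lam" and xs: "simple_rep R xs"
  shows "AE w in P. sint S xs w = sint A xs w + sint (S - A) xs w"
proof -
  have SA: "S - A \<in> sets lam" using A S_sets by simp
  have "\<forall>p\<in>set xs. snd p \<in> R" using xs by (simp add: simple_rep_iff)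
  then show ?thesis
  proof (induction xs)
    case (Cons p xs)
    have p: "snd p \<in> R" using Cons.prems by simp
    have "A \<inter> snd p \<union> (S - A) \<inter> snd p = S \<inter> snd p" "(A \<inter> snd p) \<inter> ((S - A) \<inter> snd p) = {}"
      using sets.sets_into_space[OF A] space_lam by blast+
    with Lam_Un[OF sets_Int_R[OF A p] sets_Int_R[OF SA p]]
    have "AE w in P. \<Lambda> (S \<inter> snd p) w = \<Lambda> (A \<inter> snd p) w + \<Lambda> ((S - A) \<inter> snd p) w" by simp
    moreover have "AE w in P. sint S xs w = sint A xs w + sint (S - A) xs w"
      using Cons by simp
    ultimately show ?case by eventually_elim (simp add: algebra_simps)
  qed simp
qed

section \<open>Finiteness of the modular with exponent 0 on simple functions\<close>

lemma Phi_fun_zero_finite: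
  assumes C: "C \<in> R" and u: "0 \<le> u"
  shows "(\<integral>\<^sup>+s. Phi 0 u s * indicator C s \<partial>lam) < \<infinity>"
proof -
  let ?c = "ennreal (2 + u + 2 * u\<^sup>2)" and ?w = "\<lambda>s. \<integral>\<^sup>+x. ennreal (wgt x) \<partial>qlt_abs (\<rho> s)"
  have Cs [measurable]: "C \<in> sets lam" using C R_sets by auto
  have w [measurable]: "?w \<in> borel_measurable lam"
    using measurable_abs_kernel[of "\<lambda>_. 1" "\<lambda>x. ennreal (wgt x)"] by simp
  have "set_integrable lam C a" "set_integrable lam C \<sigma>2"
    using chars C by (auto simp: qid_characteristics_def)
  then have "(\<integral>\<^sup>+s. ennreal \<bar>a s\<bar> * indicator C s \<partial>lam) < \<infinity>" "(\<integral>\<^sup>+s. ennreal \<bar>\<sigma>2 s\<bar> * indicator C s \<partial>lam) < \<infinity>"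
    by (auto simp: set_integrable_def integrable_iff_bounded abs_mult indicator_mult_ennreal mult.commute nn_integral_set_ennreal)
  moreover have "(\<integral>\<^sup>+s. ennreal (\<sigma>2 s) * indicator C s \<partial>lam) \<le> (\<integral>\<^sup>+s. ennreal \<bar>\<sigma>2 s\<bar> * indicator C s \<partial>lam)"
    by (intro nn_integral_mono mult_right_mono ennreal_leI) auto
  ultimately have fin: "(\<integral>\<^sup>+s. ennreal \<bar>a s\<bar> * indicator C s \<partial>lam) < \<infinity>" "(\<integral>\<^sup>+s. ennreal (\<sigma>2 s) * indicator C s \<partial>lam) < \<infinity>"
    by (auto intro: le_less_trans)
  have "(\<integral>\<^sup>+s. Phi 0 u s * indicator C s \<partial>lam)
      \<le> (\<integral>\<^sup>+s. ?c * (ennreal \<bar>a s\<bar> * indicator C s + ennreal (\<sigma>2 s) * indicator C s + ?w s * indicator C s) \<partial>lam)"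
  proof (rule nn_integral_mono)
    fix s assume s: "s \<in> space lam"
    show "Phi 0 u s * indicator C s
      \<le> ?c * (ennreal \<bar>a s\<bar> * indicator C s + ennreal (\<sigma>2 s) * indicator C s + ?w s * indicator C s)"
    proof (cases "s \<in> C")
      case True
      then show ?thesis
        using Phi_fun_zero_exponent_bound[where \<rho>=\<rho> and s=s and \<sigma>=\<sigma>2 and a=a, OF qlt_space[OF s] sigma2_nonneg[OF s] u] by simp
    qed simp
  qed
  also have "\<dots> = ?c * ((\<integral>\<^sup>+s. ennreal \<bar>a s\<bar> * indicator C s \<partial>lam) + (\<integral>\<^sup>+s. ennreal (\<sigma>2 s) * indicator C s \<partial>lam) + (\<integral>\<^sup>+s. ?w s * indicator C s \<partial>lam))"
    by (subst nn_integral_cmult, measurable, subst nn_integral_add, measurable, subst nn_integral_add, measurable)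
  also have "\<dots> < \<infinity>"
    using fin weight_finite[OF C] by (simp add: ennreal_mult_less_top)
  finally show ?thesis .
qed

lemma modular_zero_simple_finite:
  assumes xs: "simple_rep R xs"
  shows "modular 0 (simple_fun xs) < \<infinity>"
proof -
  \<comment> \<open>A crude bound for the modulus, chosen because it follows by induction on the
    list without reference to disjointness.\<close>
  define M where "M = (\<Sum>p\<leftarrow>xs. \<bar>fst p\<bar>)"
  define C where "C = (\<Union>p\<in>set xs. snd p)"
  have C: "C \<in> R" unfolding C_def using xs by (intro R.finite_UN) (auto simp: simple_rep_iff)
  have M0: "0 \<le> M" unfolding M_def by (intro sum_list_nonneg) auto
  have b: "\<bar>simple_fun xs s\<bar> \<le> M * indicator C s" for s
    unfolding M_def C_def
  proof (induction xs)
    case (Cons p xs)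
    have n: "0 \<le> (\<Sum>p\<leftarrow>xs. \<bar>fst p\<bar>)" by (intro sum_list_nonneg) auto
    have "\<bar>simple_fun (p # xs) s\<bar> \<le> \<bar>fst p\<bar> * indicator (snd p) s + \<bar>simple_fun xs s\<bar>"
      using abs_triangle_ineq[of "fst p"] by (simp add: indicator_def)
    also have "\<dots> \<le> \<bar>fst p\<bar> * indicator (snd p) s + (\<Sum>p\<leftarrow>xs. \<bar>fst p\<bar>) * indicator (\<Union>p\<in>set xs. snd p) s"
      using Cons.IH by simp
    also have "\<dots> \<le> (\<Sum>p\<leftarrow>p # xs. \<bar>fst p\<bar>) * indicator (\<Union>p\<in>set (p # xs). snd p) s"
      using n by (auto simp: indicator_def)
    finally show ?case .
  qed simp
  have "modular 0 (simple_fun xs) \<le> (\<integral>\<^sup>+s. Phi 0 M s * indicator C s \<partial>lam)"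
    unfolding modular_def
  proof (rule nn_integral_mono)
    fix s assume s: "s \<in> space lam"
    have "Phi 0 \<bar>simple_fun xs s\<bar> s \<le> Phi 0 (M * indicator C s) s"
      using b by (intro Phi_fun_mono sigma2_nonneg s) auto
    also have "\<dots> = Phi 0 M s * indicator C s" by (simp add: indicator_def Phi_fun_zero)
    finally show "Phi 0 \<bar>simple_fun xs s\<bar> s \<le> Phi 0 M s * indicator C s" .
  qed
  also have "\<dots> < \<infinity>" by (rule Phi_fun_zero_finite[OF C M0])
  finally show ?thesis .
qed

end

section \<open>Uniqueness of the stochastic integral\<close>

context qid_core
begin

lemma Phi_fun_zero_less_top:
  assumes s: "s \<in> space lam" and u: "0 \<le> u"
  shows "Phi 0 u s < \<infinity>"
proof -
  have "Phi 0 u s \<le> ennreal (2 + u + 2 * u\<^sup>2) *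
      (ennreal \<bar>a s\<bar> + ennreal (\<sigma>2 s) + wint (qlt_abs (\<rho> s)))"
    using Phi_fun_zero_exponent_bound[where \<rho>=\<rho> and s=s and \<sigma>=\<sigma>2 and a=a, OF qlt_space[OF s] sigma2_nonneg[OF s] u] .
  also have "\<dots> < \<infinity>"
    using qlt_space[OF s] by (simp add: quasi_levy_type_def ennreal_mult_less_top)
  finally show ?thesis .
qed

lemma eventually_le_power:
  fixes f :: "nat \<Rightarrow> ennreal"
  assumes "f \<longlonglongrightarrow> 0"
  shows "\<exists>N. \<forall>n\<ge>N. f n \<le> ennreal ((1 / 2) ^ j)"
proof -
  have "eventually (\<lambda>n. f n < ennreal ((1 / 2) ^ j)) sequentially"
    by (rule order_tendstoD(2)[OF assms]) simp
  then show ?thesis by (auto simp: eventually_sequentially intro: less_imp_le)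
qed

text \<open>
  A gliding hump argument: along a subsequence of the simple functions the mass sits up to
  \<open>2\<^sup>-\<^sup>j\<close> on disjoint sets \<open>D j\<close>, so that the integrals over the union of the \<open>D j\<close> with even
  \<open>j\<close> vanish along the odd \<open>j\<close>, and those over its complement along the even \<open>j\<close>.
\<close>

lemma simple_null_vanishes:
  assumes zs: "\<And>n. simple_rep R (zs n)" and ae: "AE s in lam. (\<lambda>n. simple_fun (zs n) s) \<longlonglongrightarrow> 0"
    and lim: "\<And>A. A \<in> sets lam \<Longrightarrow> \<exists>Y\<in>borel_measurable P. (\<lambda>n. pd P (\<lambda>w. sint A (zs n) w - Y w)) \<longlonglongrightarrow> 0"
  shows "(\<lambda>n. pd P (sint S (zs n))) \<longlonglongrightarrow> 0"
proof -
  obtain Sn :: "nat \<Rightarrow> 's set" where Sn: "range Sn \<subseteq> R" "incseq Sn" "(\<Union>n. Sn n) = S"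
    using chars by (auto simp: qid_characteristics_def qid_random_measure_def)
  define h where "h n = simple_fun (zs n)" for n
  have h [measurable]: "h n \<in> borel_measurable lam" for n
    unfolding h_def by (rule simple_fun_measurable[OF zs])
  \<comment> \<open>Points at which all functions from index \<open>k\<close> on are bounded by 1.
    By pointwise convergence these sets exhaust the space up to a null set.\<close>
  define T where "T k = {s \<in> space lam. \<forall>n. k \<le> n \<longrightarrow> \<bar>h n s\<bar> \<le> 1}" for k
  have T [measurable]: "T k \<in> sets lam" for k unfolding T_def by measurable
  \<comment> \<open>Intersecting with \<open>Sn k\<close> puts the set into \<open>R\<close>, over
    which the density with exponent 0 at the value 1 is integrable; this is the domination on
    \<open>G k\<close>.\<close>
  define G where "G k = T k \<inter> Sn k" for k
  have GR: "G k \<in> R" for k unfolding G_def by (rule sets_Int_R[OF T]) (use Sn in auto)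
  then have G [measurable]: "G k \<in> sets lam" for k using R_sets by auto
  have Gm: "G k \<subseteq> G l" if "k \<le> l" for k l
    using monoD[OF Sn(2) that] that unfolding G_def T_def by auto
  define \<mu> where "\<mu> n A = modular 0 (\<lambda>s. indicator A s * h n s)" for n A
  \<comment> \<open>The bound by 1 holds on \<open>G k\<close> only from index \<open>k\<close> on,
    hence the offset.\<close>
  have \<mu>1: "(\<lambda>n. \<mu> n (G k)) \<longlonglongrightarrow> 0" for k
  proof (rule LIMSEQ_offset)
    have "(\<lambda>n. \<integral>\<^sup>+s. Phi 0 \<bar>indicator (G k) s * h (n + k) s\<bar> s \<partial>lam) \<longlonglongrightarrow> (\<integral>\<^sup>+s. 0 \<partial>lam)"
    proof (rule nn_integral_dominated_convergence)
      show "(\<lambda>s. Phi 0 \<bar>indicator (G k) s * h (n + k) s\<bar> s) \<in> borel_measurable lam" for n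
        by (rule Phi_fun_measurable) measurable
      have "(\<lambda>s. Phi 0 \<bar>1\<bar> s) \<in> borel_measurable lam" by (rule Phi_fun_measurable) simp
      then show "(\<lambda>s. Phi 0 1 s * indicator (G k) s) \<in> borel_measurable lam" by simp
      show "(\<integral>\<^sup>+s. Phi 0 1 s * indicator (G k) s \<partial>lam) < \<infinity>"
        by (rule Phi_fun_zero_finite[OF GR]) simp
      have b: "\<bar>indicator (G k) s * h (n + k) s\<bar> \<le> 1" for s n
        by (auto simp: G_def T_def indicator_def)
      show "AE s in lam. Phi 0 \<bar>indicator (G k) s * h (n + k) s\<bar> s \<le> Phi 0 1 s * indicator (G k) s" for n
      proof (rule AE_I2)
        fix s assume s: "s \<in> space lam"
        show "Phi 0 \<bar>indicator (G k) s * h (n + k) s\<bar> s \<le> Phi 0 1 s * indicator (G k) s"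
        proof (cases "s \<in> G k")
          case True
          then have "Phi 0 \<bar>indicator (G k) s * h (n + k) s\<bar> s \<le> Phi 0 1 s"
            by (intro Phi_fun_mono b sigma2_nonneg s) auto
          then show ?thesis using True by simp
        qed (simp add: Phi_fun_zero)
      qed
      show "AE s in lam. (\<lambda>n. Phi 0 \<bar>indicator (G k) s * h (n + k) s\<bar> s) \<longlonglongrightarrow> 0"
        using ae AE_space
      proof eventually_elim
        fix s assume l: "(\<lambda>n. simple_fun (zs n) s) \<longlonglongrightarrow> 0" and s: "s \<in> space lam"
        have "(\<lambda>n. h (n + k) s) \<longlonglongrightarrow> 0" unfolding h_def by (rule LIMSEQ_ignore_initial_segment[OF l])
        from tendsto_mult_right_zero[OF this, of "indicator (G k) s"]
        have "(\<lambda>n. indicator (G k) s * h (n + k) s) \<longlonglongrightarrow> 0" .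
        from Phi_fun_tendsto_0[where \<rho>=\<rho> and s=s and \<sigma>=\<sigma>2 and p=0 and v=1, OF qlt_space[OF s] order_refl sigma2_nonneg[OF s] this b Phi_fun_zero_less_top[OF s]]
        show "(\<lambda>n. Phi 0 \<bar>indicator (G k) s * h (n + k) s\<bar> s) \<longlonglongrightarrow> 0" by simp
      qed
    qed simp
    then show "(\<lambda>n. \<mu> (n + k) (G k)) \<longlonglongrightarrow> 0" by (simp add: \<mu>_def modular_def)
  qed
  have \<mu>2: "(\<lambda>k. \<mu> n (S - G k)) \<longlonglongrightarrow> 0" for n
  proof -
    have "(\<lambda>k. \<integral>\<^sup>+s. Phi 0 \<bar>indicator (S - G k) s * h n s\<bar> s \<partial>lam) \<longlonglongrightarrow> (\<integral>\<^sup>+s. 0 \<partial>lam)"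
    proof (rule nn_integral_dominated_convergence)
      note [measurable] = S_sets
      show "(\<lambda>s. Phi 0 \<bar>indicator (S - G k) s * h n s\<bar> s) \<in> borel_measurable lam" for k
        by (rule Phi_fun_measurable) measurable
      show "(\<lambda>s. Phi 0 \<bar>h n s\<bar> s) \<in> borel_measurable lam" by (rule Phi_fun_measurable) measurable
      show "(\<integral>\<^sup>+s. Phi 0 \<bar>h n s\<bar> s \<partial>lam) < \<infinity>"
        using modular_zero_simple_finite[OF zs] by (simp add: modular_def h_def)
      show "AE s in lam. Phi 0 \<bar>indicator (S - G k) s * h n s\<bar> s \<le> Phi 0 \<bar>h n s\<bar> s" for k
        by (intro AE_I2 Phi_fun_mono sigma2_nonneg) (auto simp: indicator_def)
      show "AE s in lam. (\<lambda>k. Phi 0 \<bar>indicator (S - G k) s * h n s\<bar> s) \<longlonglongrightarrow> 0"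
        using ae AE_space
      proof eventually_elim
        fix s assume l: "(\<lambda>n. simple_fun (zs n) s) \<longlonglongrightarrow> 0" and s: "s \<in> space lam"
        from LIMSEQ_D[OF l, of 1] obtain k0 where k0: "\<And>n. n \<ge> k0 \<Longrightarrow> \<bar>h n s\<bar> < 1"
          by (auto simp: h_def)
        obtain k1 where k1: "s \<in> Sn k1" using s space_lam Sn(3) by blast
        have "indicator (S - G k) s * h n s = 0" if "max k0 k1 \<le> k" for k
        proof -
          have "s \<in> Sn k" using monoD[OF Sn(2), of k1 k] k1 that by auto
          moreover have "s \<in> T k" using s k0 that by (auto simp: T_def intro: less_imp_le)
          ultimately show ?thesis by (simp add: G_def)
        qed
        then have "eventually (\<lambda>k. Phi 0 \<bar>indicator (S - G k) s * h n s\<bar> s = 0) sequentially"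
          by (intro eventually_sequentiallyI[of "max k0 k1"]) (simp only: abs_zero Phi_fun_zero)
        then show "(\<lambda>k. Phi 0 \<bar>indicator (S - G k) s * h n s\<bar> s) \<longlonglongrightarrow> 0"
          by (rule tendsto_eventually)
      qed
    qed simp
    then show ?thesis by (simp add: \<mu>_def modular_def)
  qed
  \<comment> \<open>The pairs consist of a function index and an index into the sets
    \<open>G\<close>. A function with large index has little modular on the current set by the first
    limit, and a later set then captures nearly all of its modular by the second.\<close>
  have "\<exists>x :: nat \<Rightarrow> nat \<times> nat. \<forall>j. \<mu> (fst (x j)) (S - G (snd (x j))) \<le> ennreal ((1 / 2) ^ j) \<and>
      (fst (x j) < fst (x (Suc j)) \<and> snd (x j) \<le> snd (x (Suc j)) \<and> \<mu> (fst (x (Suc j))) (G (snd (x j))) \<le> ennreal ((1 / 2) ^ j))"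
  proof (rule dependent_nat_choice)
    show "\<exists>x. \<mu> (fst x) (S - G (snd x)) \<le> ennreal ((1 / 2) ^ 0)"
      using eventually_le_power[OF \<mu>2, of 0 0] by auto
  next
    fix x :: "nat \<times> nat" and j
    from eventually_le_power[OF \<mu>1, of "snd x" j] obtain N where N: "\<forall>n\<ge>N. \<mu> n (G (snd x)) \<le> ennreal ((1 / 2) ^ j)" by blast
    define n where "n = max N (Suc (fst x))"
    from eventually_le_power[OF \<mu>2, of n "Suc j"] obtain K where K: "\<forall>k\<ge>K. \<mu> n (S - G k) \<le> ennreal ((1 / 2) ^ Suc j)" by blast
    show "\<exists>y. \<mu> (fst y) (S - G (snd y)) \<le> ennreal ((1 / 2) ^ Suc j) \<and>
      (fst x < fst y \<and> snd x \<le> snd y \<and> \<mu> (fst y) (G (snd x)) \<le> ennreal ((1 / 2) ^ j))"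
      using N K by (intro exI[of _ "(n, max K (snd x))"]) (auto simp: n_def)
  qed
  then obtain x :: "nat \<Rightarrow> nat \<times> nat" where x: "\<And>j. \<mu> (fst (x j)) (S - G (snd (x j))) \<le> ennreal ((1 / 2) ^ j)"
    "\<And>j. fst (x j) < fst (x (Suc j))" "\<And>j. snd (x j) \<le> snd (x (Suc j))"
    "\<And>j. \<mu> (fst (x (Suc j))) (G (snd (x j))) \<le> ennreal ((1 / 2) ^ j)" by blast
  \<comment> \<open>The shift by one places function \<open>m j\<close> between the sets
    \<open>H j\<close> and \<open>H (Suc j)\<close>, so that it lives essentially on their
    difference \<open>D j\<close>.\<close>
  define m where "m j = fst (x (Suc j))" for j
  define H where "H j = G (snd (x j))" for j
  have Hm: "H i \<subseteq> H j" if "i \<le> j" for i j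
    using lift_Suc_mono_le[of "\<lambda>j. snd (x j)" i j] x(3) that by (auto simp: H_def intro!: Gm)
  have H [measurable]: "H j \<in> sets lam" for j by (simp add: H_def)
  have m: "strict_mono m" unfolding m_def by (rule strict_monoI_Suc) (rule x(2))
  define D where "D j = H (Suc j) - H j" for j
  have D [measurable]: "D j \<in> sets lam" for j by (simp add: D_def)
  have Ddis: "D i \<inter> D j = {}" if "i \<noteq> j" for i j
  proof -
    have *: "D i \<inter> D j = {}" if "i < j" for i j using Hm[of "Suc i" j] that by (auto simp: D_def)
    show ?thesis using *[of i j] *[of j i] \<open>i \<noteq> j\<close> by (cases "i < j") auto
  qed
  let ?C = "ennreal (8 * 2 powr 0)"
  \<comment> \<open>Outside \<open>D j\<close> there remain a part inside \<open>H j\<close> and a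
    part outside \<open>H (Suc j)\<close>, each at most \<open>(1 / 2) ^ j\<close>; the constant of
    \<open>modular_add\<close> for exponent 0 is 8, so 16 results.\<close>
  have \<mu>D: "\<mu> (m j) (S - D j) \<le> ennreal (16 * (1 / 2) ^ j)" for j
  proof -
    have "\<mu> (m j) (S - D j) \<le> modular 0 (\<lambda>s. indicator (H j) s * h (m j) s + indicator (S - H (Suc j)) s * h (m j) s)"
      unfolding \<mu>_def
    proof (intro modular_mono AE_I2)
      fix s
      show "\<bar>indicator (S - D j) s * h (m j) s\<bar> \<le> \<bar>indicator (H j) s * h (m j) s + indicator (S - H (Suc j)) s * h (m j) s\<bar>"
        using Hm[of j "Suc j"] by (auto simp: D_def indicator_def)
    qed simp
    also have "\<dots> \<le> ?C * (\<mu> (m j) (H j) + \<mu> (m j) (S - H (Suc j)))"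
      unfolding \<mu>_def using S_sets by (intro modular_add) auto
    also have "\<dots> \<le> ?C * (ennreal ((1 / 2) ^ j) + ennreal ((1 / 2) ^ Suc j))"
      unfolding m_def H_def by (intro mult_left_mono add_mono x) simp
    also have "\<dots> \<le> ?C * (ennreal ((1 / 2) ^ j) + ennreal ((1 / 2) ^ j))"
      by (intro mult_left_mono add_mono ennreal_leI) auto
    also have "\<dots> = ennreal (16 * (1 / 2) ^ j)"
    proof -
      have "?C * (ennreal u + ennreal u) = ennreal (8 * 2 powr 0 * (u + u))" if "0 \<le> u" for u
        using that by (simp only: ennreal_mult ennreal_plus zero_le_numeral mult_nonneg_nonneg add_nonneg_nonneg powr_ge_zero)
      from this[of "(1 / 2) ^ j"] show ?thesis by simp
    qed
    finally show ?thesis .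
  qed
  \<comment> \<open>Over a set that misses the humps \<open>D (r i)\<close> the integrals vanish
    along a subsequence. The limit in probability exists along the whole sequence by assumption, so
    it is 0 and the whole sequence vanishes.\<close>
  have vanish: "(\<lambda>n. pd P (sint A (zs n))) \<longlonglongrightarrow> 0"
    if A [measurable]: "A \<in> sets lam" and r: "strict_mono r" and AD: "\<And>i. A \<inter> D (r i) = {}" for A and r :: "nat \<Rightarrow> nat"
  proof -
    have AS: "A \<subseteq> S" using sets.sets_into_space[OF A] space_lam by simp
    from lim[OF A] obtain Y where Y [measurable]: "Y \<in> borel_measurable P"
      and Yl: "(\<lambda>n. pd P (\<lambda>w. sint A (zs n) w - Y w)) \<longlonglongrightarrow> 0" by blast
    have me [measurable]: "sint A (zs n) \<in> borel_measurable P" for n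
      by (rule simple_integral_measurable'[OF A zs])
    have b: "modular 0 (simple_fun (restrict_rep A (zs (m (r i))))) \<le> ennreal (16 * (1 / 2) ^ r i)" for i
    proof -
      have "modular 0 (simple_fun (restrict_rep A (zs (m (r i))))) \<le> \<mu> (m (r i)) (S - D (r i))"
        unfolding \<mu>_def using AD[of i] AS
        by (intro modular_mono AE_I2) (auto simp: simple_fun_restrict h_def indicator_def)
      also note \<mu>D
      finally show ?thesis .
    qed
    have "(\<lambda>j. 16 * (1 / 2) ^ j :: real) \<longlonglongrightarrow> 16 * 0"
      by (intro tendsto_intros LIMSEQ_power_zero) simp
    from LIMSEQ_subseq_LIMSEQ[OF tendsto_ennrealI[OF this] r]
    have "(\<lambda>i. ennreal (16 * (1 / 2) ^ r i)) \<longlonglongrightarrow> 0" by (simp add: o_def)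
    then have "(\<lambda>i. modular 0 (simple_fun (restrict_rep A (zs (m (r i)))))) \<longlonglongrightarrow> 0"
      by (rule ennreal_squeeze_zero[OF b])
    from tendsto_pd_simple[OF simple_rep_restrict[OF A zs] order_refl this]
    have 0: "(\<lambda>i. pd P (\<lambda>w. sint A (zs (m (r i))) w - 0)) \<longlonglongrightarrow> 0"
      by (simp add: simple_integral_restrict[OF A])
    have "strict_mono (\<lambda>i. m (r i))" using strict_mono_compose[OF m r] .
    from LIMSEQ_subseq_LIMSEQ[OF Yl this]
    have "(\<lambda>i. pd P (\<lambda>w. sint A (zs (m (r i))) w - Y w)) \<longlonglongrightarrow> 0" by (simp add: o_def)
    from P.pd_limit_unique[OF me Y _ this 0] have "AE w in P. Y w = 0" by simp
    then have "pd P (\<lambda>w. sint A (zs n) w - Y w) = pd P (sint A (zs n))" for n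
      by (intro P.pd_cong_AE) auto
    with Yl show ?thesis by simp
  qed
  define B where "B = (\<Union>i. D (2 * i))"
  have B: "B \<in> sets lam" unfolding B_def by measurable
  then have SB: "S - B \<in> sets lam" using S_sets by simp
  have 1: "(\<lambda>n. pd P (sint B (zs n))) \<longlonglongrightarrow> 0"
  proof (rule vanish[OF B, of "\<lambda>i. 2 * i + 1"])
    show "B \<inter> D (2 * i + 1) = {}" for i
    proof -
      have "2 * j \<noteq> 2 * i + 1" for j by presburger
      then show ?thesis unfolding B_def using Ddis by blast
    qed
  qed (simp add: strict_mono_def)
  have 2: "(\<lambda>n. pd P (sint (S - B) (zs n))) \<longlonglongrightarrow> 0"
    by (rule vanish[OF SB, of "\<lambda>i. 2 * i"]) (auto simp: strict_mono_def B_def)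
  have "pd P (sint S (zs n)) \<le> pd P (sint B (zs n)) + pd P (sint (S - B) (zs n))" for n
  proof -
    have "pd P (sint S (zs n)) = pd P (\<lambda>w. sint B (zs n) w + sint (S - B) (zs n) w)"
      by (rule P.pd_cong_AE[OF simple_integral_split[OF B zs]])
    also have "\<dots> \<le> pd P (sint B (zs n)) + pd P (sint (S - B) (zs n))"
      by (intro P.pd_triangle simple_integral_measurable' B SB zs)
    finally show ?thesis .
  qed
  moreover have "(\<lambda>n. pd P (sint B (zs n)) + pd P (sint (S - B) (zs n))) \<longlonglongrightarrow> 0"
    using tendsto_add[OF 1 2] by simp
  ultimately show ?thesis by (rule ennreal_squeeze_zero)
qed

section \<open>Independence of the approximating sequence and linearity of the integral\<close>

lemma approximates_rm_iff:
  "approx \<phi> f \<longleftrightarrow> (\<forall>n. simple_rep R (\<phi> n)) \<and> (AE s in lam. (\<lambda>n. simple_fun (\<phi> n) s) \<longlonglongrightarrow> f s) \<and>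
    (\<forall>A\<in>sets lam. \<exists>Y\<in>borel_measurable P. (\<lambda>n. pd P (\<lambda>w. sint A (\<phi> n) w - Y w)) \<longlonglongrightarrow> 0)"
proof -
  have "tendsto_in_prob P (\<lambda>n. sint A (\<phi> n)) Y \<longleftrightarrow> (\<lambda>n. pd P (\<lambda>w. sint A (\<phi> n) w - Y w)) \<longlonglongrightarrow> 0"
    if "\<forall>n. simple_rep R (\<phi> n)" "A \<in> sets lam" "Y \<in> borel_measurable P" for A Y
    using that by (intro P.tendsto_in_prob_iff_pd simple_integral_measurable') auto
  then show ?thesis unfolding approximates_rm_def by blast
qed

lemma approximates_lincomb:
  assumes \<phi>: "approx \<phi> f" and \<psi>: "approx \<psi> g"
  shows "\<exists>zs. approx zs (\<lambda>s. \<alpha> * f s + \<beta> * g s) \<and>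
    (\<forall>n. AE w in P. sint S (zs n) w = \<alpha> * sint S (\<phi> n) w + \<beta> * sint S (\<psi> n) w)"
proof -
  have r: "simple_rep R (\<phi> n)" "simple_rep R (\<psi> n)" for n using \<phi> \<psi> by (auto simp: approximates_rm_iff)
  have "\<forall>n. \<exists>zs. simple_rep R zs \<and> (\<forall>s. simple_fun zs s = \<alpha> * simple_fun (\<phi> n) s + \<beta> * simple_fun (\<psi> n) s) \<and>
    (\<forall>A\<in>sets lam. AE w in P. sint A zs w = \<alpha> * sint A (\<phi> n) w + \<beta> * sint A (\<psi> n) w)"
    using simple_lincomb[OF r(1) r(2)] by blast
  then obtain zs where zs: "\<forall>n. simple_rep R (zs n) \<and> (\<forall>s. simple_fun (zs n) s = \<alpha> * simple_fun (\<phi> n) s + \<beta> * simple_fun (\<psi> n) s) \<and>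
    (\<forall>A\<in>sets lam. AE w in P. sint A (zs n) w = \<alpha> * sint A (\<phi> n) w + \<beta> * sint A (\<psi> n) w)"
    using choice[of "\<lambda>n zs. simple_rep R zs \<and> (\<forall>s. simple_fun zs s = \<alpha> * simple_fun (\<phi> n) s + \<beta> * simple_fun (\<psi> n) s) \<and>
    (\<forall>A\<in>sets lam. AE w in P. sint A zs w = \<alpha> * sint A (\<phi> n) w + \<beta> * sint A (\<psi> n) w)"] by blast
  have l: "AE s in lam. (\<lambda>n. simple_fun (\<phi> n) s) \<longlonglongrightarrow> f s" "AE s in lam. (\<lambda>n. simple_fun (\<psi> n) s) \<longlonglongrightarrow> g s"
    using \<phi> \<psi> by (auto simp: approximates_rm_iff)
  have "AE s in lam. (\<lambda>n. simple_fun (zs n) s) \<longlonglongrightarrow> \<alpha> * f s + \<beta> * g s"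
    using l
  proof eventually_elim
    fix s assume "(\<lambda>n. simple_fun (\<phi> n) s) \<longlonglongrightarrow> f s" "(\<lambda>n. simple_fun (\<psi> n) s) \<longlonglongrightarrow> g s"
    then have "(\<lambda>n. \<alpha> * simple_fun (\<phi> n) s + \<beta> * simple_fun (\<psi> n) s) \<longlonglongrightarrow> \<alpha> * f s + \<beta> * g s"
      by (intro tendsto_intros)
    then show "(\<lambda>n. simple_fun (zs n) s) \<longlonglongrightarrow> \<alpha> * f s + \<beta> * g s" using zs by simp
  qed
  moreover have "\<exists>Y\<in>borel_measurable P. (\<lambda>n. pd P (\<lambda>w. sint A (zs n) w - Y w)) \<longlonglongrightarrow> 0"
    if A: "A \<in> sets lam" for A
  proof -
    obtain Y Z where Y [measurable]: "Y \<in> borel_measurable P" and Z [measurable]: "Z \<in> borel_measurable P"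
      and YZ: "(\<lambda>n. pd P (\<lambda>w. sint A (\<phi> n) w - Y w)) \<longlonglongrightarrow> 0"
        "(\<lambda>n. pd P (\<lambda>w. sint A (\<psi> n) w - Z w)) \<longlonglongrightarrow> 0"
      using \<phi> \<psi> A unfolding approximates_rm_iff by blast
    have "(\<lambda>n. pd P (\<lambda>w. (\<alpha> * sint A (\<phi> n) w + \<beta> * sint A (\<psi> n) w) - (\<alpha> * Y w + \<beta> * Z w))) \<longlonglongrightarrow> 0"
      by (intro P.pd_tendsto_lincomb simple_integral_measurable' A r Y Z YZ)
    moreover have "pd P (\<lambda>w. sint A (zs n) w - (\<alpha> * Y w + \<beta> * Z w)) =
        pd P (\<lambda>w. (\<alpha> * sint A (\<phi> n) w + \<beta> * sint A (\<psi> n) w) - (\<alpha> * Y w + \<beta> * Z w))" for n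
    proof (rule P.pd_cong_AE)
      have "AE w in P. sint A (zs n) w = \<alpha> * sint A (\<phi> n) w + \<beta> * sint A (\<psi> n) w"
        using zs A by blast
      then show "AE w in P. sint A (zs n) w - (\<alpha> * Y w + \<beta> * Z w) =
        (\<alpha> * sint A (\<phi> n) w + \<beta> * sint A (\<psi> n) w) - (\<alpha> * Y w + \<beta> * Z w)"
        by eventually_elim simp
    qed
    ultimately have "(\<lambda>n. pd P (\<lambda>w. sint A (zs n) w - (\<alpha> * Y w + \<beta> * Z w))) \<longlonglongrightarrow> 0" by simp
    moreover have "(\<lambda>w. \<alpha> * Y w + \<beta> * Z w) \<in> borel_measurable P" by measurable
    ultimately show ?thesis by (intro bexI[of _ "\<lambda>w. \<alpha> * Y w + \<beta> * Z w"])
  qed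
  ultimately show ?thesis using zs S_sets unfolding approximates_rm_iff by (intro exI[of _ zs]) blast
qed

text \<open>The difference of the two sequences approximates 0, and the gliding hump argument
  applies to it.\<close>

lemma approximates_limit_unique:
  assumes \<phi>: "approx \<phi> f" and \<psi>: "approx \<psi> f"
    and Y [measurable]: "Y \<in> borel_measurable P" and Z [measurable]: "Z \<in> borel_measurable P"
    and YZ: "(\<lambda>n. pd P (\<lambda>w. sint S (\<phi> n) w - Y w)) \<longlonglongrightarrow> 0"
      "(\<lambda>n. pd P (\<lambda>w. sint S (\<psi> n) w - Z w)) \<longlonglongrightarrow> 0"
  shows "AE w in P. Y w = Z w"
proof -
  from approximates_lincomb[OF \<phi> \<psi>, of 1 "-1"] obtain zs where zs: "approx zs (\<lambda>s. 0)"
    and z: "\<And>n. AE w in P. sint S (zs n) w = 1 * sint S (\<phi> n) w + (-1) * sint S (\<psi> n) w"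
    by auto
  have r: "simple_rep R (\<phi> n)" "simple_rep R (\<psi> n)" "simple_rep R (zs n)" for n using \<phi> \<psi> zs by (auto simp: approximates_rm_iff)
  have m [measurable]: "sint S (\<phi> n) \<in> borel_measurable P" "sint S (\<psi> n) \<in> borel_measurable P"
    "sint S (zs n) \<in> borel_measurable P" for n
    by (intro simple_integral_measurable r)+
  have 0: "(\<lambda>n. pd P (\<lambda>w. sint S (zs n) w - 0)) \<longlonglongrightarrow> 0"
    using zs unfolding approximates_rm_iff by (simp add: simple_null_vanishes)
  have "(\<lambda>n. pd P (\<lambda>w. (1 * sint S (\<phi> n) w + (-1) * sint S (\<psi> n) w) - (1 * Y w + (-1) * Z w))) \<longlonglongrightarrow> 0"
    by (intro P.pd_tendsto_lincomb m Y Z YZ)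
  moreover have "pd P (\<lambda>w. (1 * sint S (\<phi> n) w + (-1) * sint S (\<psi> n) w) - (1 * Y w + (-1) * Z w)) =
      pd P (\<lambda>w. sint S (zs n) w - (Y w - Z w))" for n
    using z[of n] by (intro P.pd_cong_AE) (auto elim!: eventually_mono)
  ultimately have "(\<lambda>n. pd P (\<lambda>w. sint S (zs n) w - (Y w - Z w))) \<longlonglongrightarrow> 0" by simp
  from P.pd_limit_unique[OF m(3) _ _ this 0] have "AE w in P. Y w - Z w = 0" by simp
  then show ?thesis by simp
qed

abbreviation stoch_int :: "('s \<Rightarrow> real) \<Rightarrow> 'w \<Rightarrow> real" where
  "stoch_int f \<equiv> integral_rm P R \<Lambda> lam S f"

text \<open>\<open>integral_rm\<close> chooses a limit along some unspecified approximating
  sequence; uniqueness transfers it to every such sequence.\<close>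

lemma stoch_int:
  assumes "approx \<phi> f"
  shows "stoch_int f \<in> borel_measurable P"
    and "(\<lambda>n. pd P (\<lambda>w. sint S (\<phi> n) w - stoch_int f w)) \<longlonglongrightarrow> 0"
proof -
  have pd_iff: "tendsto_in_prob P (\<lambda>n. sint S (\<psi> n)) Y \<longleftrightarrow> (\<lambda>n. pd P (\<lambda>w. sint S (\<psi> n) w - Y w)) \<longlonglongrightarrow> 0"
    if "approx \<psi> f" "Y \<in> borel_measurable P" for \<psi> Y
    using that by (intro P.tendsto_in_prob_iff_pd simple_integral_measurable) (auto simp: approximates_rm_iff)
  obtain Y where Y [measurable]: "Y \<in> borel_measurable P" and l: "(\<lambda>n. pd P (\<lambda>w. sint S (\<phi> n) w - Y w)) \<longlonglongrightarrow> 0"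
    using assms S_sets unfolding approximates_rm_iff by blast
  have "\<exists>Y. Y \<in> borel_measurable P \<and> (\<exists>\<phi>. approx \<phi> f \<and> tendsto_in_prob P (\<lambda>n. sint S (\<phi> n)) Y)"
    using Y l assms pd_iff by blast
  from someI_ex[OF this]
  obtain \<psi> where I: "stoch_int f \<in> borel_measurable P" and \<psi>: "approx \<psi> f"
    and t: "tendsto_in_prob P (\<lambda>n. sint S (\<psi> n)) (stoch_int f)"
    unfolding integral_rm_def[symmetric] by blast
  have "(\<lambda>n. pd P (\<lambda>w. sint S (\<psi> n) w - stoch_int f w)) \<longlonglongrightarrow> 0"
    using t pd_iff[OF \<psi> I] by simp
  from approximates_limit_unique[OF assms \<psi> Y I l this] have e: "AE w in P. Y w = stoch_int f w" .
  have "pd P (\<lambda>w. sint S (\<phi> n) w - Y w) = pd P (\<lambda>w. sint S (\<phi> n) w - stoch_int f w)" for n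
    using e by (intro P.pd_cong_AE) (auto elim!: eventually_mono)
  with l show "(\<lambda>n. pd P (\<lambda>w. sint S (\<phi> n) w - stoch_int f w)) \<longlonglongrightarrow> 0" by simp
  show "stoch_int f \<in> borel_measurable P" by (rule I)
qed

lemma stoch_int_lincomb:
  assumes f: "integrable_Lam f" and g: "integrable_Lam g"
  shows "AE w in P. stoch_int (\<lambda>s. \<alpha> * f s + \<beta> * g s) w = \<alpha> * stoch_int f w + \<beta> * stoch_int g w"
proof -
  obtain \<phi> \<psi> where \<phi>: "approx \<phi> f" and \<psi>: "approx \<psi> g"
    using f g by (auto simp: integrable_rm_def)
  from approximates_lincomb[OF \<phi> \<psi>, of \<alpha> \<beta>] obtain zs where zs: "approx zs (\<lambda>s. \<alpha> * f s + \<beta> * g s)"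
    and z: "\<And>n. AE w in P. sint S (zs n) w = \<alpha> * sint S (\<phi> n) w + \<beta> * sint S (\<psi> n) w"
    by blast
  note I = stoch_int[OF \<phi>] stoch_int[OF \<psi>] stoch_int[OF zs]
  note [measurable] = I(1,3,5)
  have r: "simple_rep R (\<phi> n)" "simple_rep R (\<psi> n)" "simple_rep R (zs n)" for n using \<phi> \<psi> zs by (auto simp: approximates_rm_iff)
  have m: "sint S (\<phi> n) \<in> borel_measurable P" "sint S (\<psi> n) \<in> borel_measurable P"
    "sint S (zs n) \<in> borel_measurable P" for n
    by (intro simple_integral_measurable r)+
  have "(\<lambda>n. pd P (\<lambda>w. (\<alpha> * sint S (\<phi> n) w + \<beta> * sint S (\<psi> n) w) - (\<alpha> * stoch_int f w + \<beta> * stoch_int g w))) \<longlonglongrightarrow> 0"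
    by (intro P.pd_tendsto_lincomb m I)
  moreover have "pd P (\<lambda>w. (\<alpha> * sint S (\<phi> n) w + \<beta> * sint S (\<psi> n) w) - (\<alpha> * stoch_int f w + \<beta> * stoch_int g w)) =
      pd P (\<lambda>w. sint S (zs n) w - (\<alpha> * stoch_int f w + \<beta> * stoch_int g w))" for n
    using z[of n] by (intro P.pd_cong_AE) (auto elim!: eventually_mono)
  ultimately have "(\<lambda>n. pd P (\<lambda>w. sint S (zs n) w - (\<alpha> * stoch_int f w + \<beta> * stoch_int g w))) \<longlonglongrightarrow> 0" by simp
  from P.pd_limit_unique[OF m(3) I(5) _ I(6) this] show ?thesis by simp
qed

end

section \<open>Moments and continuity\<close>

context qid_core
begin

lemma U_fun_le_Phi_fun: "ennreal \<bar>U_fun a \<rho> u s\<bar> \<le> Phi p \<bar>u\<bar> s"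
proof -
  have "ennreal \<bar>U_fun a \<rho> u s\<bar> \<le> U_sup a \<rho> \<bar>u\<bar> s"
    unfolding U_sup_def by (rule SUP_upper2[of "sgn u"]) (auto simp: sgn_if)
  also have "\<dots> \<le> Phi p \<bar>u\<bar> s" unfolding Phi_fun_eq add.assoc by (rule le_iff_add[THEN iffD2, OF exI, OF refl])
  finally show ?thesis .
qed

lemma variance_le_Phi_fun: "ennreal (u\<^sup>2 * \<sigma>2 s) \<le> Phi p \<bar>u\<bar> s"
  unfolding Phi_fun_eq power2_abs by (metis add.assoc add.commute le_iff_add)

lemma V_fun_le_Phi_fun: "V_fun \<rho> p \<bar>u\<bar> s \<le> Phi p \<bar>u\<bar> s"
  unfolding Phi_fun_eq by (metis add.commute le_iff_add)

text \<open>A single number \<open>V\<close> bounds drift, variance and both jump measures because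
  \<open>Phi_fun\<close> dominates each of its summands. The images of the Jordan kernels serve as
  the two jump measures.\<close>

lemma qid_law_simple:
  assumes xs: "simple_rep R xs" and p: "0 \<le> p" and V: "modular p (simple_fun xs) \<le> ennreal V" "0 \<le> V"
  shows "qid_law p V (distr P borel (sint S xs))"
proof -
  define f where "f = simple_fun xs"
  have f [measurable]: "f \<in> borel_measurable lam" unfolding f_def by (rule simple_fun_measurable[OF xs])
  have M: "(\<integral>\<^sup>+s. Phi p \<bar>f s\<bar> s \<partial>lam) \<le> ennreal V" using V(1) by (simp add: modular_def f_def)
  have le: "(\<integral>\<^sup>+s. g s \<partial>lam) \<le> ennreal V" if "\<And>s. s \<in> space lam \<Longrightarrow> g s \<le> Phi p \<bar>f s\<bar> s" for g
    by (rule order_trans[OF nn_integral_mono M]) (rule that)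
  have Um [measurable]: "(\<lambda>s. U_fun a \<rho> (f s) s) \<in> borel_measurable lam" by (rule U_fun_measurable[OF f])
  have U: "(\<integral>\<^sup>+s. ennreal (norm (U_fun a \<rho> (f s) s)) \<partial>lam) \<le> ennreal V"
    by (rule le) (simp add: U_fun_le_Phi_fun)
  then have Ui: "integrable lam (\<lambda>s. U_fun a \<rho> (f s) s)"
    by (intro integrableI_bounded) (auto intro: le_less_trans)
  have s: "(\<integral>\<^sup>+s. ennreal ((f s)\<^sup>2 * \<sigma>2 s) \<partial>lam) \<le> ennreal V"
    by (rule le) (rule variance_le_Phi_fun)
  then have si: "integrable lam (\<lambda>s. (f s)\<^sup>2 * \<sigma>2 s)"
    using sigma2_nonneg by (intro integrableI_nonneg AE_I2) (auto intro: le_less_trans)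
  have v: "(\<integral>\<^sup>+s. \<integral>\<^sup>+x. ennreal (vpow p (x * f s)) \<partial>qlt_abs (\<rho> s) \<partial>lam) \<le> ennreal V"
  proof (rule le)
    fix s
    show "(\<integral>\<^sup>+x. ennreal (vpow p (x * f s)) \<partial>qlt_abs (\<rho> s)) \<le> Phi p \<bar>f s\<bar> s"
      using V_fun_le_Phi_fun[of p "f s" s] unfolding V_fun_vpow vpow_abs .
  qed
  have "(\<integral>\<^sup>+s. \<integral>\<^sup>+x. ennreal (wgt (x * f s)) \<partial>qlt_abs (\<rho> s) \<partial>lam) \<le> (\<integral>\<^sup>+s. \<integral>\<^sup>+x. ennreal (vpow p (x * f s)) \<partial>qlt_abs (\<rho> s) \<partial>lam)"
    by (intro nn_integral_mono ennreal_leI wgt_le_vpow p)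
  with v have w: "(\<integral>\<^sup>+s. \<integral>\<^sup>+x. ennreal (wgt (x * f s)) \<partial>qlt_abs (\<rho> s) \<partial>lam) < \<infinity>"
    by (auto intro: le_less_trans order_trans)
  note ex = image_exponent[OF f w]
  let ?\<nu>p = "image_pos f" and ?\<nu>n = "image_neg f"
  let ?\<gamma> = "LINT s|lam. U_fun a \<rho> (f s) s" and ?b = "LINT s|lam. (f s)\<^sup>2 * \<sigma>2 s"
  have b0: "0 \<le> ?b" using sigma2_nonneg by (intro integral_nonneg_AE AE_I2) auto
  have ch: "char (distr P borel (sint S xs)) \<theta> =
      exp (\<i> * of_real (\<theta> * ?\<gamma>) - of_real (\<theta>\<^sup>2 / 2 * ?b) + (CLINT x|?\<nu>p. lk \<theta> x) - (CLINT x|?\<nu>n. lk \<theta> x))" for \<theta>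
  proof -
    have i1: "integrable lam (\<lambda>s. \<i> * complex_of_real (\<theta> * U_fun a \<rho> (f s) s))"
      by (intro integrable_mult_right integrable_of_real Ui)
    have i2: "integrable lam (\<lambda>s. complex_of_real (\<theta>\<^sup>2 / 2 * ((f s)\<^sup>2 * \<sigma>2 s)))"
      by (intro integrable_mult_right integrable_of_real si)
    have "(CLINT s|lam. psi (\<theta> * f s) s) = (CLINT s|lam. \<i> * of_real (\<theta> * U_fun a \<rho> (f s) s) - of_real (\<theta>\<^sup>2 / 2 * ((f s)\<^sup>2 * \<sigma>2 s))
        + qlt_integral (\<rho> s) (\<lambda>x. lk \<theta> (x * f s)))"
      by (intro Bochner_Integration.integral_cong refl psi_scale)
    also have "\<dots> = (CLINT s|lam. \<i> * complex_of_real (\<theta> * U_fun a \<rho> (f s) s)) - (CLINT s|lam. complex_of_real (\<theta>\<^sup>2 / 2 * ((f s)\<^sup>2 * \<sigma>2 s)))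
        + ((CLINT x|?\<nu>p. lk \<theta> x) - (CLINT x|?\<nu>n. lk \<theta> x))"
      unfolding Bochner_Integration.integral_add[OF Bochner_Integration.integrable_diff[OF i1 i2] ex(1)]
        Bochner_Integration.integral_diff[OF i1 i2] ex(2) ..
    also have "(CLINT s|lam. \<i> * complex_of_real (\<theta> * U_fun a \<rho> (f s) s)) = \<i> * of_real (\<theta> * ?\<gamma>)"
      by (simp only: integral_mult_right_zero integral_complex_of_real)
    also have "(CLINT s|lam. complex_of_real (\<theta>\<^sup>2 / 2 * ((f s)\<^sup>2 * \<sigma>2 s))) = of_real (\<theta>\<^sup>2 / 2 * ?b)"
      by (simp only: integral_mult_right_zero integral_complex_of_real)
    finally show ?thesis unfolding char_simple_integral(1)[OF xs] f_def[symmetric] by (simp only: add_diff_eq)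
  qed
  have D: "real_distribution (distr P borel (sint S xs))"
    by (rule P.real_distribution_distr) (rule simple_integral_measurable[OF xs])
  have "ennreal \<bar>?\<gamma>\<bar> \<le> ennreal V"
    using order_trans[OF integral_norm_bound_ennreal[OF Ui] U] by simp
  then have g: "\<bar>?\<gamma>\<bar> \<le> V" using V(2) by simp
  have "ennreal ?b = (\<integral>\<^sup>+s. ennreal ((f s)\<^sup>2 * \<sigma>2 s) \<partial>lam)"
    using sigma2_nonneg by (intro nn_integral_eq_integral[symmetric] si AE_I2) auto
  then have "ennreal ?b \<le> ennreal V" using s by simp
  then have b: "?b \<le> V" using V(2) by simp
  have vm: "(\<lambda>x. ennreal (vpow p x)) \<in> borel_measurable borel" by measurable
  show ?thesis
    unfolding qid_law_def
    by (intro conjI exI[of _ ?\<gamma>] exI[of _ ?b] exI[of _ ?\<nu>p] exI[of _ ?\<nu>n] allI D g b0 b ch sets_kernel_image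
        order_trans[OF image_le_abs(1)[OF f vm] v] order_trans[OF image_le_abs(2)[OF f vm] v])
qed

lemma abs_moment_distr:
  assumes [measurable]: "X \<in> borel_measurable P"
  shows "abs_moment P p X = moment p (distr P borel X)"
  unfolding abs_moment_def by (rule nn_integral_distr[symmetric]) measurable

lemma moment_simple_bounded:
  assumes p: "0 < p" and V: "0 \<le> V"
  shows "\<exists>B. \<forall>xs. simple_rep R xs \<longrightarrow> modular p (simple_fun xs) \<le> ennreal V \<longrightarrow>
    abs_moment P p (sint S xs) \<le> ennreal B"
  using qid_law_moment_bounded[OF p, of V] qid_law_simple[OF _ less_imp_le[OF p] _ V]
    abs_moment_distr[OF simple_integral_measurable] by metis

lemma moment_simple_small:
  assumes p: "0 < p" and e: "0 < \<epsilon>"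
  shows "\<exists>V>0. \<forall>xs. simple_rep R xs \<longrightarrow> modular p (simple_fun xs) \<le> ennreal V \<longrightarrow>
    abs_moment P p (sint S xs) \<le> ennreal \<epsilon>"
  using qid_law_moment_small[OF p e] qid_law_simple[OF _ less_imp_le[OF p] _ less_imp_le]
    abs_moment_distr[OF simple_integral_measurable] by metis

section \<open>Density of simple functions in the modular\<close>

lemma simple_function_rep:
  assumes g: "simple_function lam g" and C: "C \<in> R"
  shows "\<exists>xs. simple_rep R xs \<and> (\<forall>s\<in>space lam. simple_fun xs s = g s * indicator C s)"
proof -
  let ?E = "\<lambda>y. {s \<in> space lam. g s = y} \<inter> C"
  obtain ys where ys: "set ys = g ` space lam" "distinct ys"
    using finite_distinct_list[of "g ` space lam"] g by (auto simp: simple_function_def)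
  let ?xs = "map (\<lambda>y. (y, ?E y)) ys"
  have "?E y \<in> R" if "y \<in> set ys" for y
  proof (rule sets_Int_R[OF _ C])
    have "g -` {y} \<inter> space lam \<in> sets lam" using g that ys by (auto simp: simple_function_def)
    also have "g -` {y} \<inter> space lam = {s \<in> space lam. g s = y}" by auto
    finally show "{s \<in> space lam. g s = y} \<in> sets lam" .
  qed
  then have "simple_rep R ?xs"
    using ys(2) by (auto simp: simple_rep_iff sorted_wrt_map sorted_wrt_iff_nth_less nth_eq_iff_index_eq)
  moreover have "simple_fun ?xs s = g s * indicator C s" if s: "s \<in> space lam" for s
  proof -
    have "simple_fun ?xs s = (\<Sum>y\<leftarrow>ys. y * indicator (?E y) s)"
      by (simp add: simple_fun_def o_def)
    also have "\<dots> = (\<Sum>y\<in>set ys. y * indicator (?E y) s)"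
      by (rule sum_list_distinct_conv_sum_set[OF ys(2)])
    also have "\<dots> = (\<Sum>y\<in>set ys. if y = g s then g s * indicator C s else 0)"
      using s by (intro sum.cong refl) (auto simp: indicator_def)
    also have "\<dots> = g s * indicator C s"
      unfolding sum.delta[OF finite_set] using s ys(1) by auto
    finally show ?thesis .
  qed
  ultimately show ?thesis by blast
qed

lemma ex_simple_approximation:
  assumes f: "f \<in> borel_measurable lam"
  shows "\<exists>\<phi>. (\<forall>n. simple_rep R (\<phi> n)) \<and> (\<forall>s\<in>space lam. (\<lambda>n. simple_fun (\<phi> n) s) \<longlonglongrightarrow> f s) \<and>
    (\<forall>n. \<forall>s\<in>space lam. \<bar>simple_fun (\<phi> n) s\<bar> \<le> 2 * \<bar>f s\<bar>)"
proof -
  obtain Sn :: "nat \<Rightarrow> 's set" where Sn: "range Sn \<subseteq> R" "incseq Sn" "(\<Union>n. Sn n) = S"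
    using chars by (auto simp: qid_characteristics_def qid_random_measure_def)
  obtain F where "\<forall>n. simple_function lam (F n)"
    "\<forall>s\<in>space lam. (\<lambda>n. F n s) \<longlonglongrightarrow> f s" "\<forall>n. \<forall>s\<in>space lam. dist (F n s) 0 \<le> 2 * dist (f s) 0"
    using borel_measurable_implies_sequence_metric[OF f, of 0] by blast
  then have F: "simple_function lam (F n)" "s \<in> space lam \<Longrightarrow> (\<lambda>n. F n s) \<longlonglongrightarrow> f s"
    "s \<in> space lam \<Longrightarrow> \<bar>F n s\<bar> \<le> 2 * \<bar>f s\<bar>" for n s
    by (auto simp: dist_real_def)
  \<comment> \<open>Cutting off at \<open>Sn n\<close> puts the level sets into \<open>R\<close>; at
    each point the cut-off has no effect for large \<open>n\<close>.\<close>
  have "\<forall>n. \<exists>xs. simple_rep R xs \<and> (\<forall>s\<in>space lam. simple_fun xs s = F n s * indicator (Sn n) s)"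
    using simple_function_rep[OF F(1)] Sn(1) by blast
  then obtain \<phi> where \<phi>: "\<And>n. simple_rep R (\<phi> n)" "\<And>n s. s \<in> space lam \<Longrightarrow> simple_fun (\<phi> n) s = F n s * indicator (Sn n) s"
    using choice[of "\<lambda>n xs. simple_rep R xs \<and> (\<forall>s\<in>space lam. simple_fun xs s = F n s * indicator (Sn n) s)"] by blast
  have "(\<lambda>n. simple_fun (\<phi> n) s) \<longlonglongrightarrow> f s" if s: "s \<in> space lam" for s
  proof -
    obtain k where k: "s \<in> Sn k" using s space_lam Sn(3) by blast
    have "eventually (\<lambda>n. F n s = simple_fun (\<phi> n) s) sequentially"
    proof (rule eventually_sequentiallyI[of k])
      fix n assume "k \<le> n"
      then have "s \<in> Sn n" using monoD[OF Sn(2), of k n] k by auto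
      then show "F n s = simple_fun (\<phi> n) s" by (simp add: \<phi>(2)[OF s])
    qed
    with F(2)[OF s] show ?thesis by (rule Lim_transform_eventually)
  qed
  moreover have "\<bar>simple_fun (\<phi> n) s\<bar> \<le> 2 * \<bar>f s\<bar>" if "s \<in> space lam" for n s
    using F(3)[OF that, of n] by (simp add: \<phi>(2)[OF that] indicator_def)
  ultimately show ?thesis using \<phi>(1) by (intro exI[of _ \<phi>]) blast
qed

lemma L_Phi_iff: "f \<in> LPhi p \<longleftrightarrow> f \<in> borel_measurable lam \<and> modular p f < \<infinity>"
  by (simp add: L_Phi_def modular_def)

lemma modular_approximation:
  assumes p: "0 \<le> p" and f: "f \<in> borel_measurable lam" and fin: "modular p f < \<infinity>"
    and g [measurable]: "\<And>n. g n \<in> borel_measurable lam"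
    and lim: "\<And>s. s \<in> space lam \<Longrightarrow> (\<lambda>n. g n s) \<longlonglongrightarrow> f s"
    and b: "\<And>n s. s \<in> space lam \<Longrightarrow> \<bar>g n s\<bar> \<le> 2 * \<bar>f s\<bar>"
  shows "(\<lambda>n. modular p (\<lambda>s. g n s - f s)) \<longlonglongrightarrow> 0"
proof -
  note [measurable] = f
  \<comment> \<open>The difference is at most \<open>3 * |f|\<close>, rounded up to 4, the second
    power of 2, so that two doublings give an integrable domination.\<close>
  let ?K = "ennreal ((8 * 2 powr p)\<^sup>2)"
  have sc: "Phi p (4 * \<bar>f s\<bar>) s \<le> ?K * Phi p \<bar>f s\<bar> s" if s: "s \<in> space lam" for s
    using Phi_fun_scale[where \<rho>=\<rho> and s=s and \<sigma>=\<sigma>2 and a=a and c=4 and n=2 and u="f s", OF qlt_space[OF s] p sigma2_nonneg[OF s]]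
    by (simp only: abs_mult abs_numeral) simp
  have b4: "\<bar>g n s - f s\<bar> \<le> 4 * \<bar>f s\<bar>" if "s \<in> space lam" for n s using b[OF that, of n] by linarith
  have "(\<lambda>n. \<integral>\<^sup>+s. Phi p \<bar>g n s - f s\<bar> s \<partial>lam) \<longlonglongrightarrow> (\<integral>\<^sup>+s. 0 \<partial>lam)"
  proof (rule nn_integral_dominated_convergence)
    show "(\<lambda>s. Phi p \<bar>g n s - f s\<bar> s) \<in> borel_measurable lam" for n
      by (rule Phi_fun_measurable) measurable
    show "(\<lambda>s. ?K * Phi p \<bar>f s\<bar> s) \<in> borel_measurable lam"
      using Phi_fun_measurable[OF f] by measurable
    have "(\<integral>\<^sup>+s. ?K * Phi p \<bar>f s\<bar> s \<partial>lam) = ?K * modular p f"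
      unfolding modular_def by (rule nn_integral_cmult[OF Phi_fun_measurable[OF f]])
    then show "(\<integral>\<^sup>+s. ?K * Phi p \<bar>f s\<bar> s \<partial>lam) < \<infinity>"
      using fin by (simp add: ennreal_mult_less_top)
    show "AE s in lam. Phi p \<bar>g n s - f s\<bar> s \<le> ?K * Phi p \<bar>f s\<bar> s" for n
      by (intro AE_I2 order_trans[OF Phi_fun_mono sc] b4 sigma2_nonneg p) auto
    have "AE s in lam. Phi p \<bar>f s\<bar> s \<noteq> \<infinity>"
      using fin unfolding modular_def by (intro nn_integral_PInf_AE Phi_fun_measurable f) auto
    then show "AE s in lam. (\<lambda>n. Phi p \<bar>g n s - f s\<bar> s) \<longlonglongrightarrow> 0"
      using AE_space
    proof eventually_elim
      fix s assume F: "Phi p \<bar>f s\<bar> s \<noteq> \<infinity>" and s: "s \<in> space lam"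
      have l: "(\<lambda>n. g n s - f s) \<longlonglongrightarrow> 0" using LIM_zero[OF lim[OF s]] .
      have "?K * Phi p \<bar>f s\<bar> s < \<infinity>" using F by (simp add: ennreal_mult_less_top less_top)
      then have "Phi p (4 * \<bar>f s\<bar>) s < \<infinity>" using sc[OF s] by (rule le_less_trans[rotated])
      then show "(\<lambda>n. Phi p \<bar>g n s - f s\<bar> s) \<longlonglongrightarrow> 0"
        by (rule Phi_fun_tendsto_0[where \<rho>=\<rho> and s=s and \<sigma>=\<sigma>2 and v="4 * \<bar>f s\<bar>", OF qlt_space[OF s] p sigma2_nonneg[OF s] l b4[OF s]])
    qed
  qed simp
  then show ?thesis by (simp add: modular_def)
qed

text \<open>The approximating functions form a Cauchy sequence for the modular, so over every set
  their integrals are Cauchy in probability and completeness applies. The constant in the bound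
  comes from the domination by \<open>2 * |f|\<close>, that is, from one doubling.\<close>

lemma L_Phi_approximation:
  assumes p: "0 \<le> p" and f: "f \<in> LPhi p"
  shows "\<exists>\<phi>. approx \<phi> f \<and> (\<forall>n. modular p (simple_fun (\<phi> n)) \<le> ennreal (8 * 2 powr p) * modular p f)"
proof -
  have fm [measurable]: "f \<in> borel_measurable lam" and fin: "modular p f < \<infinity>" using f by (auto simp: L_Phi_iff)
  let ?K = "ennreal (8 * 2 powr p)"
  from ex_simple_approximation[OF fm] obtain \<phi> where r: "\<And>n. simple_rep R (\<phi> n)"
    and lim: "\<And>s. s \<in> space lam \<Longrightarrow> (\<lambda>n. simple_fun (\<phi> n) s) \<longlonglongrightarrow> f s"
    and b: "\<And>n s. s \<in> space lam \<Longrightarrow> \<bar>simple_fun (\<phi> n) s\<bar> \<le> 2 * \<bar>f s\<bar>" by blast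
  have m [measurable]: "simple_fun (\<phi> n) \<in> borel_measurable lam" for n by (rule simple_fun_measurable[OF r])
  have "modular p (simple_fun (\<phi> n)) \<le> modular p (\<lambda>s. 2 * f s)" for n
    using b[of _ n] by (intro modular_mono p AE_I2) (simp add: abs_mult)
  also have "modular p (\<lambda>s. 2 * f s) \<le> ?K * modular p f"
    using modular_scale[OF p fm, of 2 1] by simp
  finally have le: "modular p (simple_fun (\<phi> n)) \<le> ?K * modular p f" for n .
  have "(\<lambda>n. modular p (\<lambda>s. simple_fun (\<phi> n) s - f s)) \<longlonglongrightarrow> 0"
    by (rule modular_approximation[OF p fm fin m lim b])
  from ennreal_tendsto_cmult[OF _ this, of ?K]
  have K0: "(\<lambda>n. ?K * modular p (\<lambda>s. simple_fun (\<phi> n) s - f s)) \<longlonglongrightarrow> 0" by simp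
  have "\<exists>Y\<in>borel_measurable P. (\<lambda>n. pd P (\<lambda>w. sint A (\<phi> n) w - Y w)) \<longlonglongrightarrow> 0"
    if A: "A \<in> sets lam" for A
  proof -
    have mA: "sint A (\<phi> n) \<in> borel_measurable P" for n
      by (rule simple_integral_measurable'[OF A r])
    have "\<exists>N. \<forall>m\<ge>N. \<forall>n\<ge>N. pd P (\<lambda>w. sint A (\<phi> m) w - sint A (\<phi> n) w) \<le> ennreal e"
      if e: "0 < e" for e
    proof -
      obtain \<delta> where \<delta>: "0 < \<delta>" and small: "\<And>xs. simple_rep R xs \<Longrightarrow> modular p (simple_fun xs) \<le> ennreal \<delta> \<Longrightarrow>
        pd P (sint S xs) \<le> ennreal e" using pd_simple_small[OF p e] by blast
      have "eventually (\<lambda>n. ?K * modular p (\<lambda>s. simple_fun (\<phi> n) s - f s) < ennreal (\<delta> / 2)) sequentially"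
        by (rule order_tendstoD(2)[OF K0]) (simp add: \<delta>)
      then obtain N where N: "\<And>n. N \<le> n \<Longrightarrow> ?K * modular p (\<lambda>s. simple_fun (\<phi> n) s - f s) \<le> ennreal (\<delta> / 2)"
        unfolding eventually_sequentially by (blast intro: less_imp_le)
      have "pd P (\<lambda>w. sint A (\<phi> m) w - sint A (\<phi> n) w) \<le> ennreal e"
        if "N \<le> m" "N \<le> n" for m n
      proof -
        from simple_lincomb[OF r[of m] r[of n], of 1 "-1"] obtain zs where zs: "simple_rep R zs"
          "\<And>s. simple_fun zs s = simple_fun (\<phi> m) s - simple_fun (\<phi> n) s"
          "AE w in P. sint A zs w = sint A (\<phi> m) w - sint A (\<phi> n) w"
          using A by auto
        have c: "modular p (\<lambda>s. f s - simple_fun (\<phi> n) s) = modular p (\<lambda>s. simple_fun (\<phi> n) s - f s)"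
          unfolding modular_def by (simp only: abs_minus_commute)
        \<comment> \<open>Restriction to \<open>A\<close> only decreases the modular, so the same
          \<open>N\<close> serves every set.\<close>
        have "modular p (simple_fun (restrict_rep A zs)) \<le> modular p (\<lambda>s. (simple_fun (\<phi> m) s - f s) + (f s - simple_fun (\<phi> n) s))"
          by (intro modular_mono p AE_I2) (auto simp: simple_fun_restrict zs(2) indicator_def)
        also have "\<dots> \<le> ?K * (modular p (\<lambda>s. simple_fun (\<phi> m) s - f s) + modular p (\<lambda>s. f s - simple_fun (\<phi> n) s))"
          by (intro modular_add p) measurable
        also have "\<dots> = ?K * modular p (\<lambda>s. simple_fun (\<phi> m) s - f s) + ?K * modular p (\<lambda>s. simple_fun (\<phi> n) s - f s)"
          by (simp only: distrib_left c)
        also have "\<dots> \<le> ennreal (\<delta> / 2) + ennreal (\<delta> / 2)" by (intro add_mono N that)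
        also have "\<dots> = ennreal \<delta>" using \<delta> by (simp add: ennreal_plus[symmetric] del: ennreal_plus)
        finally have "pd P (sint S (restrict_rep A zs)) \<le> ennreal e"
          by (rule small[OF simple_rep_restrict[OF A zs(1)]])
        then have "pd P (sint A zs) \<le> ennreal e" by (simp add: simple_integral_restrict[OF A])
        also have "pd P (sint A zs) = pd P (\<lambda>w. sint A (\<phi> m) w - sint A (\<phi> n) w)"
          by (rule P.pd_cong_AE[OF zs(3)])
        finally show ?thesis .
      qed
      then show ?thesis by blast
    qed
    from P.pd_Cauchy_converges[OF mA this] show ?thesis by blast
  qed
  then have "approx \<phi> f"
    unfolding approximates_rm_iff using r lim by auto
  with le show ?thesis by blast
qed

section \<open>Moments of the integral of a general integrand\<close>

lemma integrable_L_Phi: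
  assumes "0 \<le> p" "f \<in> LPhi p"
  shows "integrable_Lam f"
  using L_Phi_approximation[OF assms] assms(2) by (auto simp: integrable_rm_def L_Phi_iff)

lemma stoch_int_measurable:
  assumes "0 \<le> p" "f \<in> LPhi p"
  shows "stoch_int f \<in> borel_measurable P"
  using L_Phi_approximation[OF assms] stoch_int(1) by blast

text \<open>Fatou's lemma along an almost surely convergent subsequence of the simple integrals. The
  bound is assumed for all simple functions below a given modular, so that the lemma yields both
  finiteness and smallness.\<close>

lemma abs_moment_stoch_int_le:
  assumes p: "0 < p" and f: "f \<in> LPhi p"
    and B: "\<And>xs. simple_rep R xs \<Longrightarrow> modular p (simple_fun xs) \<le> ennreal (8 * 2 powr p) * modular p f \<Longrightarrow>
      abs_moment P p (sint S xs) \<le> B"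
  shows "abs_moment P p (stoch_int f) \<le> B"
proof -
  obtain \<phi> where \<phi>: "approx \<phi> f"
    and le: "\<And>n. modular p (simple_fun (\<phi> n)) \<le> ennreal (8 * 2 powr p) * modular p f"
    using L_Phi_approximation[OF less_imp_le[OF p] f] by blast
  have r: "simple_rep R (\<phi> n)" for n using \<phi> by (simp add: approximates_rm_iff)
  have m [measurable]: "sint S (\<phi> n) \<in> borel_measurable P" for n by (rule simple_integral_measurable[OF r])
  obtain k where k: "strict_mono (k :: nat \<Rightarrow> nat)" "AE w in P. (\<lambda>n. sint S (\<phi> (k n)) w) \<longlonglongrightarrow> stoch_int f w"
    using P.tendsto_in_prob_subseq_AE[OF m stoch_int[OF \<phi>]] .
  have "abs_moment P p (stoch_int f) = (\<integral>\<^sup>+w. liminf (\<lambda>n. ennreal (\<bar>sint S (\<phi> (k n)) w\<bar> powr p)) \<partial>P)"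
    unfolding abs_moment_def
  proof (rule nn_integral_cong_AE)
    show "AE w in P. ennreal (\<bar>stoch_int f w\<bar> powr p) = liminf (\<lambda>n. ennreal (\<bar>sint S (\<phi> (k n)) w\<bar> powr p))"
      using k(2)
    proof eventually_elim
      fix w assume "(\<lambda>n. sint S (\<phi> (k n)) w) \<longlonglongrightarrow> stoch_int f w"
      then have "(\<lambda>n. ennreal (\<bar>sint S (\<phi> (k n)) w\<bar> powr p)) \<longlonglongrightarrow> ennreal (\<bar>stoch_int f w\<bar> powr p)"
        using p by (intro tendsto_ennrealI tendsto_powr' tendsto_rabs tendsto_const) auto
      then show "ennreal (\<bar>stoch_int f w\<bar> powr p) = liminf (\<lambda>n. ennreal (\<bar>sint S (\<phi> (k n)) w\<bar> powr p))"
        by (intro lim_imp_Liminf[symmetric]) auto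
    qed
  qed
  also have "\<dots> \<le> liminf (\<lambda>n. abs_moment P p (sint S (\<phi> (k n))))"
    unfolding abs_moment_def by (rule nn_integral_liminf) measurable
  also have "\<dots> \<le> liminf (\<lambda>n :: nat. B)"
    by (intro Liminf_mono always_eventually allI B r le)
  also have "\<dots> = B" by (simp add: Liminf_const)
  finally show ?thesis .
qed

lemma pd_stoch_int_le:
  assumes p: "0 \<le> p" and f: "f \<in> LPhi p"
    and B: "\<And>xs. simple_rep R xs \<Longrightarrow> modular p (simple_fun xs) \<le> ennreal (8 * 2 powr p) * modular p f \<Longrightarrow>
      pd P (sint S xs) \<le> B"
  shows "pd P (stoch_int f) \<le> B"
proof -
  obtain \<phi> where \<phi>: "approx \<phi> f"
    and le: "\<And>n. modular p (simple_fun (\<phi> n)) \<le> ennreal (8 * 2 powr p) * modular p f"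
    using L_Phi_approximation[OF p f] by blast
  have r: "simple_rep R (\<phi> n)" for n using \<phi> by (simp add: approximates_rm_iff)
  note I = stoch_int[OF \<phi>]
  have le: "pd P (stoch_int f) \<le> pd P (\<lambda>w. sint S (\<phi> n) w - stoch_int f w) + B" for n
  proof -
    have "pd P (\<lambda>w. stoch_int f w - 0) \<le> pd P (\<lambda>w. stoch_int f w - sint S (\<phi> n) w) + pd P (\<lambda>w. sint S (\<phi> n) w - 0)"
      by (intro P.pd_triangle_diff I simple_integral_measurable r) simp
    also have "pd P (\<lambda>w. stoch_int f w - sint S (\<phi> n) w) = pd P (\<lambda>w. sint S (\<phi> n) w - stoch_int f w)"
      by (rule P.pd_diff_commute)
    finally have "pd P (stoch_int f) \<le> pd P (\<lambda>w. sint S (\<phi> n) w - stoch_int f w) + pd P (sint S (\<phi> n))"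
      by simp
    also have "\<dots> \<le> pd P (\<lambda>w. sint S (\<phi> n) w - stoch_int f w) + B"
      by (intro add_left_mono B r le)
    finally show ?thesis .
  qed
  have "(\<lambda>n. pd P (\<lambda>w. sint S (\<phi> n) w - stoch_int f w) + B) \<longlonglongrightarrow> 0 + B"
    by (intro tendsto_add I tendsto_const)
  from LIMSEQ_le_const[OF this] show ?thesis using le by simp
qed

lemma abs_moment_stoch_int_finite:
  assumes p: "0 \<le> p" and f: "f \<in> LPhi p"
  shows "abs_moment P p (stoch_int f) < \<infinity>"
proof (cases "p = 0")
  case True
  have "abs_moment P p (stoch_int f) \<le> (\<integral>\<^sup>+w. 1 \<partial>P)"
    unfolding abs_moment_def True by (intro nn_integral_mono) (simp add: powr_zero_eq_one)
  then show ?thesis by (simp add: P.emeasure_space_1 le_less_trans)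
next
  case False
  with p have p: "0 < p" by simp
  define V where "V = enn2real (ennreal (8 * 2 powr p) * modular p f)"
  have V: "ennreal V = ennreal (8 * 2 powr p) * modular p f" "0 \<le> V"
    using f by (simp_all add: V_def L_Phi_iff ennreal_mult_less_top)
  obtain B where B: "\<And>xs. simple_rep R xs \<Longrightarrow> modular p (simple_fun xs) \<le> ennreal V \<Longrightarrow>
    abs_moment P p (sint S xs) \<le> ennreal B"
    using moment_simple_bounded[OF p V(2)] by blast
  have "abs_moment P p (stoch_int f) \<le> ennreal B"
    by (rule abs_moment_stoch_int_le[OF p f]) (use B V(1) in auto)
  then show ?thesis by (auto intro: le_less_trans)
qed

lemma modular_zero_tendsto:
  assumes p: "0 \<le> p" and g: "\<And>n. g n \<in> LPhi p" and lim: "(\<lambda>n. modular p (g n)) \<longlonglongrightarrow> 0"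
  shows "(\<lambda>n. pd P (stoch_int (g n))) \<longlonglongrightarrow> 0"
    and "0 < p \<Longrightarrow> (\<lambda>n. abs_moment P p (stoch_int (g n))) \<longlonglongrightarrow> 0"
proof -
  from ennreal_tendsto_cmult[OF _ lim, of "ennreal (8 * 2 powr p)"]
  have K: "(\<lambda>n. ennreal (8 * 2 powr p) * modular p (g n)) \<longlonglongrightarrow> 0" by simp
  have ev: "eventually (\<lambda>n. ennreal (8 * 2 powr p) * modular p (g n) < ennreal \<delta>) sequentially" if "0 < \<delta>" for \<delta>
    by (rule order_tendstoD(2)[OF K]) (simp add: that)
  show "(\<lambda>n. pd P (stoch_int (g n))) \<longlonglongrightarrow> 0"
  proof (rule P.tendsto_0_ennrealI)
    fix e :: real assume e: "0 < e"
    obtain \<delta> where \<delta>: "0 < \<delta>" and small: "\<And>xs. simple_rep R xs \<Longrightarrow> modular p (simple_fun xs) \<le> ennreal \<delta> \<Longrightarrow>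
      pd P (sint S xs) \<le> ennreal e" using pd_simple_small[OF p e] by blast
    show "eventually (\<lambda>n. pd P (stoch_int (g n)) \<le> ennreal e) sequentially"
      using ev[OF \<delta>]
    proof eventually_elim
      fix n assume n: "ennreal (8 * 2 powr p) * modular p (g n) < ennreal \<delta>"
      show "pd P (stoch_int (g n)) \<le> ennreal e"
        by (rule pd_stoch_int_le[OF p g]) (use small n in \<open>meson less_imp_le order_trans\<close>)
    qed
  qed
  show "(\<lambda>n. abs_moment P p (stoch_int (g n))) \<longlonglongrightarrow> 0" if p': "0 < p"
  proof (rule P.tendsto_0_ennrealI)
    fix e :: real assume e: "0 < e"
    obtain \<delta> where \<delta>: "0 < \<delta>" and small: "\<And>xs. simple_rep R xs \<Longrightarrow> modular p (simple_fun xs) \<le> ennreal \<delta> \<Longrightarrow>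
      abs_moment P p (sint S xs) \<le> ennreal e" using moment_simple_small[OF p' e] by blast
    show "eventually (\<lambda>n. abs_moment P p (stoch_int (g n)) \<le> ennreal e) sequentially"
      using ev[OF \<delta>]
    proof eventually_elim
      fix n assume n: "ennreal (8 * 2 powr p) * modular p (g n) < ennreal \<delta>"
      show "abs_moment P p (stoch_int (g n)) \<le> ennreal e"
        by (rule abs_moment_stoch_int_le[OF p' g]) (use small n in \<open>meson less_imp_le order_trans\<close>)
    qed
  qed
qed

section \<open>Linearity and continuity with respect to the F-norm\<close>

lemma L_Phi_lincomb:
  assumes p: "0 \<le> p" and f: "f \<in> LPhi p" and g: "g \<in> LPhi p"
  shows "(\<lambda>s. \<alpha> * f s + \<beta> * g s) \<in> LPhi p"
proof -
  have m [measurable]: "f \<in> borel_measurable lam" "g \<in> borel_measurable lam"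
    and fin: "modular p f < \<infinity>" "modular p g < \<infinity>" using f g by (auto simp: L_Phi_iff)
  have sc: "modular p (\<lambda>s. c * h s) < \<infinity>" if h: "h \<in> borel_measurable lam" "modular p h < \<infinity>" for c :: real and h
  proof -
    obtain n where "\<bar>c\<bar> < 2 ^ n" using real_arch_pow[of 2 "\<bar>c\<bar>"] by auto
    then have "modular p (\<lambda>s. c * h s) \<le> ennreal ((8 * 2 powr p) ^ n) * modular p h"
      by (intro modular_scale p h) simp
    also have "\<dots> < \<infinity>" using h(2) by (simp add: ennreal_mult_less_top)
    finally show ?thesis .
  qed
  have "modular p (\<lambda>s. \<alpha> * f s + \<beta> * g s) \<le> ennreal (8 * 2 powr p) * (modular p (\<lambda>s. \<alpha> * f s) + modular p (\<lambda>s. \<beta> * g s))"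
    by (intro modular_add p) measurable
  also have "\<dots> < \<infinity>"
    using sc[OF m(1) fin(1), of \<alpha>] sc[OF m(2) fin(2), of \<beta>] by (simp add: ennreal_mult_less_top)
  finally show ?thesis by (simp add: L_Phi_iff)
qed

text \<open>Some admissible \<open>c\<close> lies below \<open>e\<close>, hence below 1; dividing by
  it can only enlarge the modular, which is then at most \<open>c\<close>.\<close>

lemma modular_le_norm_Phi:
  assumes p: "0 \<le> p" and g: "g \<in> LPhi p" and e: "normPhi p g < e" "e \<le> 1"
  shows "modular p g \<le> ennreal e"
proof -
  have m: "g \<in> borel_measurable lam" and fin: "modular p g < \<infinity>" using g by (auto simp: L_Phi_iff)
  let ?C = "{c. c > 0 \<and> (\<integral>\<^sup>+s. Phi p (inverse c * \<bar>g s\<bar>) s \<partial>lam) \<le> ennreal c}"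
  have eq: "(\<integral>\<^sup>+s. Phi p (inverse c * \<bar>g s\<bar>) s \<partial>lam) = modular p (\<lambda>s. inverse c * g s)" if "0 < c" for c
    using that by (simp add: modular_def abs_mult)
  \<comment> \<open>Shows that the set of admissible constants is nonempty, so that its infimum is
    meaningful: dividing by \<open>V \<ge> 1\<close> decreases the modular, which is at most
    \<open>V\<close>.\<close>
  define V where "V = max 1 (enn2real (modular p g))"
  have "modular p g = ennreal (enn2real (modular p g))" using fin by simp
  also have "\<dots> \<le> ennreal V" by (intro ennreal_leI) (simp add: V_def)
  finally have V: "1 \<le> V" "modular p g \<le> ennreal V" by (auto simp: V_def)
  have "modular p (\<lambda>s. inverse V * g s) \<le> modular p g"
    using V(1) by (intro modular_mono p AE_I2) (auto simp: abs_mult intro!: mult_left_le_one_le simp: inverse_le_1_iff)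
  then have "V \<in> ?C" using V eq[of V] by auto
  then have "?C \<noteq> {}" by blast
  moreover have "bdd_below ?C" by (rule bdd_belowI[of _ 0]) auto
  ultimately obtain c where c: "c \<in> ?C" "c < e"
    using e(1) unfolding norm_Phi_def by (subst (asm) cInf_less_iff) auto
  have "modular p g \<le> modular p (\<lambda>s. inverse c * g s)"
  proof (intro modular_mono p AE_I2)
    fix s
    have "1 \<le> inverse c" using c e by (intro one_le_inverse) auto
    then have "1 * \<bar>g s\<bar> \<le> inverse c * \<bar>g s\<bar>" by (intro mult_right_mono) auto
    then show "\<bar>g s\<bar> \<le> \<bar>inverse c * g s\<bar>" using c by (simp add: abs_mult)
  qed
  also have "\<dots> \<le> ennreal c" using c eq[of c] by auto
  also have "\<dots> \<le> ennreal e" using c by (intro ennreal_leI) simp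
  finally show ?thesis .
qed

theorem L_Phi_continuity:
  assumes p: "0 \<le> p" and f: "f \<in> LPhi p" and fn: "\<And>n. fn n \<in> LPhi p"
    and lim: "(\<lambda>n. normPhi p (\<lambda>s. fn n s - f s)) \<longlonglongrightarrow> 0"
  shows "tendsto_Lp P p (\<lambda>n. stoch_int (fn n)) (stoch_int f)"
proof -
  \<comment> \<open>By linearity continuity at \<open>f\<close> becomes continuity at 0; the
    coefficients 1 and -1 match the form of the lemmas on linear combinations.\<close>
  define g where "g n s = 1 * fn n s + (-1) * f s" for n s
  have g: "g n \<in> LPhi p" for n
    unfolding g_def[abs_def] by (rule L_Phi_lincomb[OF p fn f])
  have lim: "(\<lambda>n. normPhi p (g n)) \<longlonglongrightarrow> 0" using lim by (simp add: g_def[abs_def])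
  have "(\<lambda>n. modular p (g n)) \<longlonglongrightarrow> 0"
  proof (rule P.tendsto_0_ennrealI)
    fix e :: real assume e: "0 < e"
    have "eventually (\<lambda>n. normPhi p (g n) < min e 1) sequentially"
      by (rule order_tendstoD(2)[OF lim]) (simp add: e)
    then show "eventually (\<lambda>n. modular p (g n) \<le> ennreal e) sequentially"
    proof eventually_elim
      fix n assume "normPhi p (g n) < min e 1"
      from modular_le_norm_Phi[OF p g this] have "modular p (g n) \<le> ennreal (min e 1)" by simp
      also have "\<dots> \<le> ennreal e" by (intro ennreal_leI) simp
      finally show "modular p (g n) \<le> ennreal e" .
    qed
  qed
  note T = modular_zero_tendsto[OF p g this]
  have ae: "AE w in P. stoch_int (g n) w = stoch_int (fn n) w - stoch_int f w" for n
    using stoch_int_lincomb[OF integrable_L_Phi[OF p fn] integrable_L_Phi[OF p f], of 1 n "-1"]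
    unfolding g_def[abs_def] by (rule eventually_mono) simp
  show ?thesis
  proof (cases "p = 0")
    case True
    have "pd P (stoch_int (g n)) = pd P (\<lambda>w. stoch_int (fn n) w - stoch_int f w)" for n
      by (rule P.pd_cong_AE[OF ae])
    with T(1) have "(\<lambda>n. pd P (\<lambda>w. stoch_int (fn n) w - stoch_int f w)) \<longlonglongrightarrow> 0" by simp
    then have "tendsto_in_prob P (\<lambda>n. stoch_int (fn n)) (stoch_int f)"
      by (subst P.tendsto_in_prob_iff_pd) (auto intro: stoch_int_measurable[OF p] f fn)
    then show ?thesis by (simp add: tendsto_Lp_def True)
  next
    case False
    have "abs_moment P p (stoch_int (g n)) = abs_moment P p (\<lambda>w. stoch_int (fn n) w - stoch_int f w)" for n
      unfolding abs_moment_def by (rule nn_integral_cong_AE) (use ae[of n] in eventually_elim, simp)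
    with T(2) False p show ?thesis by (simp add: tendsto_Lp_def)
  qed
qed

end

theorem theorem6p3:
  fixes P :: "'w measure" and S :: "'s set" and R :: "'s set set"
    and \<Lambda> :: "'s set \<Rightarrow> 'w \<Rightarrow> real"
    and \<nu>0 \<nu>1 :: "'s set \<Rightarrow> real" and F :: "'s set \<Rightarrow> real set \<Rightarrow> real"
    and lam :: "'s measure" and a \<sigma>2 :: "'s \<Rightarrow> real" and \<rho> :: "'s \<Rightarrow> real set \<Rightarrow> real"
    and p q :: real
  assumes setting: "setting_A P S R \<Lambda> \<nu>0 \<nu>1 F lam a \<sigma>2 \<rho> \<or>
                    setting_B P S R \<Lambda> \<nu>0 \<nu>1 F lam a \<sigma>2 \<rho> \<or>
                    setting_C P S R \<Lambda> \<nu>0 \<nu>1 F lam a \<sigma>2 \<rho>"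
    and q: "0 \<le> q"
    and moments: "\<forall>A\<in>R. abs_moment P q (\<Lambda> A) < \<infinity>"
    and rho_moments:
      "\<forall>s\<in>S. (\<integral>\<^sup>+x\<in>{x. \<bar>x\<bar> > 1}. ennreal (\<bar>x\<bar> powr q) \<partial>qlt_pos (\<rho> s)) < \<infinity>"
    and p: "0 \<le> p" "p \<le> q"
  shows "(L_Phi lam a \<sigma>2 \<rho> p
            \<subseteq> {f. integrable_rm P R \<Lambda> lam f \<and> abs_moment P p (integral_rm P R \<Lambda> lam S f) < \<infinity>}) \<and>
         (\<forall>f\<in>L_Phi lam a \<sigma>2 \<rho> p. \<forall>g\<in>L_Phi lam a \<sigma>2 \<rho> p. \<forall>\<alpha> \<beta>.
            (\<lambda>s. \<alpha> * f s + \<beta> * g s) \<in> L_Phi lam a \<sigma>2 \<rho> p \<and>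
            (AE w in P. integral_rm P R \<Lambda> lam S (\<lambda>s. \<alpha> * f s + \<beta> * g s) w
               = \<alpha> * integral_rm P R \<Lambda> lam S f w + \<beta> * integral_rm P R \<Lambda> lam S g w)) \<and>
         (\<forall>f\<in>L_Phi lam a \<sigma>2 \<rho> p. \<forall>fn :: nat \<Rightarrow> 's \<Rightarrow> real.
            (\<forall>n. fn n \<in> L_Phi lam a \<sigma>2 \<rho> p) \<longrightarrow>
            (\<lambda>n. norm_Phi lam a \<sigma>2 \<rho> p (\<lambda>s. fn n s - f s)) \<longlonglongrightarrow> 0 \<longrightarrow>
            tendsto_Lp P p (\<lambda>n. integral_rm P R \<Lambda> lam S (fn n)) (integral_rm P R \<Lambda> lam S f))"
proof -
  interpret qid_core P S R \<Lambda> \<nu>0 \<nu>1 F lam a \<sigma>2 \<rho>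
    using setting by (elim disjE) (erule setting_A_core setting_B_core setting_C_core)+
  show ?thesis
    using integrable_L_Phi[OF p(1)] abs_moment_stoch_int_finite[OF p(1)] L_Phi_lincomb[OF p(1)]
      stoch_int_lincomb L_Phi_continuity[OF p(1)]
    by auto
qed

end
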